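(* Let $\mathcal{X}$ be a torsion free Noetherian $\mathbb{F}_1$-scheme with counting function $N(t)$, and let $X_{\mathbb{Z}}$ be the geometric realisation of $\mathcal{X}|_{\mathfrak{CRing}}$. Assume that $X_{\mathbb{Z}}$ is of finite type over $\mathbb{Z}$. Then $N(t)\in\mathbb{Z}[t]$ and $\deg N=\operatorname{reldim}X_{\mathbb{Z}}/\mathbb{Z}$, the relative dimension of $X_{\mathbb{Z}}$ over $\operatorname{Spec}\mathbb{Z}$.
   Context: A monoid is a commutative multiplicative monoid with identity $1$ and an absorbing element $0$; $\mathfrak{M}_0$ is the category of monoids, $\mathfrak{CRing}$ that of commutative rings. For a monoid $M$, $\operatorname{spec}M$ is the set of prime ideals (proper subsets $\mathfrak{p}$ with $\mathfrak{p}M\subset\mathfrak{p}$ and $M\setminus\mathfrak{p}$ multiplicatively closed) with Zariski topology and structure sheaf of localisations; a monoid scheme is a space with a sheaf of monoids locally isomorphic to some $\operatorname{spec}M$. The category $\mathfrak{MR}$ has objects those of $\mathfrak{M}_0$ and $\mathfrak{CRing}$, usual morphisms within each, $\operatorname{Hom}(M,R):=\operatorname{Hom}_{\mathfrak{CRing}}(\mathbb{Z}[M],R)$ and $\operatorname{Hom}(R,M)=\emptyset$. An $\mathbb{F}_1$-scheme is a functor $\mathcal{X}:\mathfrak{MR}\to\mathfrak{Set}$ with $\mathcal{X}|_{\mathfrak{M}_0}\cong\operatorname{Hom}(\operatorname{spec}(\cdot),X_{\mathfrak{M}_0})$ for a monoid scheme $X_{\mathfrak{M}_0}$ and $\mathcal{X}|_{\mathfrak{CRing}}\cong\operatorname{Hom}(\operatorname{Spec}(\cdot),X_{\mathbb{Z}})$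 for a scheme $X_{\mathbb{Z}}$ (geometric realisations), such that for every field $K$ the natural map $\mathcal{X}(K\text{ as monoid})\to\mathcal{X}(K)$ is bijective. It is Noetherian if $\mathcal{X}|_{\mathfrak{M}_0}$ is covered by finitely many open subfunctors $\operatorname{Hom}_{\mathfrak{M}_0}(M_i,\cdot)$ with $M_i$ finitely generated and $X_{\mathbb{Z}}$ is Noetherian; torsion free if all $\mathcal{O}_{X_{\mathfrak{M}_0},x}^\times$ are torsion free. For such $\mathcal{X}$ the counting function is the function $N(t)$ with $\#\mathcal{X}|_{\mathfrak{M}_0}(\mathbb{F}_1[C_n])=N(n+1)$ for $n\in\mathbb{N}$ ($C_n$ cyclic of order $n$, $\mathbb{F}_1[C_n]=C_n\cup\{0\}$) and $\#X_{\mathbb{Z}}(\mathbb{F}_q)=N(q)$ for all prime powers $q$; explicitly $N(t)=\sum_{x\in X_{\mathfrak{M}_0}}(t-1)^{\operatorname{rank}\mathcal{O}_{X_{\mathfrak{M}_0},x}^\times}$. *)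

theory Defs
  imports
    "HOL-Algebra.Ring_Divisibility"
    "HOL-Algebra.Subrings"
    "HOL-Algebra.IntRing"
    "HOL-Algebra.Elementary_Groups"
    "HOL-Analysis.Abstract_Topology"
    "HOL-Library.Extended_Real"
    "HOL-Library.Infinite_Typeclass"
    "HOL-Computational_Algebra.Polynomial"
begin

section \<open>Commutative monoids with an absorbing element\<close>

record 'a pmonoid = "'a monoid" +
  absorb :: 'a

text \<open>The case $0 = 1$ is allowed, just as the zero ring is; it is the value of a sheaf of monoids
  on the empty set.\<close>

locale pmonoid = comm_monoid M for M :: "'a pmonoid" (structure) +
  assumes absorb_closed: "absorb M \<in> carrier M"
    and absorb_mult: "x \<in> carrier M \<Longrightarrow> absorb M \<otimes> x = absorb M"

definition pmonoid_hom :: "'a pmonoid \<Rightarrow> 'b pmonoid \<Rightarrow> ('a \<Rightarrow> 'b) set" where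
  "pmonoid_hom M N = {f \<in> hom M N. f \<one>\<^bsub>M\<^esub> = \<one>\<^bsub>N\<^esub> \<and> f (absorb M) = absorb N}"

definition pmonoid_iso :: "'a pmonoid \<Rightarrow> 'b pmonoid \<Rightarrow> bool" where
  "pmonoid_iso M N \<longleftrightarrow> (\<exists>f \<in> pmonoid_hom M N. bij_betw f (carrier M) (carrier N))"

definition pmonoid_fin_gen :: "'a pmonoid \<Rightarrow> bool" where
  "pmonoid_fin_gen M \<longleftrightarrow>
     (\<exists>G \<subseteq> carrier M. finite G \<and>
        (\<forall>S. submonoid S M \<and> absorb M \<in> S \<and> G \<subseteq> S \<longrightarrow> S = carrier M))"

text \<open>An ideal contains the absorbing element; this only excludes the empty set.\<close>

definition pmonoid_ideal :: "'a set \<Rightarrow> 'a pmonoid \<Rightarrow> bool" where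
  "pmonoid_ideal I M \<longleftrightarrow>
     I \<subseteq> carrier M \<and> absorb M \<in> I \<and> (\<forall>a \<in> I. \<forall>x \<in> carrier M. a \<otimes>\<^bsub>M\<^esub> x \<in> I)"

definition pmonoid_prime :: "'a set \<Rightarrow> 'a pmonoid \<Rightarrow> bool" where
  "pmonoid_prime p M \<longleftrightarrow>
     pmonoid_ideal p M \<and> p \<noteq> carrier M \<and>
     (\<forall>a \<in> carrier M - p. \<forall>b \<in> carrier M - p. a \<otimes>\<^bsub>M\<^esub> b \<notin> p)"

definition group_pmonoid :: "('a, 'm) monoid_scheme \<Rightarrow> 'a option pmonoid" where
  "group_pmonoid H =
     \<lparr>carrier = insert None (Some ` carrier H),
      mult = (\<lambda>x y. case (x, y) of (Some a, Some b) \<Rightarrow> Some (a \<otimes>\<^bsub>H\<^esub> b) | _ \<Rightarrow> None),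
      one = Some \<one>\<^bsub>H\<^esub>,
      absorb = None\<rparr>"

definition ring_pmonoid :: "'a ring \<Rightarrow> 'a pmonoid" where
  "ring_pmonoid R = \<lparr>carrier = carrier R, mult = mult R, one = \<one>\<^bsub>R\<^esub>, absorb = \<zero>\<^bsub>R\<^esub>\<rparr>"

text \<open>In $\mathbb{Z}[M]$ the absorbing element of $M$ becomes the zero of the ring, so a basis is given
  by the remaining elements of $M$.\<close>

definition monoid_ring :: "'a pmonoid \<Rightarrow> ('a \<Rightarrow> int) ring" where
  "monoid_ring M =
     \<lparr>carrier = {f. finite {x. f x \<noteq> 0} \<and> {x. f x \<noteq> 0} \<subseteq> carrier M - {absorb M}},
      mult = (\<lambda>f g z. if z \<in> carrier M - {absorb M}
                then \<Sum>(x, y) \<in> {(x, y). f x \<noteq> 0 \<and> g y \<noteq> 0 \<and> x \<otimes>\<^bsub>M\<^esub> y = z}. f x * g y else 0),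
      one = (\<lambda>z. if z = \<one>\<^bsub>M\<^esub> \<and> z \<noteq> absorb M then 1 else 0),
      zero = (\<lambda>_. 0),
      add = (\<lambda>f g z. f z + g z)\<rparr>"

definition monoid_ring_map ::
  "'a pmonoid \<Rightarrow> 'b pmonoid \<Rightarrow> ('a \<Rightarrow> 'b) \<Rightarrow> ('a \<Rightarrow> int) \<Rightarrow> 'b \<Rightarrow> int" where
  "monoid_ring_map M N \<phi> =
     (\<lambda>f \<in> carrier (monoid_ring M). \<lambda>y.
        if y \<in> carrier N - {absorb N} then \<Sum>x \<in> {x. f x \<noteq> 0 \<and> \<phi> x = y}. f x else 0)"

definition monoid_ring_eval :: "'a ring \<Rightarrow> ('a \<Rightarrow> int) \<Rightarrow> 'a" where
  "monoid_ring_eval R =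
     (\<lambda>f \<in> carrier (monoid_ring (ring_pmonoid R)).
        \<Oplus>\<^bsub>R\<^esub>x \<in> {x. f x \<noteq> 0}. [f x] \<cdot>\<^bsub>R\<^esub> x)"


section \<open>Spaces with a sheaf of algebraic structures\<close>

text \<open>\<open>res X U V\<close> is the restriction of sections from \<open>U\<close> to \<open>V\<close>. The type parameter \<open>'m\<close> is the
  record extension: sheaves of rings and sheaves of monoids are both instances.\<close>

record ('x, 's, 'm) sheafed_space =
  pts :: "'x topology"
  sec :: "'x set \<Rightarrow> ('s, 'm) monoid_scheme"
  res :: "'x set \<Rightarrow> 'x set \<Rightarrow> 's \<Rightarrow> 's"

type_synonym ('x, 's) ringed_space = "('x, 's, ('s, unit) ring_ext) sheafed_space"
type_synonym ('x, 's) monoidal_space = "('x, 's, ('s, unit) pmonoid_ext) sheafed_space"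

definition is_sheaf ::
  "(('s, 'm) monoid_scheme \<Rightarrow> bool) \<Rightarrow>
   (('s, 'm) monoid_scheme \<Rightarrow> ('s, 'm) monoid_scheme \<Rightarrow> ('s \<Rightarrow> 's) set) \<Rightarrow>
   ('x, 's, 'm) sheafed_space \<Rightarrow> bool" where
  "is_sheaf ob hm X \<longleftrightarrow>
     (\<forall>U. openin (pts X) U \<longrightarrow> ob (sec X U)) \<and>
     (\<forall>U V. openin (pts X) U \<and> openin (pts X) V \<and> V \<subseteq> U \<longrightarrow>
        res X U V \<in> hm (sec X U) (sec X V)) \<and>
     (\<forall>U. openin (pts X) U \<longrightarrow> (\<forall>s \<in> carrier (sec X U). res X U U s = s)) \<and>
     (\<forall>U V W. openin (pts X) U \<and> openin (pts X) V \<and> openin (pts X) W \<and> W \<subseteq> V \<and> V \<subseteq> U \<longrightarrow>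
        (\<forall>s \<in> carrier (sec X U). res X V W (res X U V s) = res X U W s)) \<and>
     (\<forall>\<V>. (\<forall>V \<in> \<V>. openin (pts X) V) \<longrightarrow>
        (\<forall>s \<in> carrier (sec X (\<Union>\<V>)). \<forall>t \<in> carrier (sec X (\<Union>\<V>)).
           (\<forall>V \<in> \<V>. res X (\<Union>\<V>) V s = res X (\<Union>\<V>) V t) \<longrightarrow> s = t)) \<and>
     (\<forall>\<V> \<sigma>. (\<forall>V \<in> \<V>. openin (pts X) V \<and> \<sigma> V \<in> carrier (sec X V)) \<and>
        (\<forall>V \<in> \<V>. \<forall>W \<in> \<V>. res X V (V \<inter> W) (\<sigma> V) = res X W (V \<inter> W) (\<sigma> W)) \<longrightarrow>
        (\<exists>s \<in> carrier (sec X (\<Union>\<V>)). \<forall>V \<in> \<V>. res X (\<Union>\<V>) V s = \<sigma> V))"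

definition open_subspace :: "('x, 's, 'm) sheafed_space \<Rightarrow> 'x set \<Rightarrow> ('x, 's, 'm) sheafed_space" where
  "open_subspace X U = \<lparr>pts = subtopology (pts X) U, sec = sec X, res = res X\<rparr>"

definition germ :: "('x, 's, 'm) sheafed_space \<Rightarrow> 'x \<Rightarrow> 'x set \<Rightarrow> 's \<Rightarrow> ('x set \<times> 's) set" where
  "germ X x U s =
     {(V, t). openin (pts X) V \<and> x \<in> V \<and> t \<in> carrier (sec X V) \<and>
        (\<exists>W. openin (pts X) W \<and> x \<in> W \<and> W \<subseteq> U \<inter> V \<and> res X U W s = res X V W t)}"

text \<open>For a sheaf of rings this is the multiplicative monoid of the stalk; only its units are used.\<close>

definition stalk :: "('x, 's, 'm) sheafed_space \<Rightarrow> 'x \<Rightarrow> ('x set \<times> 's) set monoid" where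
  "stalk X x =
     \<lparr>carrier = {germ X x U s | U s. openin (pts X) U \<and> x \<in> U \<and> s \<in> carrier (sec X U)},
      mult = (\<lambda>A B. \<Union>(U, s) \<in> A. \<Union>(V, t) \<in> B.
                germ X x (U \<inter> V) (res X U (U \<inter> V) s \<otimes>\<^bsub>sec X (U \<inter> V)\<^esub> res X V (U \<inter> V) t)),
      one = germ X x (topspace (pts X)) \<one>\<^bsub>sec X (topspace (pts X))\<^esub>\<rparr>"

definition preim ::
  "('x, 's, 'm) sheafed_space \<Rightarrow> ('x \<Rightarrow> 'y) \<Rightarrow> 'y set \<Rightarrow> 'x set" where
  "preim X f V = {x \<in> topspace (pts X). f x \<in> V}"

text \<open>Morphisms of locally ringed (resp. monoidal) spaces: the last clause says that the maps on
  stalks are local. All functions are extensional, so that equality of morphisms is equality.\<close>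

definition sh_hom ::
  "(('t, 'n) monoid_scheme \<Rightarrow> ('s, 'm) monoid_scheme \<Rightarrow> ('t \<Rightarrow> 's) set) \<Rightarrow>
   ('x, 's, 'm) sheafed_space \<Rightarrow> ('y, 't, 'n) sheafed_space \<Rightarrow>
   (('x \<Rightarrow> 'y) \<times> ('y set \<Rightarrow> 't \<Rightarrow> 's)) set" where
  "sh_hom hm X Y =
     {(f, F).
        continuous_map (pts X) (pts Y) f \<and> f \<in> extensional (topspace (pts X)) \<and>
        (\<forall>V. openin (pts Y) V \<longrightarrow>
           F V \<in> hm (sec Y V) (sec X (preim X f V)) \<and> F V \<in> extensional (carrier (sec Y V))) \<and>
        F \<in> extensional {V. openin (pts Y) V} \<and>
        (\<forall>V W. openin (pts Y) V \<and> openin (pts Y) W \<and> W \<subseteq> V \<longrightarrow>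
           (\<forall>s \<in> carrier (sec Y V).
              F W (res Y V W s) = res X (preim X f V) (preim X f W) (F V s))) \<and>
        (\<forall>x \<in> topspace (pts X). \<forall>V. openin (pts Y) V \<and> f x \<in> V \<longrightarrow>
           (\<forall>s \<in> carrier (sec Y V).
              germ X x (preim X f V) (F V s) \<in> Units (stalk X x) \<longrightarrow>
              germ Y (f x) V s \<in> Units (stalk Y (f x))))}"

definition sh_comp ::
  "('x, 's, 'm) sheafed_space \<Rightarrow> ('y, 't, 'n) sheafed_space \<Rightarrow> ('z, 'u, 'k) sheafed_space \<Rightarrow>
   ('y \<Rightarrow> 'z) \<times> ('z set \<Rightarrow> 'u \<Rightarrow> 't) \<Rightarrow> ('x \<Rightarrow> 'y) \<times> ('y set \<Rightarrow> 't \<Rightarrow> 's) \<Rightarrow>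
   ('x \<Rightarrow> 'z) \<times> ('z set \<Rightarrow> 'u \<Rightarrow> 's)" where
  "sh_comp X Y Z g f =
     (compose (topspace (pts X)) (fst g) (fst f),
      \<lambda>W \<in> {W. openin (pts Z) W}. compose (carrier (sec Z W)) (snd f (preim Y (fst g) W)) (snd g W))"

definition sh_isomorphic ::
  "(('t, 'n) monoid_scheme \<Rightarrow> ('s, 'm) monoid_scheme \<Rightarrow> ('t \<Rightarrow> 's) set) \<Rightarrow>
   ('x, 's, 'm) sheafed_space \<Rightarrow> ('y, 't, 'n) sheafed_space \<Rightarrow> bool" where
  "sh_isomorphic hm X Y \<longleftrightarrow>
     (\<exists>(f, F) \<in> sh_hom hm X Y. homeomorphic_map (pts X) (pts Y) f \<and>
        (\<forall>V. openin (pts Y) V \<longrightarrow>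
           bij_betw (F V) (carrier (sec Y V)) (carrier (sec X (preim X f V)))))"


section \<open>Spectra\<close>

text \<open>The fraction \<open>a/s\<close> in the localisation at \<open>S\<close>, as an equivalence class. In a ring the condition
  $u a t = u b s$ is the usual $u (a t - b s) = 0$.\<close>

definition loc_frac :: "('a, 'm) monoid_scheme \<Rightarrow> 'a set \<Rightarrow> 'a \<Rightarrow> 'a \<Rightarrow> ('a \<times> 'a) set" where
  "loc_frac M S a s =
     {(b, t). b \<in> carrier M \<and> t \<in> S \<and> (\<exists>u \<in> S. u \<otimes>\<^bsub>M\<^esub> (a \<otimes>\<^bsub>M\<^esub> t) = u \<otimes>\<^bsub>M\<^esub> (b \<otimes>\<^bsub>M\<^esub> s))}"

definition loc_mult ::
  "('a, 'm) monoid_scheme \<Rightarrow> 'a set \<Rightarrow> ('a \<times> 'a) set \<Rightarrow> ('a \<times> 'a) set \<Rightarrow> ('a \<times> 'a) set" where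
  "loc_mult M S A B =
     (\<Union>(a, s) \<in> A. \<Union>(b, t) \<in> B. loc_frac M S (a \<otimes>\<^bsub>M\<^esub> b) (s \<otimes>\<^bsub>M\<^esub> t))"

definition loc_add ::
  "'a ring \<Rightarrow> 'a set \<Rightarrow> ('a \<times> 'a) set \<Rightarrow> ('a \<times> 'a) set \<Rightarrow> ('a \<times> 'a) set" where
  "loc_add R S A B =
     (\<Union>(a, s) \<in> A. \<Union>(b, t) \<in> B.
        loc_frac R S (a \<otimes>\<^bsub>R\<^esub> t \<oplus>\<^bsub>R\<^esub> b \<otimes>\<^bsub>R\<^esub> s) (s \<otimes>\<^bsub>R\<^esub> t))"

definition zariski :: "'a set set \<Rightarrow> 'a set \<Rightarrow> 'a set topology" where
  "zariski P C = topology (\<lambda>U. \<exists>I \<subseteq> C. U = {p \<in> P. \<not> I \<subseteq> p})"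

text \<open>Sections over \<open>U\<close> are the functions assigning to each prime \<open>p \<in> U\<close> an element of the localisation
  at \<open>p\<close> that are locally given by one fraction.\<close>

definition loc_sections ::
  "('a, 'm) monoid_scheme \<Rightarrow> 'a set topology \<Rightarrow> 'a set set \<Rightarrow> ('a set \<Rightarrow> ('a \<times> 'a) set) set" where
  "loc_sections M T U =
     {\<sigma> \<in> extensional U. \<forall>p \<in> U. \<exists>V a s. openin T V \<and> p \<in> V \<and> V \<subseteq> U \<and>
        a \<in> carrier M \<and> s \<in> carrier M \<and>
        (\<forall>q \<in> V. s \<notin> q \<and> \<sigma> q = loc_frac M (carrier M - q) a s)}"

definition mspec :: "'a pmonoid \<Rightarrow> ('a set, 'a set \<Rightarrow> ('a \<times> 'a) set) monoidal_space" where
  "mspec M =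
     (let T = zariski {p. pmonoid_prime p M} (carrier M); S = (\<lambda>p. carrier M - p) in
      \<lparr>pts = T,
       sec = (\<lambda>U.
         \<lparr>carrier = loc_sections M T U,
          mult = (\<lambda>\<sigma> \<tau>. \<lambda>p \<in> U. loc_mult M (S p) (\<sigma> p) (\<tau> p)),
          one = (\<lambda>p \<in> U. loc_frac M (S p) \<one>\<^bsub>M\<^esub> \<one>\<^bsub>M\<^esub>),
          absorb = (\<lambda>p \<in> U. loc_frac M (S p) (absorb M) \<one>\<^bsub>M\<^esub>)\<rparr>),
       res = (\<lambda>U V \<sigma>. restrict \<sigma> V)\<rparr>)"

definition Spec :: "'a ring \<Rightarrow> ('a set, 'a set \<Rightarrow> ('a \<times> 'a) set) ringed_space" where
  "Spec R =
     (let T = zariski {p. primeideal p R} (carrier R); S = (\<lambda>p. carrier R - p) in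
      \<lparr>pts = T,
       sec = (\<lambda>U.
         \<lparr>carrier = loc_sections R T U,
          mult = (\<lambda>\<sigma> \<tau>. \<lambda>p \<in> U. loc_mult R (S p) (\<sigma> p) (\<tau> p)),
          one = (\<lambda>p \<in> U. loc_frac R (S p) \<one>\<^bsub>R\<^esub> \<one>\<^bsub>R\<^esub>),
          zero = (\<lambda>p \<in> U. loc_frac R (S p) \<zero>\<^bsub>R\<^esub> \<one>\<^bsub>R\<^esub>),
          add = (\<lambda>\<sigma> \<tau>. \<lambda>p \<in> U. loc_add R (S p) (\<sigma> p) (\<tau> p))\<rparr>),
       res = (\<lambda>U V \<sigma>. restrict \<sigma> V)\<rparr>)"

text \<open>The morphism \<open>Y \<rightarrow> X\<close> of spectra induced by \<open>\<phi>: A \<rightarrow> B\<close>, where \<open>X\<close> and \<open>Y\<close> are the spectra of \<open>A\<close>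
  and \<open>B\<close>.\<close>

definition spectral_map ::
  "('a, 'm) monoid_scheme \<Rightarrow> ('b, 'n) monoid_scheme \<Rightarrow>
   ('a set, 'a set \<Rightarrow> ('a \<times> 'a) set, 'k) sheafed_space \<Rightarrow>
   ('b set, 'b set \<Rightarrow> ('b \<times> 'b) set, 'l) sheafed_space \<Rightarrow> ('a \<Rightarrow> 'b) \<Rightarrow>
   ('b set \<Rightarrow> 'a set) \<times> ('a set set \<Rightarrow> ('a set \<Rightarrow> ('a \<times> 'a) set) \<Rightarrow> 'b set \<Rightarrow> ('b \<times> 'b) set)" where
  "spectral_map A B X Y \<phi> =
     (let c = (\<lambda>q \<in> topspace (pts Y). {a \<in> carrier A. \<phi> a \<in> q}) in
      (c, \<lambda>V \<in> {V. openin (pts X) V}. \<lambda>\<sigma> \<in> carrier (sec X V). \<lambda>q \<in> preim Y c V.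
            \<Union>(a, s) \<in> \<sigma> (c q). loc_frac B (carrier B - q) (\<phi> a) (\<phi> s)))"

abbreviation mspec_map where
  "mspec_map M N \<phi> \<equiv> spectral_map M N (mspec M) (mspec N) \<phi>"

abbreviation Spec_map where
  "Spec_map R S \<phi> \<equiv> spectral_map R S (Spec R) (Spec S) \<phi>"

lemma istopology_zariski:
  assumes "\<And>p. p \<in> P \<Longrightarrow> p \<subset> C"
    and "\<And>a b. a \<in> C \<Longrightarrow> b \<in> C \<Longrightarrow> f a b \<in> C"
    and "\<And>p a b. p \<in> P \<Longrightarrow> a \<in> C \<Longrightarrow> b \<in> C \<Longrightarrow> f a b \<in> p \<longleftrightarrow> a \<in> p \<or> b \<in> p"
  shows "istopology (\<lambda>U. \<exists>I \<subseteq> C. U = {p \<in> P. \<not> I \<subseteq> p})"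
proof -
  define D where "D I = {p \<in> P. \<not> I \<subseteq> p}" for I
  have D: "p \<in> D I \<longleftrightarrow> p \<in> P \<and> \<not> I \<subseteq> p" for p I
    by (simp add: D_def)
  have inter: "\<exists>K \<subseteq> C. D I \<inter> D J = D K" if "I \<subseteq> C" "J \<subseteq> C" for I J
  proof -
    define K where "K = {f a b | a b. a \<in> I \<and> b \<in> J}"
    have "K \<subseteq> C"
      unfolding K_def using that assms(2) by blast
    moreover have "\<not> K \<subseteq> p \<longleftrightarrow> \<not> I \<subseteq> p \<and> \<not> J \<subseteq> p" if "p \<in> P" for p
      using assms(3)[OF that] \<open>I \<subseteq> C\<close> \<open>J \<subseteq> C\<close> unfolding K_def by (auto simp: subset_iff) metis+
    then have "D I \<inter> D J = D K"
      by (intro Set.set_eqI) (simp add: D, metis)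
    ultimately show ?thesis by blast
  qed
  have union: "\<exists>K \<subseteq> C. \<Union>\<K> = D K" if "\<forall>U \<in> \<K>. \<exists>I \<subseteq> C. U = D I" for \<K>
  proof -
    define K where "K = \<Union>{I. I \<subseteq> C \<and> D I \<in> \<K>}"
    have "K \<subseteq> C"
      unfolding K_def by blast
    moreover have "\<Union>\<K> = D K"
    proof (intro Set.set_eqI iffI)
      fix p assume "p \<in> \<Union>\<K>"
      then obtain U where U: "U \<in> \<K>" "p \<in> U" by blast
      with that obtain I where I: "I \<subseteq> C" "U = D I" by blast
      then have "I \<subseteq> K"
        unfolding K_def using U by blast
      then show "p \<in> D K"
        using U I by (auto simp: D)
    next
      fix p assume p: "p \<in> D K"
      then obtain a where "a \<in> K" "a \<notin> p" by (auto simp: D)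
      then obtain I where "a \<in> I" "D I \<in> \<K>" unfolding K_def by blast
      moreover have "p \<in> D I"
        using p \<open>a \<in> I\<close> \<open>a \<notin> p\<close> by (auto simp: D)
      ultimately show "p \<in> \<Union>\<K>" by blast
    qed
    ultimately show ?thesis by blast
  qed
  have "istopology (\<lambda>U. \<exists>I \<subseteq> C. U = D I)"
    unfolding istopology_def
  proof (intro conjI allI impI)
    fix S T assume "\<exists>I \<subseteq> C. S = D I" "\<exists>I \<subseteq> C. T = D I"
    then show "\<exists>I \<subseteq> C. S \<inter> T = D I"
      using inter by (elim exE conjE) simp
  next
    fix \<K> assume "\<forall>U \<in> \<K>. \<exists>I \<subseteq> C. U = D I"
    then show "\<exists>I \<subseteq> C. \<Union>\<K> = D I"
      by (rule union)
  qed
  then show ?thesis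
    by (simp only: D_def)
qed

lemma openin_mspec:
  assumes "pmonoid M"
  shows "openin (pts (mspec M)) U \<longleftrightarrow> (\<exists>I \<subseteq> carrier M. U = {p. pmonoid_prime p M \<and> \<not> I \<subseteq> p})"
proof -
  interpret pmonoid M by fact
  have "istopology (\<lambda>U. \<exists>I \<subseteq> carrier M. U = {p \<in> {p. pmonoid_prime p M}. \<not> I \<subseteq> p})"
  proof (rule istopology_zariski[where f = "mult M"])
    fix p a b
    assume "p \<in> {p. pmonoid_prime p M}" and ab: "a \<in> carrier M" "b \<in> carrier M"
    then have p: "pmonoid_prime p M" by simp
    have id: "x \<otimes>\<^bsub>M\<^esub> y \<in> p" if "x \<in> p" "y \<in> carrier M" for x y
      using p that unfolding pmonoid_prime_def pmonoid_ideal_def by blast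
    have "a \<otimes>\<^bsub>M\<^esub> b \<notin> p" if "a \<notin> p" "b \<notin> p"
      using p that ab unfolding pmonoid_prime_def by blast
    then show "a \<otimes>\<^bsub>M\<^esub> b \<in> p \<longleftrightarrow> a \<in> p \<or> b \<in> p"
      using id[of a b] id[of b a] ab m_comm[OF ab] by metis
  qed (auto simp: pmonoid_prime_def pmonoid_ideal_def)
  then show ?thesis
    by (simp add: mspec_def Let_def zariski_def)
qed

lemma openin_Spec:
  assumes "cring R"
  shows "openin (pts (Spec R)) U \<longleftrightarrow> (\<exists>I \<subseteq> carrier R. U = {p. primeideal p R \<and> \<not> I \<subseteq> p})"
proof -
  interpret cring R by fact
  have "istopology (\<lambda>U. \<exists>I \<subseteq> carrier R. U = {p \<in> {p. primeideal p R}. \<not> I \<subseteq> p})"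
  proof (rule istopology_zariski[where f = "mult R"])
    fix p assume "p \<in> {p. primeideal p R}"
    then interpret primeideal p R by simp
    show "p \<subset> carrier R"
      using a_subset I_notcarr by blast
    fix a b assume "a \<in> carrier R" "b \<in> carrier R"
    then show "a \<otimes>\<^bsub>R\<^esub> b \<in> p \<longleftrightarrow> a \<in> p \<or> b \<in> p"
      using I_prime I_l_closed I_r_closed by blast
  qed auto
  then show ?thesis
    by (simp add: Spec_def Let_def zariski_def)
qed


section \<open>Schemes and monoid schemes\<close>

definition affine_open :: "('x, 's) ringed_space \<Rightarrow> 'x set \<Rightarrow> 'a ring \<Rightarrow> bool" where
  "affine_open X U R \<longleftrightarrow>
     openin (pts X) U \<and> cring R \<and> sh_isomorphic ring_hom (open_subspace X U) (Spec R)"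

definition maffine_open :: "('x, 's) monoidal_space \<Rightarrow> 'x set \<Rightarrow> 'a pmonoid \<Rightarrow> bool" where
  "maffine_open X U M \<longleftrightarrow>
     openin (pts X) U \<and> pmonoid M \<and> sh_isomorphic pmonoid_hom (open_subspace X U) (mspec M)"

text \<open>A ring whose spectrum is \<open>U\<close> is isomorphic to the ring of sections over \<open>U\<close>, so it is no
  restriction to look for it in the type \<open>'s\<close>. Likewise for monoids.\<close>

definition scheme :: "('x, 's) ringed_space \<Rightarrow> bool" where
  "scheme X \<longleftrightarrow>
     is_sheaf cring ring_hom X \<and>
     (\<forall>x \<in> topspace (pts X). \<exists>U (R :: 's ring). x \<in> U \<and> affine_open X U R)"

definition monoid_scheme :: "('x, 's) monoidal_space \<Rightarrow> bool" where
  "monoid_scheme X \<longleftrightarrow>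
     is_sheaf pmonoid pmonoid_hom X \<and>
     (\<forall>x \<in> topspace (pts X). \<exists>U (M :: 's pmonoid). x \<in> U \<and> maffine_open X U M)"

definition noetherian_scheme :: "('x, 's) ringed_space \<Rightarrow> bool" where
  "noetherian_scheme X \<longleftrightarrow>
     scheme X \<and>
     (\<exists>\<U>. finite \<U> \<and> \<Union>\<U> = topspace (pts X) \<and>
        (\<forall>U \<in> \<U>. \<exists>R :: 's ring. affine_open X U R \<and> noetherian_ring R))"

definition ring_fin_gen :: "'a ring \<Rightarrow> bool" where
  "ring_fin_gen R \<longleftrightarrow>
     (\<exists>G \<subseteq> carrier R. finite G \<and> (\<forall>S. subring S R \<and> G \<subseteq> S \<longrightarrow> S = carrier R))"

text \<open>Every ring is a \<open>\<int>\<close>-algebra in exactly one way, and finitely generated as such iff it is finitely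
  generated as a ring.\<close>

definition finite_type_over_Z :: "('x, 's) ringed_space \<Rightarrow> bool" where
  "finite_type_over_Z X \<longleftrightarrow>
     scheme X \<and>
     (\<exists>\<U>. finite \<U> \<and> \<Union>\<U> = topspace (pts X) \<and>
        (\<forall>U \<in> \<U>. \<exists>R :: 's ring. affine_open X U R \<and> ring_fin_gen R))"

definition irreducible_closed :: "'x topology \<Rightarrow> 'x set \<Rightarrow> bool" where
  "irreducible_closed T Z \<longleftrightarrow>
     closedin T Z \<and> Z \<noteq> {} \<and>
     (\<forall>A B. closedin T A \<and> closedin T B \<and> Z \<subseteq> A \<union> B \<longrightarrow> Z \<subseteq> A \<or> Z \<subseteq> B)"

text \<open>The empty space has dimension \<open>-\<infinity>\<close>.\<close>

definition krull_dim :: "'x topology \<Rightarrow> ereal" where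
  "krull_dim T =
     Sup {ereal (real n) | n. \<exists>Z. (\<forall>i \<le> n. irreducible_closed T (Z i)) \<and> (\<forall>i < n. Z i \<subset> Z (Suc i))}"

text \<open>The supremum of the dimensions of the fibres of \<open>\<pi>: X \<rightarrow> S\<close>; the space underlying the
  scheme-theoretic fibre over a point is the set-theoretic fibre with the subspace topology.\<close>

definition reldim ::
  "('x, 's) ringed_space \<Rightarrow> ('y, 't) ringed_space \<Rightarrow> ('x \<Rightarrow> 'y) \<times> ('y set \<Rightarrow> 't \<Rightarrow> 's) \<Rightarrow> ereal" where
  "reldim X S \<pi> = (SUP y \<in> topspace (pts S). krull_dim (subtopology (pts X) (preim X (fst \<pi>) {y})))"


section \<open>The category of monoids and rings\<close>

datatype 'u mr_obj = MonObj "'u pmonoid" | RingObj "'u ring"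

datatype 'u mr_mor = MonMor "'u \<Rightarrow> 'u" | RingMor "'u \<Rightarrow> 'u" | MixMor "('u \<Rightarrow> int) \<Rightarrow> 'u"

fun is_mr_obj :: "'u mr_obj \<Rightarrow> bool" where
  "is_mr_obj (MonObj M) = pmonoid M"
| "is_mr_obj (RingObj R) = cring R"

fun mr_hom :: "'u mr_obj \<Rightarrow> 'u mr_obj \<Rightarrow> 'u mr_mor set" where
  "mr_hom (MonObj M) (MonObj N) = MonMor ` (pmonoid_hom M N \<inter> extensional (carrier M))"
| "mr_hom (RingObj R) (RingObj S) = RingMor ` (ring_hom R S \<inter> extensional (carrier R))"
| "mr_hom (MonObj M) (RingObj R) =
     MixMor ` (ring_hom (monoid_ring M) R \<inter> extensional (carrier (monoid_ring M)))"
| "mr_hom (RingObj R) (MonObj M) = {}"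

fun mr_id :: "'u mr_obj \<Rightarrow> 'u mr_mor" where
  "mr_id (MonObj M) = MonMor (\<lambda>x \<in> carrier M. x)"
| "mr_id (RingObj R) = RingMor (\<lambda>x \<in> carrier R. x)"

text \<open>\<open>mr_comp A B g f\<close> is the composite of \<open>f: A \<rightarrow> B\<close> followed by \<open>g\<close>.\<close>

fun mr_comp :: "'u mr_obj \<Rightarrow> 'u mr_obj \<Rightarrow> 'u mr_mor \<Rightarrow> 'u mr_mor \<Rightarrow> 'u mr_mor" where
  "mr_comp (MonObj M) B (MonMor g) (MonMor f) = MonMor (compose (carrier M) g f)"
| "mr_comp (RingObj R) B (RingMor g) (RingMor f) = RingMor (compose (carrier R) g f)"
| "mr_comp (MonObj M) B (RingMor g) (MixMor f) = MixMor (compose (carrier (monoid_ring M)) g f)"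
| "mr_comp (MonObj M) (MonObj N) (MixMor g) (MonMor f) =
     MixMor (compose (carrier (monoid_ring M)) g (monoid_ring_map M N f))"
| "mr_comp _ _ _ _ = undefined"

record ('u, 'v) mr_functor =
  fobj :: "'u mr_obj \<Rightarrow> 'v set"
  fmor :: "'u mr_obj \<Rightarrow> 'u mr_obj \<Rightarrow> 'u mr_mor \<Rightarrow> 'v \<Rightarrow> 'v"

definition is_mr_functor :: "('u, 'v) mr_functor \<Rightarrow> bool" where
  "is_mr_functor X \<longleftrightarrow>
     (\<forall>A B. is_mr_obj A \<and> is_mr_obj B \<longrightarrow>
        (\<forall>f \<in> mr_hom A B. fmor X A B f \<in> fobj X A \<rightarrow> fobj X B)) \<and>
     (\<forall>A. is_mr_obj A \<longrightarrow> (\<forall>x \<in> fobj X A. fmor X A A (mr_id A) x = x)) \<and>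
     (\<forall>A B C. is_mr_obj A \<and> is_mr_obj B \<and> is_mr_obj C \<longrightarrow>
        (\<forall>f \<in> mr_hom A B. \<forall>g \<in> mr_hom B C. \<forall>x \<in> fobj X A.
           fmor X A C (mr_comp A B g f) x = fmor X B C g (fmor X A B f x)))"

abbreviation mon_obj :: "('u, 'v) mr_functor \<Rightarrow> 'u pmonoid \<Rightarrow> 'v set" where
  "mon_obj X M \<equiv> fobj X (MonObj M)"

abbreviation mon_mor ::
  "('u, 'v) mr_functor \<Rightarrow> 'u pmonoid \<Rightarrow> 'u pmonoid \<Rightarrow> ('u \<Rightarrow> 'u) \<Rightarrow> 'v \<Rightarrow> 'v" where
  "mon_mor X M N \<phi> \<equiv> fmor X (MonObj M) (MonObj N) (MonMor \<phi>)"

abbreviation ring_obj :: "('u, 'v) mr_functor \<Rightarrow> 'u ring \<Rightarrow> 'v set" where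
  "ring_obj X R \<equiv> fobj X (RingObj R)"

abbreviation ring_mor ::
  "('u, 'v) mr_functor \<Rightarrow> 'u ring \<Rightarrow> 'u ring \<Rightarrow> ('u \<Rightarrow> 'u) \<Rightarrow> 'v \<Rightarrow> 'v" where
  "ring_mor X R S \<phi> \<equiv> fmor X (RingObj R) (RingObj S) (RingMor \<phi>)"


section \<open>\<open>\<F>\<^sub>1\<close>-schemes\<close>

definition monoid_realisation :: "('u, 'v) mr_functor \<Rightarrow> ('x, 's) monoidal_space \<Rightarrow> bool" where
  "monoid_realisation X XM \<longleftrightarrow>
     monoid_scheme XM \<and>
     (\<exists>\<eta>. (\<forall>M. pmonoid M \<longrightarrow> bij_betw (\<eta> M) (mon_obj X M) (sh_hom pmonoid_hom (mspec M) XM)) \<and>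
        (\<forall>M N. pmonoid M \<and> pmonoid N \<longrightarrow>
           (\<forall>\<phi> \<in> pmonoid_hom M N \<inter> extensional (carrier M). \<forall>x \<in> mon_obj X M.
              \<eta> N (mon_mor X M N \<phi> x) = sh_comp (mspec N) (mspec M) XM (\<eta> M x) (mspec_map M N \<phi>))))"

definition ring_realisation :: "('u, 'v) mr_functor \<Rightarrow> ('y, 't) ringed_space \<Rightarrow> bool" where
  "ring_realisation X XZ \<longleftrightarrow>
     scheme XZ \<and>
     (\<exists>\<eta>. (\<forall>R. cring R \<longrightarrow> bij_betw (\<eta> R) (ring_obj X R) (sh_hom ring_hom (Spec R) XZ)) \<and>
        (\<forall>R S. cring R \<and> cring S \<longrightarrow>
           (\<forall>\<phi> \<in> ring_hom R S \<inter> extensional (carrier R). \<forall>x \<in> ring_obj X R.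
              \<eta> S (ring_mor X R S \<phi> x) = sh_comp (Spec S) (Spec R) XZ (\<eta> R x) (Spec_map R S \<phi>))))"

text \<open>The type \<open>'u\<close> plays the part of the universe in which monoids and rings live. The two
  realisations are arguments because their types cannot be quantified over inside a definition.\<close>

definition F1_scheme ::
  "('u, 'v) mr_functor \<Rightarrow> ('x, 's) monoidal_space \<Rightarrow> ('y, 't) ringed_space \<Rightarrow> bool" where
  "F1_scheme X XM XZ \<longleftrightarrow>
     is_mr_functor X \<and> monoid_realisation X XM \<and> ring_realisation X XZ \<and>
     (\<forall>K. field K \<longrightarrow>
        bij_betw (fmor X (MonObj (ring_pmonoid K)) (RingObj K) (MixMor (monoid_ring_eval K)))
          (mon_obj X (ring_pmonoid K)) (ring_obj X K))"

definition mon_subfunctor :: "('u, 'v) mr_functor \<Rightarrow> ('u pmonoid \<Rightarrow> 'v set) \<Rightarrow> bool" where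
  "mon_subfunctor X Y \<longleftrightarrow>
     (\<forall>M. pmonoid M \<longrightarrow> Y M \<subseteq> mon_obj X M) \<and>
     (\<forall>M N. pmonoid M \<and> pmonoid N \<longrightarrow>
        (\<forall>\<phi> \<in> pmonoid_hom M N \<inter> extensional (carrier M). mon_mor X M N \<phi> \<in> Y M \<rightarrow> Y N))"

text \<open>By the Yoneda lemma \<open>x \<in> X(M)\<close> is a transformation \<open>Hom(M, -) \<rightarrow> X\<close>; openness means that each
  pull-back of \<open>Y\<close> along such a transformation consists of those \<open>\<phi>: M \<rightarrow> N\<close> for which the image of
  some fixed ideal of \<open>M\<close> generates the unit ideal of \<open>N\<close>.\<close>

definition mon_open_subfunctor :: "('u, 'v) mr_functor \<Rightarrow> ('u pmonoid \<Rightarrow> 'v set) \<Rightarrow> bool" where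
  "mon_open_subfunctor X Y \<longleftrightarrow>
     mon_subfunctor X Y \<and>
     (\<forall>M. pmonoid M \<longrightarrow> (\<forall>x \<in> mon_obj X M. \<exists>I. pmonoid_ideal I M \<and>
        (\<forall>N. pmonoid N \<longrightarrow> (\<forall>\<phi> \<in> pmonoid_hom M N \<inter> extensional (carrier M).
           mon_mor X M N \<phi> x \<in> Y N \<longleftrightarrow>
           {\<phi> a \<otimes>\<^bsub>N\<^esub> b | a b. a \<in> I \<and> b \<in> carrier N} = carrier N))))"

definition mon_represented ::
  "('u, 'v) mr_functor \<Rightarrow> ('u pmonoid \<Rightarrow> 'v set) \<Rightarrow> 'u pmonoid \<Rightarrow> bool" where
  "mon_represented X Y M \<longleftrightarrow>
     pmonoid M \<and>
     (\<exists>\<theta>. (\<forall>N. pmonoid N \<longrightarrow> bij_betw (\<theta> N) (Y N) (pmonoid_hom M N \<inter> extensional (carrier M))) \<and>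
        (\<forall>N N'. pmonoid N \<and> pmonoid N' \<longrightarrow>
           (\<forall>\<phi> \<in> pmonoid_hom N N' \<inter> extensional (carrier N). \<forall>y \<in> Y N.
              \<theta> N' (mon_mor X N N' \<phi> y) = compose (carrier M) \<phi> (\<theta> N y))))"

text \<open>Subfunctors cover if they do so on the monoids \<open>\<F>\<^sub>1[H]\<close> with \<open>H\<close> an abelian group, which are the
  analogues of fields.\<close>

definition F1_noetherian :: "('u, 'v) mr_functor \<Rightarrow> ('y, 't) ringed_space \<Rightarrow> bool" where
  "F1_noetherian X XZ \<longleftrightarrow>
     (\<exists>\<Y>. finite \<Y> \<and>
        (\<forall>Y \<in> \<Y>. mon_open_subfunctor X Y \<and> (\<exists>M. pmonoid_fin_gen M \<and> mon_represented X Y M)) \<and>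
        (\<forall>M (H :: 'u monoid). pmonoid M \<and> comm_group H \<and> pmonoid_iso M (group_pmonoid H) \<longrightarrow>
           mon_obj X M = (\<Union>Y \<in> \<Y>. Y M))) \<and>
     noetherian_scheme XZ"

definition stalk_units :: "('x, 's) monoidal_space \<Rightarrow> 'x \<Rightarrow> ('x set \<times> 's) set monoid" where
  "stalk_units XM x = units_of (stalk XM x)"

definition F1_torsion_free :: "('x, 's) monoidal_space \<Rightarrow> bool" where
  "F1_torsion_free XM \<longleftrightarrow>
     (\<forall>x \<in> topspace (pts XM). \<forall>u \<in> carrier (stalk_units XM x). \<forall>n :: nat. n > 0 \<longrightarrow>
        u [^]\<^bsub>stalk_units XM x\<^esub> n = \<one>\<^bsub>stalk_units XM x\<^esub> \<longrightarrow> u = \<one>\<^bsub>stalk_units XM x\<^esub>)"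

text \<open>The largest number of \<open>\<int>\<close>-linearly independent elements; meaningful only if this number is
  finite, as it is for finitely generated groups.\<close>

definition ab_rank :: "'g monoid \<Rightarrow> nat" where
  "ab_rank G =
     Sup {card B | B. B \<subseteq> carrier G \<and> finite B \<and>
       (\<forall>c :: 'g \<Rightarrow> int. (\<Otimes>\<^bsub>G\<^esub>b \<in> B. b [^]\<^bsub>G\<^esub> c b) = \<one>\<^bsub>G\<^esub> \<longrightarrow> (\<forall>b \<in> B. c b = 0))}"

text \<open>The orders of the finite fields \<open>K\<close> are exactly the prime powers.\<close>

definition counting_function ::
  "('u, 'v) mr_functor \<Rightarrow> ('x, 's) monoidal_space \<Rightarrow> ('y, 't) ringed_space \<Rightarrow> (real \<Rightarrow> real) \<Rightarrow> bool" where
  "counting_function X XM XZ N \<longleftrightarrow>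
     (\<forall>n (M :: 'u pmonoid). n \<ge> 1 \<and> pmonoid M \<and>
        pmonoid_iso M (group_pmonoid (integer_mod_group n)) \<longrightarrow>
        real (card (mon_obj X M)) = N (real n + 1)) \<and>
     (\<forall>K :: 'u ring. field K \<and> finite (carrier K) \<longrightarrow>
        real (card (sh_hom ring_hom (Spec K) XZ)) = N (real (card (carrier K)))) \<and>
     (\<forall>t. N t = (\<Sum>x \<in> topspace (pts XM). (t - 1) ^ ab_rank (stalk_units XM x)))"

definition poly_deg :: "int poly \<Rightarrow> ereal" where
  "poly_deg p = (if p = 0 then -\<infinity> else ereal (real (Polynomial.degree p)))"

end

theory Submission
  imports Defs "HOL-Algebra.Generated_Fields" "HOL-Algebra.Weak_Morphisms" "HOL-Library.Poly_Mapping"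
begin

text \<open>
  The monoids \<open>M\<close> of a finite affine cover of \<open>X\<close> and their primes \<open>p\<close> give numbers \<open>r\<close>, the ranks of the units
  of \<open>M\<^sub>p\<close>; the degree of the counting polynomial and the relative dimension both equal the largest \<open>r\<close>.
  For the degree, \<open>M\<close> has \<open>\<Sum>\<^sub>p m\<^bsup>r(p)\<^esup>\<close> homomorphisms to \<open>\<F>\<^sub>1[C\<^sub>m]\<close> when \<open>m\<close> is prime to the torsion, which holds
  for infinitely many \<open>m\<close>.

  A chain of \<open>n\<close> specializations in a fibre over \<open>\<int>\<close> gives \<open>n\<close> elements of an affine ring that are algebraically
  independent, over the image of \<open>\<int>\<close>, in the residue field \<open>K\<close> of a point. By the bijection between the \<open>K\<close>-points of
  \<open>X\<close> as a monoid and as a ring, applied to subfields of \<open>K\<close>, this residue field is generated by the values of a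
  homomorphism \<open>\<chi>\<close> on some \<open>M\<close>. As words of length \<open>N\<close> in the generators take \<open>O(N\<^sup>r)\<close> values under \<open>\<chi>\<close>, comparing
  dimensions of spaces spanned by values of \<open>\<chi>\<close> shows \<open>n \<le> r\<close>.

  Conversely, sending the basis of the units of \<open>M\<^sub>p\<close> to powers of the variables of a Laurent polynomial ring, and
  specializing these variables to \<open>1\<close> one after the other, gives a chain of \<open>r\<close> specializations in one fibre. They
  are proper, since on points with the same image the values that are \<open>1\<close> coincide.
\<close>

lemma exponent_le_if_infinitely_often_le:
  fixes c r :: "'i \<Rightarrow> nat"
  assumes "infinite T" and "\<And>m. m \<in> T \<Longrightarrow> m ^ d \<le> (\<Sum>i\<in>I. c i * m ^ r i)"
  shows "\<exists>i\<in>I. d \<le> r i"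
proof (rule ccontr)
  assume "\<not> ?thesis"
  then have less: "r i < d" if "i \<in> I" for i
    using that by auto
  obtain m where m: "m \<in> T" "sum c I < m"
    using assms(1) unfolding infinite_nat_iff_unbounded by blast
  show False
  proof (cases d)
    case 0
    with less have "I = {}" by auto
    then show False using assms(2)[OF m(1)] 0 by simp
  next
    case (Suc e)
    have "m ^ d \<le> (\<Sum>i\<in>I. c i * m ^ r i)"
      using assms(2)[OF m(1)] .
    also have "\<dots> \<le> (\<Sum>i\<in>I. c i * m ^ e)"
      using less Suc m(2) by (intro sum_mono mult_le_mono2 power_increasing) (auto simp: less_Suc_eq_le)
    also have "\<dots> = sum c I * m ^ e"
      by (simp add: sum_distrib_right)
    also have "\<dots> < m ^ d"
      using m(2) Suc by simp
    finally show False by simp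
  qed
qed

section \<open>Algebraic independence modulo a prime ideal\<close>

definition lin_indep_mod ::
  "('a, 'm) ring_scheme \<Rightarrow> 'a set \<Rightarrow> 'a set \<Rightarrow> 'i set \<Rightarrow> ('i \<Rightarrow> 'a) \<Rightarrow> bool" where
  "lin_indep_mod R P C I y \<longleftrightarrow>
     (\<forall>c \<in> I \<rightarrow> C. (\<Oplus>\<^bsub>R\<^esub>i\<in>I. c i \<otimes>\<^bsub>R\<^esub> y i) \<in> P \<longrightarrow> (\<forall>i\<in>I. c i \<in> P))"

definition exponents :: "nat \<Rightarrow> nat \<Rightarrow> nat list set" where
  "exponents d n = {\<alpha>. set \<alpha> \<subseteq> {..d} \<and> length \<alpha> = n}"

definition monomial :: "('a, 'm) ring_scheme \<Rightarrow> 'a list \<Rightarrow> nat list \<Rightarrow> 'a" where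
  "monomial R xs \<alpha> = foldr (\<lambda>(x, k) y. x [^]\<^bsub>R\<^esub> k \<otimes>\<^bsub>R\<^esub> y) (zip xs \<alpha>) \<one>\<^bsub>R\<^esub>"

definition alg_indep_mod :: "('a, 'm) ring_scheme \<Rightarrow> 'a set \<Rightarrow> 'a set \<Rightarrow> 'a list \<Rightarrow> bool" where
  "alg_indep_mod R P C xs \<longleftrightarrow>
     (\<forall>d. lin_indep_mod R P C (exponents d (length xs)) (monomial R xs))"

inductive_set lin_span :: "('a, 'm) ring_scheme \<Rightarrow> 'a set \<Rightarrow> 'a set \<Rightarrow> 'a set"
  for R C W where
  zero: "\<zero>\<^bsub>R\<^esub> \<in> lin_span R C W"
| add: "\<lbrakk>c \<in> C; w \<in> W; v \<in> lin_span R C W\<rbrakk> \<Longrightarrow> c \<otimes>\<^bsub>R\<^esub> w \<oplus>\<^bsub>R\<^esub> v \<in> lin_span R C W"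

lemma monomial_simps [simp]:
  "monomial R [] \<alpha> = \<one>\<^bsub>R\<^esub>"
  "monomial R (x # xs) (k # \<alpha>) = x [^]\<^bsub>R\<^esub> k \<otimes>\<^bsub>R\<^esub> monomial R xs \<alpha>"
  by (simp_all add: monomial_def)

lemma exponents_0 [simp]: "exponents d 0 = {[]}"
  by (auto simp: exponents_def)

lemma exponents_Suc: "exponents d (Suc n) = (\<Union>k\<in>{..d}. (#) k ` exponents d n)"
  by (auto simp: exponents_def length_Suc_conv)

lemma finite_exponents [simp]: "finite (exponents d n)"
  unfolding exponents_def by (simp add: finite_lists_length_eq)

lemma card_exponents: "card (exponents d n) = (d + 1) ^ n"
  unfolding exponents_def by (simp add: card_lists_length_eq)

context cring
begin

lemma monomial_closed [simp, intro]: "set xs \<subseteq> carrier R \<Longrightarrow> monomial R xs \<alpha> \<in> carrier R"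
proof (induction xs arbitrary: \<alpha>)
  case (Cons x xs)
  then show ?case by (cases \<alpha>) (auto simp: monomial_def)
qed simp

lemma finsum_exponents_Suc:
  assumes "\<And>\<alpha>. F \<alpha> \<in> carrier R"
  shows "(\<Oplus>\<alpha>\<in>exponents d (Suc n). F \<alpha>) = (\<Oplus>k\<in>{..d}. \<Oplus>\<alpha>\<in>exponents d n. F (k # \<alpha>))"
proof -
  have "(\<Oplus>\<alpha>\<in>(#) k ` exponents d n. F \<alpha>) = (\<Oplus>\<alpha>\<in>exponents d n. F (k # \<alpha>))" for k
    using assms by (subst add.finprod_reindex) auto
  then show ?thesis
    unfolding exponents_Suc using assms
    by (subst add.finprod_UN_disjoint) (auto simp: pairwise_def disjnt_def)
qed

lemma primeideal_add_cancel:
  assumes "primeideal P R" "a \<in> P" "b \<in> carrier R" "a \<oplus> b \<in> P"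
  shows "b \<in> P"
proof -
  interpret P: primeideal P R by fact
  have "b = \<ominus> a \<oplus> (a \<oplus> b)"
    using assms P.a_subset by (auto simp: r_neg1)
  then show ?thesis
    using assms P.a_inv_closed P.a_closed by metis
qed

lemma finsum_in_add_closed:
  assumes "S \<subseteq> carrier R" "\<zero> \<in> S" "\<And>a b. a \<in> S \<Longrightarrow> b \<in> S \<Longrightarrow> a \<oplus> b \<in> S"
    and "finite A" "\<And>a. a \<in> A \<Longrightarrow> f a \<in> S"
  shows "(\<Oplus>a\<in>A. f a) \<in> S"
  using assms(4,5)
proof (induction A rule: finite_induct)
  case (insert a A)
  then have "f \<in> insert a A \<rightarrow> carrier R"
    using assms(1) by blast
  with insert show ?case
    using assms(3) by (simp add: Pi_def)
qed (use assms(2) in simp)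

lemma finsum_in_ideal:
  assumes "ideal I R" "finite A" "\<And>a. a \<in> A \<Longrightarrow> f a \<in> I"
  shows "(\<Oplus>a\<in>A. f a) \<in> I"
proof -
  interpret I: ideal I R by fact
  show ?thesis
    using I.a_subset I.a_closed assms(2,3) by (intro finsum_in_add_closed) auto
qed

lemma coefficients_in_smaller_prime:
  assumes P: "primeideal P R" and Q: "primeideal Q R" "P \<subseteq> Q" and b: "b \<in> Q" "b \<notin> P"
    and f: "f \<in> {..d::nat} \<rightarrow> carrier R" "\<And>k. k \<le> d \<Longrightarrow> f k \<in> Q \<Longrightarrow> f k \<in> P"
    and sum: "(\<Oplus>k\<in>{..d}. b [^] k \<otimes> f k) \<in> P" and "k \<le> d"
  shows "f k \<in> P"
proof -
  interpret P: primeideal P R by fact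
  interpret Q: primeideal Q R by fact
  have b': "b \<in> carrier R" using b(1) Q.a_subset by blast
  have "\<forall>k\<le>d. f k \<in> P"
    using f sum
  proof (induction d arbitrary: f)
    case 0
    then show ?case using b' by simp
  next
    case (Suc d)
    define g where "g = (\<Oplus>k\<in>{..d}. b [^] k \<otimes> f (Suc k))"
    have fc: "f k \<in> carrier R" if "k \<le> Suc d" for k
      using Suc.prems(1) that by auto
    have g: "g \<in> carrier R"
      unfolding g_def using fc b' by (intro finsum_closed) auto
    have "(\<Oplus>k\<in>{..Suc d}. b [^] k \<otimes> f k) = b \<otimes> g \<oplus> f 0"
      unfolding g_def using fc b'
      by (subst add.finprod_Suc2)
        (auto simp: finsum_rdistr m_assoc m_lcomm nat_pow_Suc2 Pi_def simp del: nat_pow_Suc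
          intro!: add.finprod_cong')
    then have sum: "b \<otimes> g \<oplus> f 0 \<in> P"
      using Suc.prems(3) by simp
    have "f 0 \<in> Q"
      using primeideal_add_cancel[OF Q(1) Q.I_r_closed[OF b(1) g] fc] sum Q(2) by blast
    then have f0: "f 0 \<in> P"
      using Suc.prems(2) by blast
    have "b \<otimes> g \<in> P"
      using primeideal_add_cancel[OF P f0, of "b \<otimes> g"] sum fc b' g by (simp add: a_comm)
    then have "g \<in> P"
      using P.I_prime[OF b' g] b(2) by blast
    then have "\<forall>k\<le>d. f (Suc k) \<in> P"
      using Suc.IH[of "\<lambda>k. f (Suc k)"] Suc.prems unfolding g_def by auto
    then show ?case
      using f0 by (metis Suc_le_mono not0_implies_Suc)
  qed
  then show ?thesis using \<open>k \<le> d\<close> by blast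
qed

lemma alg_indep_mod_Cons:
  assumes P: "primeideal P R" and Q: "primeideal Q R" "P \<subseteq> Q" and b: "b \<in> Q" "b \<notin> P"
    and C: "C \<subseteq> carrier R" "C \<inter> Q \<subseteq> P" and xs: "set xs \<subseteq> carrier R" "alg_indep_mod R Q C xs"
  shows "alg_indep_mod R P C (b # xs)"
  unfolding alg_indep_mod_def lin_indep_mod_def
proof (intro allI ballI impI)
  fix d c \<alpha>
  let ?E = "exponents d (length xs)"
  assume "c \<in> exponents d (length (b # xs)) \<rightarrow> C"
    and sum: "(\<Oplus>\<alpha>\<in>exponents d (length (b # xs)). c \<alpha> \<otimes> monomial R (b # xs) \<alpha>) \<in> P"
    and \<alpha>: "\<alpha> \<in> exponents d (length (b # xs))"
  then have c: "c (k # \<alpha>) \<in> C" if "k \<le> d" "\<alpha> \<in> ?E" for k \<alpha>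
    using that by (auto simp: exponents_Suc)
  have b': "b \<in> carrier R"
    using b(1) primeideal.axioms(1)[OF Q(1)] ideal.Icarr by metis
  note cR = subsetD[OF C(1) c]
  define f where "f k = (\<Oplus>\<alpha>\<in>?E. c (k # \<alpha>) \<otimes> monomial R xs \<alpha>)" for k
  have fc: "f \<in> {..d} \<rightarrow> carrier R"
    unfolding f_def using cR xs(1) by (auto intro!: finsum_closed)
  define F where
    "F \<alpha> = (if \<alpha> \<in> exponents d (Suc (length xs)) then c \<alpha> \<otimes> monomial R (b # xs) \<alpha> else \<zero>)" for \<alpha>
  have F: "F (k # \<alpha>) = b [^] k \<otimes> (c (k # \<alpha>) \<otimes> monomial R xs \<alpha>)" if "k \<le> d" "\<alpha> \<in> ?E" for k \<alpha>
    unfolding F_def using that cR[OF that] b' xs(1) by (auto simp: exponents_Suc m_ac)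
  have Fc: "F \<alpha> \<in> carrier R" for \<alpha>
    using cR b' xs(1) F unfolding F_def
    by (auto simp: exponents_Suc simp del: monomial_simps intro!: m_closed monomial_closed)
  have "(\<Oplus>\<alpha>\<in>exponents d (length (b # xs)). c \<alpha> \<otimes> monomial R (b # xs) \<alpha>)
      = (\<Oplus>\<alpha>\<in>exponents d (Suc (length xs)). F \<alpha>)"
    using Fc by (intro add.finprod_cong') (auto simp: F_def)
  also have "\<dots> = (\<Oplus>k\<in>{..d}. \<Oplus>\<alpha>\<in>?E. F (k # \<alpha>))"
    by (rule finsum_exponents_Suc[OF Fc])
  also have "\<dots> = (\<Oplus>k\<in>{..d}. b [^] k \<otimes> f k)"
    using fc b' cR xs(1)
    by (intro add.finprod_cong') (auto simp: f_def F finsum_rdistr intro!: add.finprod_cong')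
  finally have "(\<Oplus>k\<in>{..d}. b [^] k \<otimes> f k) \<in> P"
    using sum by simp
  moreover have coeff: "c (k # \<alpha>) \<in> P" if "f k \<in> Q" "k \<le> d" "\<alpha> \<in> ?E" for k \<alpha>
  proof -
    have "c (k # \<alpha>) \<in> Q"
      using xs(2)[unfolded alg_indep_mod_def lin_indep_mod_def, rule_format,
          of "\<lambda>\<alpha>. c (k # \<alpha>)" d \<alpha>] that c[OF that(2)] unfolding f_def by blast
    then show ?thesis
      using c[OF that(2,3)] C(2) by blast
  qed
  moreover have "f k \<in> P" if "f k \<in> Q" "k \<le> d" for k
    unfolding f_def using coeff[OF that] xs(1) primeideal.axioms(1)[OF P]
    by (intro finsum_in_ideal) (auto intro: ideal.I_r_closed)
  ultimately have fP: "f k \<in> P" if "k \<le> d" for k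
    using coefficients_in_smaller_prime[OF P Q b fc] that by blast
  obtain k \<beta> where k: "\<alpha> = k # \<beta>" "k \<le> d" "\<beta> \<in> ?E"
    using \<alpha> by (auto simp: exponents_Suc)
  then show "c \<alpha> \<in> P"
    using coeff fP[OF k(2)] Q(2) by blast
qed

lemma alg_indep_mod_of_prime_chain:
  fixes n :: nat
  assumes "\<And>i. i \<le> n \<Longrightarrow> primeideal (P i) R" and "\<And>i. i < n \<Longrightarrow> P (Suc i) \<subset> P i"
    and C: "C \<subseteq> carrier R" and "\<And>i. i \<le> n \<Longrightarrow> P i \<inter> C = P 0 \<inter> C"
  shows "\<exists>xs. length xs = n \<and> set xs \<subseteq> carrier R \<and> alg_indep_mod R (P n) C xs"
  using assms(1,2,4)
proof (induction n)
  case 0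
  have "alg_indep_mod R (P 0) C []"
    using C by (auto simp: alg_indep_mod_def lin_indep_mod_def)
  then show ?case by (intro exI[of _ "[]"]) simp
next
  case (Suc n)
  then obtain xs where xs: "length xs = n" "set xs \<subseteq> carrier R" "alg_indep_mod R (P n) C xs"
    by (metis less_Suc_eq le_SucI)
  have P: "primeideal (P (Suc n)) R" "primeideal (P n) R" "P (Suc n) \<subset> P n"
    using Suc.prems(1,2) by simp_all
  then obtain b where b: "b \<in> P n" "b \<notin> P (Suc n)"
    by blast
  have "C \<inter> P n \<subseteq> P (Suc n)"
    using Suc.prems(3)[of n] Suc.prems(3)[of "Suc n"] by auto
  then have "alg_indep_mod R (P (Suc n)) C (b # xs)"
    using alg_indep_mod_Cons[OF P(1,2) _ b C _ xs(2,3)] P(3) by blast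
  moreover have "b \<in> carrier R"
    using b(1) primeideal.axioms(1)[OF P(2)] ideal.Icarr by metis
  ultimately show ?case
    using xs by (intro exI[of _ "b # xs"]) simp
qed

end

lemma monomial_hom:
  assumes "cring R" "cring S" "h \<in> ring_hom R S" "set xs \<subseteq> carrier R"
  shows "h (monomial R xs \<alpha>) = monomial S (map h xs) \<alpha>"
proof -
  interpret R: cring R by fact
  interpret S: cring S by fact
  interpret ring_hom_cring R S h by unfold_locales fact
  show ?thesis
    using assms(4)
  proof (induction xs arbitrary: \<alpha>)
    case Nil
    show ?case by simp
  next
    case (Cons x xs)
    show ?case
    proof (cases \<alpha>)
      case Nil
      then show ?thesis by (simp add: monomial_def)
    next
      case (Cons k \<beta>)
      then show ?thesis
        using Cons.IH[of \<beta>] Cons.prems by (simp add: hom_pow)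
    qed
  qed
qed

lemma alg_indep_mod_hom:
  assumes "cring R" "cring S" "h \<in> ring_hom R S" and C: "C \<subseteq> carrier R" and xs: "set xs \<subseteq> carrier R"
    and indep: "alg_indep_mod R {r \<in> carrier R. h r \<in> P} C xs"
  shows "alg_indep_mod S P (h ` C) (map h xs)"
  unfolding alg_indep_mod_def lin_indep_mod_def
proof (intro allI ballI impI)
  interpret R: cring R by fact
  interpret S: cring S by fact
  interpret ring_hom_cring R S h by unfold_locales fact
  fix d c \<alpha>
  let ?E = "exponents d (length (map h xs))"
  assume c: "c \<in> ?E \<rightarrow> h ` C" and sum: "(\<Oplus>\<^bsub>S\<^esub>\<alpha>\<in>?E. c \<alpha> \<otimes>\<^bsub>S\<^esub> monomial S (map h xs) \<alpha>) \<in> P"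
    and \<alpha>: "\<alpha> \<in> ?E"
  from c have "\<forall>\<alpha>\<in>?E. \<exists>b. b \<in> C \<and> c \<alpha> = h b" by auto
  then obtain b where b: "\<And>\<alpha>. \<alpha> \<in> ?E \<Longrightarrow> b \<alpha> \<in> C" "\<And>\<alpha>. \<alpha> \<in> ?E \<Longrightarrow> c \<alpha> = h (b \<alpha>)"
    by metis
  have bR: "b \<alpha> \<in> carrier R" if "\<alpha> \<in> ?E" for \<alpha>
    using b(1)[OF that] C by blast
  have "h (\<Oplus>\<^bsub>R\<^esub>\<alpha>\<in>?E. b \<alpha> \<otimes>\<^bsub>R\<^esub> monomial R xs \<alpha>)
      = (\<Oplus>\<^bsub>S\<^esub>\<alpha>\<in>?E. c \<alpha> \<otimes>\<^bsub>S\<^esub> monomial S (map h xs) \<alpha>)"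
    using bR b(2) xs by (subst hom_finsum)
      (auto simp flip: monomial_hom[OF assms(1-3) xs] intro!: S.add.finprod_cong')
  moreover have "(\<Oplus>\<^bsub>R\<^esub>\<alpha>\<in>?E. b \<alpha> \<otimes>\<^bsub>R\<^esub> monomial R xs \<alpha>) \<in> carrier R"
    using bR xs by (intro R.finsum_closed) auto
  ultimately have "b \<alpha> \<in> {r \<in> carrier R. h r \<in> P}"
    using indep[unfolded alg_indep_mod_def lin_indep_mod_def, rule_format, of b d \<alpha>] b(1) sum \<alpha> by simp
  then show "c \<alpha> \<in> P"
    using b(2)[OF \<alpha>] by simp
qed

definition int_image :: "('a, 'm) ring_scheme \<Rightarrow> 'a set" where
  "int_image R = range (\<lambda>n :: int. [n] \<cdot>\<^bsub>R\<^esub> \<one>\<^bsub>R\<^esub>)"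

lemma (in cring) int_image_subring: "subring (int_image R) R"
proof (rule ring.subringI[OF ring_axioms])
  show "int_image R \<subseteq> carrier R"
    unfolding int_image_def by auto
  have "\<one> = [(1 :: int)] \<cdot> \<one>"
    by (simp add: add_pow_def int_pow_def nat_pow_def)
  then show "\<one> \<in> int_image R"
    unfolding int_image_def by (rule range_eqI)
  fix h1 assume "h1 \<in> int_image R"
  then obtain m :: int where m: "h1 = [m] \<cdot> \<one>" unfolding int_image_def by auto
  then have "\<ominus> h1 = [(- m)] \<cdot> \<one>"
    using add.int_pow_neg[of \<one> m] by simp
  then show "\<ominus> h1 \<in> int_image R"
    unfolding int_image_def by (rule range_eqI)
  fix h2 assume "h2 \<in> int_image R"
  then obtain n :: int where n: "h2 = [n] \<cdot> \<one>" unfolding int_image_def by auto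
  have "h1 \<oplus> h2 = [(m + n)] \<cdot> \<one>"
    unfolding m n by (simp add: add.int_pow_mult)
  then show "h1 \<oplus> h2 \<in> int_image R"
    unfolding int_image_def by (rule range_eqI)
  have "h1 \<otimes> h2 = [(n * m)] \<cdot> \<one>"
    unfolding m n using add.int_pow_pow[of \<one> m n] by (simp add: add_pow_ldistr_int)
  then show "h1 \<otimes> h2 \<in> int_image R"
    unfolding int_image_def by (rule range_eqI)
qed

lemma ring_hom_int_add_pow:
  assumes "cring R" "cring S" "h \<in> ring_hom R S" "x \<in> carrier R"
  shows "h ([(n :: int)] \<cdot>\<^bsub>R\<^esub> x) = [n] \<cdot>\<^bsub>S\<^esub> h x"
proof -
  interpret R: cring R by fact
  interpret S: cring S by fact
  interpret ring_hom_cring R S h by unfold_locales fact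
  interpret group_hom "add_monoid R" "add_monoid S" h
    by unfold_locales (auto simp: hom_def)
  show ?thesis
    using hom_int_pow[of x n] assms(4) by (simp add: add_pow_def)
qed

lemma int_image_hom:
  assumes "cring R" "cring S" "h \<in> ring_hom R S"
  shows "h ` int_image R = int_image S"
proof -
  interpret R: cring R by fact
  show ?thesis
    unfolding int_image_def image_image
    using ring_hom_int_add_pow[OF assms R.one_closed] ring_hom_one[OF assms(3)] by simp
qed

section \<open>Fields filtered by finite sets of polynomial growth\<close>

context cring
begin

lemma lin_span_closed:
  assumes "C \<subseteq> carrier R" "W \<subseteq> carrier R"
  shows "lin_span R C W \<subseteq> carrier R"
proof
  fix v assume "v \<in> lin_span R C W"
  then show "v \<in> carrier R"
    by (induction rule: lin_span.induct) (use assms in auto)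
qed

lemma lin_span_mono:
  assumes "W \<subseteq> W'"
  shows "lin_span R C W \<subseteq> lin_span R C W'"
proof
  fix v assume "v \<in> lin_span R C W"
  then show "v \<in> lin_span R C W'"
    by (induction rule: lin_span.induct) (use assms in \<open>auto intro: lin_span.intros\<close>)
qed

lemma lin_span_incl:
  assumes "subring C R" "W \<subseteq> carrier R" "w \<in> W"
  shows "w \<in> lin_span R C W"
proof -
  have "\<one> \<otimes> w \<oplus> \<zero> \<in> lin_span R C W"
    using subringE(3)[OF assms(1)] assms(3) by (intro lin_span.intros)
  then show ?thesis
    using assms by auto
qed

lemma lin_span_add:
  assumes "C \<subseteq> carrier R" "W \<subseteq> carrier R" and u: "u \<in> lin_span R C W" and v: "v \<in> lin_span R C W"
  shows "u \<oplus> v \<in> lin_span R C W"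
  using u
proof (induction rule: lin_span.induct)
  case zero
  then show ?case
    using v lin_span_closed[OF assms(1,2)] by auto
next
  case (add c w u)
  have "c \<otimes> w \<oplus> u \<oplus> v = c \<otimes> w \<oplus> (u \<oplus> v)"
    using add.hyps v assms lin_span_closed[OF assms(1,2)] by (intro a_assoc) auto
  then show ?case
    using lin_span.add[OF add.hyps(1,2) add.IH] by simp
qed

lemma lin_span_smult:
  assumes "subring C R" "W \<subseteq> carrier R" and "c \<in> C" and v: "v \<in> lin_span R C W"
  shows "c \<otimes> v \<in> lin_span R C W"
  using v
proof (induction rule: lin_span.induct)
  case zero
  then show ?case
    using assms(3) subringE(1)[OF assms(1)] by (auto simp: subset_iff lin_span.zero)
next
  case (add d w v)
  have "c \<otimes> (d \<otimes> w \<oplus> v) = (c \<otimes> d) \<otimes> w \<oplus> c \<otimes> v"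
    using add.hyps assms(2,3) subringE(1)[OF assms(1)] lin_span_closed[of C W]
    by (auto simp: r_distr m_assoc subset_iff)
  then show ?case
    using lin_span.add[OF _ add.hyps(2) add.IH] subringE(6)[OF assms(1,3) add.hyps(1)] by simp
qed

lemma lin_span_mult:
  assumes C: "subring C R" and W: "V \<subseteq> carrier R" "W \<subseteq> carrier R" "U \<subseteq> carrier R"
    and prod: "\<And>v w. v \<in> V \<Longrightarrow> w \<in> W \<Longrightarrow> v \<otimes> w \<in> U"
    and a: "a \<in> lin_span R C V" and b: "b \<in> lin_span R C W"
  shows "a \<otimes> b \<in> lin_span R C U"
proof -
  note CR = subringE(1)[OF C]
  note cl = lin_span_closed[OF CR W(1)] lin_span_closed[OF CR W(2)]
  have single: "v \<otimes> b \<in> lin_span R C U" if v: "v \<in> V" for v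
    using b
  proof (induction rule: lin_span.induct)
    case zero
    then show ?case
      using v W(1) by (auto simp: subset_iff lin_span.zero)
  next
    case (add c w b)
    have "v \<otimes> (c \<otimes> w \<oplus> b) = c \<otimes> (v \<otimes> w) \<oplus> v \<otimes> b"
      using add.hyps v W CR cl by (auto simp: r_distr m_lcomm subset_iff)
    then show ?case
      using lin_span.add[OF add.hyps(1) prod[OF v add.hyps(2)] add.IH] by simp
  qed
  show ?thesis
    using a
  proof (induction rule: lin_span.induct)
    case zero
    then show ?case
      using b cl by (auto simp: subset_iff lin_span.zero)
  next
    case (add c v a)
    have "(c \<otimes> v \<oplus> a) \<otimes> b = c \<otimes> (v \<otimes> b) \<oplus> a \<otimes> b"
      using add.hyps b W CR cl by (auto simp: l_distr m_assoc subset_iff)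
    then show ?case
      using lin_span_add[OF CR W(3) lin_span_smult[OF C W(3) add.hyps(1) single[OF add.hyps(2)]] add.IH]
      by simp
  qed
qed

lemma lin_span_insertE:
  assumes C: "subring C R" and "insert w W \<subseteq> carrier R" and v: "v \<in> lin_span R C (insert w W)"
  obtains a u where "a \<in> C" "u \<in> lin_span R C W" "v = a \<otimes> w \<oplus> u"
proof -
  note CR = subringE(1)[OF C]
  have cl: "lin_span R C W \<subseteq> carrier R"
    using lin_span_closed[OF CR] assms(2) by blast
  have "\<exists>a\<in>C. \<exists>u\<in>lin_span R C W. v = a \<otimes> w \<oplus> u"
    using v
  proof (induction rule: lin_span.induct)
    case zero
    have "\<zero> = \<zero> \<otimes> w \<oplus> \<zero>" using assms(2) by simp
    then show ?case
      using subringE(2)[OF C] lin_span.zero by blast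
  next
    case (add c w' v)
    then obtain a u where *: "a \<in> C" "u \<in> lin_span R C W" "v = a \<otimes> w \<oplus> u"
      by blast
    then have cr: "a \<in> carrier R" "u \<in> carrier R" "c \<in> carrier R" "w \<in> carrier R" "w' \<in> carrier R"
      using cl CR assms(2) add.hyps by auto
    show ?case
    proof (cases "w' = w")
      case True
      then have "c \<otimes> w' \<oplus> v = (c \<oplus> a) \<otimes> w \<oplus> u"
        using * cr by (simp add: l_distr a_assoc)
      then show ?thesis
        using * subringE(7)[OF C add.hyps(1)] by blast
    next
      case False
      then have "c \<otimes> w' \<oplus> u \<in> lin_span R C W"
        using add.hyps * by (intro lin_span.add) auto
      moreover have "c \<otimes> w' \<oplus> v = a \<otimes> w \<oplus> (c \<otimes> w' \<oplus> u)"
        using * cr by (simp add: a_lcomm)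
      ultimately show ?thesis
        using * by blast
    qed
  qed
  then show thesis using that by blast
qed

end

lemma (in cring) linear_relation_by_elimination:
  assumes C: "subring C R" and "finite I" "j \<in> I" and a: "a \<in> I \<rightarrow> C" and y: "y \<in> I \<rightarrow> carrier R"
    and b: "b \<in> I - {j} \<rightarrow> C" "(\<Oplus>i\<in>I - {j}. b i \<otimes> (a j \<otimes> y i \<oplus> \<ominus> a i \<otimes> y j)) = \<zero>"
  shows "\<exists>c \<in> I \<rightarrow> C. (\<forall>i \<in> I - {j}. c i = b i \<otimes> a j) \<and> (\<Oplus>i\<in>I. c i \<otimes> y i) = \<zero>"
proof -
  define J where "J = I - {j}"
  have I: "I = insert j J" "finite J" "j \<notin> J"
    using assms(2,3) unfolding J_def by auto
  note CR = subringE(1)[OF C]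
  have aC: "a i \<in> C" "a i \<in> carrier R" and yR: "y i \<in> carrier R" if "i \<in> insert j J" for i
    using a y CR that unfolding I(1) by auto
  have bC: "b i \<in> C" "b i \<in> carrier R" if "i \<in> J" for i
    using b(1) that CR unfolding J_def by auto
  define c where "c i = (if i = j then \<Oplus>i\<in>J. b i \<otimes> \<ominus> a i else b i \<otimes> a j)" for i
  have "(\<Oplus>i\<in>J. b i \<otimes> \<ominus> a i) \<in> C"
    using CR subringE(2,5,6,7)[OF C] bC(1) aC(1) I(2) by (intro finsum_in_add_closed) auto
  then have c: "c \<in> I \<rightarrow> C"
    unfolding c_def I(1) using bC(1) aC(1) subringE(6)[OF C] by auto
  then have "(\<Oplus>i\<in>I. c i \<otimes> y i) = c j \<otimes> y j \<oplus> (\<Oplus>i\<in>J. c i \<otimes> y i)"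
    using I(2,3) CR yR unfolding I(1) by (simp add: subset_iff Pi_def)
  also have "(\<Oplus>i\<in>J. c i \<otimes> y i) = (\<Oplus>i\<in>J. b i \<otimes> a j \<otimes> y i)"
    using bC aC yR I(3) by (intro add.finprod_cong') (auto simp: c_def)
  also have "c j \<otimes> y j = (\<Oplus>i\<in>J. b i \<otimes> \<ominus> a i \<otimes> y j)"
    unfolding c_def using bC aC yR I(2) by (simp add: finsum_ldistr Pi_def)
  also have "\<dots> \<oplus> (\<Oplus>i\<in>J. b i \<otimes> a j \<otimes> y i)
      = (\<Oplus>i\<in>J. b i \<otimes> (a j \<otimes> y i \<oplus> \<ominus> a i \<otimes> y j))"
  proof -
    have "b i \<otimes> (a j \<otimes> y i \<oplus> \<ominus> a i \<otimes> y j) = b i \<otimes> \<ominus> a i \<otimes> y j \<oplus> b i \<otimes> a j \<otimes> y i" if "i \<in> J" for i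
      using that bC aC yR by (simp add: r_distr m_assoc a_comm)
    then show ?thesis
      using bC aC yR by (simp add: finsum_addf Pi_def cong: add.finprod_cong)
  qed
  finally have "(\<Oplus>i\<in>I. c i \<otimes> y i) = \<zero>"
    using b(2) unfolding J_def by simp
  then show ?thesis
    using c by (intro bexI[of _ c]) (auto simp: c_def)
qed

lemma (in domain) linear_relation_exists:
  assumes C: "subring C R" and "finite W" "W \<subseteq> carrier R" and "finite I" "card W < card I"
    and "y \<in> I \<rightarrow> lin_span R C W"
  shows "\<exists>c \<in> I \<rightarrow> C. (\<exists>i\<in>I. c i \<noteq> \<zero>) \<and> (\<Oplus>i\<in>I. c i \<otimes> y i) = \<zero>"
  using assms(2-)
proof (induction W arbitrary: I y rule: finite_induct)
  case empty
  have "y i = \<zero>" if "i \<in> I" for i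
  proof -
    have "y i \<in> lin_span R C {}" using empty.prems(4) that by blast
    then show ?thesis by (cases rule: lin_span.cases) auto
  qed
  then have "(\<Oplus>i\<in>I. \<one> \<otimes> y i) = \<zero>"
    by (intro add.finprod_one_eqI) auto
  moreover obtain i where "i \<in> I"
    using empty.prems(3) by fastforce
  ultimately show ?case
    using subringE(3)[OF C] by (intro bexI[of _ "\<lambda>_. \<one>"]) auto
next
  case (insert w W)
  note CR = subringE(1)[OF C]
  have W: "W \<subseteq> carrier R" and w: "w \<in> carrier R" using insert.prems(1) by auto
  have cl: "lin_span R C W \<subseteq> carrier R"
    by (rule lin_span_closed[OF CR W])
  have "\<forall>i\<in>I. \<exists>a u. a \<in> C \<and> u \<in> lin_span R C W \<and> y i = a \<otimes> w \<oplus> u"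
    using lin_span_insertE[OF C insert.prems(1)] insert.prems(4) by (metis Pi_mem)
  then obtain a u where a: "\<And>i. i \<in> I \<Longrightarrow> a i \<in> C" and u: "\<And>i. i \<in> I \<Longrightarrow> u i \<in> lin_span R C W"
    and y: "\<And>i. i \<in> I \<Longrightarrow> y i = a i \<otimes> w \<oplus> u i"
    by metis
  note aR = subsetD[OF CR a] and uR = subsetD[OF cl u]
  show ?case
  proof (cases "\<forall>i\<in>I. a i = \<zero>")
    case True
    then have "y \<in> I \<rightarrow> lin_span R C W"
      using y u uR w by auto
    then show ?thesis
      using insert.IH[OF W insert.prems(2)] insert.prems(3) insert.hyps by simp
  next
    case False
    then obtain j where j: "j \<in> I" "a j \<noteq> \<zero>" by blast
    define z where "z i = a j \<otimes> y i \<oplus> \<ominus> a i \<otimes> y j" for i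
    have z: "z i = a j \<otimes> u i \<oplus> \<ominus> a i \<otimes> u j" if "i \<in> I" for i
      unfolding z_def y[OF that] y[OF j(1)]
      using aR[OF that] aR[OF j(1)] uR[OF that] uR[OF j(1)] w by algebra
    have "z \<in> I - {j} \<rightarrow> lin_span R C W"
      using z a u j subringE(5)[OF C] lin_span_add[OF CR W] lin_span_smult[OF C W] by auto
    moreover have "card W < card (I - {j})"
      using j insert by simp
    ultimately obtain b i where b: "b \<in> I - {j} \<rightarrow> C" "(\<Oplus>i\<in>I - {j}. b i \<otimes> z i) = \<zero>"
      and i: "i \<in> I - {j}" "b i \<noteq> \<zero>"
      using insert.IH[OF W, of "I - {j}" z] insert.prems(2) by auto
    have "y \<in> I \<rightarrow> carrier R"
      using y aR uR w by auto
    then obtain c where c: "c \<in> I \<rightarrow> C" "\<forall>i \<in> I - {j}. c i = b i \<otimes> a j" "(\<Oplus>i\<in>I. c i \<otimes> y i) = \<zero>"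
      using linear_relation_by_elimination[OF C insert.prems(2) j(1) _ _ b(1), of a y] a b(2)
      unfolding z_def by auto
    moreover have "c i \<noteq> \<zero>"
      using c(2) i b(1) CR aR[OF j(1)] j(2) integral[of "b i" "a j"] by auto
    ultimately show ?thesis
      using i(1) by blast
  qed
qed

lemma (in field) generate_field_fraction:
  assumes T: "subring T R" and "S \<subseteq> T" and "x \<in> generate_field R S"
  shows "\<exists>a\<in>T. \<exists>b\<in>T. b \<noteq> \<zero> \<and> x \<otimes> b = a"
proof -
  note TR = subsetD[OF subringE(1)[OF T]]
  have cl: "h \<in> carrier R" if "h \<in> generate_field R S" for h
    using generate_field_in_carrier[OF _ that] assms(2) TR by blast
  show ?thesis
    using assms(3)
  proof (induction rule: generate_field.induct)
    case one
    then show ?case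
      using subringE(3)[OF T] by (intro bexI[of _ \<one>]) auto
  next
    case (incl h)
    then show ?case
      using subringE(3)[OF T] assms(2) TR by (intro bexI[of _ h] bexI[of _ \<one>]) auto
  next
    case (a_inv h)
    then show ?case
      using subringE(5)[OF T] cl TR by (metis l_minus)
  next
    case (m_inv h)
    then obtain a b where *: "a \<in> T" "b \<in> T" "b \<noteq> \<zero>" "h \<otimes> b = a" by blast
    have h: "h \<in> Units R" "h \<in> carrier R"
      using m_inv.hyps cl field_Units by auto
    have "inv h \<otimes> a = b"
      unfolding *(4)[symmetric] using h TR[OF *(2)] by (simp add: m_assoc[symmetric])
    moreover have "a \<noteq> \<zero>"
      using * m_inv.hyps(2) h(2) TR integral by blast
    ultimately show ?case using * by blast
  next
    case (eng_add x y)
    then obtain a b c d where *: "a \<in> T" "b \<in> T" "b \<noteq> \<zero>" "x \<otimes> b = a" "c \<in> T" "d \<in> T" "d \<noteq> \<zero>" "y \<otimes> d = c"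
      by blast
    have "(x \<oplus> y) \<otimes> (b \<otimes> d) = x \<otimes> b \<otimes> d \<oplus> y \<otimes> d \<otimes> b"
      using cl[OF eng_add.hyps(1)] cl[OF eng_add.hyps(2)] TR[OF *(2)] TR[OF *(6)] by algebra
    moreover have "b \<otimes> d \<noteq> \<zero>"
      using * TR integral by blast
    ultimately show ?case
      using * subringE(6,7)[OF T] by (metis (no_types))
  next
    case (eng_mult x y)
    then obtain a b c d where *: "a \<in> T" "b \<in> T" "b \<noteq> \<zero>" "x \<otimes> b = a" "c \<in> T" "d \<in> T" "d \<noteq> \<zero>" "y \<otimes> d = c"
      by blast
    have "(x \<otimes> y) \<otimes> (b \<otimes> d) = (x \<otimes> b) \<otimes> (y \<otimes> d)"
      using cl[OF eng_mult.hyps(1)] cl[OF eng_mult.hyps(2)] TR[OF *(2)] TR[OF *(6)] by algebra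
    moreover have "b \<otimes> d \<noteq> \<zero>"
      using * TR integral by blast
    ultimately show ?case
      using * subringE(6)[OF T] by (metis (no_types))
  qed
qed

lemma (in field) generate_field_common_denominator:
  assumes T: "subring T R" and "S \<subseteq> T" and "set xs \<subseteq> generate_field R S"
  shows "\<exists>s\<in>T. s \<noteq> \<zero> \<and> (\<forall>x\<in>set xs. x \<otimes> s \<in> T)"
  using assms(3)
proof (induction xs)
  case Nil
  then show ?case
    using subringE(3)[OF T] by (intro bexI[of _ \<one>]) auto
next
  case (Cons x xs)
  note TR = subsetD[OF subringE(1)[OF T]]
  obtain s where s: "s \<in> T" "s \<noteq> \<zero>" "\<forall>x\<in>set xs. x \<otimes> s \<in> T"
    using Cons by auto
  obtain b where b: "b \<in> T" "b \<noteq> \<zero>" "x \<otimes> b \<in> T"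
    using generate_field_fraction[OF T assms(2), of x] Cons.prems by auto
  have cl: "y \<in> carrier R" if "y \<in> set (x # xs)" for y
    using generate_field_in_carrier[of S y] assms(2) TR Cons.prems that by blast
  have "y \<otimes> (s \<otimes> b) \<in> T" if "y \<in> set (x # xs)" for y
  proof (cases "y = x")
    case True
    have "x \<otimes> (s \<otimes> b) = s \<otimes> (x \<otimes> b)"
      using cl[of x] s b TR by (simp add: m_lcomm)
    then show ?thesis
      using True subringE(6)[OF T] s b by simp
  next
    case False
    have "y \<otimes> (s \<otimes> b) = (y \<otimes> s) \<otimes> b"
      using cl[OF that] s b TR by (simp add: m_assoc)
    then show ?thesis
      using False that subringE(6)[OF T] s b by simp
  qed
  moreover have "s \<otimes> b \<noteq> \<zero>"
    using s b TR integral by blast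
  ultimately show ?case
    using subringE(6)[OF T s(1) b(1)] by blast
qed

locale multiplicative_filtration = field R for R (structure) +
  fixes C :: "'a set" and W :: "nat \<Rightarrow> 'a set"
  assumes C: "subring C R"
    and W_finite: "finite (W N)"
    and W_closed: "W N \<subseteq> carrier R"
    and W_mono: "M \<le> N \<Longrightarrow> W M \<subseteq> W N"
    and W_one: "\<one> \<in> W 0"
    and W_mult: "v \<in> W M \<Longrightarrow> w \<in> W N \<Longrightarrow> v \<otimes> w \<in> W (M + N)"
begin

definition V :: "nat \<Rightarrow> 'a set" where
  "V N = lin_span R C (W N)"

lemma V_closed: "V N \<subseteq> carrier R"
  unfolding V_def by (rule lin_span_closed[OF subringE(1)[OF C] W_closed])

lemma V_mono: "M \<le> N \<Longrightarrow> V M \<subseteq> V N"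
  unfolding V_def by (rule lin_span_mono[OF W_mono])

lemma W_subset_V: "W N \<subseteq> V N"
  unfolding V_def using lin_span_incl[OF C W_closed] by blast

lemma V_mult: "a \<in> V M \<Longrightarrow> b \<in> V N \<Longrightarrow> a \<otimes> b \<in> V (M + N)"
  unfolding V_def by (rule lin_span_mult[OF C W_closed W_closed W_closed W_mult])

lemma V_pow:
  assumes "a \<in> V N"
  shows "a [^] k \<in> V (k * N)"
proof (induction k)
  case 0
  then show ?case using W_one W_subset_V by auto
next
  case (Suc k)
  then show ?case using V_mult[OF Suc.IH assms] by (simp add: add.commute)
qed

lemma finite_subset_V:
  assumes "finite Y" "Y \<subseteq> (\<Union>N. V N)"
  shows "\<exists>N. Y \<subseteq> V N"
  using assms
proof (induction Y rule: finite_induct)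
  case (insert y Y)
  then obtain M N where "Y \<subseteq> V M" "y \<in> V N" by auto
  then have "insert y Y \<subseteq> V (max M N)"
    using V_mono[of M "max M N"] V_mono[of N "max M N"] by auto
  then show ?case by blast
qed simp

lemma subring_Union_V: "subring (\<Union>N. V N) R"
proof (rule ring.subringI[OF ring_axioms])
  note CR = subringE(1)[OF C]
  show "(\<Union>N. V N) \<subseteq> carrier R"
    using V_closed by blast
  show "\<one> \<in> (\<Union>N. V N)"
    using W_one W_subset_V by blast
  show "\<ominus> a \<in> (\<Union>N. V N)" if a: "a \<in> (\<Union>N. V N)" for a
  proof -
    obtain N where "a \<in> V N" using a by blast
    then have "\<ominus> \<one> \<otimes> a \<in> V N"
      unfolding V_def using subringE(3,5)[OF C] by (intro lin_span_smult[OF C W_closed])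
    then show ?thesis
      using \<open>a \<in> V N\<close> V_closed by (auto simp: l_minus subset_iff)
  qed
  fix a b assume "a \<in> (\<Union>N. V N)" "b \<in> (\<Union>N. V N)"
  then obtain M N where ab: "a \<in> V M" "b \<in> V N" by blast
  show "a \<otimes> b \<in> (\<Union>N. V N)"
    using V_mult[OF ab] by blast
  have "a \<in> V (M + N)" "b \<in> V (M + N)"
    using ab V_mono[of M "M + N"] V_mono[of N "M + N"] by auto
  then show "a \<oplus> b \<in> (\<Union>N. V N)"
    unfolding V_def using lin_span_add[OF CR W_closed] by blast
qed

lemma scaled_monomial_in_V:
  assumes s: "s \<in> V D" and xs: "set xs \<subseteq> carrier R" "\<And>x. x \<in> set xs \<Longrightarrow> x \<otimes> s \<in> V D"
    and "\<alpha> \<in> exponents d (length xs)"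
  shows "s [^] (length xs * d) \<otimes> monomial R xs \<alpha> \<in> V (length xs * d * D)"
  using xs assms(4)
proof (induction xs arbitrary: \<alpha>)
  case Nil
  then show ?case using W_one W_subset_V by auto
next
  case (Cons x xs)
  then obtain k \<beta> where \<alpha>: "\<alpha> = k # \<beta>" "k \<le> d" "\<beta> \<in> exponents d (length xs)"
    by (auto simp: exponents_Suc)
  have cl: "s \<in> carrier R" "x \<in> carrier R" "monomial R xs \<beta> \<in> carrier R"
    using s V_closed Cons.prems(1) by auto
  have "s [^] d = s [^] k \<otimes> s [^] (d - k)"
    using \<alpha>(2) cl by (simp add: nat_pow_mult)
  then have "s [^] (length (x # xs) * d) \<otimes> monomial R (x # xs) \<alpha>
      = (x \<otimes> s) [^] k \<otimes> s [^] (d - k) \<otimes> (s [^] (length xs * d) \<otimes> monomial R xs \<beta>)"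
    using cl unfolding \<alpha>(1) by (simp add: nat_pow_mult[symmetric] nat_pow_distrib m_ac)
  also have "\<dots> \<in> V (k * D + (d - k) * D + length xs * d * D)"
    using Cons.IH[OF _ _ \<alpha>(3)] Cons.prems(1,2) s by (intro V_mult V_pow) auto
  also have "k * D + (d - k) * D + length xs * d * D = length (x # xs) * d * D"
    using \<alpha>(2) by (simp add: algebra_simps flip: add_mult_distrib)
  finally show ?case .
qed

lemma card_exponents_le_card_W:
  assumes s: "s \<in> V D" "s \<noteq> \<zero>" and xs: "set xs \<subseteq> carrier R" "\<And>x. x \<in> set xs \<Longrightarrow> x \<otimes> s \<in> V D"
    and indep: "alg_indep_mod R {\<zero>} C xs"
  shows "(d + 1) ^ length xs \<le> card (W (length xs * d * D))"
proof (rule ccontr)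
  let ?n = "length xs"
  let ?E = "exponents d ?n"
  have sR: "s \<in> carrier R" using s(1) V_closed by blast
  assume "\<not> ?thesis"
  then have less: "card (W (?n * d * D)) < card ?E"
    by (simp add: card_exponents)
  have "s [^] (?n * d) \<otimes> monomial R xs \<alpha> \<in> V (?n * d * D)" if "\<alpha> \<in> ?E" for \<alpha>
    by (rule scaled_monomial_in_V[OF s(1) xs that])
  then have "(\<lambda>\<alpha>. s [^] (?n * d) \<otimes> monomial R xs \<alpha>) \<in> ?E \<rightarrow> lin_span R C (W (?n * d * D))"
    unfolding V_def by (rule Pi_I)
  from linear_relation_exists[OF C W_finite W_closed finite_exponents less this]
  obtain c where c: "c \<in> ?E \<rightarrow> C" "\<exists>\<alpha>\<in>?E. c \<alpha> \<noteq> \<zero>"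
    and rel: "(\<Oplus>\<alpha>\<in>?E. c \<alpha> \<otimes> (s [^] (?n * d) \<otimes> monomial R xs \<alpha>)) = \<zero>"
    by blast
  have cR: "c \<alpha> \<in> carrier R" if "\<alpha> \<in> ?E" for \<alpha>
    using c(1) that subringE(1)[OF C] by blast
  have "s [^] (?n * d) \<otimes> (\<Oplus>\<alpha>\<in>?E. c \<alpha> \<otimes> monomial R xs \<alpha>)
      = (\<Oplus>\<alpha>\<in>?E. c \<alpha> \<otimes> (s [^] (?n * d) \<otimes> monomial R xs \<alpha>))"
    using cR sR xs(1) by (subst finsum_rdistr) (auto simp: m_lcomm intro!: add.finprod_cong')
  moreover have "s [^] k \<noteq> \<zero>" for k :: nat
    using sR s(2) by (induction k) (auto dest: integral)
  ultimately have "(\<Oplus>\<alpha>\<in>?E. c \<alpha> \<otimes> monomial R xs \<alpha>) = \<zero>"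
    using rel sR cR xs(1) integral[of "s [^] (?n * d)" "\<Oplus>\<alpha>\<in>?E. c \<alpha> \<otimes> monomial R xs \<alpha>"]
    by (auto simp: finsum_closed)
  then show False
    using indep c unfolding alg_indep_mod_def lin_indep_mod_def by blast
qed

lemma length_alg_indep_le_growth:
  assumes growth: "\<And>N. card (W N) \<le> A * (N + 1) ^ r"
    and xs: "set xs \<subseteq> generate_field R (\<Union>N. W N)" and indep: "alg_indep_mod R {\<zero>} C xs"
  shows "length xs \<le> r"
proof -
  let ?n = "length xs"
  have cl: "set xs \<subseteq> carrier R"
    using generate_field_in_carrier[of "\<Union>N. W N"] xs W_closed by blast
  obtain s where s: "s \<in> (\<Union>N. V N)" "s \<noteq> \<zero>" "\<forall>x\<in>set xs. x \<otimes> s \<in> (\<Union>N. V N)"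
    using generate_field_common_denominator[OF subring_Union_V _ xs] W_subset_V by blast
  then have "insert s ((\<lambda>x. x \<otimes> s) ` set xs) \<subseteq> (\<Union>N. V N)"
    by auto
  then obtain D where D: "insert s ((\<lambda>x. x \<otimes> s) ` set xs) \<subseteq> V D"
    using finite_subset_V[of "insert s ((\<lambda>x. x \<otimes> s) ` set xs)"] by auto
  have "(d + 1) ^ ?n \<le> card (W (?n * d * D))" for d
    by (rule card_exponents_le_card_W[OF _ s(2) cl _ indep]) (use D in auto)
  moreover have "card (W (?n * d * D)) \<le> (A * (?n * D + 1) ^ r) * (d + 1) ^ r" for d
  proof -
    have "card (W (?n * d * D)) \<le> A * (?n * d * D + 1) ^ r"
      by (rule growth)
    also have "\<dots> \<le> A * ((?n * D + 1) * (d + 1)) ^ r"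
      by (intro mult_le_mono2 power_mono) (simp_all add: algebra_simps)
    also have "\<dots> = A * (?n * D + 1) ^ r * (d + 1) ^ r"
      by (simp only: power_mult_distrib mult.assoc)
    finally show ?thesis .
  qed
  ultimately have "\<exists>i\<in>{()}. ?n \<le> r"
    by (intro exponent_le_if_infinitely_often_le[where T = "range Suc" and c = "\<lambda>_. A * (?n * D + 1) ^ r"])
      (auto intro: order_trans simp: finite_image_iff)
  then show ?thesis by simp
qed

end

section \<open>Lattices of relations\<close>

definition int_lattice :: "'g set \<Rightarrow> ('g \<Rightarrow> int) set \<Rightarrow> bool" where
  "int_lattice G L \<longleftrightarrow>
     (\<lambda>_. 0) \<in> L \<and> (\<forall>x\<in>L. \<forall>y\<in>L. (\<lambda>g. x g - y g) \<in> L) \<and> (\<forall>x\<in>L. \<forall>g. g \<notin> G \<longrightarrow> x g = 0)"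

lemma int_latticeD:
  assumes "int_lattice G L"
  shows "(\<lambda>_. 0) \<in> L" "x \<in> L \<Longrightarrow> y \<in> L \<Longrightarrow> (\<lambda>g. x g - y g) \<in> L"
    "x \<in> L \<Longrightarrow> g \<notin> G \<Longrightarrow> x g = 0"
  using assms by (simp_all add: int_lattice_def)

lemma int_lattice_lincomb:
  assumes "int_lattice G L" "x \<in> L" "y \<in> L"
  shows "(\<lambda>g. x g + k * y g) \<in> L"
proof (induction k rule: int_induct[where k = 0])
  case base
  then show ?case using assms(2) by simp
next
  case (step1 k)
  have "(\<lambda>g. x g + k * y g - (0 - y g)) \<in> L"
    by (intro int_latticeD[OF assms(1)] step1 assms)
  then show ?case by (simp add: algebra_simps)
next
  case (step2 k)
  then have "(\<lambda>g. x g + k * y g - y g) \<in> L"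
    by (intro int_latticeD(2)[OF assms(1)] assms)
  then show ?case by (simp add: algebra_simps)
qed

lemma int_lattice_sum:
  assumes "int_lattice G L" "finite I" "\<And>i. i \<in> I \<Longrightarrow> y i \<in> L"
  shows "(\<lambda>g. \<Sum>i\<in>I. k i * y i g) \<in> L"
  using assms(2,3)
proof (induction I rule: finite_induct)
  case empty
  then show ?case using assms(1) by (simp add: int_lattice_def)
next
  case (insert i I)
  then have "(\<lambda>g. (\<Sum>i\<in>I. k i * y i g) + k i * y i g) \<in> L"
    by (intro int_lattice_lincomb[OF assms(1)]) auto
  with insert.hyps show ?case by (simp add: add.commute)
qed

definition free_coordinates :: "('g \<Rightarrow> int) set \<Rightarrow> 'g set \<Rightarrow> bool" where
  "free_coordinates L B \<longleftrightarrow> (\<forall>x\<in>L. (\<forall>g. g \<notin> B \<longrightarrow> x g = 0) \<longrightarrow> (\<forall>g. x g = 0))"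

text \<open>The relation \<open>e \<cdot> g = \<Sum>\<^sub>b c b g \<cdot> b\<close>.\<close>

definition coordinate_relation ::
  "'g set \<Rightarrow> int \<Rightarrow> ('g \<Rightarrow> 'g \<Rightarrow> int) \<Rightarrow> 'g \<Rightarrow> 'g \<Rightarrow> int" where
  "coordinate_relation B e c g = (\<lambda>x. (if x = g then e else 0) - (if x \<in> B then c x g else 0))"

lemma maximal_free_coordinates:
  assumes "finite G" and L: "int_lattice G L"
  obtains B where "B \<subseteq> G" "free_coordinates L B"
    "\<And>j. j \<in> G - B \<Longrightarrow> \<exists>x\<in>L. x j > 0 \<and> (\<forall>g. g \<notin> insert j B \<longrightarrow> x g = 0)"
proof -
  define ok where "ok B \<longleftrightarrow> B \<subseteq> G \<and> free_coordinates L B" for B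
  have "ok {}" by (simp add: ok_def free_coordinates_def)
  moreover have "\<forall>B. ok B \<longrightarrow> card B < Suc (card G)"
    unfolding ok_def using assms(1) by (simp add: card_mono less_Suc_eq_le)
  ultimately obtain B where B: "ok B" and max: "\<And>B'. ok B' \<Longrightarrow> card B' \<le> card B"
    using ex_has_greatest_nat[of ok "{}" card] by blast
  have finB: "finite B"
    using B assms(1) finite_subset unfolding ok_def by blast
  have "\<exists>x\<in>L. x j > 0 \<and> (\<forall>g. g \<notin> insert j B \<longrightarrow> x g = 0)" if j: "j \<in> G - B" for j
  proof -
    have "\<not> ok (insert j B)"
      using max[of "insert j B"] j finB by auto
    then have "\<not> free_coordinates L (insert j B)"
      using B j by (simp add: ok_def)
    then obtain x g where x: "x \<in> L" "\<forall>g. g \<notin> insert j B \<longrightarrow> x g = 0" "x g \<noteq> 0"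
      unfolding free_coordinates_def by blast
    have "x j \<noteq> 0"
    proof
      assume "x j = 0"
      with x(2) have "\<forall>g. g \<notin> B \<longrightarrow> x g = 0" by (metis insertE)
      then show False using B x(1,3) unfolding ok_def free_coordinates_def by blast
    qed
    then consider "x j > 0" | "0 - x j > 0" by linarith
    then show ?thesis
    proof cases
      case 1
      then show ?thesis using x(1,2) by blast
    next
      case 2
      moreover have "(\<lambda>g. 0 - x g) \<in> L"
        by (intro int_latticeD[OF L] x(1))
      ultimately show ?thesis
        using x(2) by (intro bexI[of _ "\<lambda>g. 0 - x g"]) simp_all
    qed
  qed
  with B that show thesis unfolding ok_def by blast
qed

lemma coordinate_relations_exist:
  assumes "finite G" and L: "int_lattice G L"
  obtains B e c where "B \<subseteq> G" "e > 0" "free_coordinates L B"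
    "\<And>g. g \<in> G \<Longrightarrow> coordinate_relation B (int e) c g \<in> L"
proof (rule maximal_free_coordinates[OF assms])
  fix B assume B: "B \<subseteq> G" "free_coordinates L B"
    and "\<And>j. j \<in> G - B \<Longrightarrow> \<exists>x\<in>L. x j > 0 \<and> (\<forall>g. g \<notin> insert j B \<longrightarrow> x g = 0)"
  then obtain y where y: "\<And>j. j \<in> G - B \<Longrightarrow> y j \<in> L \<and> y j j > 0 \<and> (\<forall>g. g \<notin> insert j B \<longrightarrow> y j g = 0)"
    by metis
  define e where "e = nat (\<Prod>j\<in>G - B. y j j)"
  have e: "e > 0" "int e = (\<Prod>j\<in>G - B. y j j)"
    using y by (auto simp: e_def intro!: prod_pos less_imp_le)
  define k where "k g = (\<Prod>j\<in>G - B - {g}. y j j)" for g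
  define c where "c b g = (if g \<in> B then if b = g then int e else 0 else - (k g * y g b))" for b g
  have "coordinate_relation B (int e) c g \<in> L" if g: "g \<in> G" for g
  proof (cases "g \<in> B")
    case True
    then have "coordinate_relation B (int e) c g = (\<lambda>_. 0)"
      by (auto simp: coordinate_relation_def c_def)
    then show ?thesis using L by (simp add: int_lattice_def)
  next
    case False
    with g have "int e = k g * y g g"
      unfolding e(2) k_def using prod.remove[of "G - B" g "\<lambda>j. y j j"] assms(1)
      by (simp add: mult.commute)
    then have "coordinate_relation B (int e) c g = (\<lambda>x. 0 + k g * y g x)"
      using y[of g] g False by (auto simp: coordinate_relation_def c_def)
    moreover have "(\<lambda>x. 0 + k g * y g x) \<in> L"
      using y[of g] g False by (intro int_lattice_lincomb[OF L] int_latticeD(1)[OF L]) auto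
    ultimately show ?thesis by simp
  qed
  with B e(1) that show thesis by blast
qed

lemma coordinates_of_basis:
  assumes "free_coordinates L B" and rel: "coordinate_relation B e c b' \<in> L" and "b \<in> B" "b' \<in> B"
  shows "c b b' = (if b = b' then e else 0)"
proof -
  have "\<forall>g. g \<notin> B \<longrightarrow> coordinate_relation B e c b' g = 0"
    using assms(4) by (auto simp: coordinate_relation_def)
  then have "coordinate_relation B e c b' b = 0"
    using assms(1) rel unfolding free_coordinates_def by blast
  then show ?thesis
    using assms(3) by (simp add: coordinate_relation_def split: if_splits)
qed

lemma coordinates_of_lattice_vanish:
  assumes "finite G" and L: "int_lattice G L" and free: "free_coordinates L B"
    and rel: "\<And>g. g \<in> G \<Longrightarrow> coordinate_relation B e c g \<in> L" and x: "x \<in> L" and b: "b \<in> B"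
  shows "(\<Sum>g\<in>G. x g * c b g) = 0"
proof -
  let ?r = "coordinate_relation B e c"
  define w where "w z = (\<Sum>g\<in>G. x g * ?r g z) + - e * x z" for z
  have "w \<in> L"
    unfolding w_def
    by (rule int_lattice_lincomb[OF L int_lattice_sum[OF L assms(1) rel] x])
  moreover have w: "w z = (if z \<in> B then - (\<Sum>g\<in>G. x g * c z g) else 0)" for z
  proof -
    have "(\<Sum>g\<in>G. x g * ?r g z)
        = (\<Sum>g\<in>G. (if z = g then x g * e else 0) - (if z \<in> B then x g * c z g else 0))"
      by (intro sum.cong) (auto simp: coordinate_relation_def algebra_simps)
    also have "\<dots> = e * x z - (if z \<in> B then \<Sum>g\<in>G. x g * c z g else 0)"
      using assms(1) int_latticeD(3)[OF L x] by (auto simp: sum_subtractf)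
    finally show ?thesis by (simp add: w_def)
  qed
  moreover from w have "\<forall>g. g \<notin> B \<longrightarrow> w g = 0"
    by simp
  ultimately have "w b = 0"
    using free unfolding free_coordinates_def by blast
  then show ?thesis using w b by simp
qed

section \<open>Finitely generated monoids with zero\<close>

definition pmonoid_generators :: "'a pmonoid \<Rightarrow> 'a set \<Rightarrow> bool" where
  "pmonoid_generators M G \<longleftrightarrow>
     finite G \<and> G \<subseteq> carrier M \<and> (\<forall>S. submonoid S M \<and> absorb M \<in> S \<and> G \<subseteq> S \<longrightarrow> S = carrier M)"

definition word :: "('a, 'm) monoid_scheme \<Rightarrow> 'a set \<Rightarrow> ('a \<Rightarrow> nat) \<Rightarrow> 'a" where
  "word M H u = (\<Otimes>\<^bsub>M\<^esub>g\<in>H. g [^]\<^bsub>M\<^esub> u g)"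

definition word_relations :: "('a, 'm) monoid_scheme \<Rightarrow> 'a set \<Rightarrow> ('a \<Rightarrow> int) set" where
  "word_relations M H =
     {\<lambda>g. if g \<in> H then int (u g) - int (v g) else 0 | u v. word M H u = word M H v}"

lemma pmonoid_fin_gen_iff: "pmonoid_fin_gen M \<longleftrightarrow> (\<exists>G. pmonoid_generators M G)"
  unfolding pmonoid_fin_gen_def pmonoid_generators_def by blast

context comm_monoid
begin

lemma word_closed: "H \<subseteq> carrier G \<Longrightarrow> word G H u \<in> carrier G"
  unfolding word_def by (intro finprod_closed) auto

lemma word_add:
  assumes "H \<subseteq> carrier G"
  shows "word G H (\<lambda>g. u g + v g) = word G H u \<otimes> word G H v"
proof -
  have "word G H (\<lambda>g. u g + v g) = (\<Otimes>g\<in>H. g [^] u g \<otimes> g [^] v g)"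
    unfolding word_def using assms by (intro finprod_cong') (auto simp: nat_pow_mult)
  then show ?thesis
    unfolding word_def using assms by (subst (asm) finprod_multf) auto
qed

lemma word_zero: "word G H (\<lambda>_. 0) = \<one>"
  unfolding word_def by (simp add: finprod_one_eqI)

lemma word_generator:
  assumes "H \<subseteq> carrier G" "finite H" "h \<in> H"
  shows "word G H (\<lambda>g. if g = h then 1 else 0) = h"
proof -
  have "word G H (\<lambda>g. if g = h then 1 else 0) = (\<Otimes>g\<in>H. if h = g then g else \<one>)"
    unfolding word_def using assms by (intro finprod_cong') auto
  also have "\<dots> = h"
    using finprod_singleton[OF assms(3,2), of "\<lambda>g. g"] assms(1) by auto
  finally show ?thesis .
qed

lemma int_lattice_word_relations:
  assumes "H \<subseteq> carrier G"
  shows "int_lattice H (word_relations G H)"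
  unfolding int_lattice_def
proof (intro conjI ballI)
  show "(\<lambda>_. 0) \<in> word_relations G H"
    unfolding word_relations_def by (intro CollectI exI[of _ "\<lambda>_. 0"]) auto
  fix x assume "x \<in> word_relations G H"
  then obtain u v where x: "x = (\<lambda>g. if g \<in> H then int (u g) - int (v g) else 0)"
    and uv: "word G H u = word G H v"
    unfolding word_relations_def by blast
  show "\<forall>g. g \<notin> H \<longrightarrow> x g = 0"
    using x by simp
  fix y assume "y \<in> word_relations G H"
  then obtain u' v' where y: "y = (\<lambda>g. if g \<in> H then int (u' g) - int (v' g) else 0)"
    and uv': "word G H u' = word G H v'"
    unfolding word_relations_def by blast
  have "word G H (\<lambda>g. u g + v' g) = word G H (\<lambda>g. v g + u' g)"
    using uv uv' word_add[OF assms] by simp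
  then show "(\<lambda>g. x g - y g) \<in> word_relations G H"
    unfolding word_relations_def x y
    by (intro CollectI exI[of _ "\<lambda>g. u g + v' g"] exI[of _ "\<lambda>g. v g + u' g"]) auto
qed

end

definition int_word :: "('u, 'm) monoid_scheme \<Rightarrow> 'g set \<Rightarrow> ('g \<Rightarrow> 'u) \<Rightarrow> ('g \<Rightarrow> int) \<Rightarrow> 'u" where
  "int_word U H a x = (\<Otimes>\<^bsub>U\<^esub>g\<in>H. a g [^]\<^bsub>U\<^esub> x g)"

context comm_group
begin

lemma int_word_closed: "a \<in> H \<rightarrow> carrier G \<Longrightarrow> int_word G H a x \<in> carrier G"
  unfolding int_word_def by (intro finprod_closed) auto

lemma int_word_add:
  assumes "a \<in> H \<rightarrow> carrier G"
  shows "int_word G H a (\<lambda>g. x g + y g) = int_word G H a x \<otimes> int_word G H a y"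
proof -
  have "int_word G H a (\<lambda>g. x g + y g) = (\<Otimes>g\<in>H. a g [^] x g \<otimes> a g [^] y g)"
    unfolding int_word_def using assms by (intro finprod_cong') (auto simp: int_pow_mult Pi_def)
  also have "\<dots> = int_word G H a x \<otimes> int_word G H a y"
    unfolding int_word_def using assms by (intro finprod_multf) auto
  finally show ?thesis .
qed

lemma int_word_cong:
  assumes "a \<in> H \<rightarrow> carrier G" "\<And>g. g \<in> H \<Longrightarrow> a g = b g \<and> x g = y g"
  shows "int_word G H a x = int_word G H b y"
  unfolding int_word_def using assms by (intro finprod_cong') (auto simp: Pi_def)

lemma int_word_zero: "int_word G H a (\<lambda>_. 0) = \<one>"
  unfolding int_word_def by (simp add: finprod_one_eqI)

lemma int_word_single:
  assumes "a \<in> H \<rightarrow> carrier G" "finite H" "h \<in> H"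
  shows "int_word G H a (\<lambda>g. if g = h then k else 0) = a h [^] k"
proof -
  have "int_word G H a (\<lambda>g. if g = h then k else 0) = (\<Otimes>g\<in>H. if h = g then a g [^] k else \<one>)"
    unfolding int_word_def using assms by (intro finprod_cong') (auto simp: Pi_def)
  also have "\<dots> = a h [^] k"
    using finprod_singleton[OF assms(3,2), of "\<lambda>g. a g [^] k"] assms(1) by (auto simp: Pi_def)
  finally show ?thesis .
qed

lemma int_word_subset:
  assumes "a \<in> H \<rightarrow> carrier G" "finite H" "B \<subseteq> H"
  shows "int_word G H a (\<lambda>g. if g \<in> B then x g else 0) = int_word G B a x"
  unfolding int_word_def using assms by (intro finprod_mono_neutral_cong_right) (auto simp: Pi_def)

end

abbreviation pm_homs :: "'a pmonoid \<Rightarrow> 'b pmonoid \<Rightarrow> ('a \<Rightarrow> 'b) set" where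
  "pm_homs M N \<equiv> pmonoid_hom M N \<inter> extensional (carrier M)"

definition pm_kernel :: "'a pmonoid \<Rightarrow> 'b pmonoid \<Rightarrow> ('a \<Rightarrow> 'b) \<Rightarrow> 'a set" where
  "pm_kernel M N \<chi> = {x \<in> carrier M. \<chi> x = absorb N}"

definition pm_field :: "'a pmonoid \<Rightarrow> bool" where
  "pm_field N \<longleftrightarrow> pmonoid N \<and> carrier N = insert (absorb N) (Units N) \<and> absorb N \<notin> Units N"

lemma pmonoid_homD:
  assumes "\<chi> \<in> pmonoid_hom M N"
  shows "x \<in> carrier M \<Longrightarrow> \<chi> x \<in> carrier N"
    and "x \<in> carrier M \<Longrightarrow> y \<in> carrier M \<Longrightarrow> \<chi> (x \<otimes>\<^bsub>M\<^esub> y) = \<chi> x \<otimes>\<^bsub>N\<^esub> \<chi> y"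
    and "\<chi> \<one>\<^bsub>M\<^esub> = \<one>\<^bsub>N\<^esub>" and "\<chi> (absorb M) = absorb N"
  using assms by (auto simp: pmonoid_hom_def hom_def)

lemma pm_fieldD:
  assumes "pm_field N"
  shows "pmonoid N" "carrier N = insert (absorb N) (Units N)" "absorb N \<notin> Units N"
  using assms by (simp_all add: pm_field_def)

lemma (in pmonoid) absorb_mult_right: "x \<in> carrier M \<Longrightarrow> x \<otimes> absorb M = absorb M"
  using absorb_mult m_comm absorb_closed by metis

lemma pmonoid_primeD:
  assumes "pmonoid M" "pmonoid_prime p M"
  shows "p \<subseteq> carrier M" "absorb M \<in> p" "\<one>\<^bsub>M\<^esub> \<notin> p"
    and "a \<in> carrier M \<Longrightarrow> b \<in> carrier M \<Longrightarrow> a \<otimes>\<^bsub>M\<^esub> b \<in> p \<longleftrightarrow> a \<in> p \<or> b \<in> p"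
proof -
  interpret pmonoid M by fact
  show sub: "p \<subseteq> carrier M" and "absorb M \<in> p"
    using assms(2) unfolding pmonoid_prime_def pmonoid_ideal_def by auto
  have id: "a \<otimes>\<^bsub>M\<^esub> x \<in> p" if "a \<in> p" "x \<in> carrier M" for a x
    using assms(2) that unfolding pmonoid_prime_def pmonoid_ideal_def by blast
  have "a \<otimes>\<^bsub>M\<^esub> b \<notin> p" if "a \<in> carrier M - p" "b \<in> carrier M - p" for a b
    using assms(2) that unfolding pmonoid_prime_def by blast
  then show "a \<in> carrier M \<Longrightarrow> b \<in> carrier M \<Longrightarrow> a \<otimes>\<^bsub>M\<^esub> b \<in> p \<longleftrightarrow> a \<in> p \<or> b \<in> p"
    using id[of a b] id[of b a] m_comm[of a b] by auto
  show "\<one>\<^bsub>M\<^esub> \<notin> p"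
  proof
    assume "\<one>\<^bsub>M\<^esub> \<in> p"
    then have "carrier M \<subseteq> p" using id by (metis l_one subsetI)
    then show False using assms(2) sub unfolding pmonoid_prime_def by blast
  qed
qed

lemma pm_field_iso_group_pmonoid:
  assumes N: "pm_field N"
  shows "pmonoid_iso N (group_pmonoid (units_of N))"
proof -
  interpret pmonoid N using pm_fieldD(1)[OF N] .
  have car: "carrier N = insert (absorb N) (Units N)" and na: "absorb N \<notin> Units N"
    using pm_fieldD[OF N] by auto
  define f where "f x = (if x = absorb N then None else Some x)" for x
  have "f \<in> hom N (group_pmonoid (units_of N))"
  proof (rule homI)
    show "f x \<in> carrier (group_pmonoid (units_of N))" if "x \<in> carrier N" for x
      using that car by (auto simp: f_def group_pmonoid_def units_of_carrier)
    fix x y assume xy: "x \<in> carrier N" "y \<in> carrier N"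
    show "f (x \<otimes>\<^bsub>N\<^esub> y) = f x \<otimes>\<^bsub>group_pmonoid (units_of N)\<^esub> f y"
    proof (cases "x = absorb N \<or> y = absorb N")
      case True
      then show ?thesis
        using xy absorb_mult absorb_mult_right by (auto simp: f_def group_pmonoid_def split: option.split)
    next
      case False
      then have "x \<otimes>\<^bsub>N\<^esub> y \<noteq> absorb N"
        using xy car na Units_m_closed by (metis insertE)
      with False show ?thesis
        by (simp add: f_def group_pmonoid_def units_of_mult)
    qed
  qed
  moreover have "\<one>\<^bsub>N\<^esub> \<noteq> absorb N"
    using na Units_one_closed by metis
  then have "f \<one>\<^bsub>N\<^esub> = \<one>\<^bsub>group_pmonoid (units_of N)\<^esub>"
    by (simp add: f_def group_pmonoid_def units_of_one)
  moreover have "f (absorb N) = absorb (group_pmonoid (units_of N))"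
    by (simp add: f_def group_pmonoid_def)
  moreover have "bij_betw f (carrier N) (carrier (group_pmonoid (units_of N)))"
  proof (rule bij_betw_imageI)
    show "inj_on f (carrier N)"
      by (auto simp: inj_on_def f_def)
    show "f ` carrier N = carrier (group_pmonoid (units_of N))"
      using car na by (auto simp: f_def group_pmonoid_def units_of_carrier image_iff)
  qed
  ultimately show ?thesis
    unfolding pmonoid_iso_def pmonoid_hom_def by blast
qed

lemma pm_kernel_prime:
  assumes M: "pmonoid M" and N: "pm_field N" and \<chi>: "\<chi> \<in> pmonoid_hom M N"
  shows "pmonoid_prime (pm_kernel M N \<chi>) M"
    and "x \<in> carrier M - pm_kernel M N \<chi> \<Longrightarrow> \<chi> x \<in> Units N"
proof -
  interpret M: pmonoid M by fact
  interpret N: pmonoid N using pm_fieldD(1)[OF N] .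
  note \<chi> = pmonoid_homD[OF \<chi>]
  show un: "\<chi> x \<in> Units N" if "x \<in> carrier M - pm_kernel M N \<chi>" for x
    using that \<chi>(1)[of x] pm_fieldD(2)[OF N] by (auto simp: pm_kernel_def)
  have nz: "x \<noteq> absorb N" if "x \<in> Units N" for x
    using that pm_fieldD(3)[OF N] by blast
  have "a \<otimes>\<^bsub>M\<^esub> b \<notin> pm_kernel M N \<chi>"
    if "a \<in> carrier M - pm_kernel M N \<chi>" "b \<in> carrier M - pm_kernel M N \<chi>" for a b
    using nz[OF N.Units_m_closed[OF un[OF that(1)] un[OF that(2)]]] \<chi>(2)[of a b] that
    by (simp add: pm_kernel_def)
  moreover have "\<one>\<^bsub>M\<^esub> \<notin> pm_kernel M N \<chi>"
    using \<chi>(3) nz[OF N.Units_one_closed] by (simp add: pm_kernel_def)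
  then have "pm_kernel M N \<chi> \<noteq> carrier M"
    using M.one_closed by blast
  ultimately show "pmonoid_prime (pm_kernel M N \<chi>) M"
    unfolding pmonoid_prime_def pmonoid_ideal_def
    using \<chi> M.absorb_closed N.absorb_mult by (simp add: pm_kernel_def subset_iff)
qed

lemma pm_homs_eqI:
  assumes "pmonoid M" and G: "pmonoid_generators M G" and \<chi>: "\<chi> \<in> pm_homs M N" "\<chi>' \<in> pm_homs M N"
    and eq: "\<And>g. g \<in> G \<Longrightarrow> \<chi> g = \<chi>' g"
  shows "\<chi> = \<chi>'"
proof -
  interpret M: pmonoid M by fact
  define S where "S = {x \<in> carrier M. \<chi> x = \<chi>' x}"
  have "submonoid S M"
    unfolding S_def using \<chi> by (intro submonoid.intro) (auto simp: pmonoid_hom_def hom_def)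
  moreover have "absorb M \<in> S" "G \<subseteq> S"
    unfolding S_def using \<chi> eq G M.absorb_closed by (auto simp: pmonoid_hom_def pmonoid_generators_def)
  ultimately have "S = carrier M"
    using G by (simp add: pmonoid_generators_def)
  then show ?thesis
    using \<chi> by (intro extensionalityI[of _ "carrier M"]) (auto simp: S_def)
qed

lemma finite_pm_homs:
  assumes "pmonoid M" "pmonoid_generators M G" "finite (carrier N)"
  shows "finite (pm_homs M N)"
proof -
  have "inj_on (\<lambda>\<chi>. restrict \<chi> G) (pm_homs M N)"
  proof (rule inj_onI)
    fix \<chi> \<chi>' assume \<chi>: "\<chi> \<in> pm_homs M N" "\<chi>' \<in> pm_homs M N" and eq: "restrict \<chi> G = restrict \<chi>' G"
    show "\<chi> = \<chi>'"
    proof (rule pm_homs_eqI[OF assms(1,2) \<chi>])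
      show "\<chi> g = \<chi>' g" if "g \<in> G" for g
        using fun_cong[OF eq, of g] that by simp
    qed
  qed
  moreover have "(\<lambda>\<chi>. restrict \<chi> G) ` pm_homs M N \<subseteq> G \<rightarrow>\<^sub>E carrier N"
    using assms(2) by (auto simp: pmonoid_hom_def hom_def pmonoid_generators_def)
  moreover have "finite (G \<rightarrow>\<^sub>E carrier N)"
    using assms(2,3) by (intro finite_PiE) (auto simp: pmonoid_generators_def)
  ultimately show ?thesis
    by (meson finite_imageD finite_subset)
qed

lemma pm_hom_word:
  assumes M: "pmonoid M" and N: "pmonoid N" and \<chi>: "\<chi> \<in> pmonoid_hom M N"
    and H: "finite H" "H \<subseteq> carrier M" "\<And>g. g \<in> H \<Longrightarrow> \<chi> g \<in> Units N"
  shows "\<chi> (word M H u) = int_word (units_of N) H \<chi> (\<lambda>g. int (u g))"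
proof -
  interpret M: pmonoid M by fact
  interpret N: pmonoid N by fact
  interpret U: comm_group "units_of N" by (rule N.units_comm_group)
  note hom = pmonoid_homD[OF \<chi>]
  have pow: "\<chi> (g [^]\<^bsub>M\<^esub> n) = \<chi> g [^]\<^bsub>units_of N\<^esub> n" if "g \<in> carrier M" for g and n :: nat
    by (induction n) (use that hom in \<open>auto simp: units_of_one units_of_mult\<close>)
  have "\<chi> (\<Otimes>\<^bsub>M\<^esub>g\<in>F. g [^]\<^bsub>M\<^esub> u g) = (\<Otimes>\<^bsub>units_of N\<^esub>g\<in>F. \<chi> g [^]\<^bsub>units_of N\<^esub> u g)"
    if "finite F" "F \<subseteq> H" for F
    using that
  proof (induction F rule: finite_induct)
    case empty
    then show ?case using hom by (simp add: units_of_one)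
  next
    case (insert g F)
    have cl: "h \<in> carrier M" "\<chi> h \<in> carrier (units_of N)" if "h \<in> insert g F" for h
      using insert.prems H(2,3) that by (auto simp: units_of_carrier)
    then have "(\<Otimes>\<^bsub>M\<^esub>h\<in>insert g F. h [^]\<^bsub>M\<^esub> u h) = g [^]\<^bsub>M\<^esub> u g \<otimes>\<^bsub>M\<^esub> (\<Otimes>\<^bsub>M\<^esub>h\<in>F. h [^]\<^bsub>M\<^esub> u h)"
      using insert.hyps by (intro M.finprod_insert) auto
    moreover have "(\<Otimes>\<^bsub>units_of N\<^esub>h\<in>insert g F. \<chi> h [^]\<^bsub>units_of N\<^esub> u h)
        = \<chi> g [^]\<^bsub>units_of N\<^esub> u g \<otimes>\<^bsub>units_of N\<^esub> (\<Otimes>\<^bsub>units_of N\<^esub>h\<in>F. \<chi> h [^]\<^bsub>units_of N\<^esub> u h)"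
      using insert.hyps cl by (intro U.finprod_insert) auto
    moreover have "(\<Otimes>\<^bsub>M\<^esub>h\<in>F. h [^]\<^bsub>M\<^esub> u h) \<in> carrier M"
      using cl by (intro M.finprod_closed) auto
    ultimately show ?case
      using insert cl(1)[of g] pow[of g] hom(2)[of "g [^]\<^bsub>M\<^esub> u g"] by (simp add: units_of_mult)
  qed
  then show ?thesis
    using H(1) by (simp add: word_def int_word_def int_pow_int)
qed

text \<open>The units of the localisation at \<open>p\<close> are generated by the generators outside \<open>p\<close>; up to torsion
  they are free on \<open>B\<close>, and \<open>c b g / e\<close> is the coordinate of \<open>g\<close> at \<open>b\<close>.\<close>

section \<open>Bases of the elements outside a prime\<close>

locale prime_basis = pmonoid M for M :: "'a pmonoid" (structure) +
  fixes G p B :: "'a set" and e :: nat and c :: "'a \<Rightarrow> 'a \<Rightarrow> int"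
  assumes generators: "pmonoid_generators M G"
    and prime: "pmonoid_prime p M"
    and basis: "B \<subseteq> G - p" and e_pos: "e > 0"
    and free: "free_coordinates (word_relations M (G - p)) B"
    and relation: "g \<in> G - p \<Longrightarrow> coordinate_relation B (int e) c g \<in> word_relations M (G - p)"

lemma prime_basis_exists:
  assumes "pmonoid M" "pmonoid_generators M G" "pmonoid_prime p M"
  shows "\<exists>B e c. prime_basis M G p B e c"
proof -
  interpret pmonoid M by fact
  have H: "finite (G - p)" "G - p \<subseteq> carrier M"
    using assms(2) by (auto simp: pmonoid_generators_def)
  obtain B e c where "B \<subseteq> G - p" "e > 0" "free_coordinates (word_relations M (G - p)) B"
    "\<And>g. g \<in> G - p \<Longrightarrow> coordinate_relation B (int e) c g \<in> word_relations M (G - p)"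
    using coordinate_relations_exist[OF H(1) int_lattice_word_relations[OF H(2)]] by blast
  with assms have "prime_basis M G p B e c"
    by (simp add: prime_basis_def prime_basis_axioms_def)
  then show ?thesis by blast
qed

context prime_basis
begin

abbreviation "H \<equiv> G - p"

lemma H: "finite H" "H \<subseteq> carrier M"
  using generators by (auto simp: pmonoid_generators_def)

lemma finite_basis: "finite B"
  using basis H(1) finite_subset by blast

lemmas prime_simps = pmonoid_primeD[OF pmonoid_axioms prime]

lemma word_notin_prime: "word M H u \<notin> p"
proof -
  have pow: "g [^] n \<notin> p" if "g \<in> H" for g and n :: nat
    by (induction n) (use that H(2) prime_simps(3,4) in auto)
  have "(\<Otimes>g\<in>F. g [^] u g) \<in> carrier M - p" if "finite F" "F \<subseteq> H" for F
    using that
  proof (induction F rule: finite_induct)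
    case (insert g F)
    then show ?case
      using H(2) pow[of g "u g"] prime_simps(4)[of "g [^] u g" "\<Otimes>g\<in>F. g [^] u g"]
      by (subst finprod_insert) (auto simp: subset_iff Pi_def)
  qed (use prime_simps in simp)
  then show ?thesis
    unfolding word_def using H(1) by blast
qed

lemma outside_prime_is_word:
  assumes "x \<in> carrier M" "x \<notin> p"
  obtains u where "x = word M H u"
proof -
  define S where "S = p \<union> range (word M H)"
  have "submonoid S M"
  proof (rule submonoid.intro)
    show S: "S \<subseteq> carrier M"
      unfolding S_def using prime_simps(1) word_closed[OF H(2)] by auto
    show "\<one> \<in> S"
      unfolding S_def using word_zero[of H] by (metis UnI2 rangeI)
    fix x y assume xy: "x \<in> S" "y \<in> S"
    show "x \<otimes> y \<in> S"
    proof (cases "x \<in> p \<or> y \<in> p")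
      case True
      then show ?thesis
        using xy S prime_simps(4)[of x y] unfolding S_def by blast
    next
      case False
      then obtain u v where "x = word M H u" "y = word M H v"
        using xy unfolding S_def by auto
      then show ?thesis
        unfolding S_def using word_add[OF H(2), of u v, symmetric] by auto
    qed
  qed
  moreover have "G \<subseteq> S"
  proof
    fix g assume "g \<in> G"
    then show "g \<in> S"
      unfolding S_def using word_generator[OF H(2,1), of g] by (metis DiffI UnI1 UnI2 rangeI)
  qed
  ultimately have "S = carrier M"
    using generators prime_simps(2) unfolding S_def pmonoid_generators_def by blast
  with assms that show thesis
    unfolding S_def by blast
qed

lemma basis_coordinates: "b \<in> B \<Longrightarrow> b' \<in> B \<Longrightarrow> c b b' = (if b = b' then int e else 0)"
  using coordinates_of_basis[OF free relation] basis by blast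

lemma relation_coordinates_vanish:
  "x \<in> word_relations M H \<Longrightarrow> b \<in> B \<Longrightarrow> (\<Sum>g\<in>H. x g * c b g) = 0"
  by (rule coordinates_of_lattice_vanish[OF H(1) int_lattice_word_relations[OF H(2)] free relation])

end

locale prime_basis_hom = prime_basis +
  fixes N :: "'b pmonoid" and \<chi> :: "'a \<Rightarrow> 'b"
  assumes N: "pmonoid N" and hom: "\<chi> \<in> pmonoid_hom M N" and hom_units: "g \<in> G - p \<Longrightarrow> \<chi> g \<in> Units N"
begin

sublocale N: pmonoid N by (rule N)

sublocale U: comm_group "units_of N" by (rule N.units_comm_group)

lemma hom_closed: "\<chi> \<in> H \<rightarrow> carrier (units_of N)" "\<chi> \<in> B \<rightarrow> carrier (units_of N)"
  using hom_units basis by (auto simp: units_of_carrier)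

lemma hom_word: "\<chi> (word M H u) = int_word (units_of N) H \<chi> (\<lambda>g. int (u g))"
  by (rule pm_hom_word[OF pmonoid_axioms N hom H hom_units])

lemma hom_relation:
  assumes "x \<in> word_relations M H"
  shows "int_word (units_of N) H \<chi> x = \<one>\<^bsub>units_of N\<^esub>"
proof -
  let ?E = "int_word (units_of N) H \<chi>"
  obtain u v where x: "x = (\<lambda>g. if g \<in> H then int (u g) - int (v g) else 0)" "word M H u = word M H v"
    using assms unfolding word_relations_def by blast
  have "?E x \<otimes>\<^bsub>units_of N\<^esub> ?E (\<lambda>g. int (v g)) = ?E (\<lambda>g. int (u g))"
    unfolding U.int_word_add[OF hom_closed(1), symmetric]
    by (rule U.int_word_cong) (use hom_closed(1) in \<open>auto simp: x(1)\<close>)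
  also have "\<dots> = ?E (\<lambda>g. int (v g))"
    using x(2) by (simp only: flip: hom_word)
  finally show ?thesis
    using U.int_word_closed[OF hom_closed(1)] U.r_cancel_one by blast
qed

lemma hom_exponent_multiple:
  "int_word (units_of N) H \<chi> (\<lambda>g. int e * q g)
     = int_word (units_of N) B \<chi> (\<lambda>b. \<Sum>g\<in>H. q g * c b g)"
proof -
  let ?E = "int_word (units_of N) H \<chi>"
  define x where "x z = (\<Sum>g\<in>H. q g * coordinate_relation B (int e) c g z)" for z
  let ?y = "\<lambda>z. if z \<in> B then \<Sum>g\<in>H. q g * c z g else 0"
  have "x \<in> word_relations M H"
    unfolding x_def
    by (rule int_lattice_sum[OF int_lattice_word_relations[OF H(2)] H(1) relation])
  then have trivial: "?E x = \<one>\<^bsub>units_of N\<^esub>"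
    by (rule hom_relation)
  have x: "int e * q z = x z + ?y z" if "z \<in> H" for z
  proof -
    have "x z = (\<Sum>g\<in>H. (if z = g then q g * int e else 0) - (if z \<in> B then q g * c z g else 0))"
      unfolding x_def by (intro sum.cong) (auto simp: coordinate_relation_def algebra_simps)
    also have "\<dots> = int e * q z - ?y z"
      using that H(1) by (auto simp: sum_subtractf)
    finally show ?thesis by simp
  qed
  have "?E (\<lambda>g. int e * q g) = ?E (\<lambda>z. x z + ?y z)"
    by (rule U.int_word_cong[OF hom_closed(1)]) (simp add: x)
  also have "\<dots> = ?E ?y"
    using U.int_word_add[OF hom_closed(1)] trivial U.int_word_closed[OF hom_closed(1)] by simp
  also have "\<dots> = int_word (units_of N) B \<chi> (\<lambda>b. \<Sum>g\<in>H. q g * c b g)"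
    by (rule U.int_word_subset[OF hom_closed(1) H(1) basis])
  finally show ?thesis .
qed

lemma hom_pow_exponent:
  assumes g: "g \<in> H"
  shows "\<chi> g [^]\<^bsub>units_of N\<^esub> e = int_word (units_of N) B \<chi> (\<lambda>b. c b g)"
proof -
  let ?q = "\<lambda>x. if x = g then 1 else 0 :: int"
  have "\<chi> g [^]\<^bsub>units_of N\<^esub> e = int_word (units_of N) H \<chi> (\<lambda>x. if x = g then int e else 0)"
    using U.int_word_single[OF hom_closed(1) H(1) g] by (simp add: int_pow_int)
  also have "\<dots> = int_word (units_of N) H \<chi> (\<lambda>x. int e * ?q x)"
    by (rule U.int_word_cong[OF hom_closed(1)]) auto
  also have "\<dots> = int_word (units_of N) B \<chi> (\<lambda>b. \<Sum>x\<in>H. ?q x * c b x)"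
    by (rule hom_exponent_multiple)
  also have "(\<lambda>b. \<Sum>x\<in>H. ?q x * c b x) = (\<lambda>b. c b g)"
    using H(1) g by (auto simp: if_distrib[where f = "\<lambda>z. z * _"] cong: if_cong)
  finally show ?thesis .
qed

text \<open>Writing the exponents of a word as \<open>e \<cdot> q + r\<close> with \<open>r < e\<close> leaves finitely many choices for \<open>r\<close>,
  while the part \<open>e \<cdot> q\<close> is a word in \<open>B\<close>.\<close>

definition word_values :: "nat \<Rightarrow> 'b set" where
  "word_values n = (\<lambda>u. \<chi> (word M H u)) ` (H \<rightarrow> {..n})"

definition coordinate_size :: nat where
  "coordinate_size = (\<Sum>g\<in>H. \<Sum>b\<in>B. nat \<bar>c b g\<bar>)"

lemma coordinate_bound:
  assumes "b \<in> B" "\<And>g. g \<in> H \<Longrightarrow> 0 \<le> q g \<and> q g \<le> int n"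
  shows "\<bar>\<Sum>g\<in>H. q g * c b g\<bar> \<le> int (n * coordinate_size)"
proof -
  have "\<bar>\<Sum>g\<in>H. q g * c b g\<bar> \<le> (\<Sum>g\<in>H. int n * (\<Sum>b\<in>B. \<bar>c b g\<bar>))"
  proof (rule order_trans[OF sum_abs sum_mono])
    fix g assume g: "g \<in> H"
    have "\<bar>c b g\<bar> \<le> (\<Sum>b\<in>B. \<bar>c b g\<bar>)"
      using assms(1) finite_basis by (intro member_le_sum) auto
    then show "\<bar>q g * c b g\<bar> \<le> int n * (\<Sum>b\<in>B. \<bar>c b g\<bar>)"
      unfolding abs_mult using assms(2)[OF g] by (intro mult_mono) auto
  qed
  then show ?thesis
    by (simp add: coordinate_size_def sum_distrib_left)
qed

lemma word_values_subset:
  "word_values n \<subseteq>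
     (\<lambda>(r, s). int_word (units_of N) H \<chi> r \<otimes>\<^bsub>units_of N\<^esub> int_word (units_of N) B \<chi> s) `
       ((H \<rightarrow>\<^sub>E {0..<int e}) \<times>
        (B \<rightarrow>\<^sub>E {- int (n * coordinate_size)..int (n * coordinate_size)}))"
proof
  fix y assume "y \<in> word_values n"
  then obtain u where u: "\<And>g. g \<in> H \<Longrightarrow> u g \<le> n" "y = \<chi> (word M H u)"
    by (auto simp: word_values_def)
  define q where "q g = int (u g div e)" for g
  define r where "r = (\<lambda>g\<in>H. int (u g mod e))"
  define s where "s = (\<lambda>b\<in>B. \<Sum>g\<in>H. q g * c b g)"
  have "y = int_word (units_of N) H \<chi> (\<lambda>g. r g + int e * q g)"
    unfolding u(2) hom_word
    by (rule U.int_word_cong[OF hom_closed(1)]) (simp add: r_def q_def flip: of_nat_mult of_nat_add)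
  also have "\<dots> = int_word (units_of N) H \<chi> r \<otimes>\<^bsub>units_of N\<^esub> int_word (units_of N) H \<chi> (\<lambda>g. int e * q g)"
    by (rule U.int_word_add[OF hom_closed(1)])
  also have "int_word (units_of N) H \<chi> (\<lambda>g. int e * q g) = int_word (units_of N) B \<chi> s"
    unfolding hom_exponent_multiple
    by (rule U.int_word_cong[OF hom_closed(2)]) (simp add: s_def)
  finally have "y = int_word (units_of N) H \<chi> r \<otimes>\<^bsub>units_of N\<^esub> int_word (units_of N) B \<chi> s" .
  moreover have "r \<in> H \<rightarrow>\<^sub>E {0..<int e}"
    using e_pos by (auto simp: r_def)
  moreover have "0 \<le> q g \<and> q g \<le> int n" if "g \<in> H" for g
    using order_trans[OF div_le_dividend u(1)[OF that]] by (simp add: q_def)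
  then have "s b \<in> {- int (n * coordinate_size)..int (n * coordinate_size)}" if "b \<in> B" for b
    using coordinate_bound[OF that, of q n] that by (auto simp: s_def)
  then have "s \<in> B \<rightarrow>\<^sub>E {- int (n * coordinate_size)..int (n * coordinate_size)}"
    by (auto simp: s_def)
  ultimately show "y \<in> (\<lambda>(r, s). int_word (units_of N) H \<chi> r \<otimes>\<^bsub>units_of N\<^esub> int_word (units_of N) B \<chi> s) `
      ((H \<rightarrow>\<^sub>E {0..<int e}) \<times>
       (B \<rightarrow>\<^sub>E {- int (n * coordinate_size)..int (n * coordinate_size)}))"
    by (intro image_eqI[of _ _ "(r, s)"]) simp_all
qed

lemma word_values_finite: "finite (word_values n)"
  and card_word_values:
    "card (word_values n) \<le> e ^ card H * (2 * coordinate_size + 1) ^ card B * (n + 1) ^ card B"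
proof -
  let ?I = "{- int (n * coordinate_size)..int (n * coordinate_size)}"
  let ?A = "(H \<rightarrow>\<^sub>E {0..<int e}) \<times> (B \<rightarrow>\<^sub>E ?I)"
  have fin: "finite ?A"
    using H(1) finite_basis by (intro finite_cartesian_product finite_PiE) auto
  then show "finite (word_values n)"
    by (rule finite_surj[OF _ word_values_subset])
  have "card (word_values n) \<le> card ?A"
    by (rule surj_card_le[OF fin word_values_subset])
  also have "\<dots> = e ^ card H * card ?I ^ card B"
    using H(1) finite_basis by (simp add: card_cartesian_product card_PiE)
  also have "card ?I = 2 * (n * coordinate_size) + 1"
    unfolding card_atLeastAtMost_int by linarith
  also have "e ^ card H * (2 * (n * coordinate_size) + 1) ^ card B
      \<le> e ^ card H * ((2 * coordinate_size + 1) * (n + 1)) ^ card B"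
    by (intro mult_le_mono2 power_mono) (simp_all add: algebra_simps)
  also have "\<dots> = e ^ card H * (2 * coordinate_size + 1) ^ card B * (n + 1) ^ card B"
    by (simp only: power_mult_distrib mult.assoc)
  finally show "card (word_values n) \<le> e ^ card H * (2 * coordinate_size + 1) ^ card B * (n + 1) ^ card B" .
qed

lemma word_values_mono: "m \<le> n \<Longrightarrow> word_values m \<subseteq> word_values n"
  unfolding word_values_def by (intro image_mono Pi_mono) auto

lemma one_in_word_values: "\<one>\<^bsub>N\<^esub> \<in> word_values 0"
  unfolding word_values_def using word_zero[of H] pmonoid_homD(3)[OF hom]
  by (intro image_eqI[of _ _ "\<lambda>_. 0"]) auto

lemma word_values_mult:
  assumes "v \<in> word_values m" "w \<in> word_values n"
  shows "v \<otimes>\<^bsub>N\<^esub> w \<in> word_values (m + n)"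
proof -
  obtain u u' where u: "u \<in> H \<rightarrow> {..m}" "u' \<in> H \<rightarrow> {..n}" "v = \<chi> (word M H u)" "w = \<chi> (word M H u')"
    using assms by (auto simp: word_values_def)
  then have "v \<otimes>\<^bsub>N\<^esub> w = \<chi> (word M H (\<lambda>g. u g + u' g))"
    using word_add[OF H(2)] word_closed[OF H(2)] pmonoid_homD(2)[OF hom] by simp
  moreover have "(\<lambda>g. u g + u' g) \<in> H \<rightarrow> {..m + n}"
    using u(1,2) by (auto simp: Pi_def intro: add_mono)
  ultimately show ?thesis
    unfolding word_values_def by (rule image_eqI)
qed

lemma hom_image_subset_word_values:
  assumes "\<And>x. x \<in> p \<Longrightarrow> \<chi> x = absorb N"
  shows "\<chi> ` carrier M \<subseteq> insert (absorb N) (\<Union>n. word_values n)"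
proof
  fix y assume "y \<in> \<chi> ` carrier M"
  then obtain x where x: "x \<in> carrier M" "y = \<chi> x" by blast
  show "y \<in> insert (absorb N) (\<Union>n. word_values n)"
  proof (cases "x \<in> p")
    case True
    then show ?thesis using x(2) assms by simp
  next
    case False
    then obtain u where u: "x = word M H u"
      using outside_prime_is_word[OF x(1)] by blast
    have "u \<in> H \<rightarrow> {..Max (insert 0 (u ` H))}"
      using H(1) by (auto intro!: Max_ge)
    then have "y \<in> word_values (Max (insert 0 (u ` H)))"
      unfolding word_values_def x(2) u by (rule imageI)
    then show ?thesis by blast
  qed
qed

end

context prime_basis
begin

definition coordinate :: "('a \<Rightarrow> nat) \<Rightarrow> 'a \<Rightarrow> int" where
  "coordinate u b = (\<Sum>g\<in>H. int (u g) * c b g)"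

lemma coordinate_eqI:
  assumes "word M H u = word M H v" "b \<in> B"
  shows "coordinate u b = coordinate v b"
proof -
  have "(\<lambda>g. if g \<in> H then int (u g) - int (v g) else 0) \<in> word_relations M H"
    unfolding word_relations_def using assms(1) by blast
  from relation_coordinates_vanish[OF this assms(2)]
  have "(\<Sum>g\<in>H. (int (u g) - int (v g)) * c b g) = 0"
    by (rule back_subst[where P = "\<lambda>z. z = 0"]) (intro sum.cong, auto)
  then show ?thesis
    by (simp add: coordinate_def left_diff_distrib sum_subtractf)
qed

lemma coordinate_add: "coordinate (\<lambda>g. u g + v g) = (\<lambda>b. coordinate u b + coordinate v b)"
  by (rule ext) (simp add: coordinate_def algebra_simps sum.distrib)

lemma coordinate_basis:
  assumes "b \<in> B" "b' \<in> B"
  shows "coordinate (\<lambda>g. if g = b then 1 else 0) b' = (if b' = b then int e else 0)"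
proof -
  have "coordinate (\<lambda>g. if g = b then 1 else 0) b' = (\<Sum>g\<in>H. if g = b then c b' g else 0)"
    unfolding coordinate_def by (intro sum.cong) auto
  also have "\<dots> = c b' b"
    using assms(1) basis H(1) by (auto simp: sum.delta)
  finally show ?thesis
    using basis_coordinates[OF assms(2,1)] by auto
qed

lemma hom_of_word_function:
  assumes N: "pmonoid N" and E_unit: "\<And>u. E u \<in> Units N" and E_zero: "E (\<lambda>_. 0) = \<one>\<^bsub>N\<^esub>"
    and E_add: "\<And>u w. E (\<lambda>g. u g + w g) = E u \<otimes>\<^bsub>N\<^esub> E w"
    and E_eqI: "\<And>u w. word M H u = word M H w \<Longrightarrow> E u = E w"
  shows "\<exists>\<chi> \<in> pm_homs M N. (\<forall>x\<in>p. \<chi> x = absorb N) \<and> (\<forall>u. \<chi> (word M H u) = E u)"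
proof -
  interpret N: pmonoid N by fact
  define \<chi> where "\<chi> = (\<lambda>x\<in>carrier M. if x \<in> p then absorb N else E (SOME u. x = word M H u))"
  have \<chi>_prime: "\<chi> x = absorb N" if "x \<in> p" for x
    using that prime_simps(1) by (auto simp: \<chi>_def)
  have \<chi>_word: "\<chi> (word M H u) = E u" for u
  proof -
    have "E (SOME w. word M H u = word M H w) = E u"
      by (rule E_eqI[OF someI2[of "\<lambda>w. word M H u = word M H w"]]) simp_all
    then show ?thesis
      using word_notin_prime word_closed[OF H(2)] by (simp add: \<chi>_def)
  qed
  have \<chi>_closed: "\<chi> x \<in> carrier N" if "x \<in> carrier M" for x
    using E_unit \<chi>_prime[of x] that N.absorb_closed by (cases "x \<in> p") (auto simp: \<chi>_def)
  have "\<chi> (x \<otimes> y) = \<chi> x \<otimes>\<^bsub>N\<^esub> \<chi> y" if xy: "x \<in> carrier M" "y \<in> carrier M" for x y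
  proof (cases "x \<in> p \<or> y \<in> p")
    case True
    then show ?thesis
      using xy prime_simps(4)[OF xy] \<chi>_prime \<chi>_closed N.absorb_mult N.absorb_mult_right by auto
  next
    case False
    then obtain u w where "x = word M H u" "y = word M H w"
      using outside_prime_is_word xy by metis
    then show ?thesis
      using \<chi>_word E_add word_add[OF H(2), symmetric] by simp
  qed
  moreover have "\<chi> \<one> = \<one>\<^bsub>N\<^esub>"
    using \<chi>_word[of "\<lambda>_. 0"] by (simp add: word_zero E_zero)
  ultimately have "\<chi> \<in> pm_homs M N"
    using \<chi>_closed \<chi>_prime prime_simps(2) by (auto simp: pmonoid_hom_def hom_def \<chi>_def)
  then show ?thesis using \<chi>_prime \<chi>_word by blast
qed

lemma basis_values_extend:
  assumes N: "pmonoid N" and v: "\<And>b. b \<in> B \<Longrightarrow> v b \<in> Units N"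
  shows "\<exists>\<chi> \<in> pm_homs M N. (\<forall>x\<in>p. \<chi> x = absorb N) \<and> (\<forall>x\<in>carrier M - p. \<chi> x \<in> Units N) \<and>
    (\<forall>b\<in>B. \<chi> b = v b [^]\<^bsub>units_of N\<^esub> e)"
proof -
  interpret N: pmonoid N by fact
  interpret U: comm_group "units_of N" by (rule N.units_comm_group)
  have vB: "v \<in> B \<rightarrow> carrier (units_of N)"
    using v by (auto simp: units_of_carrier)
  define E where "E u = int_word (units_of N) B v (coordinate u)" for u
  have E_unit: "E u \<in> Units N" for u
    using U.int_word_closed[OF vB] by (simp add: E_def units_of_carrier)
  have E_add: "E (\<lambda>g. u g + w g) = E u \<otimes>\<^bsub>N\<^esub> E w" for u w
    using U.int_word_add[OF vB] by (simp add: E_def coordinate_add units_of_mult)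
  have E_eqI: "E u = E w" if "word M H u = word M H w" for u w
    unfolding E_def by (rule U.int_word_cong[OF vB]) (use coordinate_eqI[OF that] in simp)
  have "coordinate (\<lambda>_. 0) = (\<lambda>_. 0)"
    by (rule ext) (simp add: coordinate_def)
  then have E_zero: "E (\<lambda>_. 0) = \<one>\<^bsub>N\<^esub>"
    using U.int_word_zero by (simp add: E_def units_of_one)
  have "\<exists>\<chi> \<in> pm_homs M N. (\<forall>x\<in>p. \<chi> x = absorb N) \<and> (\<forall>u. \<chi> (word M H u) = E u)"
    by (rule hom_of_word_function[OF N E_unit E_zero E_add]) (rule E_eqI)
  then obtain \<chi> where \<chi>: "\<chi> \<in> pm_homs M N" "\<forall>x\<in>p. \<chi> x = absorb N" and "\<forall>u. \<chi> (word M H u) = E u"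
    by (elim bexE conjE)
  then have \<chi>_word: "\<chi> (word M H u) = E u" for u by (elim allE)
  have "\<chi> x \<in> Units N" if x: "x \<in> carrier M - p" for x
  proof -
    obtain u where u: "x = word M H u"
      using x by (elim DiffE) (rule outside_prime_is_word)
    show ?thesis unfolding u \<chi>_word by (rule E_unit)
  qed
  moreover have "\<chi> b = v b [^]\<^bsub>units_of N\<^esub> e" if b: "b \<in> B" for b
  proof -
    have "\<chi> b = E (\<lambda>g. if g = b then 1 else 0)"
      using \<chi>_word[of "\<lambda>g. if g = b then 1 else 0"] word_generator[OF H(2,1), of b] b basis by auto
    also have "\<dots> = int_word (units_of N) B v (\<lambda>g. if g = b then int e else 0)"
      unfolding E_def by (rule U.int_word_cong[OF vB]) (use coordinate_basis[OF b] in auto)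
    also have "\<dots> = v b [^]\<^bsub>units_of N\<^esub> e"
      using U.int_word_single[OF vB finite_basis b] by (simp add: int_pow_int)
    finally show ?thesis .
  qed
  ultimately show ?thesis
    using \<chi> by blast
qed

end

section \<open>Counting homomorphisms\<close>

lemma (in comm_group) pow_coprime_order_bij:
  assumes "finite (carrier G)" "coprime (Coset.order G) e"
  shows "bij_betw (\<lambda>x. x [^] e) (carrier G) (carrier G)"
proof -
  have "inj_on (\<lambda>x. x [^] e) (carrier G)"
  proof (rule inj_onI)
    fix x y assume xy: "x \<in> carrier G" "y \<in> carrier G" and eq: "x [^] e = y [^] e"
    define z where "z = x \<otimes> inv y"
    have z: "z \<in> carrier G" unfolding z_def using xy by simp
    have "z [^] e = \<one>"
      unfolding z_def using xy eq by (simp add: nat_pow_distrib nat_pow_inv)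
    then have "ord z dvd e"
      using pow_eq_id z by blast
    moreover have "ord z dvd Coset.order G"
      by (rule ord_dvd_group_order[OF z])
    ultimately have "ord z = 1"
      using assms(2) coprime_common_divisor_nat by blast
    then have "z = \<one>"
      using pow_ord_eq_1[OF z] z by simp
    moreover have "x = z \<otimes> y"
      unfolding z_def using xy by (simp add: m_assoc)
    ultimately show "x = y"
      using xy by simp
  qed
  moreover have "(\<lambda>x. x [^] e) ` carrier G \<subseteq> carrier G"
    by auto
  ultimately show ?thesis
    using assms(1) endo_inj_surj unfolding bij_betw_def by blast
qed

lemma (in prime_basis) prime_basis_hom_if_kernel:
  assumes N: "pm_field N" and \<chi>: "\<chi> \<in> pm_homs M N" and kernel: "pm_kernel M N \<chi> = p"
  shows "prime_basis_hom M G p B e c N \<chi>"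
  using pm_kernel_prime(2)[OF pmonoid_axioms N, of \<chi>] \<chi> kernel H(2) pm_fieldD(1)[OF N] prime_basis_axioms
  by (auto simp: prime_basis_hom_def prime_basis_hom_axioms_def)

lemma (in prime_basis) pm_homs_eq_if_eq_on_basis:
  assumes N: "pm_field N" and root: "inj_on (\<lambda>x. x [^]\<^bsub>units_of N\<^esub> e) (Units N)"
    and \<chi>: "\<chi> \<in> pm_homs M N" "pm_kernel M N \<chi> = p" and \<chi>': "\<chi>' \<in> pm_homs M N" "pm_kernel M N \<chi>' = p"
    and eq: "\<And>b. b \<in> B \<Longrightarrow> \<chi> b = \<chi>' b"
  shows "\<chi> = \<chi>'"
proof -
  interpret X: prime_basis_hom M G p B e c N \<chi> by (rule prime_basis_hom_if_kernel[OF N \<chi>])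
  interpret X': prime_basis_hom M G p B e c N \<chi>' by (rule prime_basis_hom_if_kernel[OF N \<chi>'])
  have "\<chi> g = \<chi>' g" if "g \<in> G" for g
  proof (cases "g \<in> p")
    case True
    then have "g \<in> pm_kernel M N \<chi>" "g \<in> pm_kernel M N \<chi>'"
      using \<chi>(2) \<chi>'(2) by auto
    then show ?thesis by (simp add: pm_kernel_def)
  next
    case False
    with that have g: "g \<in> H" by simp
    have "\<chi> g [^]\<^bsub>units_of N\<^esub> e = int_word (units_of N) B \<chi>' (\<lambda>b. c b g)"
      unfolding X.hom_pow_exponent[OF g]
      by (rule X.U.int_word_cong[OF X.hom_closed(2)]) (simp add: eq)
    then have "\<chi> g [^]\<^bsub>units_of N\<^esub> e = \<chi>' g [^]\<^bsub>units_of N\<^esub> e"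
      unfolding X'.hom_pow_exponent[OF g] .
    then show ?thesis
      using inj_onD[OF root] X.hom_units[OF g] X'.hom_units[OF g] by blast
  qed
  then show ?thesis
    using pm_homs_eqI[OF pmonoid_axioms generators] \<chi>(1) \<chi>'(1) by blast
qed

lemma (in prime_basis) hom_with_basis_values_exists:
  assumes N: "pm_field N" and root: "(\<lambda>x. x [^]\<^bsub>units_of N\<^esub> e) ` Units N = Units N"
    and w: "\<And>b. b \<in> B \<Longrightarrow> w b \<in> Units N"
  shows "\<exists>\<chi>\<in>pm_homs M N. pm_kernel M N \<chi> = p \<and> (\<forall>b\<in>B. \<chi> b = w b)"
proof -
  have "\<exists>v\<in>Units N. v [^]\<^bsub>units_of N\<^esub> e = w b" if "b \<in> B" for b
  proof -
    have "w b \<in> (\<lambda>x. x [^]\<^bsub>units_of N\<^esub> e) ` Units N"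
      unfolding root by (rule w[OF that])
    then show ?thesis by auto
  qed
  then obtain v where v: "\<And>b. b \<in> B \<Longrightarrow> v b \<in> Units N \<and> v b [^]\<^bsub>units_of N\<^esub> e = w b"
    by metis
  then obtain \<chi> where \<chi>: "\<chi> \<in> pm_homs M N" "\<forall>x\<in>p. \<chi> x = absorb N" "\<forall>x\<in>carrier M - p. \<chi> x \<in> Units N"
      "\<forall>b\<in>B. \<chi> b = v b [^]\<^bsub>units_of N\<^esub> e"
    using basis_values_extend[OF pm_fieldD(1)[OF N], of v] by blast
  have "\<chi> x \<noteq> absorb N" if "x \<in> carrier M - p" for x
    using bspec[OF \<chi>(3) that] pm_fieldD(3)[OF N] by metis
  then have "pm_kernel M N \<chi> = p"
    using \<chi>(2) prime_simps(1) by (auto simp: pm_kernel_def)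
  then show ?thesis using \<chi>(1,4) v by auto
qed

lemma (in prime_basis) card_homs_with_kernel:
  assumes N: "pm_field N" and fin: "finite (carrier N)" and cop: "coprime (card (Units N)) e"
  shows "card {\<chi> \<in> pm_homs M N. pm_kernel M N \<chi> = p} = card (Units N) ^ card B"
proof -
  interpret N: pmonoid N using pm_fieldD(1)[OF N] .
  interpret U: comm_group "units_of N" by (rule N.units_comm_group)
  let ?A = "{\<chi> \<in> pm_homs M N. pm_kernel M N \<chi> = p}"
  have "finite (carrier (units_of N))" "Coset.order (units_of N) = card (Units N)"
    using fin pm_fieldD(2)[OF N] by (simp_all add: units_of_carrier Coset.order_def)
  then have root: "bij_betw (\<lambda>x. x [^]\<^bsub>units_of N\<^esub> e) (Units N) (Units N)"
    using U.pow_coprime_order_bij[of e] cop by (simp add: units_of_carrier)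
  have "bij_betw (\<lambda>\<chi>. restrict \<chi> B) ?A (B \<rightarrow>\<^sub>E Units N)"
  proof (rule bij_betw_imageI)
    show "inj_on (\<lambda>\<chi>. restrict \<chi> B) ?A"
    proof (rule inj_onI)
      fix \<chi> \<chi>' assume \<chi>: "\<chi> \<in> ?A" "\<chi>' \<in> ?A" and eq: "restrict \<chi> B = restrict \<chi>' B"
      have "\<chi> b = \<chi>' b" if "b \<in> B" for b
        using fun_cong[OF eq, of b] that by simp
      then show "\<chi> = \<chi>'"
        using pm_homs_eq_if_eq_on_basis[OF N bij_betw_imp_inj_on[OF root]] \<chi> by blast
    qed
    show "(\<lambda>\<chi>. restrict \<chi> B) ` ?A = B \<rightarrow>\<^sub>E Units N"
    proof
      show "(\<lambda>\<chi>. restrict \<chi> B) ` ?A \<subseteq> B \<rightarrow>\<^sub>E Units N"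
      proof (rule image_subsetI)
        fix \<chi> assume \<chi>: "\<chi> \<in> ?A"
        have "prime_basis_hom M G p B e c N \<chi>" using prime_basis_hom_if_kernel[OF N] \<chi> by blast
        from prime_basis_hom.hom_units[OF this] show "restrict \<chi> B \<in> B \<rightarrow>\<^sub>E Units N"
          using basis by (simp add: restrict_PiE_iff subset_iff)
      qed
      show "B \<rightarrow>\<^sub>E Units N \<subseteq> (\<lambda>\<chi>. restrict \<chi> B) ` ?A"
      proof
        fix w assume w: "w \<in> B \<rightarrow>\<^sub>E Units N"
        have "\<exists>\<chi>\<in>pm_homs M N. pm_kernel M N \<chi> = p \<and> (\<forall>b\<in>B. \<chi> b = w b)"
          by (rule hom_with_basis_values_exists[OF N bij_betw_imp_surj_on[OF root]]) (rule PiE_mem[OF w])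
        then obtain \<chi> where \<chi>: "\<chi> \<in> ?A" "\<forall>b\<in>B. \<chi> b = w b" by auto
        moreover have "restrict \<chi> B = w"
          using \<chi>(2) PiE_arb[OF w] by (auto simp: restrict_def)
        ultimately show "w \<in> (\<lambda>\<chi>. restrict \<chi> B) ` ?A"
          by (intro image_eqI[of _ _ \<chi>]) simp_all
      qed
    qed
  qed
  then have "card ?A = card (B \<rightarrow>\<^sub>E Units N)"
    by (rule bij_betw_same_card)
  then show ?thesis
    using finite_basis by (simp add: card_PiE)
qed

lemma finite_pmonoid_primes:
  assumes M: "pmonoid M" "pmonoid_generators M G"
  shows "finite {p. pmonoid_prime p M}"
proof -
  have sub: "q \<subseteq> p" if p: "pmonoid_prime p M" and q: "pmonoid_prime q M" and eq: "G - p = G - q" for p q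
  proof
    fix x assume x: "x \<in> q"
    then have xM: "x \<in> carrier M"
      using pmonoid_primeD(1)[OF M(1) q] by blast
    obtain B e c B' e' c' where P: "prime_basis M G p B e c" and Q: "prime_basis M G q B' e' c'"
      using prime_basis_exists[OF M p] prime_basis_exists[OF M q] by blast
    show "x \<in> p"
    proof (rule ccontr)
      assume "x \<notin> p"
      then obtain u where "x = word M (G - q) u"
        using prime_basis.outside_prime_is_word[OF P xM] eq by metis
      then show False
        using x prime_basis.word_notin_prime[OF Q] by blast
    qed
  qed
  have "inj_on (\<lambda>p. G - p) {p. pmonoid_prime p M}"
  proof (rule inj_onI)
    fix p q assume "p \<in> {p. pmonoid_prime p M}" "q \<in> {p. pmonoid_prime p M}" "G - p = G - q"
    then show "p = q" using sub[of p q] sub[of q p] by auto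
  qed
  moreover have "(\<lambda>p. G - p) ` {p. pmonoid_prime p M} \<subseteq> Pow G"
    by auto
  moreover have "finite G"
    using M(2) by (simp add: pmonoid_generators_def)
  ultimately show ?thesis
    by (meson finite_Pow_iff finite_imageD finite_subset)
qed

text \<open>The rank of the group of units of the localisation of \<open>M\<close> at \<open>p\<close>, for finitely generated \<open>M\<close>.\<close>

definition unit_rank :: "'a pmonoid \<Rightarrow> 'a set \<Rightarrow> nat" where
  "unit_rank M p = card (SOME B. \<exists>G e c. prime_basis M G p B e c)"

lemma prime_basis_of_unit_rank:
  assumes "pmonoid M" "pmonoid_fin_gen M" "pmonoid_prime p M"
  shows "\<exists>e G B c. prime_basis M G p B e c \<and> card B = unit_rank M p"
proof -
  have "\<exists>B G e c. prime_basis M G p B e c"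
    using prime_basis_exists[OF assms(1) _ assms(3)] assms(2) unfolding pmonoid_fin_gen_iff by blast
  from someI_ex[OF this] show ?thesis
    unfolding unit_rank_def by blast
qed

lemma card_pm_homs:
  assumes M: "pmonoid M" "pmonoid_fin_gen M"
  obtains E where "E > 0"
    "\<And>N :: 'b pmonoid. pm_field N \<Longrightarrow> finite (carrier N) \<Longrightarrow> coprime (card (Units N)) E \<Longrightarrow>
       card (pm_homs M N) = (\<Sum>p\<in>{p. pmonoid_prime p M}. card (Units N) ^ unit_rank M p)"
proof -
  let ?P = "{p. pmonoid_prime p M}"
  obtain G where G: "pmonoid_generators M G"
    using M(2) unfolding pmonoid_fin_gen_iff by blast
  have "\<forall>p\<in>?P. \<exists>e G B c. prime_basis M G p B e c \<and> card B = unit_rank M p"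
    using prime_basis_of_unit_rank[OF M] by simp
  from bchoice[OF this] obtain e
    where e: "\<And>p. p \<in> ?P \<Longrightarrow> \<exists>G B c. prime_basis M G p B (e p) c \<and> card B = unit_rank M p"
    by blast
  have fin: "finite ?P"
    by (rule finite_pmonoid_primes[OF M(1) G])
  show thesis
  proof (rule that)
    show "(\<Prod>p\<in>?P. e p) > 0"
      using e prime_basis.e_pos by (intro prod_pos) blast
    fix N :: "'b pmonoid"
    assume N: "pm_field N" "finite (carrier N)" and cop: "coprime (card (Units N)) (\<Prod>p\<in>?P. e p)"
    have "card {\<chi> \<in> pm_homs M N. pm_kernel M N \<chi> = p} = card (Units N) ^ unit_rank M p" if p: "p \<in> ?P" for p
    proof -
      obtain G B c where B: "prime_basis M G p B (e p) c" "card B = unit_rank M p"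
        using e[OF p] by blast
      have "coprime (card (Units N)) (e p)"
        by (rule coprime_divisors[OF dvd_refl dvd_prodI[OF fin p] cop])
      then show ?thesis
        using prime_basis.card_homs_with_kernel[OF B(1) N] B(2) by simp
    qed
    moreover have "card (pm_homs M N) = (\<Sum>p\<in>?P. card {\<chi> \<in> pm_homs M N. pm_kernel M N \<chi> = p})"
    proof -
      have "pm_homs M N = (\<Union>p\<in>?P. {\<chi> \<in> pm_homs M N. pm_kernel M N \<chi> = p})"
        using pm_kernel_prime(1)[OF M(1) N(1)] by auto
      then have "card (pm_homs M N) = card (\<Union>p\<in>?P. {\<chi> \<in> pm_homs M N. pm_kernel M N \<chi> = p})"
        by (rule arg_cong)
      also have "finite {\<chi> \<in> pm_homs M N. pm_kernel M N \<chi> = p}" for p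
        by (rule finite_subset[OF _ finite_pm_homs[OF M(1) G N(2)]]) auto
      then have "card (\<Union>p\<in>?P. {\<chi> \<in> pm_homs M N. pm_kernel M N \<chi> = p})
          = (\<Sum>p\<in>?P. card {\<chi> \<in> pm_homs M N. pm_kernel M N \<chi> = p})"
        using fin by (intro card_UN_disjoint) auto
      finally show ?thesis .
    qed
    ultimately show "card (pm_homs M N) = (\<Sum>p\<in>?P. card (Units N) ^ unit_rank M p)"
      by simp
  qed
qed

definition image_pmonoid :: "('a \<Rightarrow> 'b) \<Rightarrow> 'a pmonoid \<Rightarrow> 'b pmonoid" where
  "image_pmonoid f M =
     \<lparr>carrier = f ` carrier M,
      mult = (\<lambda>x y. f (inv_into (carrier M) f x \<otimes>\<^bsub>M\<^esub> inv_into (carrier M) f y)),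
      one = f \<one>\<^bsub>M\<^esub>, absorb = f (absorb M)\<rparr>"

context pmonoid
begin

lemma image_pmonoid_simps:
  assumes "inj_on f (carrier M)"
  shows "carrier (image_pmonoid f M) = f ` carrier M" "\<one>\<^bsub>image_pmonoid f M\<^esub> = f \<one>"
    "absorb (image_pmonoid f M) = f (absorb M)"
    "x \<in> carrier M \<Longrightarrow> y \<in> carrier M \<Longrightarrow> f x \<otimes>\<^bsub>image_pmonoid f M\<^esub> f y = f (x \<otimes> y)"
  using assms by (simp_all add: image_pmonoid_def)

lemma pmonoid_image:
  assumes f: "inj_on f (carrier M)"
  shows "pmonoid (image_pmonoid f M)"
  by unfold_locales
    (use absorb_closed absorb_mult in \<open>auto simp: image_pmonoid_simps[OF f] m_ac\<close>)

lemma Units_image_pmonoid: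
  assumes f: "inj_on f (carrier M)"
  shows "Units (image_pmonoid f M) = f ` Units M"
  unfolding Units_def using f
  by (auto simp: image_pmonoid_simps[OF f] inj_on_eq_iff[OF f] intro!: imageI)

lemma image_pmonoid_iso:
  assumes f: "inj_on f (carrier M)"
  shows "pmonoid_iso (image_pmonoid f M) M"
proof -
  let ?g = "inv_into (carrier M) f"
  have "?g \<in> pmonoid_hom (image_pmonoid f M) M"
    using f absorb_closed by (auto simp: pmonoid_hom_def image_pmonoid_simps[OF f] intro!: homI)
  moreover have "bij_betw ?g (carrier (image_pmonoid f M)) (carrier M)"
    unfolding image_pmonoid_simps(1)[OF f] using f by (intro bij_betw_inv_into bij_betw_imageI) auto
  ultimately show ?thesis
    unfolding pmonoid_iso_def by blast
qed

lemma pm_field_image: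
  assumes f: "inj_on f (carrier M)" and M: "pm_field M"
  shows "pm_field (image_pmonoid f M)"
  using pm_fieldD[OF M] pmonoid_image[OF f] inj_on_image_mem_iff[OF f absorb_closed, of "Units M"]
  unfolding pm_field_def Units_image_pmonoid[OF f] image_pmonoid_simps[OF f] by auto

end

lemma pm_field_group_pmonoid:
  fixes H :: "'a monoid"
  assumes "comm_group H"
  shows "pm_field (group_pmonoid H)" "Units (group_pmonoid H) = Some ` carrier H"
proof -
  interpret comm_group H by fact
  interpret M: pmonoid "group_pmonoid H"
    by unfold_locales (auto simp: group_pmonoid_def m_ac split: option.splits)
  show units: "Units (group_pmonoid H) = Some ` carrier H"
  proof
    show "Units (group_pmonoid H) \<subseteq> Some ` carrier H"
      by (auto simp: Units_def group_pmonoid_def)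
    show "Some ` carrier H \<subseteq> Units (group_pmonoid H)"
    proof
      fix x assume "x \<in> Some ` carrier H"
      then obtain a where a: "a \<in> carrier H" "x = Some a" by blast
      then have "Some (inv\<^bsub>H\<^esub> a) \<in> carrier (group_pmonoid H)"
        "Some (inv\<^bsub>H\<^esub> a) \<otimes>\<^bsub>group_pmonoid H\<^esub> x = \<one>\<^bsub>group_pmonoid H\<^esub>"
        "x \<otimes>\<^bsub>group_pmonoid H\<^esub> Some (inv\<^bsub>H\<^esub> a) = \<one>\<^bsub>group_pmonoid H\<^esub>" "x \<in> carrier (group_pmonoid H)"
        by (simp_all add: group_pmonoid_def)
      then show "x \<in> Units (group_pmonoid H)"
        unfolding Units_def by blast
    qed
  qed
  show "pm_field (group_pmonoid H)"
    unfolding pm_field_def units using M.pmonoid_axioms by (auto simp: group_pmonoid_def)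
qed

lemma cyclic_pm_field_exists:
  assumes "m > 0"
  obtains N :: "('u :: infinite) pmonoid"
  where "pm_field N" "finite (carrier N)" "card (Units N) = m"
    "pmonoid_iso N (group_pmonoid (integer_mod_group m))"
proof -
  let ?Z = "integer_mod_group m"
  have Z: "carrier ?Z = {0..<int m}"
    using assms by (simp add: integer_mod_group_def)
  note G = pm_field_group_pmonoid[OF abelian_integer_mod_group[of m]]
  interpret G: pmonoid "group_pmonoid ?Z" using pm_fieldD(1)[OF G(1)] .
  obtain i :: "nat \<Rightarrow> 'u" where i: "inj i"
    using infinite_countable_subset[OF infinite_UNIV] by blast
  define f where "f x = i (to_nat x)" for x :: "int option"
  have inj: "inj f"
    by (auto simp: f_def intro!: injI dest!: injD[OF i])
  then have f: "inj_on f (carrier (group_pmonoid ?Z))"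
    by (rule inj_on_subset) simp
  have units: "Units (image_pmonoid f (group_pmonoid ?Z)) = f ` Some ` {0..<int m}"
    using G.Units_image_pmonoid[OF f] G(2) Z by simp
  show thesis
  proof (rule that)
    show "pm_field (image_pmonoid f (group_pmonoid ?Z))"
      by (rule G.pm_field_image[OF f G(1)])
    show "finite (carrier (image_pmonoid f (group_pmonoid ?Z)))"
      by (subst pm_fieldD(2)[OF G.pm_field_image[OF f G(1)]]) (simp add: units)
    show "card (Units (image_pmonoid f (group_pmonoid ?Z))) = m"
      unfolding units image_image by (subst card_image) (auto intro!: inj_onI dest!: injD[OF inj])
    show "pmonoid_iso (image_pmonoid f (group_pmonoid ?Z)) (group_pmonoid ?Z)"
      by (rule G.image_pmonoid_iso[OF f])
  qed
qed

section \<open>Localization and residue fields\<close>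

definition localization :: "'a ring \<Rightarrow> 'a set \<Rightarrow> ('a \<times> 'a) set ring" where
  "localization R S =
     \<lparr>carrier = {loc_frac R S a s | a s. a \<in> carrier R \<and> s \<in> S},
      mult = loc_mult R S, one = loc_frac R S \<one>\<^bsub>R\<^esub> \<one>\<^bsub>R\<^esub>,
      zero = loc_frac R S \<zero>\<^bsub>R\<^esub> \<one>\<^bsub>R\<^esub>, add = loc_add R S\<rparr>"

lemma localization_simps:
  "carrier (localization R S) = {loc_frac R S a s | a s. a \<in> carrier R \<and> s \<in> S}"
  "\<one>\<^bsub>localization R S\<^esub> = loc_frac R S \<one>\<^bsub>R\<^esub> \<one>\<^bsub>R\<^esub>"
  "\<zero>\<^bsub>localization R S\<^esub> = loc_frac R S \<zero>\<^bsub>R\<^esub> \<one>\<^bsub>R\<^esub>"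
  "x \<otimes>\<^bsub>localization R S\<^esub> y = loc_mult R S x y"
  "x \<oplus>\<^bsub>localization R S\<^esub> y = loc_add R S x y"
  by (simp_all add: localization_def)

locale multiplicative_subset = cring R for R :: "'a ring" (structure) +
  fixes S :: "'a set"
  assumes S_subset: "S \<subseteq> carrier R" and one_in_S: "\<one> \<in> S"
    and S_mult: "a \<in> S \<Longrightarrow> b \<in> S \<Longrightarrow> a \<otimes> b \<in> S"
begin

abbreviation frac :: "'a \<Rightarrow> 'a \<Rightarrow> ('a \<times> 'a) set" where
  "frac \<equiv> loc_frac R S"

lemma S_closed: "s \<in> S \<Longrightarrow> s \<in> carrier R"
  using S_subset by auto

lemma frac_self: "a \<in> carrier R \<Longrightarrow> s \<in> S \<Longrightarrow> (a, s) \<in> frac a s"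
  unfolding loc_frac_def using one_in_S by auto

lemma frac_subset:
  assumes "a \<in> carrier R" "s \<in> S" "b \<in> carrier R" "t \<in> S" "u \<in> S" and eq: "u \<otimes> (a \<otimes> t) = u \<otimes> (b \<otimes> s)"
  shows "frac b t \<subseteq> frac a s"
proof
  fix y assume "y \<in> frac b t"
  then obtain d w v where y: "y = (d, w)" "d \<in> carrier R" "w \<in> S" "v \<in> S" "v \<otimes> (b \<otimes> w) = v \<otimes> (d \<otimes> t)"
    unfolding loc_frac_def by auto
  have cl: "s \<in> carrier R" "t \<in> carrier R" "u \<in> carrier R" "v \<in> carrier R" "w \<in> carrier R"
    using assms y S_closed by auto
  have "(u \<otimes> (v \<otimes> t)) \<otimes> (a \<otimes> w) = (v \<otimes> w) \<otimes> (u \<otimes> (a \<otimes> t))"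
    using assms(1) cl by (simp add: m_ac)
  also have "\<dots> = (v \<otimes> (b \<otimes> w)) \<otimes> (u \<otimes> s)"
    unfolding eq using assms(3) cl by (simp add: m_ac)
  also have "\<dots> = (u \<otimes> (v \<otimes> t)) \<otimes> (d \<otimes> s)"
    unfolding y(5) using cl y(2) by (simp add: m_ac)
  finally have "\<exists>u\<in>S. u \<otimes> (a \<otimes> w) = u \<otimes> (d \<otimes> s)"
    by (rule bexI[OF _ S_mult[OF assms(5) S_mult[OF y(4) assms(4)]]])
  then show "y \<in> frac a s"
    unfolding loc_frac_def y(1) using y(2,3) by simp
qed

lemma frac_eq_iff:
  assumes "a \<in> carrier R" "s \<in> S" "b \<in> carrier R" "t \<in> S"
  shows "frac a s = frac b t \<longleftrightarrow> (\<exists>u\<in>S. u \<otimes> (a \<otimes> t) = u \<otimes> (b \<otimes> s))"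
proof
  assume "frac a s = frac b t"
  then have "(b, t) \<in> frac a s"
    using frac_self[OF assms(3,4)] by simp
  then show "\<exists>u\<in>S. u \<otimes> (a \<otimes> t) = u \<otimes> (b \<otimes> s)"
    by (simp add: loc_frac_def)
next
  assume "\<exists>u\<in>S. u \<otimes> (a \<otimes> t) = u \<otimes> (b \<otimes> s)"
  then obtain u where u: "u \<in> S" "u \<otimes> (a \<otimes> t) = u \<otimes> (b \<otimes> s)" by blast
  show "frac a s = frac b t"
    using frac_subset[OF assms u] frac_subset[OF assms(3,4,1,2) u(1) u(2)[symmetric]] by blast
qed

lemma frac_eqI:
  assumes "a \<in> carrier R" "s \<in> S" "b \<in> carrier R" "t \<in> S" and "a \<otimes> t = b \<otimes> s"
  shows "frac a s = frac b t"
  unfolding frac_eq_iff[OF assms(1-4)] using one_in_S assms(5) by auto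

lemma frac_memD:
  assumes "(b, t) \<in> frac a s" "a \<in> carrier R" "s \<in> S"
  shows "b \<in> carrier R" "t \<in> S" "frac b t = frac a s"
proof -
  show b: "b \<in> carrier R" and t: "t \<in> S"
    using assms(1) by (auto simp: loc_frac_def)
  have "\<exists>u\<in>S. u \<otimes> (a \<otimes> t) = u \<otimes> (b \<otimes> s)"
    using assms(1) by (simp add: loc_frac_def)
  then show "frac b t = frac a s"
    using frac_eq_iff[OF assms(2,3) b t] by simp
qed

lemma frac_mult_cong:
  assumes "a \<in> carrier R" "s \<in> S" "a' \<in> carrier R" "s' \<in> S" "b \<in> carrier R" "t \<in> S" "b' \<in> carrier R" "t' \<in> S"
    and "frac a s = frac a' s'" "frac b t = frac b' t'"
  shows "frac (a \<otimes> b) (s \<otimes> t) = frac (a' \<otimes> b') (s' \<otimes> t')"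
    and "frac (a \<otimes> t \<oplus> b \<otimes> s) (s \<otimes> t) = frac (a' \<otimes> t' \<oplus> b' \<otimes> s') (s' \<otimes> t')"
proof -
  obtain u v where u: "u \<in> S" "u \<otimes> (a \<otimes> s') = u \<otimes> (a' \<otimes> s)" and v: "v \<in> S" "v \<otimes> (b \<otimes> t') = v \<otimes> (b' \<otimes> t)"
    using assms(9,10) unfolding frac_eq_iff[OF assms(1-4)] frac_eq_iff[OF assms(5-8)] by blast
  have cl: "s \<in> carrier R" "t \<in> carrier R" "s' \<in> carrier R" "t' \<in> carrier R" "u \<in> carrier R" "v \<in> carrier R"
    using assms(2,4,6,8) u(1) v(1) S_closed by auto
  note uv = S_mult[OF u(1) v(1)] and st = S_mult[OF assms(2,6)] S_mult[OF assms(4,8)]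
  have "(u \<otimes> v) \<otimes> ((a \<otimes> b) \<otimes> (s' \<otimes> t')) = (u \<otimes> (a \<otimes> s')) \<otimes> (v \<otimes> (b \<otimes> t'))"
    using cl assms by (simp add: m_ac)
  also have "\<dots> = (u \<otimes> v) \<otimes> ((a' \<otimes> b') \<otimes> (s \<otimes> t))"
    unfolding u v using cl assms by (simp add: m_ac)
  finally show "frac (a \<otimes> b) (s \<otimes> t) = frac (a' \<otimes> b') (s' \<otimes> t')"
    using uv st assms by (subst frac_eq_iff) auto
  have "(u \<otimes> v) \<otimes> ((a \<otimes> t \<oplus> b \<otimes> s) \<otimes> (s' \<otimes> t'))
      = (u \<otimes> (a \<otimes> s')) \<otimes> (v \<otimes> (t \<otimes> t')) \<oplus> (v \<otimes> (b \<otimes> t')) \<otimes> (u \<otimes> (s \<otimes> s'))"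
    using cl assms by (simp add: l_distr r_distr m_ac)
  also have "\<dots> = (u \<otimes> v) \<otimes> ((a' \<otimes> t' \<oplus> b' \<otimes> s') \<otimes> (s \<otimes> t))"
    unfolding u v using cl assms by (simp add: l_distr r_distr m_ac)
  finally show "frac (a \<otimes> t \<oplus> b \<otimes> s) (s \<otimes> t) = frac (a' \<otimes> t' \<oplus> b' \<otimes> s') (s' \<otimes> t')"
    using uv st assms cl by (subst frac_eq_iff) auto
qed

lemma UN_frac_eq:
  assumes "a \<in> carrier R" "s \<in> S" "b \<in> carrier R" "t \<in> S"
    and f: "\<And>x u y v. x \<in> carrier R \<Longrightarrow> u \<in> S \<Longrightarrow> y \<in> carrier R \<Longrightarrow> v \<in> S \<Longrightarrow>
      frac x u = frac a s \<Longrightarrow> frac y v = frac b t \<Longrightarrow> f x u y v = E"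
  shows "(\<Union>(x, u)\<in>frac a s. \<Union>(y, v)\<in>frac b t. f x u y v) = E"
proof -
  have "f x u y v = E" if "(x, u) \<in> frac a s" "(y, v) \<in> frac b t" for x u y v
    by (rule f[OF frac_memD(1,2)[OF that(1) assms(1,2)] frac_memD(1,2)[OF that(2) assms(3,4)]
        frac_memD(3)[OF that(1) assms(1,2)] frac_memD(3)[OF that(2) assms(3,4)]])
  then show ?thesis
    using frac_self[OF assms(1,2)] frac_self[OF assms(3,4)] by fast
qed

lemma loc_mult_frac:
  assumes "a \<in> carrier R" "s \<in> S" "b \<in> carrier R" "t \<in> S"
  shows "loc_mult R S (frac a s) (frac b t) = frac (a \<otimes> b) (s \<otimes> t)"
  unfolding loc_mult_def by (rule UN_frac_eq[OF assms]) (rule frac_mult_cong(1)[OF _ _ assms(1,2) _ _ assms(3,4)])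

lemma loc_add_frac:
  assumes "a \<in> carrier R" "s \<in> S" "b \<in> carrier R" "t \<in> S"
  shows "loc_add R S (frac a s) (frac b t) = frac (a \<otimes> t \<oplus> b \<otimes> s) (s \<otimes> t)"
  unfolding loc_add_def by (rule UN_frac_eq[OF assms]) (rule frac_mult_cong(2)[OF _ _ assms(1,2) _ _ assms(3,4)])

lemma frac_in_localization: "a \<in> carrier R \<Longrightarrow> s \<in> S \<Longrightarrow> frac a s \<in> carrier (localization R S)"
  by (auto simp: localization_simps)

lemma localizationE:
  assumes "x \<in> carrier (localization R S)"
  obtains a s where "a \<in> carrier R" "s \<in> S" "x = frac a s"
  using assms by (auto simp: localization_simps)

lemma localization_comm_monoid: "comm_monoid (localization R S)"
proof (rule comm_monoidI)
  fix x y z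
  assume "x \<in> carrier (localization R S)" "y \<in> carrier (localization R S)" "z \<in> carrier (localization R S)"
  then obtain a s b t c u where [simp]: "x = frac a s" "y = frac b t" "z = frac c u"
    and m: "a \<in> carrier R" "s \<in> S" "b \<in> carrier R" "t \<in> S" "c \<in> carrier R" "u \<in> S"
    by (elim localizationE) blast
  show "x \<otimes>\<^bsub>localization R S\<^esub> y \<otimes>\<^bsub>localization R S\<^esub> z = x \<otimes>\<^bsub>localization R S\<^esub> (y \<otimes>\<^bsub>localization R S\<^esub> z)"
    using m S_mult S_closed by (simp add: localization_simps loc_mult_frac m_assoc)
next
  fix x y assume "x \<in> carrier (localization R S)" "y \<in> carrier (localization R S)"
  then obtain a s b t where [simp]: "x = frac a s" "y = frac b t"
    and m: "a \<in> carrier R" "s \<in> S" "b \<in> carrier R" "t \<in> S"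
    by (elim localizationE) blast
  show "x \<otimes>\<^bsub>localization R S\<^esub> y \<in> carrier (localization R S)"
    using m S_mult frac_in_localization by (simp add: localization_simps(4) loc_mult_frac)
  show "x \<otimes>\<^bsub>localization R S\<^esub> y = y \<otimes>\<^bsub>localization R S\<^esub> x"
    using m S_closed by (simp add: localization_simps(4) loc_mult_frac m_comm)
next
  show "\<one>\<^bsub>localization R S\<^esub> \<in> carrier (localization R S)"
    using frac_in_localization[OF one_closed one_in_S] by (simp add: localization_simps(2))
  fix x assume "x \<in> carrier (localization R S)"
  then obtain a s where "x = frac a s" "a \<in> carrier R" "s \<in> S" by (elim localizationE) blast
  then show "\<one>\<^bsub>localization R S\<^esub> \<otimes>\<^bsub>localization R S\<^esub> x = x"
    using one_in_S S_closed by (simp add: localization_simps(2,4) loc_mult_frac)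
qed

lemma localization_abelian_group: "abelian_group (localization R S)"
proof (rule abelian_groupI)
  fix x y z
  assume "x \<in> carrier (localization R S)" "y \<in> carrier (localization R S)" "z \<in> carrier (localization R S)"
  then obtain a s b t c u where [simp]: "x = frac a s" "y = frac b t" "z = frac c u"
    and m: "a \<in> carrier R" "s \<in> S" "b \<in> carrier R" "t \<in> S" "c \<in> carrier R" "u \<in> S"
    by (elim localizationE) blast
  note mc = S_closed[OF m(2)] S_closed[OF m(4)] S_closed[OF m(6)]
  have "(a \<otimes> t \<oplus> b \<otimes> s) \<otimes> u \<oplus> c \<otimes> (s \<otimes> t) = a \<otimes> (t \<otimes> u) \<oplus> (b \<otimes> u \<oplus> c \<otimes> t) \<otimes> s"
    using m(1,3,5) mc by algebra
  then show "x \<oplus>\<^bsub>localization R S\<^esub> y \<oplus>\<^bsub>localization R S\<^esub> z = x \<oplus>\<^bsub>localization R S\<^esub> (y \<oplus>\<^bsub>localization R S\<^esub> z)"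
    using m mc S_mult by (simp add: localization_simps loc_add_frac m_assoc)
next
  fix x y assume "x \<in> carrier (localization R S)" "y \<in> carrier (localization R S)"
  then obtain a s b t where [simp]: "x = frac a s" "y = frac b t"
    and m: "a \<in> carrier R" "s \<in> S" "b \<in> carrier R" "t \<in> S"
    by (elim localizationE) blast
  note mc = S_closed[OF m(2)] S_closed[OF m(4)]
  show "x \<oplus>\<^bsub>localization R S\<^esub> y \<in> carrier (localization R S)"
    using m mc S_mult frac_in_localization by (simp add: localization_simps(5) loc_add_frac)
  show "x \<oplus>\<^bsub>localization R S\<^esub> y = y \<oplus>\<^bsub>localization R S\<^esub> x"
    using m mc by (simp add: localization_simps(5) loc_add_frac a_comm m_comm)
next
  show "\<zero>\<^bsub>localization R S\<^esub> \<in> carrier (localization R S)"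
    using frac_in_localization[OF zero_closed one_in_S] by (simp add: localization_simps(3))
  fix x assume "x \<in> carrier (localization R S)"
  then obtain a s where [simp]: "x = frac a s" and m: "a \<in> carrier R" "s \<in> S"
    by (elim localizationE) blast
  note mc = S_closed[OF m(2)]
  show "\<zero>\<^bsub>localization R S\<^esub> \<oplus>\<^bsub>localization R S\<^esub> x = x"
    using m mc one_in_S by (simp add: localization_simps(3,5) loc_add_frac)
  have "\<ominus> a \<otimes> s \<oplus> a \<otimes> s = \<zero>"
    using m(1) mc by algebra
  then have "frac (\<ominus> a) s \<oplus>\<^bsub>localization R S\<^esub> x = frac \<zero> (s \<otimes> s)"
    using m by (simp add: localization_simps(5) loc_add_frac)
  also have "\<dots> = \<zero>\<^bsub>localization R S\<^esub>"
    unfolding localization_simps(3) using m mc one_in_S S_mult by (intro frac_eqI) auto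
  finally show "\<exists>y\<in>carrier (localization R S). y \<oplus>\<^bsub>localization R S\<^esub> x = \<zero>\<^bsub>localization R S\<^esub>"
    using frac_in_localization[of "\<ominus> a" s] m by blast
qed

lemma localization_cring: "cring (localization R S)"
proof (rule cringI[OF localization_abelian_group localization_comm_monoid])
  fix x y z
  assume "x \<in> carrier (localization R S)" "y \<in> carrier (localization R S)" "z \<in> carrier (localization R S)"
  then obtain a s b t c u where [simp]: "x = frac a s" "y = frac b t" "z = frac c u"
    and m: "a \<in> carrier R" "s \<in> S" "b \<in> carrier R" "t \<in> S" "c \<in> carrier R" "u \<in> S"
    by (elim localizationE) blast
  note mc = S_closed[OF m(2)] S_closed[OF m(4)] S_closed[OF m(6)]
  have "(a \<otimes> t \<oplus> b \<otimes> s) \<otimes> c \<otimes> (s \<otimes> u \<otimes> (t \<otimes> u))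
      = (a \<otimes> c \<otimes> (t \<otimes> u) \<oplus> b \<otimes> c \<otimes> (s \<otimes> u)) \<otimes> (s \<otimes> t \<otimes> u)"
    using m(1,3,5) mc by algebra
  then have "frac ((a \<otimes> t \<oplus> b \<otimes> s) \<otimes> c) (s \<otimes> t \<otimes> u)
      = frac (a \<otimes> c \<otimes> (t \<otimes> u) \<oplus> b \<otimes> c \<otimes> (s \<otimes> u)) (s \<otimes> u \<otimes> (t \<otimes> u))"
    using m mc S_mult by (intro frac_eqI) auto
  then show "(x \<oplus>\<^bsub>localization R S\<^esub> y) \<otimes>\<^bsub>localization R S\<^esub> z
      = x \<otimes>\<^bsub>localization R S\<^esub> z \<oplus>\<^bsub>localization R S\<^esub> y \<otimes>\<^bsub>localization R S\<^esub> z"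
    using m mc S_mult by (simp add: localization_simps loc_mult_frac loc_add_frac)
qed

lemma localization_map_hom: "(\<lambda>a. frac a \<one>) \<in> ring_hom R (localization R S)"
  using one_in_S by (intro ring_hom_memI)
    (auto simp: frac_in_localization localization_simps(2,4,5) loc_mult_frac loc_add_frac)

lemma frac_mult_denominator:
  assumes "a \<in> carrier R" "s \<in> S"
  shows "frac a s \<otimes>\<^bsub>localization R S\<^esub> frac s \<one> = frac a \<one>"
  using assms one_in_S S_closed S_mult
  by (simp add: localization_simps(4) loc_mult_frac) (intro frac_eqI; simp add: S_closed)

lemma frac_unit_iff:
  assumes a: "a \<in> carrier R" and s: "s \<in> S"
  shows "frac a s \<in> Units (localization R S) \<longleftrightarrow> (\<exists>b\<in>carrier R. a \<otimes> b \<in> S)"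
proof
  assume "frac a s \<in> Units (localization R S)"
  then obtain y where y: "y \<in> carrier (localization R S)" "frac a s \<otimes>\<^bsub>localization R S\<^esub> y = \<one>\<^bsub>localization R S\<^esub>"
    unfolding Units_def by blast
  obtain b t where b: "b \<in> carrier R" and t: "t \<in> S" "y = frac b t"
    using y(1) by (rule localizationE)
  have "frac (a \<otimes> b) (s \<otimes> t) = frac \<one> \<one>"
    using y(2) a s b t by (simp add: localization_simps(2,4) loc_mult_frac)
  then obtain u where u: "u \<in> S" "u \<otimes> (a \<otimes> b \<otimes> \<one>) = u \<otimes> (\<one> \<otimes> (s \<otimes> t))"
    using a b S_mult[OF s t(1)] one_in_S by (auto simp: frac_eq_iff)
  then have "a \<otimes> (b \<otimes> u) = u \<otimes> (s \<otimes> t)"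
    using a b s t(1) u(1) S_closed by (simp add: m_ac)
  then show "\<exists>b\<in>carrier R. a \<otimes> b \<in> S"
    using b u(1) s t(1) S_closed S_mult by (metis m_closed)
next
  interpret L: cring "localization R S" by (rule localization_cring)
  assume "\<exists>b\<in>carrier R. a \<otimes> b \<in> S"
  then obtain b where b: "b \<in> carrier R" "a \<otimes> b \<in> S" by blast
  have "frac a s \<otimes>\<^bsub>localization R S\<^esub> frac (b \<otimes> s) (a \<otimes> b) = \<one>\<^bsub>localization R S\<^esub>"
    unfolding localization_simps(2,4) loc_mult_frac[OF a s m_closed[OF b(1) S_closed[OF s]] b(2)]
    by (rule frac_eqI) (use S_mult[OF s b(2)] a b s S_closed one_in_S in \<open>simp_all add: m_ac\<close>)
  moreover have "frac a s \<in> carrier (localization R S)" "frac (b \<otimes> s) (a \<otimes> b) \<in> carrier (localization R S)"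
    using a b s S_closed frac_in_localization by auto
  ultimately show "frac a s \<in> Units (localization R S)"
    using L.Units_one_closed L.unit_factor by metis
qed

end

lemma primeideal_complement_multiplicative:
  fixes R :: "'a ring" (structure)
  assumes "primeideal p R"
  shows "multiplicative_subset R (carrier R - p)"
proof -
  interpret primeideal p R by fact
  have "\<one> \<notin> p"
    using I_notcarr one_imp_carrier by blast
  then show ?thesis
    by unfold_locales (use I_prime in blast)+
qed

lemma prime_frac_unit_iff:
  fixes R :: "'a ring"
  assumes p: "primeideal p R" and a: "a \<in> carrier R" and s: "s \<in> carrier R" "s \<notin> p"
  shows "loc_frac R (carrier R - p) a s \<in> Units (localization R (carrier R - p)) \<longleftrightarrow> a \<notin> p"
proof -
  interpret primeideal p R by fact
  interpret multiplicative_subset R "carrier R - p"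
    by (rule primeideal_complement_multiplicative[OF p])
  show ?thesis
    using a s frac_unit_iff[of a s] I_r_closed[of a] by (auto intro!: bexI[of _ "\<one>\<^bsub>R\<^esub>"])
qed

locale fraction_extension =
  \<iota>: ring_hom_cring R R' \<iota> + \<psi>: ring_hom_cring R T \<psi>
  for R :: "('a, 'm) ring_scheme" and R' :: "('b, 'n) ring_scheme" and T :: "('c, 'k) ring_scheme" and \<iota> \<psi> +
  assumes kernel: "a \<in> carrier R \<Longrightarrow> \<iota> a = \<zero>\<^bsub>R'\<^esub> \<Longrightarrow> \<psi> a = \<zero>\<^bsub>T\<^esub>"
    and fraction: "z \<in> carrier R' \<Longrightarrow>
      \<exists>a\<in>carrier R. \<exists>s\<in>carrier R. \<psi> s \<in> Units T \<and> z \<otimes>\<^bsub>R'\<^esub> \<iota> s = \<iota> a"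
begin

definition extends_to :: "'b \<Rightarrow> 'c \<Rightarrow> bool" where
  "extends_to z w \<longleftrightarrow> z \<in> carrier R' \<and> w \<in> carrier T \<and>
     (\<exists>a\<in>carrier R. \<exists>s\<in>carrier R. \<psi> s \<in> Units T \<and>
        z \<otimes>\<^bsub>R'\<^esub> \<iota> s = \<iota> a \<and> w \<otimes>\<^bsub>T\<^esub> \<psi> s = \<psi> a)"

lemma extends_to_unique:
  assumes "extends_to z v" "extends_to z w"
  shows "v = w"
proof -
  have z: "z \<in> carrier R'" and vw: "v \<in> carrier T" "w \<in> carrier T"
    using assms by (auto simp: extends_to_def)
  obtain a s where s: "a \<in> carrier R" "s \<in> carrier R" "\<psi> s \<in> Units T"
      "z \<otimes>\<^bsub>R'\<^esub> \<iota> s = \<iota> a" "v \<otimes>\<^bsub>T\<^esub> \<psi> s = \<psi> a"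
    using assms(1) by (auto simp: extends_to_def)
  obtain b t where t: "b \<in> carrier R" "t \<in> carrier R" "\<psi> t \<in> Units T"
      "z \<otimes>\<^bsub>R'\<^esub> \<iota> t = \<iota> b" "w \<otimes>\<^bsub>T\<^esub> \<psi> t = \<psi> b"
    using assms(2) by (auto simp: extends_to_def)
  have "\<iota> (a \<otimes>\<^bsub>R\<^esub> t) = \<iota> (b \<otimes>\<^bsub>R\<^esub> s)"
    using z s(1,2) t(1,2) by (simp add: s(4)[symmetric] t(4)[symmetric] \<iota>.S.m_ac)
  then have "\<iota> (a \<otimes>\<^bsub>R\<^esub> t \<ominus>\<^bsub>R\<^esub> b \<otimes>\<^bsub>R\<^esub> s) = \<zero>\<^bsub>R'\<^esub>"
    using s(1,2) t(1,2) by (simp add: \<iota>.R.minus_eq \<iota>.S.r_neg del: \<iota>.hom_mult)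
  then have "\<psi> (a \<otimes>\<^bsub>R\<^esub> t \<ominus>\<^bsub>R\<^esub> b \<otimes>\<^bsub>R\<^esub> s) = \<zero>\<^bsub>T\<^esub>"
    using s(1,2) t(1,2) by (intro kernel) simp_all
  then have "\<psi> a \<otimes>\<^bsub>T\<^esub> \<psi> t = \<psi> b \<otimes>\<^bsub>T\<^esub> \<psi> s"
    using s(1,2) t(1,2) \<psi>.S.r_right_minus_eq by (simp add: \<iota>.R.minus_eq \<psi>.S.minus_eq)
  then have "(\<psi> t \<otimes>\<^bsub>T\<^esub> \<psi> s) \<otimes>\<^bsub>T\<^esub> v = (\<psi> t \<otimes>\<^bsub>T\<^esub> \<psi> s) \<otimes>\<^bsub>T\<^esub> w"
    using s(2) t(2) vw by (simp add: s(5)[symmetric] t(5)[symmetric] \<psi>.S.m_ac)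
  then show ?thesis
    using \<psi>.S.Units_l_cancel[of "\<psi> t \<otimes>\<^bsub>T\<^esub> \<psi> s" v w] s(3) t(3) vw by simp
qed

lemma extends_to_mult_add:
  assumes "extends_to x v" "extends_to y w"
  shows "extends_to (x \<otimes>\<^bsub>R'\<^esub> y) (v \<otimes>\<^bsub>T\<^esub> w)" "extends_to (x \<oplus>\<^bsub>R'\<^esub> y) (v \<oplus>\<^bsub>T\<^esub> w)"
proof -
  have cl: "x \<in> carrier R'" "y \<in> carrier R'" "v \<in> carrier T" "w \<in> carrier T"
    using assms by (auto simp: extends_to_def)
  obtain a s where s: "a \<in> carrier R" "s \<in> carrier R" "\<psi> s \<in> Units T"
      "x \<otimes>\<^bsub>R'\<^esub> \<iota> s = \<iota> a" "v \<otimes>\<^bsub>T\<^esub> \<psi> s = \<psi> a"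
    using assms(1) by (auto simp: extends_to_def)
  obtain b t where t: "b \<in> carrier R" "t \<in> carrier R" "\<psi> t \<in> Units T"
      "y \<otimes>\<^bsub>R'\<^esub> \<iota> t = \<iota> b" "w \<otimes>\<^bsub>T\<^esub> \<psi> t = \<psi> b"
    using assms(2) by (auto simp: extends_to_def)
  have st: "s \<otimes>\<^bsub>R\<^esub> t \<in> carrier R" "\<psi> (s \<otimes>\<^bsub>R\<^esub> t) \<in> Units T"
    using s t by simp_all
  show "extends_to (x \<otimes>\<^bsub>R'\<^esub> y) (v \<otimes>\<^bsub>T\<^esub> w)"
    unfolding extends_to_def using cl s(1,2) t(1,2) st
    by (intro conjI bexI[of _ "a \<otimes>\<^bsub>R\<^esub> b"] bexI[of _ "s \<otimes>\<^bsub>R\<^esub> t"])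
      (simp_all add: s(4,5)[symmetric] t(4,5)[symmetric] \<iota>.S.m_ac \<psi>.S.m_ac)
  show "extends_to (x \<oplus>\<^bsub>R'\<^esub> y) (v \<oplus>\<^bsub>T\<^esub> w)"
    unfolding extends_to_def using cl s(1,2) t(1,2) st
    by (intro conjI bexI[of _ "a \<otimes>\<^bsub>R\<^esub> t \<oplus>\<^bsub>R\<^esub> b \<otimes>\<^bsub>R\<^esub> s"] bexI[of _ "s \<otimes>\<^bsub>R\<^esub> t"])
      (simp_all add: s(4,5)[symmetric] t(4,5)[symmetric] \<iota>.S.m_ac \<psi>.S.m_ac \<iota>.S.r_distr \<psi>.S.r_distr)
qed

lemma extends_to_map: "r \<in> carrier R \<Longrightarrow> extends_to (\<iota> r) (\<psi> r)"
  unfolding extends_to_def by (intro conjI bexI[of _ r] bexI[of _ "\<one>\<^bsub>R\<^esub>"]) simp_all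

lemma fraction_hom_exists: "\<exists>\<phi>\<in>ring_hom R' T. \<forall>r\<in>carrier R. \<phi> (\<iota> r) = \<psi> r"
proof -
  have "\<exists>w. extends_to z w" if z: "z \<in> carrier R'" for z
  proof -
    obtain a s where s: "a \<in> carrier R" "s \<in> carrier R" "\<psi> s \<in> Units T" "z \<otimes>\<^bsub>R'\<^esub> \<iota> s = \<iota> a"
      using fraction[OF z] by blast
    then have "extends_to z (\<psi> a \<otimes>\<^bsub>T\<^esub> inv\<^bsub>T\<^esub> (\<psi> s))"
      unfolding extends_to_def using z
      by (intro conjI bexI[of _ a] bexI[of _ s]) (simp_all add: \<psi>.S.m_assoc)
    then show ?thesis ..
  qed
  then obtain \<phi> where \<phi>: "extends_to z (\<phi> z)" if "z \<in> carrier R'" for z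
    by metis
  note \<phi>_eqI = extends_to_unique[OF \<phi>]
  have "\<phi> \<in> ring_hom R' T"
  proof (rule ring_hom_memI)
    show "\<phi> x \<in> carrier T" if "x \<in> carrier R'" for x
      using \<phi>[OF that] by (simp add: extends_to_def)
    show "\<phi> (x \<otimes>\<^bsub>R'\<^esub> y) = \<phi> x \<otimes>\<^bsub>T\<^esub> \<phi> y" "\<phi> (x \<oplus>\<^bsub>R'\<^esub> y) = \<phi> x \<oplus>\<^bsub>T\<^esub> \<phi> y"
      if "x \<in> carrier R'" "y \<in> carrier R'" for x y
      using extends_to_mult_add[OF \<phi>[OF that(1)] \<phi>[OF that(2)]] that by (simp_all add: \<phi>_eqI)
    show "\<phi> \<one>\<^bsub>R'\<^esub> = \<one>\<^bsub>T\<^esub>"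
      using extends_to_map[OF \<iota>.R.one_closed] by (simp add: \<phi>_eqI)
  qed
  then show ?thesis
    using \<phi>_eqI[OF \<iota>.hom_closed extends_to_map] by blast
qed

end

lemma fraction_field:
  fixes R :: "'a ring" (structure)
  assumes "domain R"
  defines "F \<equiv> localization R (carrier R - {\<zero>})"
  shows "field F"
    and "(\<lambda>a. loc_frac R (carrier R - {\<zero>}) a \<one>) \<in> ring_hom R F"
    and "a \<in> carrier R \<Longrightarrow> loc_frac R (carrier R - {\<zero>}) a \<one> = \<zero>\<^bsub>F\<^esub> \<longleftrightarrow> a = \<zero>"
proof -
  interpret domain R by fact
  interpret multiplicative_subset R "carrier R - {\<zero>}"
    by unfold_locales (auto simp: integral_iff)
  show zero: "frac a \<one> = \<zero>\<^bsub>F\<^esub> \<longleftrightarrow> a = \<zero>" if "a \<in> carrier R" for a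
    using that frac_eq_iff[OF that one_in_S zero_closed one_in_S]
    by (auto simp: F_def localization_simps(3) integral_iff)
  show "(\<lambda>a. frac a \<one>) \<in> ring_hom R F"
    unfolding F_def by (rule localization_map_hom)
  show "field F"
  proof (rule cring.cring_fieldI2)
    show "cring F" unfolding F_def by (rule localization_cring)
    show "\<zero>\<^bsub>F\<^esub> \<noteq> \<one>\<^bsub>F\<^esub>"
      using zero[of \<one>] by (simp add: F_def localization_simps(2))
    fix x assume "x \<in> carrier F" "x \<noteq> \<zero>\<^bsub>F\<^esub>"
    then obtain a s where x: "x = frac a s" "a \<in> carrier R" "s \<in> carrier R - {\<zero>}"
      unfolding F_def by (elim localizationE)
    have "frac \<zero> s = frac \<zero> \<one>"
      using x(3) by (intro frac_eqI) auto
    then have "a \<noteq> \<zero>"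
      using \<open>x \<noteq> \<zero>\<^bsub>F\<^esub>\<close> x(1) by (auto simp: F_def localization_simps(3))
    then have "x \<otimes>\<^bsub>F\<^esub> frac s a = frac (a \<otimes> s) (s \<otimes> a)"
      using x by (simp add: F_def localization_simps(4) loc_mult_frac)
    also have "\<dots> = \<one>\<^bsub>F\<^esub>"
      unfolding F_def localization_simps(2)
      using x \<open>a \<noteq> \<zero>\<close> by (intro frac_eqI) (auto simp: m_comm integral_iff)
    finally have "x \<otimes>\<^bsub>F\<^esub> frac s a = \<one>\<^bsub>F\<^esub>" .
    moreover have "frac s a \<in> carrier F"
      unfolding F_def using x \<open>a \<noteq> \<zero>\<close> by (intro frac_in_localization) auto
    ultimately show "\<exists>b\<in>carrier F. x \<otimes>\<^bsub>F\<^esub> b = \<one>\<^bsub>F\<^esub>" by blast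
  qed
qed

lemma countable_imp_inj_into_infinite:
  assumes "countable A"
  obtains f :: "'a \<Rightarrow> 'u :: infinite" where "inj_on f A"
proof -
  obtain i :: "nat \<Rightarrow> 'u" where "inj i"
    using infinite_countable_subset[OF infinite_UNIV] by blast
  then have "inj_on (i \<circ> to_nat_on A) A"
    using assms by (intro comp_inj_on inj_on_to_nat_on) (auto intro: inj_on_subset)
  then show ?thesis by (rule that)
qed

lemma residue_field_exists:
  fixes R :: "'a ring"
  assumes R: "cring R" and P: "primeideal P R" and "countable (carrier R)"
  obtains K :: "'u :: infinite ring" and \<psi> where "field K" "\<psi> \<in> ring_hom R K"
    "\<And>r. r \<in> carrier R \<Longrightarrow> \<psi> r = \<zero>\<^bsub>K\<^esub> \<longleftrightarrow> r \<in> P"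
    "\<And>z. z \<in> carrier K \<Longrightarrow> \<exists>a\<in>carrier R. \<exists>b\<in>carrier R - P. z \<otimes>\<^bsub>K\<^esub> \<psi> b = \<psi> a"
proof -
  interpret R: cring R by fact
  interpret P: primeideal P R by fact
  interpret D: domain "R Quot P" by (rule P.quotient_is_domain)
  define q where "q = (+>\<^bsub>R\<^esub>) P"
  have q: "q \<in> ring_hom R (R Quot P)" unfolding q_def by (rule P.rcos_ring_hom)
  have carrier_D: "carrier (R Quot P) = q ` carrier R"
    unfolding q_def FactRing_def A_RCOSETS_def' by auto
  have q_zero: "q r = \<zero>\<^bsub>R Quot P\<^esub> \<longleftrightarrow> r \<in> P" if "r \<in> carrier R" for r
    using that P.a_rcos_const P.a_rcos_self unfolding q_def FactRing_def by auto
  interpret S: multiplicative_subset "R Quot P" "carrier (R Quot P) - {\<zero>\<^bsub>R Quot P\<^esub>}"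
    by unfold_locales (auto simp: D.integral_iff)
  define F where "F = localization (R Quot P) (carrier (R Quot P) - {\<zero>\<^bsub>R Quot P\<^esub>})"
  note F = fraction_field[OF D.domain_axioms, folded F_def]
  interpret F: field F by (rule F(1))
  have "carrier F \<subseteq> (\<lambda>(a, b). S.frac a b) ` (q ` carrier R \<times> q ` carrier R)"
    unfolding F_def localization_simps carrier_D by auto
  then have "countable (carrier F)"
    by (rule countable_subset) (use assms(3) in \<open>intro countable_image countable_SIGMA; simp\<close>)
  then obtain f :: "_ \<Rightarrow> 'u" where f: "inj_on f (carrier F)"
    by (rule countable_imp_inj_into_infinite)
  define K where "K = image_ring f F"
  have carrier_K: "carrier K = f ` carrier F"
    unfolding K_def by (rule image_ring_carrier)
  interpret K: field K unfolding K_def by (rule F.inj_imp_image_ring_is_field[OF f])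
  have f_hom: "f \<in> ring_hom F K"
    using inj_imp_image_ring_iso[OF f] unfolding K_def ring_iso_def by simp
  have f_zero: "f x = \<zero>\<^bsub>K\<^esub> \<longleftrightarrow> x = \<zero>\<^bsub>F\<^esub>" if "x \<in> carrier F" for x
    using ring_hom_zero[OF f_hom F.ring_axioms K.ring_axioms] inj_onD[OF f _ that F.zero_closed] by metis
  define \<psi> where "\<psi> r = f (S.frac (q r) \<one>\<^bsub>R Quot P\<^esub>)" for r
  have "\<psi> \<in> ring_hom R K"
    using ring_hom_trans[OF ring_hom_trans[OF q F(2)] f_hom] by (simp add: \<psi>_def[abs_def] comp_def)
  moreover have "\<psi> r = \<zero>\<^bsub>K\<^esub> \<longleftrightarrow> r \<in> P" if "r \<in> carrier R" for r
    using that carrier_D f_zero ring_hom_closed[OF F(2), of "q r"] F(3) q_zero by (simp add: \<psi>_def)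
  moreover have "\<exists>a\<in>carrier R. \<exists>b\<in>carrier R - P. z \<otimes>\<^bsub>K\<^esub> \<psi> b = \<psi> a" if z: "z \<in> carrier K" for z
  proof -
    obtain x where x: "x \<in> carrier F" "z = f x" using z carrier_K by blast
    from x(1) obtain u v where "u \<in> carrier (R Quot P)" "v \<in> carrier (R Quot P) - {\<zero>\<^bsub>R Quot P\<^esub>}" "x = S.frac u v"
      unfolding F_def by (elim S.localizationE)
    then obtain a b where ab: "a \<in> carrier R" "b \<in> carrier R" "q b \<noteq> \<zero>\<^bsub>R Quot P\<^esub>" "x = S.frac (q a) (q b)"
      unfolding carrier_D by blast
    have "q a \<in> carrier (R Quot P)" "q b \<in> carrier (R Quot P) - {\<zero>\<^bsub>R Quot P\<^esub>}"
      using ab carrier_D by auto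
    then have "z \<otimes>\<^bsub>K\<^esub> \<psi> b = \<psi> a"
      using ring_hom_mult[OF f_hom x(1) ring_hom_closed[OF F(2), of "q b"]] S.frac_mult_denominator[of "q a" "q b"]
      by (simp add: \<psi>_def x(2) ab(4) F_def)
    then show ?thesis using ab q_zero by blast
  qed
  ultimately show thesis by (rule that[OF K.field_axioms])
qed

section \<open>A Laurent polynomial ring with a shift\<close>

definition type_ring :: "'a :: comm_ring_1 ring" where
  "type_ring = \<lparr>carrier = UNIV, mult = (*), one = 1, zero = 0, add = (+)\<rparr>"

lemma type_ring_simps [simp]:
  "carrier type_ring = UNIV" "x \<otimes>\<^bsub>type_ring\<^esub> y = x * y" "\<one>\<^bsub>type_ring\<^esub> = 1"
  "\<zero>\<^bsub>type_ring\<^esub> = 0" "x \<oplus>\<^bsub>type_ring\<^esub> y = x + y"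
  by (simp_all add: type_ring_def)

lemma type_ring_pow [simp]: "x [^]\<^bsub>type_ring\<^esub> (n :: nat) = x ^ n"
  by (induction n) (simp_all add: mult.commute)

lemma cring_type_ring: "cring type_ring"
  by (intro cringI abelian_groupI comm_monoidI)
    (auto simp: algebra_simps intro!: exI[of _ "- x" for x])

lemma domain_type_ring: "domain (type_ring :: 'a :: idom ring)"
  by (intro domainI cring_type_ring) simp_all

lemma frag_extend_mult:
  fixes f :: "'a :: monoid_add \<Rightarrow> 'b :: monoid_add"
  assumes f: "\<And>a b. f (a + b) = f a + f b"
  shows "frag_extend (frag_of \<circ> f) (x * y) = frag_extend (frag_of \<circ> f) x * frag_extend (frag_of \<circ> f) y"
  using subset_UNIV
proof (induction x rule: frag_induction)
  case (one a)
  show ?case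
    using subset_UNIV
    by (induction y rule: frag_induction)
      (simp_all add: Poly_Mapping.mult_single f right_diff_distrib frag_extend_diff)
qed (simp_all add: left_diff_distrib frag_extend_diff)

lemma countable_poly: "countable (UNIV :: 'a :: {countable, zero} poly set)"
  by (rule countableI'[of "\<lambda>p. to_nat (coeffs p)"]) (auto intro!: injI simp: coeffs_eq_iff)

lemma countable_poly_mapping:
  assumes "countable (UNIV :: 'a set)"
  shows "countable (UNIV :: ('a \<Rightarrow>\<^sub>0 'b :: {countable, zero}) set)"
proof -
  have "inj (\<lambda>p :: 'a \<Rightarrow>\<^sub>0 'b. (\<lambda>k. (k, Poly_Mapping.lookup p k)) ` Poly_Mapping.keys p)"
  proof (intro injI poly_mapping_eqI)
    fix p q :: "'a \<Rightarrow>\<^sub>0 'b" and k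
    assume eq: "(\<lambda>k. (k, Poly_Mapping.lookup p k)) ` Poly_Mapping.keys p =
      (\<lambda>k. (k, Poly_Mapping.lookup q k)) ` Poly_Mapping.keys q" (is "?G p = ?G q")
    have "(k, v) \<in> ?G r \<longleftrightarrow> v \<noteq> 0 \<and> Poly_Mapping.lookup r k = v" for r v
      by (auto simp: in_keys_iff)
    then show "Poly_Mapping.lookup p k = Poly_Mapping.lookup q k"
      using eq by metis
  qed
  moreover have "countable (UNIV \<times> UNIV :: ('a \<times> 'b) set)"
    using assms by (intro countable_SIGMA) auto
  then have "countable {A :: ('a \<times> 'b) set. finite A \<and> A \<subseteq> UNIV \<times> UNIV}"
    by (rule countable_Collect_finite_subset)
  ultimately show ?thesis
    by (elim countable_image_inj_on[rotated]) (rule countable_subset; auto)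
qed

text \<open>The exponents are the finitely supported integer sequences, written as polynomials because these
  form a linearly ordered group; \<open>\<phi>\<close> shifts the variables \<open>t\<close>.\<close>

lemma laurent_ring_with_shift_exists:
  obtains A :: "'u :: infinite ring" and \<phi> t where "domain A" "countable (carrier A)" "\<phi> \<in> ring_hom A A"
    "\<And>i :: nat. t i \<in> Units A" "\<phi> (t 0) = \<one>\<^bsub>A\<^esub>" "\<And>i. \<phi> (t (Suc i)) = t i"
    "\<And>i n :: nat. 0 < n \<Longrightarrow> t i [^]\<^bsub>A\<^esub> n \<noteq> \<one>\<^bsub>A\<^esub>"
proof -
  define L :: "(int poly \<Rightarrow>\<^sub>0 int) ring" where "L = type_ring"
  interpret L: domain L unfolding L_def by (rule domain_type_ring)
  have "countable (UNIV :: (int poly \<Rightarrow>\<^sub>0 int) set)"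
    by (intro countable_poly_mapping countable_poly)
  then obtain f :: "(int poly \<Rightarrow>\<^sub>0 int) \<Rightarrow> 'u" where f: "inj f"
    by (rule countable_imp_inj_into_infinite)
  define A where "A = image_ring f L"
  have inj_L: "inj_on f (carrier L)"
    using f by (simp add: L_def)
  have carrier_A: "carrier A = range f"
    unfolding A_def by (simp add: image_ring_carrier L_def)
  interpret A: domain A unfolding A_def by (rule L.inj_imp_image_ring_is_domain[OF inj_L])
  have f_hom: "f \<in> ring_hom L A"
    using inj_imp_image_ring_iso[OF inj_L] unfolding A_def ring_iso_def by simp
  have f_mult: "f x \<otimes>\<^bsub>A\<^esub> f y = f (x * y)" and f_add: "f x \<oplus>\<^bsub>A\<^esub> f y = f (x + y)" and f_one: "\<one>\<^bsub>A\<^esub> = f 1" for x y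
    using ring_hom_mult[OF f_hom] ring_hom_add[OF f_hom] ring_hom_one[OF f_hom] by (simp_all add: L_def)
  define shift :: "(int poly \<Rightarrow>\<^sub>0 int) \<Rightarrow> int poly \<Rightarrow>\<^sub>0 int" where
    "shift = frag_extend (frag_of \<circ> poly_shift 1)"
  have shift_mult: "shift (x * y) = shift x * shift y" for x y
    unfolding shift_def by (rule frag_extend_mult) (simp add: poly_eq_iff coeff_poly_shift)
  have shift_add: "shift (x + y) = shift x + shift y" for x y
    unfolding shift_def by (rule frag_extend_add)
  have shift_one: "shift 1 = 1"
    unfolding shift_def by (simp flip: Poly_Mapping.single_one)
  define \<phi> where "\<phi> = f \<circ> shift \<circ> the_inv f"
  define t where "t i = f (frag_of (monom 1 i))" for i
  have \<phi>: "\<phi> (f x) = f (shift x)" for x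
    using f by (simp add: \<phi>_def the_inv_f_f)
  have t_pow: "t i [^]\<^bsub>A\<^esub> n = f (frag_of (monom (int n) i))" for i n :: nat
    by (induction n) (simp_all add: t_def f_one f_mult Poly_Mapping.mult_single add_monom add.commute)
  show thesis
  proof (rule that[OF A.domain_axioms])
    show "countable (carrier A)"
      unfolding carrier_A using \<open>countable UNIV\<close> by (rule countable_image)
    show "\<phi> \<in> ring_hom A A"
      by (rule ring_hom_memI)
        (auto simp: carrier_A f_one \<phi> f_mult f_add shift_mult shift_add shift_one)
    fix i n :: nat
    have "t i \<otimes>\<^bsub>A\<^esub> f (frag_of (monom (- 1) i)) = \<one>\<^bsub>A\<^esub>"
      by (simp add: t_def f_mult f_one Poly_Mapping.mult_single add_monom)
    then show "t i \<in> Units A"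
      using A.Units_one_closed A.unit_factor[of "t i" "f (frag_of (monom (- 1) i))"]
      by (simp add: carrier_A t_def)
    show "\<phi> (t 0) = \<one>\<^bsub>A\<^esub>"
      unfolding t_def \<phi> shift_def f_one by (simp add: poly_shift_1)
    show "\<phi> (t (Suc i)) = t i"
      unfolding t_def \<phi> shift_def by (simp add: poly_shift_monom)
    assume "0 < n"
    then show "t i [^]\<^bsub>A\<^esub> n \<noteq> \<one>\<^bsub>A\<^esub>"
      using f unfolding t_pow f_one
      by (auto dest!: injD simp: frag_of_eq simp flip: Poly_Mapping.single_one)
  qed
qed

text \<open>Shifting the variables of the Laurent ring sends them to \<open>1\<close> one after the other.\<close>

lemma specialization_homs_exist:
  obtains A K :: "'u :: infinite ring" and J t where "cring A" "field K" "\<And>i :: nat. J i \<in> ring_hom A K"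
    "\<And>i a. a \<in> carrier A \<Longrightarrow> J i a = \<zero>\<^bsub>K\<^esub> \<Longrightarrow> J (Suc i) a = \<zero>\<^bsub>K\<^esub>"
    "\<And>i :: nat. t i \<in> Units A"
    "\<And>i n :: nat. 0 < n \<Longrightarrow> J i (t i) [^]\<^bsub>K\<^esub> n \<noteq> \<one>\<^bsub>K\<^esub>" "\<And>i. J (Suc i) (t i) = \<one>\<^bsub>K\<^esub>"
proof -
  obtain A :: "'u ring" and \<phi> t where A: "domain A" "countable (carrier A)" and \<phi>: "\<phi> \<in> ring_hom A A"
      and t: "\<And>i :: nat. t i \<in> Units A" and t_shift: "\<phi> (t 0) = \<one>\<^bsub>A\<^esub>" "\<And>i. \<phi> (t (Suc i)) = t i"
      and t_pow: "\<And>i n :: nat. 0 < n \<Longrightarrow> t i [^]\<^bsub>A\<^esub> n \<noteq> \<one>\<^bsub>A\<^esub>"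
    by (rule laurent_ring_with_shift_exists) (rule that)
  interpret A: domain A by (rule A(1))
  obtain K :: "'u ring" and j where K: "field K" and j: "j \<in> ring_hom A K"
      and kernel: "\<And>a. a \<in> carrier A \<Longrightarrow> j a = \<zero>\<^bsub>K\<^esub> \<longleftrightarrow> a \<in> {\<zero>\<^bsub>A\<^esub>}"
      and "\<And>z. z \<in> carrier K \<Longrightarrow> \<exists>a\<in>carrier A. \<exists>b\<in>carrier A - {\<zero>\<^bsub>A\<^esub>}. z \<otimes>\<^bsub>K\<^esub> j b = j a"
    by (rule residue_field_exists[OF A.is_cring A.zeroprimeideal A(2)]) (rule that)
  interpret K: field K by (rule K)
  interpret j: ring_hom_cring A K j by unfold_locales (rule j)
  have iterate: "\<phi> ^^ i \<in> ring_hom A A" for i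
  proof (induction i)
    case (Suc i)
    then show ?case unfolding funpow.simps by (rule ring_hom_trans[OF _ \<phi>])
  qed (simp add: ring_hom_def)
  have j_eqD: "x = y" if "x \<in> carrier A" "y \<in> carrier A" "j x = j y" for x y
  proof -
    have "j (x \<ominus>\<^bsub>A\<^esub> y) = \<zero>\<^bsub>K\<^esub>" using that by (simp add: A.minus_eq K.r_neg)
    then show ?thesis using kernel[of "x \<ominus>\<^bsub>A\<^esub> y"] that by (simp add: A.r_right_minus_eq)
  qed
  have shift: "(\<phi> ^^ i) (t (i + k)) = t k" for i k
    by (induction i arbitrary: k) (simp_all add: t_shift(2) flip: add_Suc_right)
  define J where "J i = j \<circ> (\<phi> ^^ i)" for i
  show thesis
  proof (rule that[of A K J t, OF A.is_cring K _ _ t])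
    show "J i \<in> ring_hom A K" for i
      unfolding J_def by (rule ring_hom_trans[OF iterate j])
    show "J (Suc i) a = \<zero>\<^bsub>K\<^esub>" if "a \<in> carrier A" "J i a = \<zero>\<^bsub>K\<^esub>" for i a
      using that kernel ring_hom_closed[OF iterate that(1)] ring_hom_zero[OF \<phi> A.ring_axioms A.ring_axioms]
      by (simp add: J_def)
    show "J i (t i) [^]\<^bsub>K\<^esub> n \<noteq> \<one>\<^bsub>K\<^esub>" if "0 < n" for i n :: nat
      using shift[of i 0] t_pow[OF that, of 0] j_eqD[of "t 0 [^]\<^bsub>A\<^esub> n" "\<one>\<^bsub>A\<^esub>"] t[of 0]
      by (auto simp: J_def simp flip: j.hom_pow)
    show "J (Suc i) (t i) = \<one>\<^bsub>K\<^esub>" for i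
      using shift[of i 0] t_shift(1) by (simp add: J_def)
  qed
qed

lemma openin_SpecD: "cring R \<Longrightarrow> openin (pts (Spec R)) U \<Longrightarrow> p \<in> U \<Longrightarrow> primeideal p R"
  by (auto simp: openin_Spec)

lemma topspace_Spec: "cring R \<Longrightarrow> topspace (pts (Spec R)) = {p. primeideal p R}"
proof (rule antisym)
  assume R: "cring R"
  then show "topspace (pts (Spec R)) \<subseteq> {p. primeideal p R}"
    using openin_SpecD by fastforce
  have "\<not> carrier R \<subseteq> p" if "primeideal p R" for p
    using that primeideal.I_notcarr[of p R] additive_subgroup.a_subset ideal.axioms(1) primeideal.axioms(1) by blast
  then have "openin (pts (Spec R)) {p. primeideal p R}"
    unfolding openin_Spec[OF R] by (intro exI[of _ "carrier R"]) auto
  then show "{p. primeideal p R} \<subseteq> topspace (pts (Spec R))"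
    by (rule openin_subset)
qed

lemma openin_Spec_basic:
  "cring R \<Longrightarrow> s \<in> carrier R \<Longrightarrow> openin (pts (Spec R)) {p. primeideal p R \<and> s \<notin> p}"
  unfolding openin_Spec by (intro exI[of _ "{s}"]) auto

section \<open>Germs and invertible sections\<close>

locale presheaf_of_monoids =
  fixes X :: "('x, 's, 'm) sheafed_space"
  assumes sec_monoid: "openin (pts X) U \<Longrightarrow> comm_monoid (sec X U)"
    and res_hom: "openin (pts X) U \<Longrightarrow> openin (pts X) V \<Longrightarrow> V \<subseteq> U \<Longrightarrow> res X U V \<in> hom (sec X U) (sec X V)"
    and res_one: "openin (pts X) U \<Longrightarrow> openin (pts X) V \<Longrightarrow> V \<subseteq> U \<Longrightarrow>
      res X U V \<one>\<^bsub>sec X U\<^esub> = \<one>\<^bsub>sec X V\<^esub>"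
    and res_id: "openin (pts X) U \<Longrightarrow> s \<in> carrier (sec X U) \<Longrightarrow> res X U U s = s"
    and res_comp: "openin (pts X) U \<Longrightarrow> openin (pts X) V \<Longrightarrow> openin (pts X) W \<Longrightarrow> W \<subseteq> V \<Longrightarrow> V \<subseteq> U \<Longrightarrow>
      s \<in> carrier (sec X U) \<Longrightarrow> res X V W (res X U V s) = res X U W s"
begin

abbreviation neighbourhood :: "'x \<Rightarrow> 'x set \<Rightarrow> bool" where
  "neighbourhood x U \<equiv> openin (pts X) U \<and> x \<in> U"

abbreviation mult_sections :: "'x set \<Rightarrow> 's \<Rightarrow> 'x set \<Rightarrow> 's \<Rightarrow> 's" where
  "mult_sections U s V t \<equiv> res X U (U \<inter> V) s \<otimes>\<^bsub>sec X (U \<inter> V)\<^esub> res X V (U \<inter> V) t"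

lemma res_closed:
  "openin (pts X) U \<Longrightarrow> openin (pts X) V \<Longrightarrow> V \<subseteq> U \<Longrightarrow> s \<in> carrier (sec X U) \<Longrightarrow> res X U V s \<in> carrier (sec X V)"
  using res_hom by (rule hom_in_carrier)

lemma res_mult_sections:
  assumes "openin (pts X) U" "s \<in> carrier (sec X U)" "openin (pts X) V" "t \<in> carrier (sec X V)"
    and "openin (pts X) W" "W \<subseteq> U \<inter> V"
  shows "res X (U \<inter> V) W (mult_sections U s V t) = res X U W s \<otimes>\<^bsub>sec X W\<^esub> res X V W t"
proof -
  have UV: "openin (pts X) (U \<inter> V)" using assms(1,3) by blast
  have "res X U (U \<inter> V) s \<in> carrier (sec X (U \<inter> V))" "res X V (U \<inter> V) t \<in> carrier (sec X (U \<inter> V))"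
    using UV assms by (simp_all add: res_closed)
  then show ?thesis
    using hom_mult[OF res_hom[OF UV assms(5,6)]] UV assms by (simp add: res_comp)
qed

lemma mult_sections_closed:
  assumes "openin (pts X) U" "s \<in> carrier (sec X U)" "openin (pts X) V" "t \<in> carrier (sec X V)"
  shows "mult_sections U s V t \<in> carrier (sec X (U \<inter> V))"
proof -
  interpret comm_monoid "sec X (U \<inter> V)" using assms by (intro sec_monoid) blast
  show ?thesis using assms by (simp add: res_closed openin_Int)
qed

lemma germ_memD:
  assumes "(V, t) \<in> germ X x U s"
  obtains W where "neighbourhood x V" "t \<in> carrier (sec X V)" "neighbourhood x W" "W \<subseteq> U \<inter> V" "res X U W s = res X V W t"
  using assms unfolding germ_def by auto

lemma germ_self: "neighbourhood x U \<Longrightarrow> s \<in> carrier (sec X U) \<Longrightarrow> (U, s) \<in> germ X x U s"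
  unfolding germ_def by auto

lemma germ_subset:
  assumes U: "neighbourhood x U" "s \<in> carrier (sec X U)" and V: "neighbourhood x V" "t \<in> carrier (sec X V)"
    and W: "neighbourhood x W" "W \<subseteq> U \<inter> V" "res X U W s = res X V W t"
  shows "germ X x U s \<subseteq> germ X x V t"
proof (rule subsetI, clarify)
  fix A r assume "(A, r) \<in> germ X x U s"
  then obtain B where A: "neighbourhood x A" "r \<in> carrier (sec X A)"
      and B: "neighbourhood x B" "B \<subseteq> U \<inter> A" "res X U B s = res X A B r"
    by (rule germ_memD)
  have WB: "neighbourhood x (W \<inter> B)" using W(1) B(1) by blast
  have "res X V (W \<inter> B) t = res X W (W \<inter> B) (res X U W s)"
    unfolding W(3) using V W(1,2) WB by (intro res_comp[symmetric]) auto
  also have "\<dots> = res X U (W \<inter> B) s"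
    using U W(1,2) WB by (intro res_comp) auto
  also have "\<dots> = res X B (W \<inter> B) (res X U B s)"
    using U B(1,2) WB by (intro res_comp[symmetric]) auto
  also have "\<dots> = res X A (W \<inter> B) r"
    unfolding B(3) using A B(1,2) WB by (intro res_comp) auto
  finally show "(A, r) \<in> germ X x V t"
    unfolding germ_def using A WB W(2) B(2) by (auto intro!: exI[of _ "W \<inter> B"])
qed

lemma germ_eq_iff:
  assumes "neighbourhood x U" "s \<in> carrier (sec X U)" "neighbourhood x V" "t \<in> carrier (sec X V)"
  shows "germ X x U s = germ X x V t \<longleftrightarrow> (\<exists>W. neighbourhood x W \<and> W \<subseteq> U \<inter> V \<and> res X U W s = res X V W t)"
proof
  assume "germ X x U s = germ X x V t"
  then have "(V, t) \<in> germ X x U s" using germ_self[OF assms(3,4)] by simp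
  then show "\<exists>W. neighbourhood x W \<and> W \<subseteq> U \<inter> V \<and> res X U W s = res X V W t"
    by (elim germ_memD) blast
next
  assume "\<exists>W. neighbourhood x W \<and> W \<subseteq> U \<inter> V \<and> res X U W s = res X V W t"
  then obtain W where W: "neighbourhood x W" "W \<subseteq> U \<inter> V" "res X U W s = res X V W t" by blast
  then have "W \<subseteq> V \<inter> U" by blast
  with W show "germ X x U s = germ X x V t"
    using germ_subset[OF assms W] germ_subset[OF assms(3,4,1,2) W(1)] by simp
qed

lemma germ_mult_cong:
  assumes U: "neighbourhood x U" "s \<in> carrier (sec X U)" and V: "neighbourhood x V" "t \<in> carrier (sec X V)"
    and mem: "(U', s') \<in> germ X x U s" "(V', t') \<in> germ X x V t"
  shows "germ X x (U' \<inter> V') (mult_sections U' s' V' t') = germ X x (U \<inter> V) (mult_sections U s V t)"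
proof -
  obtain W1 where U': "neighbourhood x U'" "s' \<in> carrier (sec X U')"
      and W1: "neighbourhood x W1" "W1 \<subseteq> U \<inter> U'" "res X U W1 s = res X U' W1 s'"
    using mem(1) by (rule germ_memD)
  obtain W2 where V': "neighbourhood x V'" "t' \<in> carrier (sec X V')"
      and W2: "neighbourhood x W2" "W2 \<subseteq> V \<inter> V'" "res X V W2 t = res X V' W2 t'"
    using mem(2) by (rule germ_memD)
  have W: "neighbourhood x (W1 \<inter> W2)" using W1(1) W2(1) by blast
  have "res X U' (W1 \<inter> W2) s' = res X U (W1 \<inter> W2) s"
    using res_comp[of U W1 "W1 \<inter> W2" s] res_comp[of U' W1 "W1 \<inter> W2" s'] U U' W1 W by auto
  moreover have "res X V' (W1 \<inter> W2) t' = res X V (W1 \<inter> W2) t"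
    using res_comp[of V W2 "W1 \<inter> W2" t] res_comp[of V' W2 "W1 \<inter> W2" t'] V V' W2 W by auto
  ultimately have "res X (U' \<inter> V') (W1 \<inter> W2) (mult_sections U' s' V' t')
      = res X (U \<inter> V) (W1 \<inter> W2) (mult_sections U s V t)"
    using U V U' V' W W1(2) W2(2) by (subst (1 2) res_mult_sections) auto
  then show ?thesis
    using U V U' V' W W1(2) W2(2)
    by (subst germ_eq_iff) (auto simp: mult_sections_closed intro!: exI[of _ "W1 \<inter> W2"])
qed

lemma stalk_mult_germ:
  assumes U: "neighbourhood x U" "s \<in> carrier (sec X U)" and V: "neighbourhood x V" "t \<in> carrier (sec X V)"
  shows "germ X x U s \<otimes>\<^bsub>stalk X x\<^esub> germ X x V t = germ X x (U \<inter> V) (mult_sections U s V t)"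
proof -
  have "germ X x U s \<otimes>\<^bsub>stalk X x\<^esub> germ X x V t
      = (\<Union>(A, a)\<in>germ X x U s. \<Union>(B, b)\<in>germ X x V t. germ X x (A \<inter> B) (mult_sections A a B b))"
    by (simp add: stalk_def)
  also have "\<dots> = germ X x (U \<inter> V) (mult_sections U s V t)"
    using germ_self[OF U] germ_self[OF V] germ_mult_cong[OF U V] by fast
  finally show ?thesis .
qed

definition invertible_near :: "'x \<Rightarrow> 'x set \<Rightarrow> 's \<Rightarrow> bool" where
  "invertible_near x U s \<longleftrightarrow>
     (\<exists>W t. neighbourhood x W \<and> W \<subseteq> U \<and> t \<in> carrier (sec X W) \<and>
        res X U W s \<otimes>\<^bsub>sec X W\<^esub> t = \<one>\<^bsub>sec X W\<^esub>)"

lemma invertible_near_res: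
  assumes "openin (pts X) U" "neighbourhood x V" "V \<subseteq> U" "s \<in> carrier (sec X U)"
  shows "invertible_near x V (res X U V s) \<longleftrightarrow> invertible_near x U s"
proof
  assume "invertible_near x V (res X U V s)"
  then show "invertible_near x U s"
    using assms unfolding invertible_near_def by (metis res_comp subset_trans)
next
  assume "invertible_near x U s"
  then obtain W t where W: "neighbourhood x W" "W \<subseteq> U" "t \<in> carrier (sec X W)"
      "res X U W s \<otimes>\<^bsub>sec X W\<^esub> t = \<one>\<^bsub>sec X W\<^esub>"
    unfolding invertible_near_def by blast
  have VW: "neighbourhood x (V \<inter> W)" using assms(2) W(1) by blast
  have "res X U (V \<inter> W) s \<otimes>\<^bsub>sec X (V \<inter> W)\<^esub> res X W (V \<inter> W) t = res X W (V \<inter> W) \<one>\<^bsub>sec X W\<^esub>"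
    using hom_mult[OF res_hom[of W "V \<inter> W"] res_closed[OF assms(1) _ W(2) assms(4)] W(3)] W(1,2,4) VW assms(1,4)
    by (simp add: res_comp)
  then show "invertible_near x V (res X U V s)"
    unfolding invertible_near_def using VW W(1,3) assms
    by (intro exI[of _ "V \<inter> W"] exI[of _ "res X W (V \<inter> W) t"]) (simp add: res_comp res_closed res_one)
qed

lemma stalk_mult_eq_one_iff:
  assumes U: "neighbourhood x U" "s \<in> carrier (sec X U)" and V: "neighbourhood x V" "t \<in> carrier (sec X V)"
  shows "germ X x U s \<otimes>\<^bsub>stalk X x\<^esub> germ X x V t = \<one>\<^bsub>stalk X x\<^esub> \<longleftrightarrow>
    (\<exists>W. neighbourhood x W \<and> W \<subseteq> U \<inter> V \<and> res X U W s \<otimes>\<^bsub>sec X W\<^esub> res X V W t = \<one>\<^bsub>sec X W\<^esub>)"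
proof -
  define T where "T = topspace (pts X)"
  interpret T: comm_monoid "sec X T" unfolding T_def by (rule sec_monoid) simp
  have T: "neighbourhood x T"
    unfolding T_def using U(1) openin_subset by blast
  have one_T: "res X T W \<one>\<^bsub>sec X T\<^esub> = \<one>\<^bsub>sec X W\<^esub>" and sub_T: "W \<subseteq> T" if "openin (pts X) W" for W
    using that T openin_subset[OF that] by (auto intro!: res_one simp: T_def)
  have "\<one>\<^bsub>stalk X x\<^esub> = germ X x T \<one>\<^bsub>sec X T\<^esub>"
    by (simp add: stalk_def T_def)
  then have "germ X x U s \<otimes>\<^bsub>stalk X x\<^esub> germ X x V t = \<one>\<^bsub>stalk X x\<^esub> \<longleftrightarrow>
      germ X x (U \<inter> V) (mult_sections U s V t) = germ X x T \<one>\<^bsub>sec X T\<^esub>"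
    using stalk_mult_germ[OF U V] by simp
  also have "\<dots> \<longleftrightarrow> (\<exists>W. neighbourhood x W \<and> W \<subseteq> U \<inter> V \<inter> T \<and>
      res X (U \<inter> V) W (mult_sections U s V t) = res X T W \<one>\<^bsub>sec X T\<^esub>)"
    using U V T mult_sections_closed[of U s V t] by (intro germ_eq_iff) auto
  also have "\<dots> \<longleftrightarrow> (\<exists>W. neighbourhood x W \<and> W \<subseteq> U \<inter> V \<and>
      res X U W s \<otimes>\<^bsub>sec X W\<^esub> res X V W t = \<one>\<^bsub>sec X W\<^esub>)"
    using U V one_T sub_T res_mult_sections[of U s V t] by (intro ex_cong1) (simp add: le_inf_iff cong: conj_cong)
  finally show ?thesis .
qed

lemma germ_unit_iff:
  assumes U: "neighbourhood x U" "s \<in> carrier (sec X U)"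
  shows "germ X x U s \<in> Units (stalk X x) \<longleftrightarrow> invertible_near x U s"
proof
  assume "germ X x U s \<in> Units (stalk X x)"
  then obtain V t where V: "neighbourhood x V" "t \<in> carrier (sec X V)"
      "germ X x U s \<otimes>\<^bsub>stalk X x\<^esub> germ X x V t = \<one>\<^bsub>stalk X x\<^esub>"
    unfolding Units_def stalk_def by auto
  then obtain W where "neighbourhood x W" "W \<subseteq> U \<inter> V" "res X U W s \<otimes>\<^bsub>sec X W\<^esub> res X V W t = \<one>\<^bsub>sec X W\<^esub>"
    using stalk_mult_eq_one_iff[OF U V(1,2)] by blast
  then show "invertible_near x U s"
    unfolding invertible_near_def using res_closed[of V W t] V(1,2) by blast
next
  assume "invertible_near x U s"
  then obtain W t where W: "neighbourhood x W" "W \<subseteq> U" "t \<in> carrier (sec X W)"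
      "res X U W s \<otimes>\<^bsub>sec X W\<^esub> t = \<one>\<^bsub>sec X W\<^esub>"
    unfolding invertible_near_def by blast
  interpret W: comm_monoid "sec X W" using W(1) by (intro sec_monoid) blast
  have "t \<otimes>\<^bsub>sec X W\<^esub> res X U W s = \<one>\<^bsub>sec X W\<^esub>"
    using W U res_closed[of U W s] by (simp add: W.m_comm)
  then have "germ X x U s \<otimes>\<^bsub>stalk X x\<^esub> germ X x W t = \<one>\<^bsub>stalk X x\<^esub>"
      "germ X x W t \<otimes>\<^bsub>stalk X x\<^esub> germ X x U s = \<one>\<^bsub>stalk X x\<^esub>"
    unfolding stalk_mult_eq_one_iff[OF U W(1,3)] stalk_mult_eq_one_iff[OF W(1,3) U]
    using W res_id[of W t] by (auto intro!: exI[of _ W])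
  moreover have "germ X x U s \<in> carrier (stalk X x)" "germ X x W t \<in> carrier (stalk X x)"
    unfolding stalk_def using U W by auto
  ultimately show "germ X x U s \<in> Units (stalk X x)"
    unfolding Units_def by blast
qed

end

lemma sh_homD:
  assumes "(f, F) \<in> sh_hom hm X Y"
  shows "continuous_map (pts X) (pts Y) f" "f \<in> extensional (topspace (pts X))"
    "\<And>V. openin (pts Y) V \<Longrightarrow> F V \<in> hm (sec Y V) (sec X (preim X f V))"
    "\<And>V. openin (pts Y) V \<Longrightarrow> F V \<in> extensional (carrier (sec Y V))"
    "F \<in> extensional {V. openin (pts Y) V}"
    "\<And>V W s. openin (pts Y) V \<Longrightarrow> openin (pts Y) W \<Longrightarrow> W \<subseteq> V \<Longrightarrow> s \<in> carrier (sec Y V) \<Longrightarrow>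
      F W (res Y V W s) = res X (preim X f V) (preim X f W) (F V s)"
    "\<And>x V s. x \<in> topspace (pts X) \<Longrightarrow> openin (pts Y) V \<Longrightarrow> f x \<in> V \<Longrightarrow> s \<in> carrier (sec Y V) \<Longrightarrow>
      germ X x (preim X f V) (F V s) \<in> Units (stalk X x) \<Longrightarrow> germ Y (f x) V s \<in> Units (stalk Y (f x))"
proof -
  note * = assms[unfolded sh_hom_def mem_Collect_eq prod.case]
  show "continuous_map (pts X) (pts Y) f" "f \<in> extensional (topspace (pts X))"
      "F \<in> extensional {V. openin (pts Y) V}"
    using * by - (elim conjE, assumption)+
  have sections: "\<forall>V. openin (pts Y) V \<longrightarrow>
      F V \<in> hm (sec Y V) (sec X (preim X f V)) \<and> F V \<in> extensional (carrier (sec Y V))"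
    and natural: "\<forall>V W. openin (pts Y) V \<and> openin (pts Y) W \<and> W \<subseteq> V \<longrightarrow>
      (\<forall>s\<in>carrier (sec Y V). F W (res Y V W s) = res X (preim X f V) (preim X f W) (F V s))"
    and local: "\<forall>x\<in>topspace (pts X). \<forall>V. openin (pts Y) V \<and> f x \<in> V \<longrightarrow>
      (\<forall>s\<in>carrier (sec Y V). germ X x (preim X f V) (F V s) \<in> Units (stalk X x) \<longrightarrow>
        germ Y (f x) V s \<in> Units (stalk Y (f x)))"
    using * by - (elim conjE, assumption)+
  fix V assume V: "openin (pts Y) V"
  show "F V \<in> hm (sec Y V) (sec X (preim X f V))" "F V \<in> extensional (carrier (sec Y V))"
    using sections V by simp_all
  show "F W (res Y V W s) = res X (preim X f V) (preim X f W) (F V s)"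
    if "openin (pts Y) W" "W \<subseteq> V" "s \<in> carrier (sec Y V)" for W s
    using natural V that by simp
  show "germ Y (f x) V s \<in> Units (stalk Y (f x))"
    if "x \<in> topspace (pts X)" "f x \<in> V" "s \<in> carrier (sec Y V)"
      "germ X x (preim X f V) (F V s) \<in> Units (stalk X x)" for x s
    using local V that by simp
qed

lemma sheaf_sec_cring: "is_sheaf cring ring_hom X \<Longrightarrow> openin (pts X) U \<Longrightarrow> cring (sec X U)"
  by (simp add: is_sheaf_def)

lemma sheaf_res_hom:
  "is_sheaf cring ring_hom X \<Longrightarrow> openin (pts X) U \<Longrightarrow> openin (pts X) V \<Longrightarrow> V \<subseteq> U \<Longrightarrow>
    res X U V \<in> ring_hom (sec X U) (sec X V)"
  by (simp add: is_sheaf_def)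

lemma ring_sheaf_presheaf:
  assumes "is_sheaf cring ring_hom X"
  shows "presheaf_of_monoids X"
proof (rule presheaf_of_monoids.intro)
  fix U assume U: "openin (pts X) U"
  then show "comm_monoid (sec X U)"
    using sheaf_sec_cring[OF assms] cring.axioms(2) by blast
  show "res X U U s = s" if "s \<in> carrier (sec X U)" for s
    using assms U that by (simp add: is_sheaf_def)
  fix V assume V: "openin (pts X) V" "V \<subseteq> U"
  note hom = sheaf_res_hom[OF assms U V]
  show "res X U V \<in> hom (sec X U) (sec X V)"
    using hom by (simp add: ring_hom_def hom_def Pi_def)
  show "res X U V \<one>\<^bsub>sec X U\<^esub> = \<one>\<^bsub>sec X V\<^esub>"
    using hom by (rule ring_hom_one)
next
  fix U V W s
  assume "openin (pts X) U" "openin (pts X) V" "openin (pts X) W" "W \<subseteq> V" "V \<subseteq> U" "s \<in> carrier (sec X U)"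
  then show "res X V W (res X U V s) = res X U W s"
    using assms by (simp add: is_sheaf_def)
qed

lemma open_subspace_simps [simp]:
  "pts (open_subspace X U) = subtopology (pts X) U" "sec (open_subspace X U) = sec X"
  "res (open_subspace X U) = res X"
  by (simp_all add: open_subspace_def)

context presheaf_of_monoids
begin

lemma open_subspace_presheaf: "openin (pts X) U \<Longrightarrow> presheaf_of_monoids (open_subspace X U)"
  by (rule presheaf_of_monoids.intro) (auto simp: openin_open_subtopology sec_monoid res_hom res_one res_id res_comp)

lemma invertible_near_open_subspace:
  assumes U: "openin (pts X) U" and V: "V \<subseteq> U"
  shows "presheaf_of_monoids.invertible_near (open_subspace X U) x V s \<longleftrightarrow> invertible_near x V s"
  unfolding presheaf_of_monoids.invertible_near_def[OF open_subspace_presheaf[OF U]] invertible_near_def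
  using V by (auto simp: openin_open_subtopology[OF U])

end

lemma invertible_near_pullback:
  assumes X: "presheaf_of_monoids X" and Y: "presheaf_of_monoids Y" and g: "(f, F) \<in> sh_hom ring_hom X Y"
    and x: "x \<in> topspace (pts X)" and V: "openin (pts Y) V" "f x \<in> V" and s: "s \<in> carrier (sec Y V)"
  shows "presheaf_of_monoids.invertible_near X x (preim X f V) (F V s) \<longleftrightarrow>
    presheaf_of_monoids.invertible_near Y (f x) V s"
proof
  interpret X: presheaf_of_monoids X by fact
  interpret Y: presheaf_of_monoids Y by fact
  note F = sh_homD[OF g]
  have preim: "X.neighbourhood x (preim X f W)" if "Y.neighbourhood (f x) W" for W
    using F(1) that x by (auto simp: continuous_map_def preim_def)
  have Fs: "F V s \<in> carrier (sec X (preim X f V))"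
    using ring_hom_closed[OF F(3)[OF V(1)] s] .
  show "Y.invertible_near (f x) V s" if "X.invertible_near x (preim X f V) (F V s)"
    using that F(7)[OF x V s] Y.germ_unit_iff[OF conjI[OF V] s] X.germ_unit_iff[OF preim[OF conjI[OF V]] Fs] by simp
  assume "Y.invertible_near (f x) V s"
  then obtain W t where W: "Y.neighbourhood (f x) W" "W \<subseteq> V" "t \<in> carrier (sec Y W)"
      "res Y V W s \<otimes>\<^bsub>sec Y W\<^esub> t = \<one>\<^bsub>sec Y W\<^esub>"
    unfolding Y.invertible_near_def by blast
  note FW = F(3)[OF conjunct1[OF W(1)]]
  have "res X (preim X f V) (preim X f W) (F V s) \<otimes>\<^bsub>sec X (preim X f W)\<^esub> F W t = \<one>\<^bsub>sec X (preim X f W)\<^esub>"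
    using F(6)[OF V(1) _ W(2) s] ring_hom_mult[OF FW Y.res_closed[OF V(1) _ W(2) s] W(3)] ring_hom_one[OF FW] W(1,4)
    by simp
  moreover have "preim X f W \<subseteq> preim X f V"
    using W(2) by (auto simp: preim_def)
  ultimately show "X.invertible_near x (preim X f V) (F V s)"
    unfolding X.invertible_near_def using preim[OF W(1)] ring_hom_closed[OF FW W(3)] by blast
qed

section \<open>Sections over spectra\<close>

abbreviation local_ring :: "'a ring \<Rightarrow> 'a set \<Rightarrow> ('a \<times> 'a) set ring" where
  "local_ring R p \<equiv> localization R (carrier R - p)"

lemma Spec_simps:
  "carrier (sec (Spec R) U) = loc_sections R (pts (Spec R)) U"
  "\<sigma> \<otimes>\<^bsub>sec (Spec R) U\<^esub> \<tau> = (\<lambda>p\<in>U. \<sigma> p \<otimes>\<^bsub>local_ring R p\<^esub> \<tau> p)"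
  "\<one>\<^bsub>sec (Spec R) U\<^esub> = (\<lambda>p\<in>U. \<one>\<^bsub>local_ring R p\<^esub>)"
  "\<zero>\<^bsub>sec (Spec R) U\<^esub> = (\<lambda>p\<in>U. \<zero>\<^bsub>local_ring R p\<^esub>)"
  "\<sigma> \<oplus>\<^bsub>sec (Spec R) U\<^esub> \<tau> = (\<lambda>p\<in>U. \<sigma> p \<oplus>\<^bsub>local_ring R p\<^esub> \<tau> p)"
  "res (Spec R) U V = (\<lambda>\<sigma>. restrict \<sigma> V)"
  by (simp_all add: Spec_def Let_def localization_simps)

lemma loc_sectionsE:
  assumes "\<sigma> \<in> loc_sections R T U" "p \<in> U"
  obtains W a s where "openin T W" "p \<in> W" "W \<subseteq> U" "a \<in> carrier R" "s \<in> carrier R"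
    "\<And>q. q \<in> W \<Longrightarrow> s \<notin> q" "\<And>q. q \<in> W \<Longrightarrow> \<sigma> q = loc_frac R (carrier R - q) a s"
proof -
  have "\<exists>W a s. openin T W \<and> p \<in> W \<and> W \<subseteq> U \<and> a \<in> carrier R \<and> s \<in> carrier R \<and>
      (\<forall>q\<in>W. s \<notin> q \<and> \<sigma> q = loc_frac R (carrier R - q) a s)"
    using assms unfolding loc_sections_def by simp
  then show ?thesis using that by metis
qed

lemma loc_sectionsI:
  assumes "\<sigma> \<in> extensional U"
    and "\<And>p. p \<in> U \<Longrightarrow> \<exists>W a s. openin T W \<and> p \<in> W \<and> W \<subseteq> U \<and> a \<in> carrier R \<and> s \<in> carrier R \<and>
      (\<forall>q\<in>W. s \<notin> q \<and> \<sigma> q = loc_frac R (carrier R - q) a s)"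
  shows "\<sigma> \<in> loc_sections R T U"
  using assms unfolding loc_sections_def by simp

lemma loc_sections_restrict:
  assumes "openin T V" "V \<subseteq> U" "\<sigma> \<in> loc_sections R T U"
  shows "restrict \<sigma> V \<in> loc_sections R T V"
proof (rule loc_sectionsI)
  fix p assume p: "p \<in> V"
  obtain W a s where W: "openin T W" "p \<in> W" "W \<subseteq> U" "a \<in> carrier R" "s \<in> carrier R"
      "\<And>q. q \<in> W \<Longrightarrow> s \<notin> q" "\<And>q. q \<in> W \<Longrightarrow> \<sigma> q = loc_frac R (carrier R - q) a s"
    by (rule loc_sectionsE[OF assms(3) subsetD[OF assms(2) p]]) (rule that)
  show "\<exists>W a s. openin T W \<and> p \<in> W \<and> W \<subseteq> V \<and> a \<in> carrier R \<and> s \<in> carrier R \<and>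
      (\<forall>q\<in>W. s \<notin> q \<and> restrict \<sigma> V q = loc_frac R (carrier R - q) a s)"
    using W assms(1) p by (intro exI[of _ "W \<inter> V"] exI[of _ a] exI[of _ s]) auto
qed simp

definition const_section :: "'a ring \<Rightarrow> 'a set set \<Rightarrow> 'a \<Rightarrow> 'a set \<Rightarrow> ('a \<times> 'a) set" where
  "const_section R V r = (\<lambda>q\<in>V. loc_frac R (carrier R - q) r \<one>\<^bsub>R\<^esub>)"

locale spectrum = cring R for R :: "'a ring" (structure)
begin

lemma prime_multiplicative_subset:
  "openin (pts (Spec R)) U \<Longrightarrow> p \<in> U \<Longrightarrow> multiplicative_subset R (carrier R - p)"
  using openin_SpecD[OF is_cring] primeideal_complement_multiplicative by blast

lemma local_ring_cring: "openin (pts (Spec R)) U \<Longrightarrow> p \<in> U \<Longrightarrow> cring (local_ring R p)"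
  using prime_multiplicative_subset by (rule multiplicative_subset.localization_cring)

lemma section_fraction:
  assumes "\<sigma> \<in> carrier (sec (Spec R) U)" "p \<in> U"
  obtains a s where "a \<in> carrier R" "s \<in> carrier R - p" "\<sigma> p = loc_frac R (carrier R - p) a s"
proof -
  obtain W a s where W: "openin (pts (Spec R)) W" "p \<in> W" "W \<subseteq> U" "a \<in> carrier R" "s \<in> carrier R"
      "\<And>q. q \<in> W \<Longrightarrow> s \<notin> q" "\<And>q. q \<in> W \<Longrightarrow> \<sigma> q = loc_frac R (carrier R - q) a s"
    by (rule loc_sectionsE[OF assms(1)[unfolded Spec_simps(1)] assms(2)]) (rule that)
  show ?thesis
    by (rule that[of a s]) (use W in auto)
qed

lemma section_value: "\<sigma> \<in> carrier (sec (Spec R) U) \<Longrightarrow> p \<in> U \<Longrightarrow> \<sigma> p \<in> carrier (local_ring R p)"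
  by (elim section_fraction) (auto simp: localization_simps)

lemma section_eqI:
  "\<sigma> \<in> carrier (sec (Spec R) U) \<Longrightarrow> \<tau> \<in> carrier (sec (Spec R) U) \<Longrightarrow>
    (\<And>p. p \<in> U \<Longrightarrow> \<sigma> p = \<tau> p) \<Longrightarrow> \<sigma> = \<tau>"
  unfolding Spec_simps(1) loc_sections_def by (elim CollectE conjE) (rule extensionalityI)

lemma pointwise_section:
  assumes \<sigma>: "\<sigma> \<in> carrier (sec (Spec R) U)" and \<tau>: "\<tau> \<in> carrier (sec (Spec R) U)"
    and U: "openin (pts (Spec R)) U"
    and num: "\<And>a s b t. a \<in> carrier R \<Longrightarrow> s \<in> carrier R \<Longrightarrow> b \<in> carrier R \<Longrightarrow> t \<in> carrier R \<Longrightarrow> num a s b t \<in> carrier R"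
    and opr: "\<And>p a s b t. p \<in> U \<Longrightarrow> a \<in> carrier R \<Longrightarrow> s \<in> carrier R - p \<Longrightarrow> b \<in> carrier R \<Longrightarrow> t \<in> carrier R - p \<Longrightarrow>
      opr p (loc_frac R (carrier R - p) a s) (loc_frac R (carrier R - p) b t)
        = loc_frac R (carrier R - p) (num a s b t) (s \<otimes> t)"
  shows "(\<lambda>p\<in>U. opr p (\<sigma> p) (\<tau> p)) \<in> carrier (sec (Spec R) U)"
  unfolding Spec_simps(1)
proof (rule loc_sectionsI)
  fix p assume p: "p \<in> U"
  obtain V a s where V: "openin (pts (Spec R)) V" "p \<in> V" "V \<subseteq> U" "a \<in> carrier R" "s \<in> carrier R"
      "\<And>q. q \<in> V \<Longrightarrow> s \<notin> q" "\<And>q. q \<in> V \<Longrightarrow> \<sigma> q = loc_frac R (carrier R - q) a s"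
    by (rule loc_sectionsE[OF \<sigma>[unfolded Spec_simps(1)] p]) (rule that)
  obtain W b t where W: "openin (pts (Spec R)) W" "p \<in> W" "W \<subseteq> U" "b \<in> carrier R" "t \<in> carrier R"
      "\<And>q. q \<in> W \<Longrightarrow> t \<notin> q" "\<And>q. q \<in> W \<Longrightarrow> \<tau> q = loc_frac R (carrier R - q) b t"
    by (rule loc_sectionsE[OF \<tau>[unfolded Spec_simps(1)] p]) (rule that)
  have "s \<otimes> t \<notin> q" if "q \<in> V \<inter> W" for q
    using multiplicative_subset.S_mult[OF prime_multiplicative_subset[OF U], of q s t] that V(3,5,6) W(5,6) by blast
  then show "\<exists>W a s. openin (pts (Spec R)) W \<and> p \<in> W \<and> W \<subseteq> U \<and> a \<in> carrier R \<and> s \<in> carrier R \<and>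
      (\<forall>q\<in>W. s \<notin> q \<and> (\<lambda>p\<in>U. opr p (\<sigma> p) (\<tau> p)) q = loc_frac R (carrier R - q) a s)"
    using V W opr num
    by (intro exI[of _ "V \<inter> W"] exI[of _ "num a s b t"] exI[of _ "s \<otimes> t"] conjI ballI) (auto simp: subset_iff)
qed simp

lemma section_mult_closed:
  assumes "openin (pts (Spec R)) U" "\<sigma> \<in> carrier (sec (Spec R) U)" "\<tau> \<in> carrier (sec (Spec R) U)"
  shows "\<sigma> \<otimes>\<^bsub>sec (Spec R) U\<^esub> \<tau> \<in> carrier (sec (Spec R) U)"
  unfolding Spec_simps(2) localization_simps
  by (rule pointwise_section[OF assms(2,3,1), where num = "\<lambda>a s b t. a \<otimes> b"])
    (simp_all add: multiplicative_subset.loc_mult_frac[OF prime_multiplicative_subset[OF assms(1)]])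

lemma section_add_closed:
  assumes "openin (pts (Spec R)) U" "\<sigma> \<in> carrier (sec (Spec R) U)" "\<tau> \<in> carrier (sec (Spec R) U)"
  shows "\<sigma> \<oplus>\<^bsub>sec (Spec R) U\<^esub> \<tau> \<in> carrier (sec (Spec R) U)"
  unfolding Spec_simps(5) localization_simps
  by (rule pointwise_section[OF assms(2,3,1), where num = "\<lambda>a s b t. a \<otimes> t \<oplus> b \<otimes> s"])
    (simp_all add: multiplicative_subset.loc_add_frac[OF prime_multiplicative_subset[OF assms(1)]])

lemma fraction_section:
  assumes "openin (pts (Spec R)) V" "a \<in> carrier R" "s \<in> carrier R" "\<And>q. q \<in> V \<Longrightarrow> s \<notin> q"
  shows "(\<lambda>q\<in>V. loc_frac R (carrier R - q) a s) \<in> carrier (sec (Spec R) V)"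
  unfolding Spec_simps(1) by (rule loc_sectionsI) (use assms in auto)

lemma const_section_hom:
  assumes V: "openin (pts (Spec R)) V"
  shows "const_section R V \<in> ring_hom R (sec (Spec R) V)"
proof (rule ring_hom_memI)
  note loc = prime_multiplicative_subset[OF V]
  fix a b assume a: "a \<in> carrier R" and b: "b \<in> carrier R"
  show "const_section R V a \<in> carrier (sec (Spec R) V)"
    unfolding const_section_def using fraction_section[OF V a one_closed] multiplicative_subset.one_in_S[OF loc] by blast
  show "const_section R V (a \<otimes> b) = const_section R V a \<otimes>\<^bsub>sec (Spec R) V\<^esub> const_section R V b"
    "const_section R V (a \<oplus> b) = const_section R V a \<oplus>\<^bsub>sec (Spec R) V\<^esub> const_section R V b"
    unfolding Spec_simps const_section_def
    using ring_hom_mult[OF multiplicative_subset.localization_map_hom[OF loc] a b]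
      ring_hom_add[OF multiplicative_subset.localization_map_hom[OF loc] a b] by (auto intro!: restrict_ext)
next
  show "const_section R V \<one> = \<one>\<^bsub>sec (Spec R) V\<^esub>"
    by (simp add: Spec_simps const_section_def localization_simps)
qed

lemma const_section_restrict: "W \<subseteq> V \<Longrightarrow> restrict (const_section R V r) W = const_section R W r"
  by (simp add: const_section_def Int_absorb1)

lemma sections_comm_monoid:
  assumes U: "openin (pts (Spec R)) U"
  shows "comm_monoid (sec (Spec R) U)"
proof -
  note loc = multiplicative_subset.localization_comm_monoid[OF prime_multiplicative_subset[OF U]]
  have one: "\<one>\<^bsub>sec (Spec R) U\<^esub> \<in> carrier (sec (Spec R) U)"
    using ring_hom_closed[OF const_section_hom[OF U] one_closed] ring_hom_one[OF const_section_hom[OF U]] by simp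
  show ?thesis
  proof (rule comm_monoidI[OF section_mult_closed[OF U] one])
    fix \<sigma> \<tau> \<upsilon>
    assume m: "\<sigma> \<in> carrier (sec (Spec R) U)" "\<tau> \<in> carrier (sec (Spec R) U)" "\<upsilon> \<in> carrier (sec (Spec R) U)"
    show "\<sigma> \<otimes>\<^bsub>sec (Spec R) U\<^esub> \<tau> \<otimes>\<^bsub>sec (Spec R) U\<^esub> \<upsilon> = \<sigma> \<otimes>\<^bsub>sec (Spec R) U\<^esub> (\<tau> \<otimes>\<^bsub>sec (Spec R) U\<^esub> \<upsilon>)"
      unfolding Spec_simps(2) using m section_value
      by (intro restrict_ext) (simp add: monoid.m_assoc[OF comm_monoid.axioms(1)[OF loc]])
  next
    fix \<sigma> assume m: "\<sigma> \<in> carrier (sec (Spec R) U)"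
    have "\<one>\<^bsub>sec (Spec R) U\<^esub> \<otimes>\<^bsub>sec (Spec R) U\<^esub> \<sigma> \<in> carrier (sec (Spec R) U)"
      by (rule section_mult_closed[OF U one m])
    then show "\<one>\<^bsub>sec (Spec R) U\<^esub> \<otimes>\<^bsub>sec (Spec R) U\<^esub> \<sigma> = \<sigma>"
      by (rule section_eqI[OF _ m]) (simp add: Spec_simps(2,3) section_value[OF m] monoid.l_one[OF comm_monoid.axioms(1)[OF loc]])
  next
    fix \<sigma> \<tau> assume m: "\<sigma> \<in> carrier (sec (Spec R) U)" "\<tau> \<in> carrier (sec (Spec R) U)"
    show "\<sigma> \<otimes>\<^bsub>sec (Spec R) U\<^esub> \<tau> = \<tau> \<otimes>\<^bsub>sec (Spec R) U\<^esub> \<sigma>"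
      unfolding Spec_simps(2) using m section_value by (intro restrict_ext) (simp add: comm_monoid.m_comm[OF loc])
  qed
qed

sublocale presheaf_of_monoids "Spec R"
proof (rule presheaf_of_monoids.intro)
  fix U assume U: "openin (pts (Spec R)) U"
  then show "comm_monoid (sec (Spec R) U)" by (rule sections_comm_monoid)
  show "res (Spec R) U U \<sigma> = \<sigma>" if "\<sigma> \<in> carrier (sec (Spec R) U)" for \<sigma>
    using that by (simp add: Spec_simps loc_sections_def extensional_restrict)
  fix V assume V: "openin (pts (Spec R)) V" "V \<subseteq> U"
  show "res (Spec R) U V \<in> hom (sec (Spec R) U) (sec (Spec R) V)"
    using V by (auto simp: hom_def Spec_simps loc_sections_restrict Int_absorb1 intro!: restrict_ext)
  show "res (Spec R) U V \<one>\<^bsub>sec (Spec R) U\<^esub> = \<one>\<^bsub>sec (Spec R) V\<^esub>"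
    using V by (simp add: Spec_simps Int_absorb1)
next
  fix U V W :: "'a set set" and \<sigma> :: "'a set \<Rightarrow> ('a \<times> 'a) set"
  assume "W \<subseteq> V"
  then show "res (Spec R) V W (res (Spec R) U V \<sigma>) = res (Spec R) U W \<sigma>"
    by (simp add: Spec_simps Int_absorb1)
qed

lemma invertible_near_Spec_iff:
  assumes U: "openin (pts (Spec R)) U" and p: "p \<in> U" and \<sigma>: "\<sigma> \<in> carrier (sec (Spec R) U)"
  shows "invertible_near p U \<sigma> \<longleftrightarrow> \<sigma> p \<in> Units (local_ring R p)"
proof
  assume "invertible_near p U \<sigma>"
  then obtain W \<tau> where W: "neighbourhood p W" "W \<subseteq> U" "\<tau> \<in> carrier (sec (Spec R) W)"
      "res (Spec R) U W \<sigma> \<otimes>\<^bsub>sec (Spec R) W\<^esub> \<tau> = \<one>\<^bsub>sec (Spec R) W\<^esub>"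
    unfolding invertible_near_def by blast
  interpret L: cring "local_ring R p" using local_ring_cring[OF U p] .
  have "\<sigma> p \<otimes>\<^bsub>local_ring R p\<^esub> \<tau> p = \<one>\<^bsub>local_ring R p\<^esub>"
    using fun_cong[OF W(4), of p] W(1) by (simp add: Spec_simps)
  then show "\<sigma> p \<in> Units (local_ring R p)"
    using section_value[OF \<sigma> p] section_value[OF W(3)] W(1) L.unit_factor[of "\<sigma> p" "\<tau> p"] L.Units_one_closed by simp
next
  assume unit: "\<sigma> p \<in> Units (local_ring R p)"
  obtain W a s where W: "openin (pts (Spec R)) W" "p \<in> W" "W \<subseteq> U" "a \<in> carrier R" "s \<in> carrier R"
      "\<And>q. q \<in> W \<Longrightarrow> s \<notin> q" "\<And>q. q \<in> W \<Longrightarrow> \<sigma> q = loc_frac R (carrier R - q) a s"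
    by (rule loc_sectionsE[OF \<sigma>[unfolded Spec_simps(1)] p]) (rule that)
  define V where "V = W \<inter> {q. primeideal q R \<and> a \<notin> q}"
  have "a \<notin> p"
    using unit W(2,4-7) prime_frac_unit_iff[OF openin_SpecD[OF is_cring U p]] by simp
  then have V: "neighbourhood p V"
    using W(1,2) openin_Spec_basic[OF is_cring W(4)] openin_SpecD[OF is_cring U p] by (auto simp: V_def)
  define \<tau> where "\<tau> = (\<lambda>q\<in>V. loc_frac R (carrier R - q) s a)"
  have "\<tau> \<in> carrier (sec (Spec R) V)"
    unfolding \<tau>_def using V W(4,5) by (intro fraction_section) (auto simp: V_def)
  moreover have "\<sigma> q \<otimes>\<^bsub>local_ring R q\<^esub> \<tau> q = \<one>\<^bsub>local_ring R q\<^esub>" if q: "q \<in> V" for q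
  proof -
    interpret multiplicative_subset R "carrier R - q"
      using prime_multiplicative_subset[OF conjunct1[OF V] q] .
    have m: "q \<in> W" "a \<in> carrier R - q" "s \<in> carrier R - q" using q W(4-6) by (auto simp: V_def)
    then have "\<sigma> q \<otimes>\<^bsub>local_ring R q\<^esub> \<tau> q = frac (a \<otimes> s) (s \<otimes> a)"
      using q W(7)[OF m(1)] by (simp add: \<tau>_def localization_simps(4) loc_mult_frac)
    also have "\<dots> = \<one>\<^bsub>local_ring R q\<^esub>"
      unfolding localization_simps(2) by (rule frac_eqI) (use m S_mult one_in_S in \<open>simp_all add: m_comm\<close>)
    finally show ?thesis .
  qed
  ultimately show "invertible_near p U \<sigma>"
    unfolding invertible_near_def using V W(3)
    by (intro exI[of _ V] exI[of _ \<tau>]) (auto simp: Spec_simps V_def intro!: restrict_ext)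
qed

end

lemma (in spectrum) sections_agree_near:
  assumes U: "openin (pts (Spec R)) U" and \<sigma>: "\<sigma> \<in> carrier (sec (Spec R) U)" and \<tau>: "\<tau> \<in> carrier (sec (Spec R) U)"
    and p: "p \<in> U" and eq: "\<sigma> p = \<tau> p"
  shows "\<exists>W. neighbourhood p W \<and> W \<subseteq> U \<and> restrict \<sigma> W = restrict \<tau> W"
proof -
  obtain V a s where V: "openin (pts (Spec R)) V" "p \<in> V" "V \<subseteq> U" "a \<in> carrier R" "s \<in> carrier R"
      "\<And>q. q \<in> V \<Longrightarrow> s \<notin> q" "\<And>q. q \<in> V \<Longrightarrow> \<sigma> q = loc_frac R (carrier R - q) a s"
    by (rule loc_sectionsE[OF \<sigma>[unfolded Spec_simps(1)] p]) (rule that)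
  obtain W b t where W: "openin (pts (Spec R)) W" "p \<in> W" "W \<subseteq> U" "b \<in> carrier R" "t \<in> carrier R"
      "\<And>q. q \<in> W \<Longrightarrow> t \<notin> q" "\<And>q. q \<in> W \<Longrightarrow> \<tau> q = loc_frac R (carrier R - q) b t"
    by (rule loc_sectionsE[OF \<tau>[unfolded Spec_simps(1)] p]) (rule that)
  note frac_eq_iff = multiplicative_subset.frac_eq_iff[OF prime_multiplicative_subset[OF U]]
  obtain u where u: "u \<in> carrier R - p" "u \<otimes> (a \<otimes> t) = u \<otimes> (b \<otimes> s)"
    using eq V(2,4-7) W(2,4-7) frac_eq_iff[OF p, of a s b t] by auto
  define D where "D = V \<inter> W \<inter> {q. primeideal q R \<and> u \<notin> q}"
  have D: "neighbourhood p D" "D \<subseteq> U"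
    using u(1) V(1-3) W(1,2) openin_Spec_basic[OF is_cring, of u] openin_SpecD[OF is_cring U p] by (auto simp: D_def)
  have "\<sigma> q = \<tau> q" if q: "q \<in> D" for q
    using q u V(3-7) W(4-7) frac_eq_iff[of q a s b t] by (auto simp: D_def)
  then have "restrict \<sigma> D = restrict \<tau> D"
    by (rule restrict_ext)
  with D show ?thesis by blast
qed

section \<open>Affine charts\<close>

locale affine_chart =
  fixes X :: "('x, 's) ringed_space" and U :: "'x set" and R :: "'r ring"
    and f :: "'x \<Rightarrow> 'r set" and F :: "'r set set \<Rightarrow> ('r set \<Rightarrow> ('r \<times> 'r) set) \<Rightarrow> 's"
  assumes sheaf: "is_sheaf cring ring_hom X" and open_U: "openin (pts X) U" and cring_R: "cring R"
    and hom: "(f, F) \<in> sh_hom ring_hom (open_subspace X U) (Spec R)"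
    and homeo: "homeomorphic_map (subtopology (pts X) U) (pts (Spec R)) f"
    and bij: "openin (pts (Spec R)) V \<Longrightarrow>
      bij_betw (F V) (carrier (sec (Spec R) V)) (carrier (sec X (preim (open_subspace X U) f V)))"

lemma affine_open_chart:
  assumes "is_sheaf cring ring_hom X" "affine_open X U R"
  obtains f F where "affine_chart X U R f F"
proof -
  obtain f F where "(f, F) \<in> sh_hom ring_hom (open_subspace X U) (Spec R)"
      "homeomorphic_map (pts (open_subspace X U)) (pts (Spec R)) f"
      "\<forall>V. openin (pts (Spec R)) V \<longrightarrow>
        bij_betw (F V) (carrier (sec (Spec R) V)) (carrier (sec (open_subspace X U) (preim (open_subspace X U) f V)))"
    using assms(2) unfolding affine_open_def sh_isomorphic_def by auto
  then have "affine_chart X U R f F"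
    using assms unfolding affine_chart_def affine_open_def by simp
  then show ?thesis by (rule that)
qed

context affine_chart
begin

sublocale R: spectrum R
  unfolding spectrum_def by (rule cring_R)

sublocale X: presheaf_of_monoids X
  by (rule ring_sheaf_presheaf[OF sheaf])

lemma topspace_U: "topspace (subtopology (pts X) U) = U"
  using openin_subset[OF open_U] by auto

lemma preim_eq: "preim (open_subspace X U) f V = {x \<in> U. f x \<in> V}"
  by (simp add: preim_def topspace_U del: topspace_subtopology)

lemma inj_f: "inj_on f U" and image_f: "f ` U = {p. primeideal p R}"
  using homeo topspace_U topspace_Spec[OF cring_R] unfolding homeomorphic_eq_everything_map by auto

lemma prime_f: "x \<in> U \<Longrightarrow> primeideal (f x) R"
  using image_f by auto

lemma f_subset_carrier: "x \<in> U \<Longrightarrow> f x \<subseteq> carrier R"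
  using prime_f additive_subgroup.a_subset ideal.axioms(1) primeideal.axioms(1) by blast

lemma open_image: "openin (pts X) V \<Longrightarrow> V \<subseteq> U \<Longrightarrow> openin (pts (Spec R)) (f ` V)"
  using homeo open_U unfolding homeomorphic_eq_everything_map open_map_def by (simp add: openin_open_subtopology)

lemma preim_image: "V \<subseteq> U \<Longrightarrow> preim (open_subspace X U) f (f ` V) = V"
  unfolding preim_eq using inj_f by (auto simp: inj_on_eq_iff subset_iff)

lemma preim_open: "openin (pts (Spec R)) V \<Longrightarrow> openin (pts X) (preim (open_subspace X U) f V)"
  using homeomorphic_imp_continuous_map[OF homeo] open_U
  unfolding continuous_map_def topspace_U preim_eq by (simp add: openin_open_subtopology)

lemma sections_iso:
  assumes "openin (pts X) V" "V \<subseteq> U"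
  shows "F (f ` V) \<in> ring_hom (sec (Spec R) (f ` V)) (sec X V)"
    and "bij_betw (F (f ` V)) (carrier (sec (Spec R) (f ` V))) (carrier (sec X V))"
  using sh_homD(3)[OF hom open_image[OF assms]] bij[OF open_image[OF assms]] preim_image[OF assms(2)] by simp_all

definition local_section :: "'x set \<Rightarrow> 's \<Rightarrow> 'r set \<Rightarrow> ('r \<times> 'r) set" where
  "local_section V s = inv_into (carrier (sec (Spec R) (f ` (U \<inter> V)))) (F (f ` (U \<inter> V))) (res X V (U \<inter> V) s)"

lemma open_Int_U: "openin (pts X) V \<Longrightarrow> openin (pts X) (U \<inter> V)"
  using open_U by (rule openin_Int)

lemma res_Int_U: "openin (pts X) V \<Longrightarrow> s \<in> carrier (sec X V) \<Longrightarrow> res X V (U \<inter> V) s \<in> carrier (sec X (U \<inter> V))"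
  using open_Int_U by (simp add: X.res_closed)

lemma local_section:
  assumes V: "openin (pts X) V" and s: "s \<in> carrier (sec X V)"
  shows "local_section V s \<in> carrier (sec (Spec R) (f ` (U \<inter> V)))"
    and "F (f ` (U \<inter> V)) (local_section V s) = res X V (U \<inter> V) s"
proof -
  have "res X V (U \<inter> V) s \<in> F (f ` (U \<inter> V)) ` carrier (sec (Spec R) (f ` (U \<inter> V)))"
    using bij_betw_imp_surj_on[OF sections_iso(2)[OF open_Int_U[OF V]]] res_Int_U[OF V s] by simp
  then show "local_section V s \<in> carrier (sec (Spec R) (f ` (U \<inter> V)))"
      "F (f ` (U \<inter> V)) (local_section V s) = res X V (U \<inter> V) s"
    unfolding local_section_def by (rule inv_into_into, rule f_inv_into_f)
qed

lemma local_section_eqI: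
  assumes V: "openin (pts X) V" and \<sigma>: "\<sigma> \<in> carrier (sec (Spec R) (f ` (U \<inter> V)))"
    and "F (f ` (U \<inter> V)) \<sigma> = res X V (U \<inter> V) s"
  shows "local_section V s = \<sigma>"
  using bij_betw_imp_inj_on[OF sections_iso(2)[OF open_Int_U[OF V]]] \<sigma> assms(3)
  unfolding local_section_def by (simp flip: assms(3))

definition germ_value :: "'x \<Rightarrow> 'x set \<Rightarrow> 's \<Rightarrow> ('r \<times> 'r) set" where
  "germ_value x V s = local_section V s (f x)"

lemma germ_value_hom:
  assumes V: "openin (pts X) V" and x: "x \<in> U \<inter> V"
  shows "germ_value x V \<in> ring_hom (sec X V) (local_ring R (f x))"
proof (rule ring_hom_memI)
  define W where "W = U \<inter> V"
  have W: "openin (pts X) W" "W \<subseteq> U" "W \<subseteq> V" "f x \<in> f ` W"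
    using open_Int_U[OF V] x by (auto simp: W_def)
  note FW = sections_iso(1)[OF W(1,2)] and rW = sheaf_res_hom[OF sheaf V W(1,3)]
    and closed = local_section(1)[OF V, folded W_def] and F_eq = local_section(2)[OF V, folded W_def]
    and eqI = local_section_eqI[OF V, folded W_def] and open_fW = open_image[OF W(1,2)]
  fix s t assume s: "s \<in> carrier (sec X V)" and t: "t \<in> carrier (sec X V)"
  show "germ_value x V s \<in> carrier (local_ring R (f x))"
    unfolding germ_value_def by (rule R.section_value[OF closed[OF s] W(4)])
  have "local_section V (s \<otimes>\<^bsub>sec X V\<^esub> t) = local_section V s \<otimes>\<^bsub>sec (Spec R) (f ` W)\<^esub> local_section V t"
    using closed[OF s] closed[OF t]
    by (intro eqI R.section_mult_closed[OF open_fW]) (simp_all add: ring_hom_mult[OF FW] F_eq s t ring_hom_mult[OF rW])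
  then show "germ_value x V (s \<otimes>\<^bsub>sec X V\<^esub> t) = germ_value x V s \<otimes>\<^bsub>local_ring R (f x)\<^esub> germ_value x V t"
    unfolding germ_value_def Spec_simps(2) using W(4) by simp
  have "local_section V (s \<oplus>\<^bsub>sec X V\<^esub> t) = local_section V s \<oplus>\<^bsub>sec (Spec R) (f ` W)\<^esub> local_section V t"
    using closed[OF s] closed[OF t]
    by (intro eqI R.section_add_closed[OF open_fW]) (simp_all add: ring_hom_add[OF FW] F_eq s t ring_hom_add[OF rW])
  then show "germ_value x V (s \<oplus>\<^bsub>sec X V\<^esub> t) = germ_value x V s \<oplus>\<^bsub>local_ring R (f x)\<^esub> germ_value x V t"
    unfolding germ_value_def Spec_simps(5) using W(4) by simp
next
  define W where "W = U \<inter> V"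
  have W: "openin (pts X) W" "W \<subseteq> U" "W \<subseteq> V" "f x \<in> f ` W"
    using open_Int_U[OF V] x by (auto simp: W_def)
  interpret comm_monoid "sec (Spec R) (f ` W)"
    by (rule R.sections_comm_monoid[OF open_image[OF W(1,2)]])
  have "local_section V \<one>\<^bsub>sec X V\<^esub> = \<one>\<^bsub>sec (Spec R) (f ` W)\<^esub>"
    using ring_hom_one[OF sections_iso(1)[OF W(1,2)]] X.res_one[OF V W(1,3)]
    by (intro local_section_eqI[OF V, folded W_def]) simp_all
  then show "germ_value x V \<one>\<^bsub>sec X V\<^esub> = \<one>\<^bsub>local_ring R (f x)\<^esub>"
    unfolding germ_value_def Spec_simps(3) using W(4) by simp
qed

lemma germ_value_res:
  assumes V: "openin (pts X) V" and W: "openin (pts X) W" "W \<subseteq> V" "x \<in> U \<inter> W" and s: "s \<in> carrier (sec X V)"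
  shows "germ_value x W (res X V W s) = germ_value x V s"
proof -
  have sub: "f ` (U \<inter> W) \<subseteq> f ` (U \<inter> V)" using W(2) by blast
  note opens = open_image[OF open_Int_U[OF V]] open_image[OF open_Int_U[OF W(1)]]
  have "F (f ` (U \<inter> W)) (restrict (local_section V s) (f ` (U \<inter> W)))
      = res X (U \<inter> V) (U \<inter> W) (F (f ` (U \<inter> V)) (local_section V s))"
    using sh_homD(6)[OF hom opens(1,2) sub local_section(1)[OF V s]] preim_image[of "U \<inter> V"] preim_image[of "U \<inter> W"]
    by (simp add: Spec_simps(6))
  also have "\<dots> = res X W (U \<inter> W) (res X V W s)"
    using V W open_Int_U by (simp add: local_section(2)[OF V s] X.res_comp s le_infI2)
  finally have "local_section W (res X V W s) = restrict (local_section V s) (f ` (U \<inter> W))"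
    using R.res_closed[OF opens(1,2) sub local_section(1)[OF V s]]
    by (intro local_section_eqI[OF W(1)]) (simp_all add: Spec_simps(6))
  then show ?thesis
    using W(3) by (simp add: germ_value_def)
qed

lemma germ_value_unit_iff:
  assumes V: "openin (pts X) V" and x: "x \<in> U \<inter> V" and s: "s \<in> carrier (sec X V)"
  shows "germ_value x V s \<in> Units (local_ring R (f x)) \<longleftrightarrow> X.invertible_near x V s"
proof -
  have UV: "openin (pts X) (U \<inter> V)" "U \<inter> V \<subseteq> U" by (simp_all add: open_Int_U V)
  note \<sigma> = local_section[OF V s]
  have "germ_value x V s \<in> Units (local_ring R (f x)) \<longleftrightarrow>
      R.invertible_near (f x) (f ` (U \<inter> V)) (local_section V s)"
    unfolding germ_value_def using x by (subst R.invertible_near_Spec_iff[OF open_image[OF UV] _ \<sigma>(1)]) auto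
  also have "\<dots> \<longleftrightarrow> presheaf_of_monoids.invertible_near (open_subspace X U) x
      (preim (open_subspace X U) f (f ` (U \<inter> V))) (F (f ` (U \<inter> V)) (local_section V s))"
    using x topspace_U
    by (intro invertible_near_pullback[OF X.open_subspace_presheaf[OF open_U] R.presheaf_of_monoids_axioms hom,
        symmetric] open_image[OF UV] \<sigma>(1)) auto
  also have "\<dots> \<longleftrightarrow> X.invertible_near x (U \<inter> V) (res X V (U \<inter> V) s)"
    unfolding preim_image[OF UV(2)] \<sigma>(2) by (rule X.invertible_near_open_subspace[OF open_U UV(2)])
  also have "\<dots> \<longleftrightarrow> X.invertible_near x V s"
    using V UV(1) x s by (intro X.invertible_near_res) auto
  finally show ?thesis .
qed

lemma germ_value_eqD:
  assumes V: "openin (pts X) V" and x: "x \<in> U \<inter> V" and st: "s \<in> carrier (sec X V)" "t \<in> carrier (sec X V)"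
    and eq: "germ_value x V s = germ_value x V t"
  shows "\<exists>W. X.neighbourhood x W \<and> W \<subseteq> U \<inter> V \<and> res X V W s = res X V W t"
proof -
  have UV: "openin (pts X) (U \<inter> V)" "U \<inter> V \<subseteq> U" by (simp_all add: open_Int_U V)
  note opens = open_image[OF UV]
  obtain D where D: "openin (pts (Spec R)) D" "f x \<in> D" "D \<subseteq> f ` (U \<inter> V)"
      "restrict (local_section V s) D = restrict (local_section V t) D"
    using R.sections_agree_near[OF opens local_section(1)[OF V st(1)] local_section(1)[OF V st(2)]
        imageI[OF x] eq[unfolded germ_value_def]] by (elim exE conjE)
  define W where "W = preim (open_subspace X U) f D"
  have W: "X.neighbourhood x W" "W \<subseteq> U \<inter> V"
    using preim_open[OF D(1)] D(2,3) x inj_f unfolding W_def preim_eq by (auto simp: inj_on_eq_iff)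
  have "res X V W r = F D (restrict (local_section V r) D)" if "r \<in> carrier (sec X V)" for r
    using sh_homD(6)[OF hom opens D(1,3) local_section(1)[OF V that]] X.res_comp[OF V UV(1) _ W(2)] W(1) that
      preim_image[OF UV(2)] local_section(2)[OF V that] by (simp add: Spec_simps(6) W_def)
  then have "res X V W s = res X V W t"
    using st D(4) by simp
  with W show ?thesis by blast
qed

definition coordinate_section :: "'r \<Rightarrow> 's" where
  "coordinate_section r = F (f ` U) (const_section R (f ` U) r)"

lemma coordinate_section_hom: "coordinate_section \<in> ring_hom R (sec X U)"
  using ring_hom_trans[OF R.const_section_hom[OF open_image[OF open_U]] sections_iso(1)[OF open_U]]
  by (simp add: coordinate_section_def[abs_def] comp_def)

lemmas coordinate_section_closed = ring_hom_closed[OF coordinate_section_hom]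

lemma germ_value_coordinate:
  assumes x: "x \<in> U" and r: "r \<in> carrier R"
  shows "germ_value x U (coordinate_section r) = loc_frac R (carrier R - f x) r \<one>\<^bsub>R\<^esub>"
proof -
  have "local_section U (coordinate_section r) = const_section R (f ` U) r"
    using ring_hom_closed[OF R.const_section_hom[OF open_image[OF open_U]] r] X.res_id[OF open_U coordinate_section_closed[OF r]]
    by (intro local_section_eqI[OF open_U]) (simp_all add: coordinate_section_def)
  then show ?thesis
    using x by (simp add: germ_value_def const_section_def)
qed

lemma coordinate_section_invertible_iff:
  assumes x: "x \<in> U" and r: "r \<in> carrier R"
  shows "X.invertible_near x U (coordinate_section r) \<longleftrightarrow> r \<notin> f x"
proof -
  have "\<one>\<^bsub>R\<^esub> \<notin> f x"
    using multiplicative_subset.one_in_S[OF primeideal_complement_multiplicative[OF prime_f[OF x]]] by simp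
  then show ?thesis
    using germ_value_unit_iff[OF open_U _ coordinate_section_closed[OF r], of x] germ_value_coordinate[OF x r]
      prime_frac_unit_iff[OF prime_f[OF x] r] x by simp
qed

lemma section_is_fraction:
  assumes V: "openin (pts X) V" and x: "x \<in> U \<inter> V" and s: "s \<in> carrier (sec X V)"
  obtains a b W where "a \<in> carrier R" "b \<in> carrier R" "b \<notin> f x" "X.neighbourhood x W" "W \<subseteq> U \<inter> V"
    "res X V W s \<otimes>\<^bsub>sec X W\<^esub> res X U W (coordinate_section b) = res X U W (coordinate_section a)"
proof -
  interpret multiplicative_subset R "carrier R - f x"
    using x by (intro primeideal_complement_multiplicative prime_f) simp
  define D where "D = U \<inter> V"
  have D: "openin (pts X) D" "D \<subseteq> U" "D \<subseteq> V" "x \<in> U \<inter> D"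
    using open_Int_U[OF V] x by (auto simp: D_def)
  obtain a b where ab: "a \<in> carrier R" "b \<in> carrier R - f x" "germ_value x V s = frac a b"
    using ring_hom_closed[OF germ_value_hom[OF V x] s] by (rule localizationE)
  define s' a' b' where "s' = res X V D s" and "a' = res X U D (coordinate_section a)"
    and "b' = res X U D (coordinate_section b)"
  have closed: "s' \<in> carrier (sec X D)" "a' \<in> carrier (sec X D)" "b' \<in> carrier (sec X D)"
    using ab D V s open_U coordinate_section_closed by (simp_all add: s'_def a'_def b'_def X.res_closed)
  interpret D: cring "sec X D" by (rule sheaf_sec_cring[OF sheaf D(1)])
  have "germ_value x D a' = frac a \<one>\<^bsub>R\<^esub>" "germ_value x D b' = frac b \<one>\<^bsub>R\<^esub>" "germ_value x D s' = frac a b"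
    unfolding s'_def a'_def b'_def using ab D V s x open_U coordinate_section_closed
    by (simp_all add: germ_value_res germ_value_coordinate)
  then have "germ_value x D (s' \<otimes>\<^bsub>sec X D\<^esub> b') = germ_value x D a'"
    using frac_mult_denominator[OF ab(1,2)] ring_hom_mult[OF germ_value_hom[OF D(1,4)] closed(1,3)] by simp
  then obtain W where W: "X.neighbourhood x W" "W \<subseteq> U \<inter> D"
      "res X D W (s' \<otimes>\<^bsub>sec X D\<^esub> b') = res X D W a'"
    using germ_value_eqD[OF D(1,4) D.m_closed[OF closed(1,3)] closed(2)] by blast
  show thesis
  proof (rule that)
    show "res X V W s \<otimes>\<^bsub>sec X W\<^esub> res X U W (coordinate_section b) = res X U W (coordinate_section a)"
      using W D V s open_U ab coordinate_section_closed ring_hom_mult[OF sheaf_res_hom[OF sheaf D(1)] closed(1,3), of W]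
      by (simp add: s'_def a'_def b'_def X.res_comp)
  qed (use ab W D in auto)
qed

end

section \<open>Points over fields\<close>

locale field_spectrum = field K for K :: "'a ring" (structure)

sublocale field_spectrum \<subseteq> spectrum K
  by unfold_locales

context field_spectrum
begin

abbreviation "pt \<equiv> {\<zero>}"

lemma primes_of_field: "{p. primeideal p K} = {pt}"
proof -
  have "p = pt" if "primeideal p K" for p
    using primeideal.I_notcarr[OF that] primeideal.axioms(1)[OF that] all_ideals by blast
  then show ?thesis using zeroprimeideal by blast
qed

lemma topspace_field: "topspace (pts (Spec K)) = {pt}"
  by (simp add: topspace_Spec[OF is_cring] primes_of_field)

lemma open_pt: "openin (pts (Spec K)) {pt}"
  using openin_topspace[of "pts (Spec K)"] by (simp add: topspace_field)

lemma preim_field: "preim (Spec K) c V = (if c pt \<in> V then {pt} else {})"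
  by (auto simp: preim_def topspace_field)

lemma sections_field:
  "bij_betw (const_section K {pt}) (carrier K) (carrier (sec (Spec K) {pt}))"
proof (rule bij_betwI')
  interpret multiplicative_subset K "carrier K - pt"
    using prime_multiplicative_subset[OF open_pt] by blast
  note field_hom = fraction_field(2)[OF domain_axioms]
  show "const_section K {pt} a \<in> carrier (sec (Spec K) {pt})" if "a \<in> carrier K" for a
    using ring_hom_closed[OF const_section_hom[OF open_pt] that] .
  show "const_section K {pt} a = const_section K {pt} b \<longleftrightarrow> a = b" if ab: "a \<in> carrier K" "b \<in> carrier K" for a b
  proof
    assume eq: "const_section K {pt} a = const_section K {pt} b"
    have "frac a \<one> = frac b \<one>"
      using fun_cong[OF eq, of pt] by (simp add: const_section_def)
    then obtain u where u: "u \<in> carrier K - pt" "u \<otimes> (a \<otimes> \<one>) = u \<otimes> (b \<otimes> \<one>)"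
      using ab one_in_S frac_eq_iff[of a \<one> b \<one>] by auto
    then show "a = b" using ab m_lcancel[of u a b] by simp
  qed simp
  show "\<exists>a\<in>carrier K. \<sigma> = const_section K {pt} a" if \<sigma>: "\<sigma> \<in> carrier (sec (Spec K) {pt})" for \<sigma>
  proof -
    obtain a s where a: "a \<in> carrier K" "s \<in> carrier K - pt" "\<sigma> pt = frac a s"
      using section_fraction[OF \<sigma>, of pt] by blast
    have "s \<in> Units K" using a(2) by (simp add: field_Units)
    then have "frac a s = frac (a \<otimes> inv s) \<one>"
      using a(1,2) one_in_S by (intro frac_eqI) (auto simp: m_assoc)
    then have "\<sigma> = const_section K {pt} (a \<otimes> inv s)"
      using a \<open>s \<in> Units K\<close> ring_hom_closed[OF const_section_hom[OF open_pt], of "a \<otimes> inv s"]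
      by (intro section_eqI[OF \<sigma>]) (simp_all add: const_section_def)
    then show ?thesis using a(1) \<open>s \<in> Units K\<close> by blast
  qed
qed

lemmas const_section_eq_iff = inj_on_eq_iff[OF bij_betw_imp_inj_on[OF sections_field]]

lemma invertible_near_const_section:
  assumes "a \<in> carrier K"
  shows "invertible_near pt {pt} (const_section K {pt} a) \<longleftrightarrow> a \<noteq> \<zero>"
  using assms ring_hom_closed[OF const_section_hom[OF open_pt] assms] prime_frac_unit_iff[OF zeroprimeideal assms]
  by (subst invertible_near_Spec_iff[OF open_pt]) (simp_all add: const_section_def)

end

context affine_chart
begin

definition point_hom :: "'a ring \<Rightarrow> ('a set \<Rightarrow> 'x) \<times> ('x set \<Rightarrow> 's \<Rightarrow> 'a set \<Rightarrow> ('a \<times> 'a) set) \<Rightarrow> ('r \<Rightarrow> 'a) \<Rightarrow> bool" where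
  "point_hom K g \<psi> \<longleftrightarrow> g \<in> sh_hom ring_hom (Spec K) X \<and> fst g {\<zero>\<^bsub>K\<^esub>} \<in> U \<and> \<psi> \<in> ring_hom R K \<and>
     (\<forall>r\<in>carrier R. snd g U (coordinate_section r) = const_section K {{\<zero>\<^bsub>K\<^esub>}} (\<psi> r))"

context
  fixes K :: "'a ring"
  assumes field_K: "field K"
begin

interpretation K: field_spectrum K
  unfolding field_spectrum_def by (rule field_K)

lemma point_hom_exists:
  assumes g: "g \<in> sh_hom ring_hom (Spec K) X" and U: "fst g K.pt \<in> U"
  obtains \<psi> where "point_hom K g \<psi>"
proof -
  have "(fst g, snd g) \<in> sh_hom ring_hom (Spec K) X"
    using g by simp
  then have gU: "snd g U \<in> ring_hom (sec X U) (sec (Spec K) {K.pt})"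
    using sh_homD(3)[OF _ open_U] U by (fastforce simp: K.preim_field)
  define \<psi> where "\<psi> = inv_into (carrier K) (const_section K {K.pt}) \<circ> (snd g U \<circ> coordinate_section)"
  have iso: "const_section K {K.pt} \<in> ring_iso K (sec (Spec K) {K.pt})"
    unfolding ring_iso_def using K.sections_field K.const_section_hom[OF K.open_pt] by simp
  have "\<psi> \<in> ring_hom R K"
    unfolding \<psi>_def using ring_iso_set_sym[OF K.ring_axioms iso]
    by (intro ring_hom_trans[OF ring_hom_trans[OF coordinate_section_hom gU]]) (simp add: ring_iso_def)
  moreover have "snd g U (coordinate_section r) = const_section K {K.pt} (\<psi> r)" if "r \<in> carrier R" for r
    using bij_betw_inv_into_right[OF K.sections_field ring_hom_closed[OF gU coordinate_section_closed[OF that]]]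
    by (simp add: \<psi>_def)
  ultimately show thesis
    using g U by (intro that[of \<psi>]) (simp add: point_hom_def)
qed

lemma point_hom_kernel:
  assumes g: "point_hom K g \<psi>" and r: "r \<in> carrier R"
  shows "\<psi> r = \<zero>\<^bsub>K\<^esub> \<longleftrightarrow> r \<in> f (fst g K.pt)"
proof -
  have g': "(fst g, snd g) \<in> sh_hom ring_hom (Spec K) X" and x: "fst g K.pt \<in> U" and \<psi>: "\<psi> r \<in> carrier K"
    and eq: "snd g U (coordinate_section r) = const_section K {K.pt} (\<psi> r)"
    using g r ring_hom_closed[of \<psi> R K] by (auto simp: point_hom_def)
  have "\<psi> r \<noteq> \<zero>\<^bsub>K\<^esub> \<longleftrightarrow> X.invertible_near (fst g K.pt) U (coordinate_section r)"
    using invertible_near_pullback[OF K.presheaf_of_monoids_axioms X.presheaf_of_monoids_axioms g' _ open_U x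
        coordinate_section_closed[OF r]] K.invertible_near_const_section[OF \<psi>] eq x
    by (simp add: K.preim_field K.topspace_field)
  then show ?thesis
    using coordinate_section_invertible_iff[OF x r] by simp
qed

lemma point_hom_section_eq:
  assumes g: "point_hom K g \<psi>" and V: "openin (pts X) V" and s: "s \<in> carrier (sec X V)"
    and ab: "a \<in> carrier R" "b \<in> carrier R" "b \<notin> f (fst g K.pt)"
    and W: "openin (pts X) W" "fst g K.pt \<in> W" "W \<subseteq> U \<inter> V"
    and fraction: "res X V W s \<otimes>\<^bsub>sec X W\<^esub> res X U W (coordinate_section b) = res X U W (coordinate_section a)"
  shows "snd g V s = const_section K {K.pt} (\<psi> a \<otimes>\<^bsub>K\<^esub> inv\<^bsub>K\<^esub> (\<psi> b))"
proof -
  have g': "(fst g, snd g) \<in> sh_hom ring_hom (Spec K) X" and \<psi>: "\<psi> \<in> ring_hom R K"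
    and coordinate: "\<And>r. r \<in> carrier R \<Longrightarrow> snd g U (coordinate_section r) = const_section K {K.pt} (\<psi> r)"
    using g by (auto simp: point_hom_def)
  have preim: "preim (Spec K) (fst g) Z = {K.pt}" if "W \<subseteq> Z" for Z
    using that W(2) by (auto simp: K.preim_field)
  have sub: "W \<subseteq> U" "W \<subseteq> V" using W(3) by auto
  have gW: "snd g W \<in> ring_hom (sec X W) (sec (Spec K) {K.pt})" and gV: "snd g V s \<in> carrier (sec (Spec K) {K.pt})"
    using sh_homD(3)[OF g' W(1)] ring_hom_closed[OF sh_homD(3)[OF g' V] s] preim[of V] preim[of W] sub by simp_all
  obtain \<alpha> where \<alpha>: "\<alpha> \<in> carrier K" "snd g V s = const_section K {K.pt} \<alpha>"
    using gV bij_betw_imp_surj_on[OF K.sections_field] by blast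
  have res: "snd g W (res X Z W t) = snd g Z t"
    if "openin (pts X) Z" "W \<subseteq> Z" "t \<in> carrier (sec X Z)" "snd g Z t = const_section K {K.pt} \<beta>" for Z t \<beta>
    using sh_homD(6)[OF g' that(1) W(1) that(2,3)] that(4) preim[OF that(2)] preim[of W]
    by (simp add: Spec_simps(6) K.const_section_restrict)
  note closed = ring_hom_closed[OF \<psi> ab(1)] ring_hom_closed[OF \<psi> ab(2)]
    coordinate_section_closed[OF ab(1)] coordinate_section_closed[OF ab(2)]
  have "const_section K {K.pt} (\<alpha> \<otimes>\<^bsub>K\<^esub> \<psi> b) = const_section K {K.pt} \<alpha> \<otimes>\<^bsub>sec (Spec K) {K.pt}\<^esub> const_section K {K.pt} (\<psi> b)"
    by (rule ring_hom_mult[OF K.const_section_hom[OF K.open_pt] \<alpha>(1) closed(2)])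
  also have "\<dots> = snd g W (res X V W s) \<otimes>\<^bsub>sec (Spec K) {K.pt}\<^esub> snd g W (res X U W (coordinate_section b))"
    using res[OF V sub(2) s \<alpha>(2)] res[OF open_U sub(1) closed(4) coordinate[OF ab(2)]] \<alpha>(2) coordinate[OF ab(2)] by simp
  also have "\<dots> = snd g W (res X U W (coordinate_section a))"
    using W(1) V open_U sub s closed by (simp add: ring_hom_mult[OF gW, symmetric] X.res_closed fraction)
  also have "\<dots> = const_section K {K.pt} (\<psi> a)"
    using res[OF open_U sub(1) closed(3) coordinate[OF ab(1)]] coordinate[OF ab(1)] by simp
  finally have "\<alpha> \<otimes>\<^bsub>K\<^esub> \<psi> b = \<psi> a"
    using \<alpha>(1) closed by (simp add: K.const_section_eq_iff)
  moreover have "\<psi> b \<in> Units K"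
    using point_hom_kernel[OF g ab(2)] ab(3) closed(2) by (simp add: K.field_Units)
  ultimately have "\<alpha> = \<psi> a \<otimes>\<^bsub>K\<^esub> inv\<^bsub>K\<^esub> (\<psi> b)"
    using \<alpha>(1) by (metis K.Units_closed K.Units_inv_closed K.Units_r_inv K.m_assoc K.r_one)
  then show ?thesis using \<alpha>(2) by simp
qed

lemma point_hom_unique:
  assumes g: "point_hom K g \<psi>" and g': "point_hom K g' \<psi>"
  shows "g = g'"
proof -
  define x where "x = fst g K.pt"
  have hom_g: "(fst g, snd g) \<in> sh_hom ring_hom (Spec K) X" "(fst g', snd g') \<in> sh_hom ring_hom (Spec K) X"
    and x: "x \<in> U" "fst g' K.pt \<in> U"
    using g g' by (auto simp: point_hom_def x_def)
  have "f (fst h K.pt) = {r \<in> carrier R. \<psi> r = \<zero>\<^bsub>K\<^esub>}" if h: "point_hom K h \<psi>" for h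
    using point_hom_kernel[OF h] f_subset_carrier[of "fst h K.pt"] h by (auto simp: point_hom_def)
  then have "f (fst g' K.pt) = f x"
    using g g' by (simp add: x_def)
  then have x': "fst g' K.pt = x"
    using inj_f x by (simp add: inj_on_eq_iff)
  have "snd g V s = snd g' V s" if V: "openin (pts X) V" and s: "s \<in> carrier (sec X V)" for V s
  proof (cases "x \<in> V")
    case True
    then obtain a b W where "a \<in> carrier R" "b \<in> carrier R" "b \<notin> f x" "X.neighbourhood x W" "W \<subseteq> U \<inter> V"
        "res X V W s \<otimes>\<^bsub>sec X W\<^esub> res X U W (coordinate_section b) = res X U W (coordinate_section a)"
      using x(1) by (elim section_is_fraction[OF V _ s, rotated]) auto
    then show ?thesis
      using point_hom_section_eq[OF g V s, of a b W] point_hom_section_eq[OF g' V s, of a b W] x' by (simp add: x_def)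
  next
    case False
    then show ?thesis
      using ring_hom_closed[OF sh_homD(3)[OF hom_g(1) V] s] ring_hom_closed[OF sh_homD(3)[OF hom_g(2) V] s] x'
      by (intro K.section_eqI[of _ "{}"]) (simp_all add: K.preim_field x_def)
  qed
  then have "snd g V = snd g' V" if "openin (pts X) V" for V
    using extensionalityI[OF sh_homD(4)[OF hom_g(1) that] sh_homD(4)[OF hom_g(2) that]] that by blast
  then have "snd g = snd g'"
    by (intro extensionalityI[OF sh_homD(5)[OF hom_g(1)] sh_homD(5)[OF hom_g(2)]]) simp
  moreover have "fst g = fst g'"
    using x' by (intro extensionalityI[OF sh_homD(2)[OF hom_g(1)] sh_homD(2)[OF hom_g(2)]])
      (simp add: K.topspace_field x_def)
  ultimately show ?thesis by (rule prod_eqI[rotated])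
qed

end

end

context field_spectrum
begin

lemma Spec_map_pt: "fst (Spec_map A K \<epsilon>) pt = {a \<in> carrier A. \<epsilon> a = \<zero>}"
  by (simp add: spectral_map_def Let_def topspace_field)

lemma sh_comp_Spec_map_pt:
  "fst (sh_comp (Spec K) (Spec A) X g (Spec_map A K \<epsilon>)) pt = fst g {a \<in> carrier A. \<epsilon> a = \<zero>}"
  by (simp add: sh_comp_def compose_def topspace_field Spec_map_pt)

lemma hom_extends_to_local_ring:
  fixes R :: "'b ring"
  assumes R: "cring R" and \<psi>: "\<psi> \<in> ring_hom R K"
  defines "P \<equiv> {r \<in> carrier R. \<psi> r \<in> pt}"
  obtains \<phi> where "\<phi> \<in> ring_hom (local_ring R P) K"
    "\<And>r. r \<in> carrier R \<Longrightarrow> \<phi> (loc_frac R (carrier R - P) r \<one>\<^bsub>R\<^esub>) = \<psi> r"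
    "\<And>z. z \<in> carrier (local_ring R P) \<Longrightarrow> \<phi> z \<noteq> \<zero> \<Longrightarrow> z \<in> Units (local_ring R P)"
proof -
  interpret R: cring R by (rule R)
  interpret \<psi>: ring_hom_cring R K \<psi> by unfold_locales (rule \<psi>)
  have prime: "primeideal P R"
    unfolding P_def
    by (rule ring_hom_ring.primeideal_vimage[OF ring_hom_ringI2[OF R.ring_axioms ring_axioms \<psi>] R zeroprimeideal])
  interpret P: multiplicative_subset R "carrier R - P"
    by (rule primeideal_complement_multiplicative[OF prime])
  have unit: "\<psi> s \<in> Units K" if "s \<in> carrier R - P" for s
    using that by (simp add: P_def field_Units)
  have \<iota>: "(\<lambda>r. P.frac r \<one>\<^bsub>R\<^esub>) \<in> ring_hom R (local_ring R P)"
    by (rule P.localization_map_hom)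
  interpret L: cring "local_ring R P" by (rule P.localization_cring)
  interpret fraction_extension R "local_ring R P" K "\<lambda>r. P.frac r \<one>\<^bsub>R\<^esub>" \<psi>
  proof (unfold_locales, rule \<iota>)
    fix a assume a: "a \<in> carrier R" "P.frac a \<one>\<^bsub>R\<^esub> = \<zero>\<^bsub>local_ring R P\<^esub>"
    then obtain u where u: "u \<in> carrier R - P" "u \<otimes>\<^bsub>R\<^esub> (a \<otimes>\<^bsub>R\<^esub> \<one>\<^bsub>R\<^esub>) = u \<otimes>\<^bsub>R\<^esub> (\<zero>\<^bsub>R\<^esub> \<otimes>\<^bsub>R\<^esub> \<one>\<^bsub>R\<^esub>)"
      using P.frac_eq_iff[of a "\<one>\<^bsub>R\<^esub>" "\<zero>\<^bsub>R\<^esub>" "\<one>\<^bsub>R\<^esub>"] P.one_in_S by (auto simp: localization_simps(3))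
    then have "\<psi> u \<otimes> \<psi> a = \<zero>"
      using a(1) by (simp flip: \<psi>.hom_mult)
    then show "\<psi> a = \<zero>"
      using unit[OF u(1)] a(1) by (auto simp: integral_iff field_Units)
  next
    fix z assume "z \<in> carrier (local_ring R P)"
    then obtain a s where "a \<in> carrier R" "s \<in> carrier R - P" "z = P.frac a s"
      by (rule P.localizationE)
    then show "\<exists>a\<in>carrier R. \<exists>s\<in>carrier R. \<psi> s \<in> Units K \<and>
        z \<otimes>\<^bsub>local_ring R P\<^esub> P.frac s \<one>\<^bsub>R\<^esub> = P.frac a \<one>\<^bsub>R\<^esub>"
      using P.frac_mult_denominator unit by blast
  qed
  obtain \<phi> where \<phi>: "\<phi> \<in> ring_hom (local_ring R P) K" "\<And>r. r \<in> carrier R \<Longrightarrow> \<phi> (P.frac r \<one>\<^bsub>R\<^esub>) = \<psi> r"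
    using fraction_hom_exists by blast
  have units: "z \<in> Units (local_ring R P)" if z_closed: "z \<in> carrier (local_ring R P)" and nonzero: "\<phi> z \<noteq> \<zero>" for z
  proof -
    obtain a s where z: "a \<in> carrier R" "s \<in> carrier R - P" "z = P.frac a s"
      using z_closed by (rule P.localizationE)
    have "\<phi> z \<otimes> \<psi> s = \<psi> a"
      using ring_hom_mult[OF \<phi>(1) P.frac_in_localization[OF z(1,2)] P.frac_in_localization[OF _ P.one_in_S, of s]]
        P.frac_mult_denominator[OF z(1,2)] \<phi>(2) z by simp
    moreover have "\<phi> z \<in> carrier K"
      using ring_hom_closed[OF \<phi>(1) P.frac_in_localization[OF z(1,2)]] z(3) by simp
    ultimately have "a \<notin> P"
      using nonzero unit[OF z(2)] by (metis (lifting) Units_closed field_Units integral DiffE P_def mem_Collect_eq singletonI singletonD)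
    then show ?thesis
      using prime_frac_unit_iff[OF prime z(1), of s] z(2,3) by simp
  qed
  show thesis by (rule that[OF \<phi>(1)]) (use \<phi>(2) units in simp_all)
qed

end

lemma Spec_map_const_section:
  assumes K: "field K" and L: "field L" and \<epsilon>: "\<epsilon> \<in> ring_hom K L" and a: "a \<in> carrier K"
  shows "snd (Spec_map K L \<epsilon>) {{\<zero>\<^bsub>K\<^esub>}} (const_section K {{\<zero>\<^bsub>K\<^esub>}} a) = const_section L {{\<zero>\<^bsub>L\<^esub>}} (\<epsilon> a)"
proof -
  interpret K: field_spectrum K unfolding field_spectrum_def by (rule K)
  interpret L: field_spectrum L unfolding field_spectrum_def by (rule L)
  interpret \<epsilon>: ring_hom_cring K L \<epsilon> by unfold_locales (rule \<epsilon>)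
  have kernel: "\<epsilon> a = \<zero>\<^bsub>L\<^esub> \<longleftrightarrow> a = \<zero>\<^bsub>K\<^esub>" if "a \<in> carrier K" for a
    using inj_onD[OF non_trivial_field_hom_is_inj[OF \<epsilon> K L] _ that K.zero_closed] by auto
  have ker_\<epsilon>: "{a \<in> carrier K. \<epsilon> a = \<zero>\<^bsub>L\<^esub>} = K.pt"
    using kernel by auto
  define c where "c = fst (Spec_map K L \<epsilon>)"
  then have pt: "c L.pt = K.pt"
    using ker_\<epsilon> by (simp add: L.Spec_map_pt)
  interpret LK: multiplicative_subset K "carrier K - K.pt"
    using K.prime_multiplicative_subset[OF K.open_pt] by blast
  interpret LL: multiplicative_subset L "carrier L - L.pt"
    using L.prime_multiplicative_subset[OF L.open_pt] by blast
  have "LL.frac (\<epsilon> b) (\<epsilon> s) = LL.frac (\<epsilon> a) \<one>\<^bsub>L\<^esub>" if bs: "(b, s) \<in> LK.frac a \<one>\<^bsub>K\<^esub>" for b s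
  proof (rule LL.frac_eqI)
    have b: "b \<in> carrier K" "s \<in> carrier K" "s \<noteq> \<zero>\<^bsub>K\<^esub>"
        and "\<exists>u\<in>carrier K - K.pt. u \<otimes>\<^bsub>K\<^esub> (a \<otimes>\<^bsub>K\<^esub> s) = u \<otimes>\<^bsub>K\<^esub> (b \<otimes>\<^bsub>K\<^esub> \<one>\<^bsub>K\<^esub>)"
      using bs by (simp_all add: loc_frac_def cong: conj_cong)
    then obtain u where "u \<in> carrier K - K.pt" "u \<otimes>\<^bsub>K\<^esub> (a \<otimes>\<^bsub>K\<^esub> s) = u \<otimes>\<^bsub>K\<^esub> (b \<otimes>\<^bsub>K\<^esub> \<one>\<^bsub>K\<^esub>)"
      by (elim bexE)
    then have "b = a \<otimes>\<^bsub>K\<^esub> s"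
      using a b K.m_lcancel[of u "a \<otimes>\<^bsub>K\<^esub> s" b] by simp
    then show "\<epsilon> b \<otimes>\<^bsub>L\<^esub> \<one>\<^bsub>L\<^esub> = \<epsilon> a \<otimes>\<^bsub>L\<^esub> \<epsilon> s" "\<epsilon> b \<in> carrier L" "\<epsilon> s \<in> carrier L - L.pt"
      using a b kernel by simp_all
  qed (use a in simp_all)
  then have "(\<Union>(b, s)\<in>LK.frac a \<one>\<^bsub>K\<^esub>. LL.frac (\<epsilon> b) (\<epsilon> s)) = LL.frac (\<epsilon> a) \<one>\<^bsub>L\<^esub>"
    using LK.frac_self[OF a LK.one_in_S] by fast
  moreover have "snd (Spec_map K L \<epsilon>) {K.pt} (const_section K {K.pt} a) =
      (\<lambda>q\<in>preim (Spec L) c {K.pt}. \<Union>(b, s)\<in>const_section K {K.pt} a (c q).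
        loc_frac L (carrier L - q) (\<epsilon> b) (\<epsilon> s))"
    using K.open_pt ring_hom_closed[OF K.const_section_hom[OF K.open_pt] a]
    by (simp add: spectral_map_def Let_def c_def)
  ultimately show ?thesis
    by (simp add: L.preim_field pt const_section_def cong: restrict_cong)
qed

context affine_chart
begin

context
  fixes K :: "'a ring"
  assumes field_K: "field K"
begin

interpretation K: field_spectrum K
  unfolding field_spectrum_def by (rule field_K)

definition stalk_point :: "'x \<Rightarrow> (('r \<times> 'r) set \<Rightarrow> 'a) \<Rightarrow> ('a set \<Rightarrow> 'x) \<times> ('x set \<Rightarrow> 's \<Rightarrow> 'a set \<Rightarrow> ('a \<times> 'a) set)" where
  "stalk_point x \<phi> =
     (\<lambda>q\<in>{K.pt}. x,
      \<lambda>V\<in>{V. openin (pts X) V}. \<lambda>s\<in>carrier (sec X V).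
        const_section K (if x \<in> V then {K.pt} else {}) (\<phi> (germ_value x V s)))"

context
  fixes x \<phi>
  assumes x: "x \<in> U" and \<phi>: "\<phi> \<in> ring_hom (local_ring R (f x)) K"
begin

lemma stalk_point_value_closed:
  "openin (pts X) V \<Longrightarrow> x \<in> V \<Longrightarrow> s \<in> carrier (sec X V) \<Longrightarrow> \<phi> (germ_value x V s) \<in> carrier K"
  using ring_hom_closed[OF \<phi> ring_hom_closed[OF germ_value_hom]] x by blast

lemma preim_stalk_point: "preim (Spec K) (fst (stalk_point x \<phi>)) V = (if x \<in> V then {K.pt} else {})"
  by (simp add: K.preim_field stalk_point_def)

lemma stalk_point_sections:
  assumes "openin (pts X) V" "s \<in> carrier (sec X V)"
  shows "snd (stalk_point x \<phi>) V s = const_section K (if x \<in> V then {K.pt} else {}) (\<phi> (germ_value x V s))"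
  using assms by (simp add: stalk_point_def)

lemma stalk_point_ring_hom:
  assumes V: "openin (pts X) V"
  shows "snd (stalk_point x \<phi>) V \<in> ring_hom (sec X V) (sec (Spec K) (preim (Spec K) (fst (stalk_point x \<phi>)) V))"
proof -
  interpret V: cring "sec X V" by (rule sheaf_sec_cring[OF sheaf V])
  have "(\<lambda>s. const_section K (if x \<in> V then {K.pt} else {}) (\<phi> (germ_value x V s))) \<in>
      ring_hom (sec X V) (sec (Spec K) (if x \<in> V then {K.pt} else {}))"
  proof (cases "x \<in> V")
    case True
    then have "(\<lambda>s. \<phi> (germ_value x V s)) \<in> ring_hom (sec X V) K"
      using ring_hom_trans[OF germ_value_hom[OF V] \<phi>] x by (simp add: comp_def)
    then show ?thesis
      using ring_hom_trans[OF _ K.const_section_hom[OF K.open_pt]] True by (simp add: comp_def)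
  next
    case False
    have empty: "openin (pts (Spec K)) {}" by simp
    have "const_section K {} a = const_section K {} b" for a b
      unfolding const_section_def by (rule restrict_ext) simp
    then have "(\<lambda>s. const_section K {} (\<phi> (germ_value x V s))) = (\<lambda>s. const_section K {} \<one>\<^bsub>K\<^esub>)"
      by blast
    moreover have "(\<lambda>s. const_section K {} \<one>\<^bsub>K\<^esub>) \<in> ring_hom (sec X V) (sec (Spec K) {})"
      by (rule ring_hom_memI)
        (use ring_hom_closed[OF K.const_section_hom[OF empty] K.one_closed] in \<open>simp_all add: Spec_simps const_section_def restrict_def\<close>)
    ultimately show ?thesis using False by simp
  qed
  then show ?thesis
    unfolding preim_stalk_point
    by (rule V.ring_hom_restrict) (simp add: stalk_point_sections[OF V])
qed

lemma stalk_point_in_sh_hom: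
  assumes local: "\<And>z. z \<in> carrier (local_ring R (f x)) \<Longrightarrow> \<phi> z \<noteq> \<zero>\<^bsub>K\<^esub> \<Longrightarrow> z \<in> Units (local_ring R (f x))"
  shows "stalk_point x \<phi> \<in> sh_hom ring_hom (Spec K) X"
proof -
  define c where "c = fst (stalk_point x \<phi>)"
  define G where "G = snd (stalk_point x \<phi>)"
  note preim = preim_stalk_point[folded c_def] and G = stalk_point_sections[folded G_def]
  have c_pt: "c K.pt = x" by (simp add: c_def stalk_point_def)
  have x_top: "x \<in> topspace (pts X)" using x openin_subset[OF open_U] by blast
  have "continuous_map (pts (Spec K)) (pts X) c"
    unfolding continuous_map_def
  proof (intro conjI allI impI)
    show "c \<in> topspace (pts (Spec K)) \<rightarrow> topspace (pts X)"
      using x_top by (simp add: K.topspace_field c_pt)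
    show "openin (pts (Spec K)) {q \<in> topspace (pts (Spec K)). c q \<in> V}" for V
      using preim[of V] K.open_pt by (simp add: preim_def)
  qed
  moreover have "G W (res X V W s) = res (Spec K) (preim (Spec K) c V) (preim (Spec K) c W) (G V s)"
    if V: "openin (pts X) V" and W: "openin (pts X) W" "W \<subseteq> V" and s: "s \<in> carrier (sec X V)" for V W s
  proof (cases "x \<in> W")
    case True
    then have "germ_value x W (res X V W s) = germ_value x V s"
      using germ_value_res[OF V W _ s] x by simp
    then show ?thesis
      using True V W s X.res_closed[OF V W s] by (simp add: preim G Spec_simps(6) K.const_section_restrict subset_iff)
  next
    case False
    then show ?thesis
      using V W s X.res_closed[OF V W s] by (simp add: preim G Spec_simps(6) const_section_def restrict_def)
  qed
  moreover have "germ X (c q) V s \<in> Units (stalk X (c q))"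
    if q: "q \<in> topspace (pts (Spec K))" and V: "openin (pts X) V" "c q \<in> V" and s: "s \<in> carrier (sec X V)"
      and unit: "germ (Spec K) q (preim (Spec K) c V) (G V s) \<in> Units (stalk (Spec K) q)" for q V s
  proof -
    have q_eq: "q = K.pt" and xV: "x \<in> V" using q V(2) c_pt by (auto simp: K.topspace_field)
    note in_K = stalk_point_value_closed[OF V(1) xV s]
    have "\<phi> (germ_value x V s) \<noteq> \<zero>\<^bsub>K\<^esub>"
      using unit xV K.germ_unit_iff[of "{K.pt}" K.pt] K.open_pt ring_hom_closed[OF K.const_section_hom[OF K.open_pt] in_K]
        K.invertible_near_const_section[OF in_K] by (simp add: preim q_eq G[OF V(1) s])
    then have "X.invertible_near x V s"
      using local ring_hom_closed[OF germ_value_hom[OF V(1)] s] germ_value_unit_iff[OF V(1) _ s] x xV by blast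
    then show ?thesis
      using X.germ_unit_iff[of V x s] V(1) xV s by (simp add: q_eq c_pt)
  qed
  moreover have "G V \<in> ring_hom (sec X V) (sec (Spec K) (preim (Spec K) c V))" if "openin (pts X) V" for V
    unfolding G_def c_def by (rule stalk_point_ring_hom[OF that])
  moreover have "c \<in> extensional (topspace (pts (Spec K)))" "G \<in> extensional {V. openin (pts X) V}"
    "\<And>V. openin (pts X) V \<Longrightarrow> G V \<in> extensional (carrier (sec X V))"
    by (simp_all add: c_def G_def stalk_point_def K.topspace_field)
  ultimately have "(c, G) \<in> sh_hom ring_hom (Spec K) X"
    unfolding sh_hom_def by simp
  then show ?thesis by (simp add: c_def G_def)
qed

end

lemma hom_point_exists:
  assumes \<psi>: "\<psi> \<in> ring_hom R K"
  obtains g where "point_hom K g \<psi>"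
proof -
  define P where "P = {r \<in> carrier R. \<psi> r \<in> K.pt}"
  have prime: "primeideal P R"
    unfolding P_def
    by (rule ring_hom_ring.primeideal_vimage[OF ring_hom_ringI2[OF R.ring_axioms K.ring_axioms \<psi>] cring_R K.zeroprimeideal])
  then have "P \<in> f ` U" unfolding image_f by simp
  then obtain x where x: "x \<in> U" "f x = P" by blast
  obtain \<phi> where \<phi>: "\<phi> \<in> ring_hom (local_ring R P) K"
      "\<And>r. r \<in> carrier R \<Longrightarrow> \<phi> (loc_frac R (carrier R - P) r \<one>\<^bsub>R\<^esub>) = \<psi> r"
      "\<And>z. z \<in> carrier (local_ring R P) \<Longrightarrow> \<phi> z \<noteq> \<zero>\<^bsub>K\<^esub> \<Longrightarrow> z \<in> Units (local_ring R P)"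
    by (rule K.hom_extends_to_local_ring[OF cring_R \<psi>, folded P_def]) (rule that)
  have "stalk_point x \<phi> \<in> sh_hom ring_hom (Spec K) X"
    by (rule stalk_point_in_sh_hom[OF x(1)]) (use \<phi>(1,3) x(2) in simp_all)
  moreover have "snd (stalk_point x \<phi>) U (coordinate_section r) = const_section K {K.pt} (\<psi> r)" if "r \<in> carrier R" for r
    using stalk_point_sections[OF x(1) _ open_U coordinate_section_closed[OF that], of \<phi>] x \<phi>(1)
      germ_value_coordinate[OF x(1) that] \<phi>(2)[OF that] by simp
  ultimately show thesis
    using \<psi> x(1) by (intro that[of "stalk_point x \<phi>"]) (simp add: point_hom_def stalk_point_def)
qed

end

lemma point_hom_base_change:
  assumes K: "field K" and L: "field L" and \<epsilon>: "\<epsilon> \<in> ring_hom K L" and g: "point_hom K g \<psi>"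
    and hom: "sh_comp (Spec L) (Spec K) X g (Spec_map K L \<epsilon>) \<in> sh_hom ring_hom (Spec L) X"
  shows "point_hom L (sh_comp (Spec L) (Spec K) X g (Spec_map K L \<epsilon>)) (\<epsilon> \<circ> \<psi>)"
proof -
  interpret K: field_spectrum K unfolding field_spectrum_def by (rule K)
  interpret L: field_spectrum L unfolding field_spectrum_def by (rule L)
  have \<psi>: "\<psi> \<in> ring_hom R K" and U: "fst g K.pt \<in> U"
    and coordinate: "\<And>r. r \<in> carrier R \<Longrightarrow> snd g U (coordinate_section r) = const_section K {K.pt} (\<psi> r)"
    using g by (auto simp: point_hom_def)
  have ker_\<epsilon>: "{a \<in> carrier K. \<epsilon> a = \<zero>\<^bsub>L\<^esub>} = K.pt"
  proof -
    interpret \<epsilon>: ring_hom_cring K L \<epsilon> by unfold_locales (rule \<epsilon>)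
    have "\<epsilon> a = \<zero>\<^bsub>L\<^esub> \<longleftrightarrow> a = \<zero>\<^bsub>K\<^esub>" if "a \<in> carrier K" for a
      using inj_onD[OF non_trivial_field_hom_is_inj[OF \<epsilon> K L] _ that K.zero_closed] by auto
    then show ?thesis by auto
  qed
  have "preim (Spec K) (fst g) U = {K.pt}"
    using U by (simp add: K.preim_field)
  then have "snd (sh_comp (Spec L) (Spec K) X g (Spec_map K L \<epsilon>)) U (coordinate_section r) = const_section L {L.pt} (\<epsilon> (\<psi> r))"
    if "r \<in> carrier R" for r
    using that coordinate Spec_map_const_section[OF K L \<epsilon> ring_hom_closed[OF \<psi> that]] coordinate_section_closed[OF that] open_U
    by (simp add: sh_comp_def compose_def)
  moreover have "fst (sh_comp (Spec L) (Spec K) X g (Spec_map K L \<epsilon>)) L.pt = fst g K.pt"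
    using ker_\<epsilon> by (simp add: L.sh_comp_Spec_map_pt)
  ultimately show ?thesis
    unfolding point_hom_def using hom U ring_hom_trans[OF \<psi> \<epsilon>] by simp
qed

end

section \<open>The multiplicative monoid of a ring\<close>

lemma ring_pmonoid_simps [simp]:
  "carrier (ring_pmonoid R) = carrier R" "x \<otimes>\<^bsub>ring_pmonoid R\<^esub> y = x \<otimes>\<^bsub>R\<^esub> y"
  "\<one>\<^bsub>ring_pmonoid R\<^esub> = \<one>\<^bsub>R\<^esub>" "absorb (ring_pmonoid R) = \<zero>\<^bsub>R\<^esub>"
  by (simp_all add: ring_pmonoid_def)

lemma Units_ring_pmonoid [simp]: "Units (ring_pmonoid R) = Units R"
  by (simp add: Units_def)

lemma (in spectrum) pmonoid_ring_pmonoid: "pmonoid (ring_pmonoid R)"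
  by unfold_locales (auto simp: m_ac)

lemma (in field_spectrum) pm_field_ring_pmonoid: "pm_field (ring_pmonoid K)"
  unfolding pm_field_def using pmonoid_ring_pmonoid field_Units by auto

lemma ring_pmonoid_hom:
  assumes "cring R" "cring S" "\<epsilon> \<in> ring_hom R S"
  shows "\<epsilon> \<in> pmonoid_hom (ring_pmonoid R) (ring_pmonoid S)"
  using assms(3) ring_hom_zero[OF assms(3)] cring.axioms(1)[OF assms(1)] cring.axioms(1)[OF assms(2)]
  by (auto simp: pmonoid_hom_def hom_def ring_hom_def)

context cring
begin

lemma finsum_product:
  assumes "finite A" "finite B" and a: "a \<in> A \<rightarrow> carrier R" and b: "b \<in> B \<rightarrow> carrier R"
  shows "(\<Oplus>x\<in>A. a x) \<otimes> (\<Oplus>y\<in>B. b y) = (\<Oplus>q\<in>A \<times> B. a (fst q) \<otimes> b (snd q))"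
  using assms(1) a
proof (induction A rule: finite_induct)
  case (insert x A)
  have a: "a z \<in> carrier R" if "z \<in> insert x A" for z
    using insert(4) that by blast
  have b: "b y \<in> carrier R" if "y \<in> B" for y
    using b that by blast
  have "(\<Oplus>q\<in>insert x A \<times> B. a (fst q) \<otimes> b (snd q)) = (\<Oplus>q\<in>Pair x ` B \<union> A \<times> B. a (fst q) \<otimes> b (snd q))"
    by (rule arg_cong[where f = "finsum R _"]) auto
  also have "\<dots> = (\<Oplus>q\<in>Pair x ` B. a (fst q) \<otimes> b (snd q)) \<oplus> (\<Oplus>q\<in>A \<times> B. a (fst q) \<otimes> b (snd q))"
    using insert(1,2) assms(2) a b by (intro finsum_Un_disjoint) auto
  also have "(\<Oplus>q\<in>Pair x ` B. a (fst q) \<otimes> b (snd q)) = a x \<otimes> (\<Oplus>y\<in>B. b y)"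
    using assms(2) a b by (subst add.finprod_reindex) (auto simp: inj_on_def finsum_rdistr)
  finally show ?case
    using insert(1,2,3) assms(2) a b by (simp add: l_distr Pi_def)
qed (use assms(2) b in simp)

lemma int_add_pow_zero: "[(0 :: int)] \<cdot> z = \<zero>"
  by (simp add: add_pow_def int_pow_def nat_pow_def)

lemma int_add_pow_sum:
  assumes "finite A" "z \<in> carrier R"
  shows "[(\<Sum>a\<in>A. n a :: int)] \<cdot> z = (\<Oplus>a\<in>A. [n a] \<cdot> z)"
  using assms by (induction A rule: finite_induct) (simp_all add: int_add_pow_zero add.int_pow_mult)

lemma int_add_pow_mult:
  "x \<in> carrier R \<Longrightarrow> y \<in> carrier R \<Longrightarrow> [(m :: int)] \<cdot> x \<otimes> [(n :: int)] \<cdot> y = [(m * n)] \<cdot> (x \<otimes> y)"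
  by (simp add: add_pow_ldistr_int add_pow_rdistr_int add.int_pow_pow mult.commute)

lemma finsum_fibres:
  assumes "finite A" "F \<in> A \<rightarrow> carrier R"
  shows "(\<Oplus>a\<in>A. F a) = (\<Oplus>z\<in>\<phi> ` A. \<Oplus>a\<in>{a \<in> A. \<phi> a = z}. F a)"
proof -
  have "(\<Union>z\<in>\<phi> ` A. {a \<in> A. \<phi> a = z}) = A" by auto
  moreover have "finsum R F (\<Union>z\<in>\<phi> ` A. {a \<in> A. \<phi> a = z}) = (\<Oplus>z\<in>\<phi> ` A. finsum R F {a \<in> A. \<phi> a = z})"
    using assms by (intro add.finprod_UN_disjoint) (auto simp: pairwise_def disjnt_def)
  ultimately show ?thesis by simp
qed

end

context spectrum
begin

lemma monoid_ring_carrier: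
  "f \<in> carrier (monoid_ring (ring_pmonoid R)) \<longleftrightarrow> finite {x. f x \<noteq> 0} \<and> {x. f x \<noteq> 0} \<subseteq> carrier R - {\<zero>}"
  by (simp add: monoid_ring_def)

lemma monoid_ring_eval_superset:
  assumes "f \<in> carrier (monoid_ring (ring_pmonoid R))" "finite A" "{x. f x \<noteq> 0} \<subseteq> A" "A \<subseteq> carrier R"
  shows "monoid_ring_eval R f = (\<Oplus>x\<in>A. [f x] \<cdot> x)"
proof -
  have "monoid_ring_eval R f = (\<Oplus>x\<in>{x. f x \<noteq> 0}. [f x] \<cdot> x)"
    using assms(1) by (simp add: monoid_ring_eval_def)
  also have "\<dots> = (\<Oplus>x\<in>A. [f x] \<cdot> x)"
    using assms by (intro add.finprod_mono_neutral_cong_left) (auto simp: int_add_pow_zero)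
  finally show ?thesis .
qed

lemma monoid_ring_eval_pushforward:
  fixes n :: "'i \<Rightarrow> int"
  assumes A: "finite A" "\<phi> \<in> A \<rightarrow> carrier R"
  defines "g \<equiv> \<lambda>z. if z \<in> carrier R - {\<zero>} then \<Sum>a\<in>{a \<in> A. \<phi> a = z}. n a else 0"
  shows "g \<in> carrier (monoid_ring (ring_pmonoid R))"
    and "monoid_ring_eval R g = (\<Oplus>a\<in>A. [n a] \<cdot> \<phi> a)"
proof -
  have "z \<in> \<phi> ` A" if "g z \<noteq> 0" for z
  proof (rule ccontr)
    assume "z \<notin> \<phi> ` A"
    then have "{a \<in> A. \<phi> a = z} = {}" by auto
    then have "g z = 0" unfolding g_def by (simp only: sum.empty if_cancel)
    with that show False by simp
  qed
  then have supp: "{z. g z \<noteq> 0} \<subseteq> \<phi> ` A" by auto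
  show g: "g \<in> carrier (monoid_ring (ring_pmonoid R))"
    unfolding monoid_ring_carrier using finite_subset[OF supp] A(1) by (auto simp: g_def)
  have "monoid_ring_eval R g = (\<Oplus>z\<in>\<phi> ` A. [g z] \<cdot> z)"
    using A supp by (intro monoid_ring_eval_superset[OF g]) auto
  also have "\<dots> = (\<Oplus>z\<in>\<phi> ` A. \<Oplus>a\<in>{a \<in> A. \<phi> a = z}. [n a] \<cdot> \<phi> a)"
  proof (rule add.finprod_cong')
    fix z assume "z \<in> \<phi> ` A"
    then have z: "z \<in> carrier R" using A(2) by auto
    have "[g z] \<cdot> z = [(\<Sum>a\<in>{a \<in> A. \<phi> a = z}. n a)] \<cdot> z"
      using z by (cases "z = \<zero>") (simp_all add: g_def)
    also have "\<dots> = (\<Oplus>a\<in>{a \<in> A. \<phi> a = z}. [n a] \<cdot> \<phi> a)"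
      using A z by (subst int_add_pow_sum) (auto intro!: add.finprod_cong')
    finally show "[g z] \<cdot> z = (\<Oplus>a\<in>{a \<in> A. \<phi> a = z}. [n a] \<cdot> \<phi> a)" .
  qed (use A(2) in \<open>auto intro!: finsum_closed\<close>)
  also have "\<dots> = (\<Oplus>a\<in>A. [n a] \<cdot> \<phi> a)"
    using A by (intro finsum_fibres[symmetric]) auto
  finally show "monoid_ring_eval R g = (\<Oplus>a\<in>A. [n a] \<cdot> \<phi> a)" .
qed

lemma monoid_ring_eval_add:
  assumes f: "f \<in> carrier (monoid_ring (ring_pmonoid R))" and g: "g \<in> carrier (monoid_ring (ring_pmonoid R))"
  shows "monoid_ring_eval R (f \<oplus>\<^bsub>monoid_ring (ring_pmonoid R)\<^esub> g) = monoid_ring_eval R f \<oplus> monoid_ring_eval R g"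
proof -
  define A where "A = {x. f x \<noteq> 0} \<union> {x. g x \<noteq> 0}"
  have A: "finite A" "A \<subseteq> carrier R" "A \<subseteq> carrier R - {\<zero>}"
    using f g by (auto simp: A_def monoid_ring_carrier)
  have supp: "{x. f x + g x \<noteq> 0} \<subseteq> A" by (auto simp: A_def)
  then have fg: "(\<lambda>x. f x + g x) \<in> carrier (monoid_ring (ring_pmonoid R))"
    using A finite_subset[OF supp] by (auto simp: monoid_ring_carrier)
  have "monoid_ring_eval R (\<lambda>x. f x + g x) = (\<Oplus>x\<in>A. [f x] \<cdot> x \<oplus> [g x] \<cdot> x)"
    unfolding monoid_ring_eval_superset[OF fg A(1) supp A(2)]
    using A(2) by (intro add.finprod_cong') (auto simp: add.int_pow_mult)
  also have "\<dots> = (\<Oplus>x\<in>A. [f x] \<cdot> x) \<oplus> (\<Oplus>x\<in>A. [g x] \<cdot> x)"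
    using A(2) by (intro finsum_addf) auto
  also have "\<dots> = monoid_ring_eval R f \<oplus> monoid_ring_eval R g"
    using monoid_ring_eval_superset[OF f A(1) _ A(2)] monoid_ring_eval_superset[OF g A(1) _ A(2)] by (auto simp: A_def)
  finally show ?thesis by (simp add: monoid_ring_def)
qed

lemma monoid_ring_eval_mult:
  assumes f: "f \<in> carrier (monoid_ring (ring_pmonoid R))" and g: "g \<in> carrier (monoid_ring (ring_pmonoid R))"
  shows "monoid_ring_eval R (f \<otimes>\<^bsub>monoid_ring (ring_pmonoid R)\<^esub> g) = monoid_ring_eval R f \<otimes> monoid_ring_eval R g"
proof -
  define A B where "A = {x. f x \<noteq> 0}" and "B = {x. g x \<noteq> 0}"
  have A: "finite A" "A \<subseteq> carrier R" and B: "finite B" "B \<subseteq> carrier R"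
    using f g by (auto simp: A_def B_def monoid_ring_carrier)
  have "{q. f (fst q) \<noteq> 0 \<and> g (snd q) \<noteq> 0 \<and> fst q \<otimes> snd q = z} = {q \<in> A \<times> B. fst q \<otimes> snd q = z}" for z
    by (auto simp: A_def B_def)
  then have "f \<otimes>\<^bsub>monoid_ring (ring_pmonoid R)\<^esub> g =
      (\<lambda>z. if z \<in> carrier R - {\<zero>} then \<Sum>q\<in>{q \<in> A \<times> B. fst q \<otimes> snd q = z}. f (fst q) * g (snd q) else 0)"
    unfolding monoid_ring_def case_prod_unfold by (simp cong: if_cong)
  moreover have "(\<lambda>q. fst q \<otimes> snd q) \<in> A \<times> B \<rightarrow> carrier R"
    using A(2) B(2) by (auto simp: subset_iff)
  ultimately have "monoid_ring_eval R (f \<otimes>\<^bsub>monoid_ring (ring_pmonoid R)\<^esub> g) =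
      (\<Oplus>q\<in>A \<times> B. [(f (fst q) * g (snd q))] \<cdot> (fst q \<otimes> snd q))"
    using monoid_ring_eval_pushforward(2)[of "A \<times> B"] A(1) B(1) by (simp only: finite_cartesian_product)
  also have "\<dots> = (\<Oplus>q\<in>A \<times> B. [f (fst q)] \<cdot> fst q \<otimes> [g (snd q)] \<cdot> snd q)"
    using A B by (intro add.finprod_cong') (auto simp: int_add_pow_mult subset_iff)
  also have "\<dots> = (\<Oplus>x\<in>A. [f x] \<cdot> x) \<otimes> (\<Oplus>y\<in>B. [g y] \<cdot> y)"
    using A B by (intro finsum_product[symmetric]) auto
  also have "\<dots> = monoid_ring_eval R f \<otimes> monoid_ring_eval R g"
    using f g by (simp add: monoid_ring_eval_def A_def B_def)
  finally show ?thesis .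
qed

lemma monoid_ring_eval_hom: "monoid_ring_eval R \<in> ring_hom (monoid_ring (ring_pmonoid R)) R"
proof (rule ring_hom_memI)
  show "monoid_ring_eval R f \<in> carrier R" if "f \<in> carrier (monoid_ring (ring_pmonoid R))" for f
    using that by (auto simp: monoid_ring_eval_def monoid_ring_carrier intro!: finsum_closed)
  have "\<one>\<^bsub>monoid_ring (ring_pmonoid R)\<^esub> =
      (\<lambda>z. if z \<in> carrier R - {\<zero>} then \<Sum>a\<in>{a \<in> {()}. \<one> = z}. 1 else 0)"
    by (auto simp: monoid_ring_def fun_eq_iff)
  then show "monoid_ring_eval R \<one>\<^bsub>monoid_ring (ring_pmonoid R)\<^esub> = \<one>"
    using monoid_ring_eval_pushforward(2)[of "{()}" "\<lambda>_. \<one>" "\<lambda>_. 1"] by simp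
qed (simp_all add: monoid_ring_eval_add monoid_ring_eval_mult)

end

lemma monoid_ring_eval_natural:
  fixes R :: "'a ring" and S :: "'b ring"
  assumes R: "cring R" and S: "cring S" and \<epsilon>: "\<epsilon> \<in> ring_hom R S" and f: "f \<in> carrier (monoid_ring (ring_pmonoid R))"
  shows "monoid_ring_eval S (monoid_ring_map (ring_pmonoid R) (ring_pmonoid S) \<epsilon> f) = \<epsilon> (monoid_ring_eval R f)"
proof -
  interpret R: spectrum R unfolding spectrum_def by (rule R)
  interpret S: spectrum S unfolding spectrum_def by (rule S)
  interpret \<epsilon>: ring_hom_cring R S \<epsilon> by unfold_locales (rule \<epsilon>)
  have supp: "finite {x. f x \<noteq> 0}" "{x. f x \<noteq> 0} \<subseteq> carrier R"
    using f by (auto simp: R.monoid_ring_carrier)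
  then have \<epsilon>_closed: "\<epsilon> \<in> {x. f x \<noteq> 0} \<rightarrow> carrier S" by auto
  have "monoid_ring_map (ring_pmonoid R) (ring_pmonoid S) \<epsilon> f =
      (\<lambda>z. if z \<in> carrier S - {\<zero>\<^bsub>S\<^esub>} then \<Sum>x\<in>{x \<in> {x. f x \<noteq> 0}. \<epsilon> x = z}. f x else 0)"
    using f by (simp add: monoid_ring_map_def cong: if_cong)
  then have "monoid_ring_eval S (monoid_ring_map (ring_pmonoid R) (ring_pmonoid S) \<epsilon> f) =
      (\<Oplus>\<^bsub>S\<^esub>x\<in>{x. f x \<noteq> 0}. [f x] \<cdot>\<^bsub>S\<^esub> \<epsilon> x)"
    using S.monoid_ring_eval_pushforward(2)[OF supp(1) \<epsilon>_closed, of f] by simp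
  also have "\<dots> = (\<Oplus>\<^bsub>S\<^esub>x\<in>{x. f x \<noteq> 0}. \<epsilon> ([f x] \<cdot>\<^bsub>R\<^esub> x))"
    using supp(2) by (intro S.add.finprod_cong') (auto simp: ring_hom_int_add_pow[OF R S \<epsilon>])
  also have "\<dots> = \<epsilon> (monoid_ring_eval R f)"
    using f \<epsilon>.hom_finsum[of "\<lambda>x. [f x] \<cdot>\<^bsub>R\<^esub> x" "{x. f x \<noteq> 0}"] supp(2)
    by (simp add: monoid_ring_eval_def comp_def Pi_def subset_iff)
  finally show ?thesis .
qed

section \<open>Points of schemes over the field with one element\<close>

lemma mr_functor_closed:
  assumes "is_mr_functor X" "is_mr_obj A" "is_mr_obj B" "h \<in> mr_hom A B" "x \<in> fobj X A"
  shows "fmor X A B h x \<in> fobj X B"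
  using assms unfolding is_mr_functor_def by blast

lemma mr_functor_comp:
  assumes "is_mr_functor X" "is_mr_obj A" "is_mr_obj B" "is_mr_obj C" "h \<in> mr_hom A B" "k \<in> mr_hom B C" "x \<in> fobj X A"
  shows "fmor X A C (mr_comp A B k h) x = fmor X B C k (fmor X A B h x)"
  using assms unfolding is_mr_functor_def by blast

lemma mon_mor_id:
  assumes "is_mr_functor X" "pmonoid M" "x \<in> mon_obj X M"
  shows "mon_mor X M M (\<lambda>a\<in>carrier M. a) x = x"
  using assms unfolding is_mr_functor_def by (metis is_mr_obj.simps(1) mr_id.simps(1))

text \<open>The ideal of \<open>M\<close> that describes the preimage of \<open>Y\<close> contains a non-zero element, that is, a unit.\<close>

lemma open_subfunctor_reflects_points:
  assumes X: "is_mr_functor X" and Y: "mon_open_subfunctor X Y" and M: "pm_field M" and N: "pm_field N"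
    and \<phi>: "\<phi> \<in> pm_homs M N" and x: "x \<in> mon_obj X M" and image: "mon_mor X M N \<phi> x \<in> Y N"
  shows "x \<in> Y M"
proof -
  interpret M: pmonoid M using pm_fieldD(1)[OF M] .
  interpret N: pmonoid N using pm_fieldD(1)[OF N] .
  have "\<forall>x \<in> mon_obj X M. \<exists>I. pmonoid_ideal I M \<and>
      (\<forall>N. pmonoid N \<longrightarrow> (\<forall>\<phi>\<in>pm_homs M N. mon_mor X M N \<phi> x \<in> Y N \<longleftrightarrow>
        {\<phi> a \<otimes>\<^bsub>N\<^esub> b | a b. a \<in> I \<and> b \<in> carrier N} = carrier N))"
    using Y M.pmonoid_axioms unfolding mon_open_subfunctor_def by simp
  then obtain I where I: "pmonoid_ideal I M"
    and criterion: "\<And>N \<phi>. pmonoid N \<Longrightarrow> \<phi> \<in> pm_homs M N \<Longrightarrow> mon_mor X M N \<phi> x \<in> Y N \<longleftrightarrow>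
      {\<phi> a \<otimes>\<^bsub>N\<^esub> b | a b. a \<in> I \<and> b \<in> carrier N} = carrier N"
    using x by (elim ballE[of _ _ x] exE conjE) auto
  obtain a b where ab: "a \<in> I" "b \<in> carrier N" "\<one>\<^bsub>N\<^esub> = \<phi> a \<otimes>\<^bsub>N\<^esub> b"
    using criterion[OF N.pmonoid_axioms \<phi>] image N.one_closed by blast
  have a: "a \<in> carrier M"
    using I ab(1) by (auto simp: pmonoid_ideal_def)
  have "absorb N \<noteq> \<one>\<^bsub>N\<^esub>"
    using pm_fieldD(3)[OF N] N.Units_one_closed by auto
  then have "a \<noteq> absorb M"
    using ab \<phi> pmonoid_homD(4)[of \<phi> M N] N.absorb_mult[OF ab(2)] by auto
  then have unit: "a \<in> Units M"
    using a pm_fieldD(2)[OF M] by blast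
  define id where "id = (\<lambda>a\<in>carrier M. a)"
  have id: "id \<in> pm_homs M M"
    using M.absorb_closed by (auto simp: id_def pmonoid_hom_def hom_def)
  have "y \<in> {id a \<otimes>\<^bsub>M\<^esub> b | a b. a \<in> I \<and> b \<in> carrier M}" if y: "y \<in> carrier M" for y
  proof -
    have "y = id a \<otimes>\<^bsub>M\<^esub> (inv\<^bsub>M\<^esub> a \<otimes>\<^bsub>M\<^esub> y)"
      using y a unit by (simp add: id_def flip: M.m_assoc)
    then show ?thesis using ab(1) y unit by blast
  qed
  moreover have "{id a \<otimes>\<^bsub>M\<^esub> b | a b. a \<in> I \<and> b \<in> carrier M} \<subseteq> carrier M"
    using I by (auto simp: id_def pmonoid_ideal_def)
  ultimately have "mon_mor X M M id x \<in> Y M"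
    using criterion[OF M.pmonoid_axioms id] by blast
  then show ?thesis
    using mon_mor_id[OF X M.pmonoid_axioms x] by (simp add: id_def)
qed

locale F1_points =
  fixes X :: "('u :: infinite, 'v) mr_functor" and XZ :: "('y, 't) ringed_space"
    and \<eta> :: "'u ring \<Rightarrow> 'v \<Rightarrow> ('u set \<Rightarrow> 'y) \<times> ('y set \<Rightarrow> 't \<Rightarrow> 'u set \<Rightarrow> ('u \<times> 'u) set)"
    and \<Y> :: "('u pmonoid \<Rightarrow> 'v set) set" and Mon :: "('u pmonoid \<Rightarrow> 'v set) \<Rightarrow> 'u pmonoid"
    and \<theta> :: "('u pmonoid \<Rightarrow> 'v set) \<Rightarrow> 'u pmonoid \<Rightarrow> 'v \<Rightarrow> 'u \<Rightarrow> 'u"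
  assumes mr_functor: "is_mr_functor X"
    and \<eta>_bij: "cring R \<Longrightarrow> bij_betw (\<eta> R) (ring_obj X R) (sh_hom ring_hom (Spec R) XZ)"
    and \<eta>_natural: "cring R \<Longrightarrow> cring S \<Longrightarrow> \<epsilon> \<in> ring_hom R S \<inter> extensional (carrier R) \<Longrightarrow> x \<in> ring_obj X R \<Longrightarrow>
      \<eta> S (ring_mor X R S \<epsilon> x) = sh_comp (Spec S) (Spec R) XZ (\<eta> R x) (Spec_map R S \<epsilon>)"
    and field_bij: "field K \<Longrightarrow> bij_betw (fmor X (MonObj (ring_pmonoid K)) (RingObj K) (MixMor (monoid_ring_eval K)))
      (mon_obj X (ring_pmonoid K)) (ring_obj X K)"
    and finite_\<Y>: "finite \<Y>"
    and Y_open: "Y \<in> \<Y> \<Longrightarrow> mon_open_subfunctor X Y"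
    and Mon: "Y \<in> \<Y> \<Longrightarrow> pmonoid (Mon Y)" and Mon_fin_gen: "Y \<in> \<Y> \<Longrightarrow> pmonoid_fin_gen (Mon Y)"
    and \<theta>_bij: "Y \<in> \<Y> \<Longrightarrow> pmonoid N \<Longrightarrow> bij_betw (\<theta> Y N) (Y N) (pm_homs (Mon Y) N)"
    and \<theta>_natural: "Y \<in> \<Y> \<Longrightarrow> pmonoid N \<Longrightarrow> pmonoid N' \<Longrightarrow> \<phi> \<in> pm_homs N N' \<Longrightarrow> y \<in> Y N \<Longrightarrow>
      \<theta> Y N' (mon_mor X N N' \<phi> y) = compose (carrier (Mon Y)) \<phi> (\<theta> Y N y)"
    and cover: "pm_field N \<Longrightarrow> mon_obj X N = (\<Union>Y\<in>\<Y>. Y N)"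
begin

lemma Y_subset: "Y \<in> \<Y> \<Longrightarrow> pmonoid N \<Longrightarrow> Y N \<subseteq> mon_obj X N"
  using Y_open unfolding mon_open_subfunctor_def mon_subfunctor_def by blast

lemma \<theta>_closed: "Y \<in> \<Y> \<Longrightarrow> pmonoid N \<Longrightarrow> y \<in> Y N \<Longrightarrow> \<theta> Y N y \<in> pm_homs (Mon Y) N"
  using bij_betwE[OF \<theta>_bij] by blast

lemma \<theta>_surj:
  assumes "Y \<in> \<Y>" "pmonoid N" "\<chi> \<in> pm_homs (Mon Y) N"
  obtains y where "y \<in> Y N" "\<theta> Y N y = \<chi>"
proof -
  have "\<chi> \<in> \<theta> Y N ` Y N"
    using bij_betw_imp_surj_on[OF \<theta>_bij[OF assms(1,2)]] assms(3) by simp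
  then show thesis using that by (elim imageE) simp
qed

definition spec_point :: "'u ring \<Rightarrow> 'v \<Rightarrow> ('u set \<Rightarrow> 'y) \<times> ('y set \<Rightarrow> 't \<Rightarrow> 'u set \<Rightarrow> ('u \<times> 'u) set)" where
  "spec_point A y = \<eta> A (fmor X (MonObj (ring_pmonoid A)) (RingObj A) (MixMor (monoid_ring_eval A)) y)"

abbreviation along :: "'u ring \<Rightarrow> 'u ring \<Rightarrow> ('u \<Rightarrow> 'u) \<Rightarrow> 'v \<Rightarrow> 'v" where
  "along A B \<epsilon> \<equiv> mon_mor X (ring_pmonoid A) (ring_pmonoid B) (restrict \<epsilon> (carrier A))"

lemma restrict_hom:
  assumes "cring A" "cring B" "\<epsilon> \<in> ring_hom A B"
  shows "restrict \<epsilon> (carrier A) \<in> ring_hom A B \<inter> extensional (carrier A)"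
    and "restrict \<epsilon> (carrier A) \<in> pm_homs (ring_pmonoid A) (ring_pmonoid B)"
proof -
  show "restrict \<epsilon> (carrier A) \<in> ring_hom A B \<inter> extensional (carrier A)"
    using ring.ring_hom_restrict[OF cring.axioms(1)[OF assms(1)] assms(3), of "restrict \<epsilon> (carrier A)"] by simp
  then show "restrict \<epsilon> (carrier A) \<in> pm_homs (ring_pmonoid A) (ring_pmonoid B)"
    using ring_pmonoid_hom[OF assms(1,2)] by simp
qed

lemma eval_mr_hom: "cring A \<Longrightarrow> MixMor (monoid_ring_eval A) \<in> mr_hom (MonObj (ring_pmonoid A)) (RingObj A)"
  using spectrum.monoid_ring_eval_hom[of A] by (simp add: spectrum_def monoid_ring_eval_def)

lemma is_mr_obj_ring_pmonoid: "cring A \<Longrightarrow> is_mr_obj (MonObj (ring_pmonoid A))"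
  using spectrum.pmonoid_ring_pmonoid[of A] by (simp add: spectrum_def)

lemma spec_point_closed:
  assumes A: "cring A" and y: "y \<in> mon_obj X (ring_pmonoid A)"
  shows "spec_point A y \<in> sh_hom ring_hom (Spec A) XZ"
  using bij_betwE[OF \<eta>_bij[OF A]] mr_functor_closed[OF mr_functor is_mr_obj_ring_pmonoid[OF A] _ eval_mr_hom[OF A] y] A
  by (simp add: spec_point_def)

lemma spec_point_bij:
  "field K \<Longrightarrow> bij_betw (spec_point K) (mon_obj X (ring_pmonoid K)) (sh_hom ring_hom (Spec K) XZ)"
  using bij_betw_trans[OF field_bij \<eta>_bij[OF fieldE(1)]] by (simp add: spec_point_def[abs_def] comp_def)

lemma spec_point_surj:
  assumes "field K" "g \<in> sh_hom ring_hom (Spec K) XZ"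
  obtains y where "y \<in> mon_obj X (ring_pmonoid K)" "spec_point K y = g"
proof -
  have "g \<in> spec_point K ` mon_obj X (ring_pmonoid K)"
    using bij_betw_imp_surj_on[OF spec_point_bij[OF assms(1)]] assms(2) by simp
  then show thesis using that by (elim imageE) simp
qed

lemma along_closed:
  assumes A: "cring A" and B: "cring B" and \<epsilon>: "\<epsilon> \<in> ring_hom A B" and y: "y \<in> mon_obj X (ring_pmonoid A)"
  shows "along A B \<epsilon> y \<in> mon_obj X (ring_pmonoid B)"
  using mr_functor_closed[OF mr_functor is_mr_obj_ring_pmonoid[OF A] is_mr_obj_ring_pmonoid[OF B] _ y] restrict_hom(2)[OF A B \<epsilon>]
  by simp

lemma spec_point_along:
  assumes A: "cring A" and B: "cring B" and \<epsilon>: "\<epsilon> \<in> ring_hom A B" and y: "y \<in> mon_obj X (ring_pmonoid A)"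
  shows "spec_point B (along A B \<epsilon> y) = sh_comp (Spec B) (Spec A) XZ (spec_point A y) (Spec_map A B (restrict \<epsilon> (carrier A)))"
proof -
  define \<epsilon>' where "\<epsilon>' = restrict \<epsilon> (carrier A)"
  define ev :: "'u ring \<Rightarrow> 'u mr_mor" where "ev C = MixMor (monoid_ring_eval C)" for C
  note \<epsilon>' = restrict_hom[OF A B \<epsilon>, folded \<epsilon>'_def]
  note objA = is_mr_obj_ring_pmonoid[OF A] and objB = is_mr_obj_ring_pmonoid[OF B]
  have rings: "is_mr_obj (RingObj A)" "is_mr_obj (RingObj B)" using A B by simp_all
  have mors: "MonMor \<epsilon>' \<in> mr_hom (MonObj (ring_pmonoid A)) (MonObj (ring_pmonoid B))"
      "RingMor \<epsilon>' \<in> mr_hom (RingObj A) (RingObj B)"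
    using \<epsilon>' by auto
  have "compose (carrier (monoid_ring (ring_pmonoid A))) (monoid_ring_eval B) (monoid_ring_map (ring_pmonoid A) (ring_pmonoid B) \<epsilon>')
      = compose (carrier (monoid_ring (ring_pmonoid A))) \<epsilon>' (monoid_ring_eval A)"
    using monoid_ring_eval_natural[OF A B, of \<epsilon>'] \<epsilon>'(1) unfolding compose_def by (intro restrict_ext) simp
  then have square: "mr_comp (MonObj (ring_pmonoid A)) (MonObj (ring_pmonoid B)) (ev B) (MonMor \<epsilon>')
      = mr_comp (MonObj (ring_pmonoid A)) (RingObj A) (RingMor \<epsilon>') (ev A)"
    by (simp add: ev_def)
  have "fmor X (MonObj (ring_pmonoid B)) (RingObj B) (ev B) (along A B \<epsilon> y)
      = fmor X (MonObj (ring_pmonoid A)) (RingObj B)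
          (mr_comp (MonObj (ring_pmonoid A)) (MonObj (ring_pmonoid B)) (ev B) (MonMor \<epsilon>')) y"
    using mr_functor_comp[OF mr_functor objA objB rings(2) mors(1) eval_mr_hom[OF B] y] by (simp add: ev_def \<epsilon>'_def)
  also have "\<dots> = ring_mor X A B \<epsilon>' (fmor X (MonObj (ring_pmonoid A)) (RingObj A) (ev A) y)"
    unfolding square using mr_functor_comp[OF mr_functor objA rings eval_mr_hom[OF A] mors(2) y] by (simp add: ev_def)
  finally show ?thesis
    using \<eta>_natural[OF A B \<epsilon>'(1) mr_functor_closed[OF mr_functor objA rings(1) eval_mr_hom[OF A] y]]
    by (simp add: spec_point_def ev_def \<epsilon>'_def)
qed

lemma along_in_Y:
  assumes "Y \<in> \<Y>" "cring A" "cring B" "\<epsilon> \<in> ring_hom A B" "y \<in> Y (ring_pmonoid A)"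
  shows "along A B \<epsilon> y \<in> Y (ring_pmonoid B)"
  using Y_open[OF assms(1)] restrict_hom(2)[OF assms(2-4)] assms(2,3,5) spectrum.pmonoid_ring_pmonoid
  unfolding mon_open_subfunctor_def mon_subfunctor_def spectrum_def by blast

lemma \<theta>_along:
  assumes Y: "Y \<in> \<Y>" and A: "cring A" and B: "cring B" and \<epsilon>: "\<epsilon> \<in> ring_hom A B"
    and y: "y \<in> Y (ring_pmonoid A)" and m: "m \<in> carrier (Mon Y)"
  shows "\<theta> Y (ring_pmonoid B) (along A B \<epsilon> y) m = \<epsilon> (\<theta> Y (ring_pmonoid A) y m)"
proof -
  have pmonoids: "pmonoid (ring_pmonoid A)" "pmonoid (ring_pmonoid B)"
    using A B by (simp_all add: spectrum.pmonoid_ring_pmonoid spectrum_def)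
  have "\<theta> Y (ring_pmonoid A) y m \<in> carrier A"
    using pmonoid_homD(1) \<theta>_closed[OF Y pmonoids(1) y] m by fastforce
  then show ?thesis
    using \<theta>_natural[OF Y pmonoids restrict_hom(2)[OF A B \<epsilon>] y] m by (simp add: compose_def)
qed

lemma along_reflects_Y:
  assumes Y: "Y \<in> \<Y>" and K: "field K" and L: "field L" and \<epsilon>: "\<epsilon> \<in> ring_hom K L"
    and y: "y \<in> mon_obj X (ring_pmonoid K)" and image: "along K L \<epsilon> y \<in> Y (ring_pmonoid L)"
  shows "y \<in> Y (ring_pmonoid K)"
proof -
  interpret K: field_spectrum K unfolding field_spectrum_def by (rule K)
  interpret L: field_spectrum L unfolding field_spectrum_def by (rule L)
  show ?thesis
    by (rule open_subfunctor_reflects_points[OF mr_functor Y_open[OF Y] K.pm_field_ring_pmonoid L.pm_field_ring_pmonoid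
      restrict_hom(2)[OF K.is_cring L.is_cring \<epsilon>] y image])
qed

end

lemma F1_points_exist:
  fixes X :: "('u :: infinite, 'v) mr_functor"
  assumes scheme: "F1_scheme X XM XZ" and noetherian: "F1_noetherian X XZ"
  obtains \<eta> \<Y> Mon \<theta> where "F1_points X XZ \<eta> \<Y> Mon \<theta>"
proof -
  have mr_functor: "is_mr_functor X" and realisation: "ring_realisation X XZ"
    and field_bij: "\<forall>K. field K \<longrightarrow> bij_betw (fmor X (MonObj (ring_pmonoid K)) (RingObj K) (MixMor (monoid_ring_eval K)))
      (mon_obj X (ring_pmonoid K)) (ring_obj X K)"
    using scheme unfolding F1_scheme_def by auto
  obtain \<eta> where \<eta>: "\<forall>R. cring R \<longrightarrow> bij_betw (\<eta> R) (ring_obj X R) (sh_hom ring_hom (Spec R) XZ)"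
      "\<forall>R S. cring R \<and> cring S \<longrightarrow> (\<forall>\<phi>\<in>ring_hom R S \<inter> extensional (carrier R). \<forall>x\<in>ring_obj X R.
        \<eta> S (ring_mor X R S \<phi> x) = sh_comp (Spec S) (Spec R) XZ (\<eta> R x) (Spec_map R S \<phi>))"
    using realisation unfolding ring_realisation_def by (elim exE conjE)
  obtain \<Y> where \<Y>: "finite \<Y>"
      "\<forall>Y\<in>\<Y>. mon_open_subfunctor X Y \<and> (\<exists>M. pmonoid_fin_gen M \<and> mon_represented X Y M)"
      "\<forall>M (H :: 'u monoid). pmonoid M \<and> comm_group H \<and> pmonoid_iso M (group_pmonoid H) \<longrightarrow> mon_obj X M = (\<Union>Y\<in>\<Y>. Y M)"
    using noetherian unfolding F1_noetherian_def by (elim exE conjE)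
  define natural_bij where "natural_bij Y M \<theta> \<longleftrightarrow>
      (\<forall>N. pmonoid N \<longrightarrow> bij_betw (\<theta> N) (Y N) (pm_homs M N)) \<and>
      (\<forall>N N'. pmonoid N \<and> pmonoid N' \<longrightarrow> (\<forall>\<phi>\<in>pm_homs N N'. \<forall>y\<in>Y N.
        \<theta> N' (mon_mor X N N' \<phi> y) = compose (carrier M) \<phi> (\<theta> N y)))"
    for Y and M :: "'u pmonoid" and \<theta> :: "'u pmonoid \<Rightarrow> _ \<Rightarrow> 'u \<Rightarrow> 'u"
  have "\<exists>M \<theta>. pmonoid_fin_gen M \<and> pmonoid M \<and> natural_bij Y M \<theta>" if "Y \<in> \<Y>" for Y
    using \<Y>(2) that unfolding mon_represented_def natural_bij_def[symmetric] by blast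
  then obtain Mon \<theta> where fin_gen: "pmonoid_fin_gen (Mon Y)" and Mon: "pmonoid (Mon Y)"
      and \<theta>: "natural_bij Y (Mon Y) (\<theta> Y)" if "Y \<in> \<Y>" for Y
    by metis
  have "F1_points X XZ \<eta> \<Y> Mon \<theta>"
  proof (rule F1_points.intro[OF mr_functor])
    show "mon_obj X N = (\<Union>Y\<in>\<Y>. Y N)" if N: "pm_field N" for N
      using \<Y>(3) pm_field_iso_group_pmonoid[OF N] pm_fieldD(1)[OF N] pmonoid.axioms(1) comm_monoid.units_comm_group
      by blast
  qed (use \<eta> \<Y>(1,2) fin_gen Mon \<theta>[unfolded natural_bij_def] field_bij in simp_all)
  then show ?thesis by (rule that)
qed

lemma int_ring_add_pow: "[(n :: int)] \<cdot>\<^bsub>\<Z>\<^esub> \<one>\<^bsub>\<Z>\<^esub> = n"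
proof -
  have nat: "[(k :: nat)] \<cdot>\<^bsub>\<Z>\<^esub> \<one>\<^bsub>\<Z>\<^esub> = int k" for k
    by (induction k) simp_all
  then show ?thesis
    by (cases "n \<ge> 0") (simp_all add: add_pow_int_ge add_pow_int_lt int_a_inv_eq)
qed

lemma irreducible_closedD:
  assumes "irreducible_closed T Z"
  shows "closedin T Z" "Z \<noteq> {}" "closedin T A \<Longrightarrow> closedin T B \<Longrightarrow> Z \<subseteq> A \<union> B \<Longrightarrow> Z \<subseteq> A \<or> Z \<subseteq> B"
  using assms by (simp_all add: irreducible_closed_def)

context affine_chart
begin

lemma point_hom_agree:
  assumes "field K" "point_hom K g \<psi>" "point_hom K g \<psi>'" "r \<in> carrier R"
  shows "\<psi> r = \<psi>' r"
proof -
  interpret K: field_spectrum K unfolding field_spectrum_def by fact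
  have "const_section K {K.pt} (\<psi> r) = const_section K {K.pt} (\<psi>' r)" "\<psi> r \<in> carrier K" "\<psi>' r \<in> carrier K"
    using assms(2-4) ring_hom_closed[of _ R K r] by (auto simp: point_hom_def)
  then show ?thesis by (simp add: K.const_section_eq_iff)
qed

section \<open>Fibres over the integers\<close>

lemma structure_map_iff:
  fixes n :: int
  assumes \<pi>: "\<pi> \<in> sh_hom ring_hom X (Spec \<Z>)" and x: "x \<in> U"
  shows "n \<in> fst \<pi> x \<longleftrightarrow> [n] \<cdot>\<^bsub>R\<^esub> \<one>\<^bsub>R\<^esub> \<in> f x"
proof -
  interpret Z: spectrum \<Z> unfolding spectrum_def by (rule int_is_cring)
  have \<pi>': "(fst \<pi>, snd \<pi>) \<in> sh_hom ring_hom X (Spec \<Z>)" and one: "\<one>\<^bsub>\<Z>\<^esub> \<in> carrier \<Z>"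
    using \<pi> by simp_all
  define T where "T = topspace (pts (Spec \<Z>))"
  define V where "V = topspace (pts X)"
  have T: "openin (pts (Spec \<Z>)) T" and V: "openin (pts X) V" "U \<subseteq> V" "x \<in> V"
    using openin_subset[OF open_U] x by (auto simp: T_def V_def)
  have preim: "preim X (fst \<pi>) T = V" and \<pi>x: "fst \<pi> x \<in> T"
    using sh_homD(1)[OF \<pi>'] V(3) by (auto simp: continuous_map_def preim_def T_def V_def)
  have hom: "snd \<pi> T \<circ> const_section \<Z> T \<in> ring_hom \<Z> (sec X V)"
    using ring_hom_trans[OF Z.const_section_hom[OF T] sh_homD(3)[OF \<pi>' T]] unfolding preim .
  note SU = sheaf_sec_cring[OF sheaf open_U]
  have "res X V U (snd \<pi> T (const_section \<Z> T n)) = [n] \<cdot>\<^bsub>sec X U\<^esub> \<one>\<^bsub>sec X U\<^esub>"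
    using ring_hom_int_add_pow[OF int_is_cring SU ring_hom_trans[OF hom sheaf_res_hom[OF sheaf V(1) open_U V(2)]] one, of n]
      ring_hom_one[OF ring_hom_trans[OF hom sheaf_res_hom[OF sheaf V(1) open_U V(2)]]] by (simp only: int_ring_add_pow comp_apply)
  also have "\<dots> = coordinate_section ([n] \<cdot>\<^bsub>R\<^esub> \<one>\<^bsub>R\<^esub>)"
    using ring_hom_int_add_pow[OF cring_R SU coordinate_section_hom R.one_closed, of n] ring_hom_one[OF coordinate_section_hom] by simp
  finally have coordinate: "res X V U (snd \<pi> T (const_section \<Z> T n)) = coordinate_section ([n] \<cdot>\<^bsub>R\<^esub> \<one>\<^bsub>R\<^esub>)" .
  have n: "n \<in> carrier \<Z>" by simp
  have prime: "primeideal (fst \<pi> x) \<Z>"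
    by (rule openin_SpecD[OF int_is_cring T \<pi>x])
  have "n \<notin> fst \<pi> x \<longleftrightarrow> Z.invertible_near (fst \<pi> x) T (const_section \<Z> T n)"
    using Z.invertible_near_Spec_iff[OF T \<pi>x ring_hom_closed[OF Z.const_section_hom[OF T] n]]
      prime_frac_unit_iff[OF prime n one] \<pi>x
      multiplicative_subset.one_in_S[OF primeideal_complement_multiplicative[OF prime]]
    by (simp add: const_section_def)
  also have "\<dots> \<longleftrightarrow> X.invertible_near x V (snd \<pi> T (const_section \<Z> T n))"
    using invertible_near_pullback[OF X.presheaf_of_monoids_axioms Z.presheaf_of_monoids_axioms \<pi>' _ T \<pi>x
        ring_hom_closed[OF Z.const_section_hom[OF T] n]] V(3) by (simp add: preim V_def)
  also have "\<dots> \<longleftrightarrow> X.invertible_near x U (coordinate_section ([n] \<cdot>\<^bsub>R\<^esub> \<one>\<^bsub>R\<^esub>))"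
    using X.invertible_near_res[of V U x "snd \<pi> T (const_section \<Z> T n)"] V open_U x ring_hom_closed[OF hom n]
    by (simp add: coordinate)
  also have "\<dots> \<longleftrightarrow> [n] \<cdot>\<^bsub>R\<^esub> \<one>\<^bsub>R\<^esub> \<notin> f x"
    by (rule coordinate_section_invertible_iff[OF x]) simp
  finally show ?thesis by blast
qed

lemma nonvanishing_open: "a \<in> carrier R \<Longrightarrow> openin (pts X) {x \<in> U. a \<notin> f x}"
proof -
  assume "a \<in> carrier R"
  then have "openin (pts X) (preim (open_subspace X U) f {p. primeideal p R \<and> a \<notin> p})"
    by (intro preim_open openin_Spec_basic cring_R)
  moreover have "preim (open_subspace X U) f {p. primeideal p R \<and> a \<notin> p} = {x \<in> U. a \<notin> f x}"
    using prime_f by (auto simp: preim_eq)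
  ultimately show ?thesis by simp
qed

lemma separating_element:
  assumes V: "openin (pts X) V" and z: "z \<in> U" "z \<in> V"
  obtains a where "a \<in> carrier R" "a \<notin> f z" "\<And>y. y \<in> U \<Longrightarrow> y \<notin> V \<Longrightarrow> a \<in> f y"
proof -
  obtain I where I: "I \<subseteq> carrier R" "f ` (U \<inter> V) = {p. primeideal p R \<and> \<not> I \<subseteq> p}"
    using open_image[OF open_Int_U[OF V]] unfolding openin_Spec[OF cring_R] by auto
  have "f z \<in> f ` (U \<inter> V)" using z by blast
  then obtain a where a: "a \<in> I" "a \<notin> f z"
    unfolding I(2) by blast
  have "a \<in> f y" if y: "y \<in> U" "y \<notin> V" for y
  proof (rule ccontr)
    assume "a \<notin> f y"
    then have "f y \<in> f ` (U \<inter> V)"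
      unfolding I(2) using prime_f[OF y(1)] a(1) by blast
    then show False
      using inj_onD[OF inj_f] y by blast
  qed
  with a I(1) show thesis by (intro that[of a]) auto
qed

definition vanishing_ideal :: "'x set \<Rightarrow> 'r set" where
  "vanishing_ideal Z = \<Inter>(f ` (Z \<inter> U))"

lemma vanishing_ideal_prime:
  assumes Z: "irreducible_closed (subtopology (pts X) S) Z" and meets: "Z \<inter> U \<noteq> {}"
  shows "primeideal (vanishing_ideal Z) R"
proof (rule primeidealI)
  show "ideal (vanishing_ideal Z) R"
    unfolding vanishing_ideal_def using prime_f meets by (intro R.i_Intersect) (auto simp: primeideal.axioms(1))
  obtain x where x: "x \<in> Z \<inter> U" using meets by blast
  then have "vanishing_ideal Z \<subseteq> f x" "f x \<subseteq> carrier R" "carrier R \<noteq> f x"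
    using f_subset_carrier primeideal.I_notcarr[OF prime_f] by (auto simp: vanishing_ideal_def)
  then show "carrier R \<noteq> vanishing_ideal Z" by blast
  fix a b assume ab: "a \<in> carrier R" "b \<in> carrier R" "a \<otimes>\<^bsub>R\<^esub> b \<in> vanishing_ideal Z"
  have Z_sub: "Z \<subseteq> S \<inter> topspace (pts X)"
    using closedin_subset[OF irreducible_closedD(1)[OF Z]] by auto
  have closed: "closedin (subtopology (pts X) S) (Z - {x \<in> U. c \<notin> f x})" if "c \<in> carrier R" for c
  proof -
    have "closedin (subtopology (pts X) S) (Z - (S \<inter> {x \<in> U. c \<notin> f x}))"
      by (intro closedin_diff irreducible_closedD(1)[OF Z] openin_subtopology_Int2 nonvanishing_open that)
    moreover have "Z - (S \<inter> {x \<in> U. c \<notin> f x}) = Z - {x \<in> U. c \<notin> f x}" using Z_sub by blast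
    ultimately show ?thesis by simp
  qed
  have "a \<in> f x \<or> b \<in> f x" if "x \<in> Z \<inter> U" for x
    using primeideal.I_prime[OF prime_f ab(1,2)] ab(3) that unfolding vanishing_ideal_def by blast
  then have "Z \<subseteq> (Z - {x \<in> U. a \<notin> f x}) \<union> (Z - {x \<in> U. b \<notin> f x})" by blast
  then have "Z \<subseteq> Z - {x \<in> U. a \<notin> f x} \<or> Z \<subseteq> Z - {x \<in> U. b \<notin> f x}"
    by (rule irreducible_closedD(3)[OF Z closed[OF ab(1)] closed[OF ab(2)]])
  then show "a \<in> vanishing_ideal Z \<or> b \<in> vanishing_ideal Z"
    unfolding vanishing_ideal_def by blast
qed (rule cring_R)

lemma vanishing_ideal_strict:
  assumes Z: "irreducible_closed (subtopology (pts X) S) Z" and Z': "irreducible_closed (subtopology (pts X) S) Z'"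
    and sub: "Z \<subset> Z'" and meets: "Z \<inter> U \<noteq> {}"
  shows "vanishing_ideal Z' \<subset> vanishing_ideal Z"
proof -
  have closed: "closedin (subtopology (pts X) S) Z" "closedin (subtopology (pts X) S) Z'"
    and sub_S: "Z' \<subseteq> S \<inter> topspace (pts X)"
    using irreducible_closedD(1)[OF Z] irreducible_closedD(1)[OF Z'] closedin_subset[of "subtopology (pts X) S" Z'] by auto
  have "closedin (subtopology (pts X) S) (Z' - (S \<inter> U))"
    by (intro closedin_diff closed(2) openin_subtopology_Int2 open_U)
  moreover have "Z' - (S \<inter> U) = Z' - U" using sub_S by blast
  ultimately have "\<not> Z' \<subseteq> Z \<union> (Z' - U)"
    using irreducible_closedD(3)[OF Z' closed(1), of "Z' - U"] sub meets by auto
  then obtain z where z: "z \<in> Z'" "z \<in> U" "z \<notin> Z" by blast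
  obtain C where C: "closedin (pts X) C" "Z = C \<inter> S"
    using closed(1) unfolding closedin_subtopology by blast
  have "openin (pts X) (topspace (pts X) - C)" "z \<in> topspace (pts X) - C"
    using C z sub_S by auto
  then obtain a where a: "a \<in> carrier R" "a \<notin> f z" "\<And>y. y \<in> U \<Longrightarrow> y \<notin> topspace (pts X) - C \<Longrightarrow> a \<in> f y"
    using separating_element[OF _ z(2)] by metis
  have "a \<in> vanishing_ideal Z" "a \<notin> vanishing_ideal Z'"
    using a C(2) z(1,2) unfolding vanishing_ideal_def by auto
  moreover have "vanishing_ideal Z' \<subseteq> vanishing_ideal Z"
    using sub unfolding vanishing_ideal_def by blast
  ultimately show ?thesis by blast
qed

lemma vanishing_ideal_Int_int_image:
  assumes \<pi>: "\<pi> \<in> sh_hom ring_hom X (Spec \<Z>)" and Z: "Z \<subseteq> preim X (fst \<pi>) {y}" and meets: "Z \<inter> U \<noteq> {}"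
  shows "vanishing_ideal Z \<inter> int_image R = {[n] \<cdot>\<^bsub>R\<^esub> \<one>\<^bsub>R\<^esub> | n :: int. n \<in> y}"
proof -
  have "[n] \<cdot>\<^bsub>R\<^esub> \<one>\<^bsub>R\<^esub> \<in> vanishing_ideal Z \<longleftrightarrow> n \<in> y" for n :: int
  proof -
    have "[n] \<cdot>\<^bsub>R\<^esub> \<one>\<^bsub>R\<^esub> \<in> f x \<longleftrightarrow> n \<in> y" if "x \<in> Z \<inter> U" for x
      using structure_map_iff[OF \<pi>, of x n] that Z by (auto simp: preim_def)
    then show ?thesis using meets unfolding vanishing_ideal_def by blast
  qed
  then show ?thesis unfolding int_image_def by auto
qed

end

lemma countable_ring_fin_gen:
  assumes "ring R" "ring_fin_gen R"
  shows "countable (carrier R)"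
proof -
  interpret ring R by fact
  obtain G where G: "G \<subseteq> carrier R" "finite G" "\<And>S. subring S R \<Longrightarrow> G \<subseteq> S \<Longrightarrow> S = carrier R"
    using assms(2) unfolding ring_fin_gen_def by blast
  define E where "E = rec_nat (insert \<one>\<^bsub>R\<^esub> G) (\<lambda>_ A. A \<union> a_inv R ` A \<union>
      (\<lambda>(a, b). a \<otimes>\<^bsub>R\<^esub> b) ` (A \<times> A) \<union> (\<lambda>(a, b). a \<oplus>\<^bsub>R\<^esub> b) ` (A \<times> A))"
  have E_Suc: "E (Suc n) = E n \<union> a_inv R ` E n \<union>
      (\<lambda>(a, b). a \<otimes>\<^bsub>R\<^esub> b) ` (E n \<times> E n) \<union> (\<lambda>(a, b). a \<oplus>\<^bsub>R\<^esub> b) ` (E n \<times> E n)" and E_0: "E 0 = insert \<one>\<^bsub>R\<^esub> G" for n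
    by (simp_all add: E_def)
  have mono: "E m \<subseteq> E n" if "m \<le> n" for m n
    using that by (rule lift_Suc_mono_le[of E, rotated]) (auto simp: E_Suc)
  have "countable (E n) \<and> E n \<subseteq> carrier R" for n
    by (induction n) (use G in \<open>auto simp: E_0 E_Suc countable_finite\<close>)
  then have count: "countable (\<Union>n. E n)" and closed: "(\<Union>n. E n) \<subseteq> carrier R"
    by auto
  have "subring (\<Union>n. E n) R"
  proof (rule subringI)
    fix h k assume "h \<in> (\<Union>n. E n)" "k \<in> (\<Union>n. E n)"
    then obtain m n where "h \<in> E m" "k \<in> E n" by blast
    then have "h \<in> E (max m n)" "k \<in> E (max m n)"
      using mono[of m "max m n"] mono[of n "max m n"] by auto
    then have "h \<otimes>\<^bsub>R\<^esub> k \<in> E (Suc (max m n))" "h \<oplus>\<^bsub>R\<^esub> k \<in> E (Suc (max m n))"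
      unfolding E_Suc by auto
    then show "h \<otimes>\<^bsub>R\<^esub> k \<in> (\<Union>n. E n)" "h \<oplus>\<^bsub>R\<^esub> k \<in> (\<Union>n. E n)" by blast+
  next
    fix h assume "h \<in> (\<Union>n. E n)"
    then obtain n where "h \<in> E n" by blast
    then have "\<ominus>\<^bsub>R\<^esub> h \<in> E (Suc n)" unfolding E_Suc by blast
    then show "\<ominus>\<^bsub>R\<^esub> h \<in> (\<Union>n. E n)" by blast
  qed (use closed E_0 in auto)
  then show ?thesis
    using G(3) E_0 count by (metis UN_upper UNIV_I insert_subset)
qed

lemma alg_indep_length_le_unit_rank:
  assumes K: "field (K :: 'a ring)" and M: "pmonoid M" "pmonoid_fin_gen M" and \<chi>: "\<chi> \<in> pm_homs M (ring_pmonoid K)"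
    and ys: "set ys \<subseteq> generate_field K (\<chi> ` carrier M)" "alg_indep_mod K {\<zero>\<^bsub>K\<^esub>} (int_image K) ys"
  shows "\<exists>p. pmonoid_prime p M \<and> length ys \<le> unit_rank M p"
proof -
  interpret K: field_spectrum K unfolding field_spectrum_def by (rule K)
  define p where "p = pm_kernel M (ring_pmonoid K) \<chi>"
  have p: "pmonoid_prime p M"
    and units: "\<And>x. x \<in> carrier M - p \<Longrightarrow> \<chi> x \<in> Units (ring_pmonoid K)"
    unfolding p_def using pm_kernel_prime[OF M(1) K.pm_field_ring_pmonoid, of \<chi>] \<chi> by auto
  obtain e G B c where prime_basis_p: "prime_basis M G p B e c" "card B = unit_rank M p"
    using prime_basis_of_unit_rank[OF M p] by blast
  interpret prime_basis M G p B e c by (rule prime_basis_p(1))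
  interpret W: prime_basis_hom M G p B e c "ring_pmonoid K" \<chi>
    using K.pmonoid_ring_pmonoid \<chi> units H(2)
    by (intro prime_basis_hom.intro prime_basis_hom_axioms.intro prime_basis_axioms) auto
  interpret multiplicative_filtration K "int_image K" W.word_values
  proof (intro multiplicative_filtration.intro multiplicative_filtration_axioms.intro K)
    show "subring (int_image K) K" by (rule K.int_image_subring)
    show "W.word_values N \<subseteq> carrier K" for N
      using pmonoid_homD(1)[of \<chi> M "ring_pmonoid K"] \<chi> word_closed[OF H(2)]
      by (auto simp: W.word_values_def)
    show "finite (W.word_values N)" for N by (rule W.word_values_finite)
    show "W.word_values M \<subseteq> W.word_values N" if "M \<le> N" for M N using that by (rule W.word_values_mono)
    show "\<one>\<^bsub>K\<^esub> \<in> W.word_values 0" using W.one_in_word_values by simp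
    show "v \<otimes>\<^bsub>K\<^esub> w \<in> W.word_values (M + N)" if "v \<in> W.word_values M" "w \<in> W.word_values N" for v w M N
      using W.word_values_mult[OF that] by simp
  qed
  have values_closed: "(\<Union>N. W.word_values N) \<subseteq> carrier K"
    using W_closed by blast
  note generated = K.generate_fieldE(1,2)[OF values_closed refl]
  have "\<chi> ` carrier M \<subseteq> insert \<zero>\<^bsub>K\<^esub> (\<Union>N. W.word_values N)"
    using W.hom_image_subset_word_values by (simp add: p_def pm_kernel_def)
  also have "\<dots> \<subseteq> generate_field K (\<Union>N. W.word_values N)"
    using generated(2) K.zero_in_generate by (simp only: insert_subset)
  finally have "generate_field K (\<chi> ` carrier M) \<subseteq> generate_field K (\<Union>N. W.word_values N)"
    using subfieldE(3)[OF generated(1)] by (intro K.generate_field_min_subfield1 generated(1)) (rule subset_trans)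
  then have "set ys \<subseteq> generate_field K (\<Union>N. W.word_values N)"
    using ys(1) by blast
  then have "length ys \<le> card B"
    by (rule length_alg_indep_le_growth[OF W.card_word_values _ ys(2)])
  then show ?thesis using p prime_basis_p(2) by auto
qed

locale F1_chart = F1_points X XZ \<eta> \<Y> Mon \<theta> + affine_chart XZ U R f F
  for X :: "('u :: infinite, 'v) mr_functor" and XZ :: "('y, 't) ringed_space" and \<eta> \<Y> Mon \<theta> U
    and R :: "'r ring" and f F
begin

lemma point_over_subfield:
  assumes K: "field (K :: 'u ring)" and Y: "Y \<in> \<Y>" and w: "w \<in> Y (ring_pmonoid K)"
    and k: "subfield k K" and in_k: "\<theta> Y (ring_pmonoid K) w ` carrier (Mon Y) \<subseteq> k"
  obtains w' where "w' \<in> mon_obj X (ring_pmonoid (K\<lparr>carrier := k\<rparr>))" "along (K\<lparr>carrier := k\<rparr>) K (\<lambda>a. a) w' = w"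
proof -
  interpret K: field_spectrum K unfolding field_spectrum_def by (rule K)
  define L where "L = K\<lparr>carrier := k\<rparr>"
  have L: "field L" unfolding L_def by (rule K.subfield_iff(2)[OF k])
  interpret L: field_spectrum L unfolding field_spectrum_def by (rule L)
  have incl: "(\<lambda>a. a) \<in> ring_hom L K"
    using subfieldE(3)[OF k] by (auto simp: ring_hom_def L_def)
  note monoids = K.pmonoid_ring_pmonoid L.pmonoid_ring_pmonoid
  define \<chi> where "\<chi> = \<theta> Y (ring_pmonoid K) w"
  have \<chi>: "\<chi> \<in> pm_homs (Mon Y) (ring_pmonoid K)"
    unfolding \<chi>_def by (rule \<theta>_closed[OF Y monoids(1) w])
  then have "\<chi> \<in> pm_homs (Mon Y) (ring_pmonoid L)"
    using in_k unfolding pmonoid_hom_def hom_def L_def \<chi>_def[symmetric] by (auto simp: image_subset_iff Pi_def)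
  then obtain w' where w': "w' \<in> Y (ring_pmonoid L)" "\<theta> Y (ring_pmonoid L) w' = \<chi>"
    by (rule \<theta>_surj[OF Y monoids(2)])
  have w'X: "w' \<in> mon_obj X (ring_pmonoid L)"
    using Y_subset[OF Y monoids(2)] w'(1) by blast
  have along_Y: "along L K (\<lambda>a. a) w' \<in> Y (ring_pmonoid K)"
    by (rule along_in_Y[OF Y L.is_cring K.is_cring incl w'(1)])
  have "\<theta> Y (ring_pmonoid K) (along L K (\<lambda>a. a) w') \<in> pm_homs (Mon Y) (ring_pmonoid K)"
    by (rule \<theta>_closed[OF Y monoids(1) along_Y])
  then have "\<theta> Y (ring_pmonoid K) (along L K (\<lambda>a. a) w') = \<chi>"
    using \<theta>_along[OF Y L.is_cring K.is_cring incl w'(1)] \<chi> w'(2)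
    by (intro extensionalityI[of _ "carrier (Mon Y)"]) auto
  then have "along L K (\<lambda>a. a) w' = w"
    using inj_onD[OF bij_betw_imp_inj_on[OF \<theta>_bij[OF Y monoids(1)]] _ along_Y w] by (simp add: \<chi>_def)
  then show thesis using that w'X by (simp add: L_def)
qed

text \<open>The \<open>K\<close>-point is defined over the subfield that the values of \<open>\<chi>\<close> generate.\<close>

lemma point_hom_in_generated_field:
  assumes K: "field (K :: 'u ring)" and g: "point_hom K g \<psi>"
  obtains Y \<chi> where "Y \<in> \<Y>" "\<chi> \<in> pm_homs (Mon Y) (ring_pmonoid K)"
    "\<psi> ` carrier R \<subseteq> generate_field K (\<chi> ` carrier (Mon Y))"
proof -
  interpret K: field_spectrum K unfolding field_spectrum_def by (rule K)
  have "g \<in> sh_hom ring_hom (Spec K) XZ" using g by (simp add: point_hom_def)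
  then obtain w where w: "w \<in> mon_obj X (ring_pmonoid K)" "spec_point K w = g"
    by (rule spec_point_surj[OF K])
  then obtain Y where Y: "Y \<in> \<Y>" "w \<in> Y (ring_pmonoid K)"
    using cover[OF K.pm_field_ring_pmonoid] by blast
  define \<chi> where "\<chi> = \<theta> Y (ring_pmonoid K) w"
  have \<chi>: "\<chi> \<in> pm_homs (Mon Y) (ring_pmonoid K)"
    unfolding \<chi>_def by (rule \<theta>_closed[OF Y(1) K.pmonoid_ring_pmonoid Y(2)])
  then have "\<chi> ` carrier (Mon Y) \<subseteq> carrier K"
    using pmonoid_homD(1)[of \<chi> "Mon Y" "ring_pmonoid K"] by auto
  define k where "k = generate_field K (\<chi> ` carrier (Mon Y))"
  note k = K.generate_fieldE(1,2)[OF \<open>\<chi> ` carrier (Mon Y) \<subseteq> carrier K\<close> k_def]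
  define L where "L = K\<lparr>carrier := k\<rparr>"
  have L: "field L" unfolding L_def by (rule K.subfield_iff(2)[OF k(1)])
  interpret L: field_spectrum L unfolding field_spectrum_def by (rule L)
  have incl: "(\<lambda>a. a) \<in> ring_hom L K"
    using subfieldE(3)[OF k(1)] by (auto simp: ring_hom_def L_def)
  define incl' where "incl' = restrict (\<lambda>a. a) (carrier L)"
  obtain w' where w': "w' \<in> mon_obj X (ring_pmonoid L)" "along L K (\<lambda>a. a) w' = w"
    using point_over_subfield[OF K Y k(1)] k(2) unfolding L_def \<chi>_def by blast
  have g_eq: "g = sh_comp (Spec K) (Spec L) XZ (spec_point L w') (Spec_map L K incl')"
    using spec_point_along[OF L.is_cring K.is_cring incl w'(1)] w' w(2) by (simp add: incl'_def)
  have "{a \<in> carrier L. incl' a = \<zero>\<^bsub>K\<^esub>} = L.pt"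
    using L.zero_closed by (auto simp: L_def incl'_def)
  then have "fst (spec_point L w') L.pt \<in> U"
    using g unfolding point_hom_def g_eq K.sh_comp_Spec_map_pt by simp
  then obtain \<psi>' where \<psi>': "point_hom L (spec_point L w') \<psi>'"
    using point_hom_exists[OF L spec_point_closed[OF L.is_cring w'(1)]] by blast
  have "incl' \<in> ring_hom L K"
    using restrict_hom(1)[OF L.is_cring K.is_cring incl] by (simp add: incl'_def)
  then have "point_hom K g (incl' \<circ> \<psi>')"
    using point_hom_base_change[OF L K _ \<psi>'] g unfolding g_eq by (simp add: point_hom_def)
  then have "\<psi> r \<in> k" if "r \<in> carrier R" for r
    using point_hom_agree[OF K g _ that] \<psi>' ring_hom_closed[of \<psi>' R L r] that
    by (fastforce simp: point_hom_def incl'_def L_def)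
  then show thesis
    using that[OF Y(1) \<chi>] by (auto simp: k_def)
qed

lemma prime_chain_length_le_unit_rank:
  fixes n :: nat
  assumes P: "\<And>i. i \<le> n \<Longrightarrow> primeideal (P i) R" and strict: "\<And>i. i < n \<Longrightarrow> P (Suc i) \<subset> P i"
    and fibre: "\<And>i. i \<le> n \<Longrightarrow> P i \<inter> int_image R = P 0 \<inter> int_image R" and countable: "countable (carrier R)"
  shows "\<exists>Y\<in>\<Y>. \<exists>p. pmonoid_prime p (Mon Y) \<and> n \<le> unit_rank (Mon Y) p"
proof -
  have int_R: "int_image R \<subseteq> carrier R"
    using subringE(1)[OF R.int_image_subring] .
  obtain xs where xs: "length xs = n" "set xs \<subseteq> carrier R" "alg_indep_mod R (P n) (int_image R) xs"
    using R.alg_indep_mod_of_prime_chain[OF P strict int_R fibre] by blast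
  obtain K :: "'u ring" and \<psi> where K: "field K" and \<psi>: "\<psi> \<in> ring_hom R K"
      and kernel: "\<And>r. r \<in> carrier R \<Longrightarrow> \<psi> r = \<zero>\<^bsub>K\<^esub> \<longleftrightarrow> r \<in> P n"
    by (rule residue_field_exists[OF cring_R P[OF order_refl] countable]) (rule that)
  interpret K: field_spectrum K unfolding field_spectrum_def by (rule K)
  obtain g where "point_hom K g \<psi>" using hom_point_exists[OF K \<psi>] by blast
  then obtain Y \<chi> where Y: "Y \<in> \<Y>" and \<chi>: "\<chi> \<in> pm_homs (Mon Y) (ring_pmonoid K)"
      and \<psi>_image: "\<psi> ` carrier R \<subseteq> generate_field K (\<chi> ` carrier (Mon Y))"
    using point_hom_in_generated_field[OF K] by blast
  have "set (map \<psi> xs) \<subseteq> generate_field K (\<chi> ` carrier (Mon Y))"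
    using \<psi>_image xs(2) by auto
  moreover have "alg_indep_mod K {\<zero>\<^bsub>K\<^esub>} (int_image K) (map \<psi> xs)"
  proof -
    have "{r \<in> carrier R. \<psi> r \<in> {\<zero>\<^bsub>K\<^esub>}} = P n"
      using kernel additive_subgroup.a_subset ideal.axioms(1) primeideal.axioms(1) P[of n] by blast
    then show ?thesis
      using alg_indep_mod_hom[OF cring_R K.is_cring \<psi> int_R xs(2), of "{\<zero>\<^bsub>K\<^esub>}"] xs(3)
        int_image_hom[OF cring_R K.is_cring \<psi>] by simp
  qed
  ultimately show ?thesis
    using alg_indep_length_le_unit_rank[OF K Mon[OF Y] Mon_fin_gen[OF Y] \<chi>, of "map \<psi> xs"] Y xs(1)
    by (intro bexI[of _ Y]) auto
qed

end

section \<open>Chains of specializations\<close>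

lemma irreducible_chain_of_specializations:
  fixes x :: "nat \<Rightarrow> 'x"
  assumes x: "\<And>i. i \<le> n \<Longrightarrow> x i \<in> topspace T \<inter> S"
    and spec: "\<And>i. i < n \<Longrightarrow> x (Suc i) \<in> T closure_of {x i}"
    and strict: "\<And>i. i < n \<Longrightarrow> x i \<notin> T closure_of {x (Suc i)}"
  shows "\<exists>Z. (\<forall>i\<le>n. irreducible_closed (subtopology T S) (Z i)) \<and> (\<forall>i<n. Z i \<subset> Z (Suc i))"
proof -
  define E where "E i = T closure_of {x i} \<inter> S" for i
  have in_E: "x i \<in> E i" if "i \<le> n" for i
    unfolding E_def using x[OF that] closure_of_subset[of "{x i}" T] by auto
  have "irreducible_closed (subtopology T S) (E i)" if i: "i \<le> n" for i
    unfolding irreducible_closed_def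
  proof (intro conjI allI impI)
    show "closedin (subtopology T S) (E i)"
      unfolding E_def closedin_subtopology by (intro exI[of _ "T closure_of {x i}"]) simp
    show "E i \<noteq> {}" using in_E[OF i] by blast
    have minimal: "E i \<subseteq> A" if A: "closedin (subtopology T S) A" "x i \<in> A" for A
    proof -
      obtain C where C: "closedin T C" "A = C \<inter> S"
        using A(1) unfolding closedin_subtopology by (elim exE conjE)
      have "T closure_of {x i} \<subseteq> C"
        by (rule closure_of_minimal[OF _ C(1)]) (use A(2) C(2) in auto)
      then show ?thesis unfolding E_def C(2) by auto
    qed
    fix A B
    assume "closedin (subtopology T S) A \<and> closedin (subtopology T S) B \<and> E i \<subseteq> A \<union> B"
    then show "E i \<subseteq> A \<or> E i \<subseteq> B"
      using minimal in_E[OF i] by blast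
  qed
  moreover have "E (Suc i) \<subset> E i" if i: "i < n" for i
  proof
    have "T closure_of {x (Suc i)} \<subseteq> T closure_of {x i}"
      using spec[OF i] by (intro closure_of_minimal) auto
    then show "E (Suc i) \<subseteq> E i" unfolding E_def by blast
    show "E (Suc i) \<noteq> E i"
      using in_E[of i] strict[OF i] i unfolding E_def by auto
  qed
  then have "E (n - i) \<subset> E (n - Suc i)" if "i < n" for i
    using that Suc_diff_Suc[OF that] diff_Suc_less[of n i] by (metis gr_implies_not_zero not_gr_zero)
  ultimately show ?thesis
    by (intro exI[of _ "\<lambda>i. E (n - i)"]) simp
qed

context affine_chart
begin

lemma closure_of_antisym:
  assumes x: "x \<in> U" and xy: "x \<in> pts X closure_of {y}" and yx: "y \<in> pts X closure_of {x}"
  shows "x = y"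
proof -
  have nbh: "v \<in> V" if "u \<in> pts X closure_of {v}" "openin (pts X) V" "u \<in> V" for u v V
    using that unfolding in_closure_of by blast
  have y: "y \<in> U" by (rule nbh[OF xy open_U x])
  have "a \<in> f x \<longleftrightarrow> a \<in> f y" if "a \<in> carrier R" for a
    using nbh[OF xy nonvanishing_open[OF that]] nbh[OF yx nonvanishing_open[OF that]] x y by blast
  then have "f x = f y"
    using f_subset_carrier[OF x] f_subset_carrier[OF y] by blast
  then show ?thesis using inj_onD[OF inj_f _ x y] by blast
qed

lemma point_hom_cong:
  assumes "point_hom K g \<psi>" "\<And>r. r \<in> carrier R \<Longrightarrow> \<psi> r = \<psi>' r"
  shows "point_hom K g \<psi>'"
  using assms R.ring_hom_restrict[of \<psi> K \<psi>'] by (simp add: point_hom_def)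

lemma structure_map_point:
  fixes n :: int
  assumes \<pi>: "\<pi> \<in> sh_hom ring_hom X (Spec \<Z>)" and K: "field K"
    and g: "g \<in> sh_hom ring_hom (Spec K) X" "fst g {\<zero>\<^bsub>K\<^esub>} \<in> U"
  shows "n \<in> fst \<pi> (fst g {\<zero>\<^bsub>K\<^esub>}) \<longleftrightarrow> [n] \<cdot>\<^bsub>K\<^esub> \<one>\<^bsub>K\<^esub> = \<zero>\<^bsub>K\<^esub>"
proof -
  obtain \<psi> where \<psi>: "point_hom K g \<psi>" by (rule point_hom_exists[OF K g])
  then have hom: "\<psi> \<in> ring_hom R K" by (simp add: point_hom_def)
  have "[n] \<cdot>\<^bsub>R\<^esub> \<one>\<^bsub>R\<^esub> \<in> carrier R" by simp
  from point_hom_kernel[OF K \<psi> this] show ?thesis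
    using structure_map_iff[OF \<pi> g(2), of n] ring_hom_int_add_pow[OF cring_R fieldE(1)[OF K] hom R.one_closed, of n]
      ring_hom_one[OF hom] by simp
qed

end

context F1_chart
begin

lemma point_over_residue_field:
  fixes K K0 :: "'u ring"
  assumes K: "field K" and K0: "field K0" and g0: "point_hom K0 g0 \<psi>0"
    and kernel: "\<And>r. r \<in> carrier R \<Longrightarrow> \<psi>0 r = \<zero>\<^bsub>K0\<^esub> \<longleftrightarrow> r \<in> f x"
    and fraction: "\<And>z. z \<in> carrier K0 \<Longrightarrow> \<exists>a\<in>carrier R. \<exists>b\<in>carrier R - f x. z \<otimes>\<^bsub>K0\<^esub> \<psi>0 b = \<psi>0 a"
    and w0: "w0 \<in> mon_obj X (ring_pmonoid K0)" "spec_point K0 w0 = g0"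
    and w: "w \<in> mon_obj X (ring_pmonoid K)" "fst (spec_point K w) {\<zero>\<^bsub>K\<^esub>} = x" and x: "x \<in> U"
  obtains \<epsilon> where "\<epsilon> \<in> ring_hom K0 K" "along K0 K \<epsilon> w0 = w"
proof -
  interpret K: field_spectrum K unfolding field_spectrum_def by (rule K)
  interpret K0: field_spectrum K0 unfolding field_spectrum_def by (rule K0)
  have \<psi>0: "\<psi>0 \<in> ring_hom R K0" using g0 by (simp add: point_hom_def)
  obtain \<psi> where g: "point_hom K (spec_point K w) \<psi>"
    using point_hom_exists[OF K spec_point_closed[OF K.is_cring w(1)]] w(2) x by blast
  then have \<psi>: "\<psi> \<in> ring_hom R K" by (simp add: point_hom_def)
  have \<psi>_kernel: "\<psi> r = \<zero>\<^bsub>K\<^esub> \<longleftrightarrow> r \<in> f x" if "r \<in> carrier R" for r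
    using point_hom_kernel[OF K g that] w(2) by simp
  interpret fraction_extension R K0 K \<psi>0 \<psi>
  proof (unfold_locales, rule \<psi>0, rule \<psi>)
    show "\<psi> a = \<zero>\<^bsub>K\<^esub>" if "a \<in> carrier R" "\<psi>0 a = \<zero>\<^bsub>K0\<^esub>" for a
      using that kernel \<psi>_kernel by blast
    show "\<exists>a\<in>carrier R. \<exists>s\<in>carrier R. \<psi> s \<in> Units K \<and> z \<otimes>\<^bsub>K0\<^esub> \<psi>0 s = \<psi>0 a" if "z \<in> carrier K0" for z
      using fraction[OF that] \<psi>_kernel ring_hom_closed[OF \<psi>] unfolding K.field_Units by (metis DiffD1 DiffD2 DiffI singletonD)
  qed
  obtain \<epsilon> where \<epsilon>: "\<epsilon> \<in> ring_hom K0 K" "\<And>r. r \<in> carrier R \<Longrightarrow> \<epsilon> (\<psi>0 r) = \<psi> r"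
    using fraction_hom_exists by blast
  have along: "along K0 K \<epsilon> w0 \<in> mon_obj X (ring_pmonoid K)"
    by (rule along_closed[OF K0.is_cring K.is_cring \<epsilon>(1) w0(1)])
  have "point_hom K (spec_point K (along K0 K \<epsilon> w0)) (restrict \<epsilon> (carrier K0) \<circ> \<psi>0)"
    using point_hom_base_change[OF K0 K conjunct1[OF restrict_hom(1)[OF K0.is_cring K.is_cring \<epsilon>(1), unfolded Int_iff]] g0]
      spec_point_closed[OF K.is_cring along] spec_point_along[OF K0.is_cring K.is_cring \<epsilon>(1) w0(1)] w0(2) by simp
  then have "point_hom K (spec_point K (along K0 K \<epsilon> w0)) \<psi>"
    by (rule point_hom_cong) (simp add: \<epsilon>(2) ring_hom_closed[OF \<psi>0])
  then have "spec_point K (along K0 K \<epsilon> w0) = spec_point K w"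
    by (rule point_hom_unique[OF K _ g])
  then have "along K0 K \<epsilon> w0 = w"
    by (rule inj_onD[OF bij_betw_imp_inj_on[OF spec_point_bij[OF K]] _ along w(1)])
  then show thesis by (rule that[OF \<epsilon>(1)])
qed

text \<open>Both points factor through the same point over the residue field of \<open>x\<close>.\<close>

lemma same_image_value_one_iff:
  fixes K :: "'u ring"
  assumes K: "field K" and x: "x \<in> U" and countable: "countable (carrier R)" and Y: "Y \<in> \<Y>"
    and w: "w \<in> Y (ring_pmonoid K)" "fst (spec_point K w) {\<zero>\<^bsub>K\<^esub>} = x"
    and w': "w' \<in> Y (ring_pmonoid K)" "fst (spec_point K w') {\<zero>\<^bsub>K\<^esub>} = x" and m: "m \<in> carrier (Mon Y)"
  shows "\<theta> Y (ring_pmonoid K) w m = \<one>\<^bsub>K\<^esub> \<longleftrightarrow> \<theta> Y (ring_pmonoid K) w' m = \<one>\<^bsub>K\<^esub>"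
proof -
  interpret K: field_spectrum K unfolding field_spectrum_def by (rule K)
  obtain K0 :: "'u ring" and \<psi>0 where K0: "field K0" and \<psi>0: "\<psi>0 \<in> ring_hom R K0"
      and kernel: "\<And>r. r \<in> carrier R \<Longrightarrow> \<psi>0 r = \<zero>\<^bsub>K0\<^esub> \<longleftrightarrow> r \<in> f x"
      and fraction: "\<And>z. z \<in> carrier K0 \<Longrightarrow> \<exists>a\<in>carrier R. \<exists>b\<in>carrier R - f x. z \<otimes>\<^bsub>K0\<^esub> \<psi>0 b = \<psi>0 a"
    by (rule residue_field_exists[OF cring_R prime_f[OF x] countable]) (rule that)
  interpret K0: field_spectrum K0 unfolding field_spectrum_def by (rule K0)
  obtain g0 where g0: "point_hom K0 g0 \<psi>0" by (rule hom_point_exists[OF K0 \<psi>0])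
  then have "g0 \<in> sh_hom ring_hom (Spec K0) XZ" by (simp add: point_hom_def)
  then obtain w0 where w0: "w0 \<in> mon_obj X (ring_pmonoid K0)" "spec_point K0 w0 = g0"
    by (rule spec_point_surj[OF K0])
  have "\<theta> Y (ring_pmonoid K) v m = \<one>\<^bsub>K\<^esub> \<longleftrightarrow> \<theta> Y (ring_pmonoid K0) w0 m = \<one>\<^bsub>K0\<^esub>"
    if v: "v \<in> Y (ring_pmonoid K)" "fst (spec_point K v) {\<zero>\<^bsub>K\<^esub>} = x" for v
  proof -
    have vX: "v \<in> mon_obj X (ring_pmonoid K)"
      using Y_subset[OF Y K.pmonoid_ring_pmonoid] v(1) by blast
    obtain \<epsilon> where \<epsilon>: "\<epsilon> \<in> ring_hom K0 K" "along K0 K \<epsilon> w0 = v"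
      by (rule point_over_residue_field[OF K K0 g0 kernel fraction w0 vX v(2) x])
    have w0Y: "w0 \<in> Y (ring_pmonoid K0)"
      using along_reflects_Y[OF Y K0 K \<epsilon>(1) w0(1)] v(1) unfolding \<epsilon>(2) by blast
    have value_eq: "\<theta> Y (ring_pmonoid K) v m = \<epsilon> (\<theta> Y (ring_pmonoid K0) w0 m)"
      using \<theta>_along[OF Y K0.is_cring K.is_cring \<epsilon>(1) w0Y m] unfolding \<epsilon>(2) .
    have "\<theta> Y (ring_pmonoid K0) w0 m \<in> carrier K0"
      using pmonoid_homD(1) \<theta>_closed[OF Y K0.pmonoid_ring_pmonoid w0Y] m by fastforce
    then show ?thesis
      using inj_on_eq_iff[OF non_trivial_field_hom_is_inj[OF \<epsilon>(1) K0 K], of _ "\<one>\<^bsub>K0\<^esub>"] ring_hom_one[OF \<epsilon>(1)]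
      by (simp add: value_eq)
  qed
  then show ?thesis using w w' by simp
qed

end

lemma (in spectrum) open_generization:
  "openin (pts (Spec R)) V \<Longrightarrow> p' \<in> V \<Longrightarrow> primeideal p R \<Longrightarrow> p \<subseteq> p' \<Longrightarrow> p \<in> V"
  by (auto simp: openin_Spec[OF is_cring])

lemma finite_type_chart:
  fixes XZ :: "('y, 't) ringed_space"
  assumes "finite_type_over_Z XZ" "x \<in> topspace (pts XZ)"
  obtains U and R :: "'t ring" and f F where "affine_chart XZ U R f F" "x \<in> U" "countable (carrier R)"
proof -
  obtain \<U> where \<U>: "\<Union>\<U> = topspace (pts XZ)" "\<forall>U\<in>\<U>. \<exists>R :: 't ring. affine_open XZ U R \<and> ring_fin_gen R"
    using assms(1) unfolding finite_type_over_Z_def by (elim conjE exE)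
  obtain U where U: "U \<in> \<U>" "x \<in> U" using \<U>(1) assms(2) by blast
  obtain R :: "'t ring" where R: "affine_open XZ U R" "ring_fin_gen R"
    using bspec[OF \<U>(2) U(1)] by (elim exE conjE)
  have "is_sheaf cring ring_hom XZ"
    using assms(1) unfolding finite_type_over_Z_def scheme_def by blast
  then obtain f F where "affine_chart XZ U R f F"
    using affine_open_chart R(1) by blast
  moreover have "countable (carrier R)"
    using R cring.axioms(1) countable_ring_fin_gen unfolding affine_open_def by blast
  ultimately show thesis using U(2) by (intro that)
qed

lemma (in prime_basis) hom_to_ring_of_unit_sequence:
  assumes A: "cring (A :: 'b ring)" and t: "\<And>i :: nat. t i \<in> Units A"
  obtains \<chi> m where "\<chi> \<in> pm_homs M (ring_pmonoid A)" "\<And>i. i < card B \<Longrightarrow> m i \<in> carrier M"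
    "\<And>i. i < card B \<Longrightarrow> \<chi> (m i) = t i [^]\<^bsub>A\<^esub> e"
proof -
  interpret A: spectrum A unfolding spectrum_def by (rule A)
  obtain m where m: "bij_betw m {0..<card B} B"
    using ex_bij_betw_nat_finite[OF finite_basis] by blast
  obtain \<chi> where \<chi>: "\<chi> \<in> pm_homs M (ring_pmonoid A)"
      and \<chi>_B: "\<forall>b\<in>B. \<chi> b = t (inv_into {0..<card B} m b) [^]\<^bsub>units_of (ring_pmonoid A)\<^esub> e"
    using basis_values_extend[OF A.pmonoid_ring_pmonoid, of "\<lambda>b. t (inv_into {0..<card B} m b)"] t by auto
  have \<chi>_basis: "\<chi> (m i) = t i [^]\<^bsub>A\<^esub> e" if "i < card B" for i
  proof -
    have "m i \<in> B" "inv_into {0..<card B} m (m i) = i"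
      using that m by (auto simp: bij_betw_def)
    then have "\<chi> (m i) = t i [^]\<^bsub>units_of (ring_pmonoid A)\<^esub> e"
      using \<chi>_B by simp
    also have "\<dots> = t i [^]\<^bsub>ring_pmonoid A\<^esub> e"
      using monoid.units_of_pow[of "ring_pmonoid A"] A.pmonoid_ring_pmonoid t
      unfolding pmonoid_def comm_monoid_def by simp
    also have "\<dots> = t i [^]\<^bsub>A\<^esub> e" by (simp add: nat_pow_def)
    finally show ?thesis .
  qed
  have m_closed: "m i \<in> carrier M" if "i < card B" for i
    using bij_betwE[OF m, rule_format, of i] that basis H(2) by auto
  show thesis by (rule that[of \<chi> m, OF \<chi>]) (use m_closed \<chi>_basis in simp_all)
qed

context F1_points
begin

lemma spec_point_along_pt:
  assumes A: "cring A" and K: "field K" and j: "j \<in> ring_hom A K" and y: "y \<in> mon_obj X (ring_pmonoid A)"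
  shows "fst (spec_point K (along A K j y)) {\<zero>\<^bsub>K\<^esub>} = fst (spec_point A y) {a \<in> carrier A. j a = \<zero>\<^bsub>K\<^esub>}"
proof -
  interpret K: field_spectrum K unfolding field_spectrum_def by (rule K)
  have "{a \<in> carrier A. restrict j (carrier A) a = \<zero>\<^bsub>K\<^esub>} = {a \<in> carrier A. j a = \<zero>\<^bsub>K\<^esub>}" by auto
  then show ?thesis
    unfolding spec_point_along[OF A K.is_cring j y] K.sh_comp_Spec_map_pt by simp
qed

lemma spec_point_specialization:
  assumes A: "cring A" and K: "field K" and j: "j \<in> ring_hom A K" "j' \<in> ring_hom A K"
    and kernels: "\<And>a. a \<in> carrier A \<Longrightarrow> j a = \<zero>\<^bsub>K\<^esub> \<Longrightarrow> j' a = \<zero>\<^bsub>K\<^esub>" and y: "y \<in> mon_obj X (ring_pmonoid A)"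
  shows "fst (spec_point K (along A K j' y)) {\<zero>\<^bsub>K\<^esub>} \<in> pts XZ closure_of {fst (spec_point K (along A K j y)) {\<zero>\<^bsub>K\<^esub>}}"
proof -
  interpret A: spectrum A unfolding spectrum_def by (rule A)
  interpret K: field K by (rule K)
  define ker where "ker h = {a \<in> carrier A. h a \<in> {\<zero>\<^bsub>K\<^esub>}}" for h
  have prime: "primeideal (ker h) A" if "h \<in> ring_hom A K" for h
    unfolding ker_def
    by (rule ring_hom_ring.primeideal_vimage[OF ring_hom_ringI2[OF A.ring_axioms K.ring_axioms that] A K.zeroprimeideal])
  define g where "g = fst (spec_point A y)"
  have "(g, snd (spec_point A y)) \<in> sh_hom ring_hom (Spec A) XZ"
    using spec_point_closed[OF A y] by (simp add: g_def)
  then have cont: "continuous_map (pts (Spec A)) (pts XZ) g" by (rule sh_homD(1))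
  have pt: "fst (spec_point K (along A K h y)) {\<zero>\<^bsub>K\<^esub>} = g (ker h)" if "h \<in> ring_hom A K" for h
    using spec_point_along_pt[OF A K that y] by (simp add: g_def ker_def)
  have "g (ker j) \<in> V" if V: "openin (pts XZ) V" "g (ker j') \<in> V" for V
  proof -
    have "openin (pts (Spec A)) {q \<in> topspace (pts (Spec A)). g q \<in> V}"
      using cont V(1) by (rule openin_continuous_map_preimage)
    then have "ker j \<in> {q \<in> topspace (pts (Spec A)). g q \<in> V}"
      by (rule A.open_generization[OF _ _ prime[OF j(1)]])
        (use prime[OF j(2)] V(2) kernels in \<open>auto simp: topspace_Spec[OF A] ker_def\<close>)
    then show ?thesis by simp
  qed
  moreover have "g (ker j') \<in> topspace (pts XZ)"
    using cont prime[OF j(2)] topspace_Spec[OF A] by (auto simp: continuous_map_def)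
  ultimately show ?thesis
    unfolding pt[OF j(1)] pt[OF j(2)] in_closure_of by blast
qed

lemma specialization_sequence_exists:
  assumes Y: "Y \<in> \<Y>" and p: "pmonoid_prime p (Mon Y)"
  obtains K :: "'u ring" and w m where "field K"
    "\<And>i. w i \<in> Y (ring_pmonoid K)"
    "\<And>i. fst (spec_point K (w (Suc i))) {\<zero>\<^bsub>K\<^esub>} \<in> pts XZ closure_of {fst (spec_point K (w i)) {\<zero>\<^bsub>K\<^esub>}}"
    "\<And>i. i < unit_rank (Mon Y) p \<Longrightarrow> m i \<in> carrier (Mon Y)"
    "\<And>i. i < unit_rank (Mon Y) p \<Longrightarrow> \<theta> Y (ring_pmonoid K) (w i) (m i) \<noteq> \<one>\<^bsub>K\<^esub>"
    "\<And>i. i < unit_rank (Mon Y) p \<Longrightarrow> \<theta> Y (ring_pmonoid K) (w (Suc i)) (m i) = \<one>\<^bsub>K\<^esub>"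
proof -
  obtain A K :: "'u ring" and J t where A: "cring A" and K: "field K" and J: "\<And>i :: nat. J i \<in> ring_hom A K"
      and kernels: "\<And>i a. a \<in> carrier A \<Longrightarrow> J i a = \<zero>\<^bsub>K\<^esub> \<Longrightarrow> J (Suc i) a = \<zero>\<^bsub>K\<^esub>"
      and t: "\<And>i :: nat. t i \<in> Units A"
      and t_pow: "\<And>i n :: nat. 0 < n \<Longrightarrow> J i (t i) [^]\<^bsub>K\<^esub> n \<noteq> \<one>\<^bsub>K\<^esub>" and t_one: "\<And>i. J (Suc i) (t i) = \<one>\<^bsub>K\<^esub>"
    by (rule specialization_homs_exist) (rule that)
  interpret A: spectrum A unfolding spectrum_def by (rule A)
  interpret K: field K by (rule K)
  obtain e G B c where basis_p: "prime_basis (Mon Y) G p B e c" "card B = unit_rank (Mon Y) p"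
    using prime_basis_of_unit_rank[OF Mon[OF Y] Mon_fin_gen[OF Y] p] by blast
  interpret prime_basis "Mon Y" G p B e c by (rule basis_p(1))
  obtain \<chi> m where \<chi>: "\<chi> \<in> pm_homs (Mon Y) (ring_pmonoid A)" and m_closed: "\<And>i. i < card B \<Longrightarrow> m i \<in> carrier (Mon Y)"
      and \<chi>_basis: "\<And>i. i < card B \<Longrightarrow> \<chi> (m i) = t i [^]\<^bsub>A\<^esub> e"
    by (rule hom_to_ring_of_unit_sequence[OF A t]) (rule that)
  obtain y where y: "y \<in> Y (ring_pmonoid A)" "\<theta> Y (ring_pmonoid A) y = \<chi>"
    by (rule \<theta>_surj[OF Y A.pmonoid_ring_pmonoid \<chi>])
  have yX: "y \<in> mon_obj X (ring_pmonoid A)"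
    using Y_subset[OF Y A.pmonoid_ring_pmonoid] y(1) by blast
  define w where "w i = along A K (J i) y" for i
  have value_w: "\<theta> Y (ring_pmonoid K) (w k) (m i) = J k (t i) [^]\<^bsub>K\<^esub> e" if "i < card B" for i k
  proof -
    interpret Jk: ring_hom_cring A K "J k" by unfold_locales (rule J)
    show ?thesis
      using \<theta>_along[OF Y A K.is_cring J y(1) m_closed[OF that]] \<chi>_basis[OF that] t y(2)
      by (simp add: w_def A.Units_closed)
  qed
  show thesis
  proof (rule that[of K w m, OF K])
    show "w i \<in> Y (ring_pmonoid K)" for i
      unfolding w_def by (rule along_in_Y[OF Y A K.is_cring J y(1)])
    show "fst (spec_point K (w (Suc i))) {\<zero>\<^bsub>K\<^esub>} \<in> pts XZ closure_of {fst (spec_point K (w i)) {\<zero>\<^bsub>K\<^esub>}}" for i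
      unfolding w_def by (rule spec_point_specialization[OF A K J J kernels yX])
  qed (use m_closed value_w t_pow e_pos t_one basis_p(2) in auto)
qed

lemma fibre_chain_exists:
  assumes finite_type: "finite_type_over_Z XZ" and \<pi>: "\<pi> \<in> sh_hom ring_hom XZ (Spec \<Z>)"
    and Y: "Y \<in> \<Y>" and p: "pmonoid_prime p (Mon Y)"
  defines "n \<equiv> unit_rank (Mon Y) p"
  shows "\<exists>y\<in>topspace (pts (Spec \<Z>)). \<exists>Z.
    (\<forall>i\<le>n. irreducible_closed (subtopology (pts XZ) (preim XZ (fst \<pi>) {y})) (Z i)) \<and> (\<forall>i<n. Z i \<subset> Z (Suc i))"
proof -
  obtain K :: "'u ring" and w m where K: "field K" and w: "\<And>i. w i \<in> Y (ring_pmonoid K)"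
      and spec: "\<And>i. fst (spec_point K (w (Suc i))) {\<zero>\<^bsub>K\<^esub>} \<in> pts XZ closure_of {fst (spec_point K (w i)) {\<zero>\<^bsub>K\<^esub>}}"
      and m: "\<And>i. i < n \<Longrightarrow> m i \<in> carrier (Mon Y)"
        "\<And>i. i < n \<Longrightarrow> \<theta> Y (ring_pmonoid K) (w i) (m i) \<noteq> \<one>\<^bsub>K\<^esub>"
        "\<And>i. i < n \<Longrightarrow> \<theta> Y (ring_pmonoid K) (w (Suc i)) (m i) = \<one>\<^bsub>K\<^esub>"
    by (rule specialization_sequence_exists[OF Y p, folded n_def]) (rule that)
  interpret K: field_spectrum K unfolding field_spectrum_def by (rule K)
  define x where "x i = fst (spec_point K (w i)) {\<zero>\<^bsub>K\<^esub>}" for i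
  have point: "spec_point K (w i) \<in> sh_hom ring_hom (Spec K) XZ" for i
    using spec_point_closed[OF K.is_cring] Y_subset[OF Y K.pmonoid_ring_pmonoid] w by blast
  have cont_\<pi>: "continuous_map (pts XZ) (pts (Spec \<Z>)) (fst \<pi>)"
    using \<pi> sh_homD(1)[of "fst \<pi>" "snd \<pi>"] by simp
  have x_top: "x i \<in> topspace (pts XZ)" for i
  proof -
    have "(fst (spec_point K (w i)), snd (spec_point K (w i))) \<in> sh_hom ring_hom (Spec K) XZ"
      using point[of i] by simp
    then have "continuous_map (pts (Spec K)) (pts XZ) (fst (spec_point K (w i)))" by (rule sh_homD(1))
    then show ?thesis by (auto simp: x_def continuous_map_def K.topspace_field)
  qed
  have "k \<in> fst \<pi> (x i) \<longleftrightarrow> [k] \<cdot>\<^bsub>K\<^esub> \<one>\<^bsub>K\<^esub> = \<zero>\<^bsub>K\<^esub>" for i and k :: int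
  proof -
    obtain U and R :: "'t ring" and f F where chart: "affine_chart XZ U R f F" "x i \<in> U" "countable (carrier R)"
      by (rule finite_type_chart[OF finite_type x_top])
    then show ?thesis
      using affine_chart.structure_map_point[OF chart(1) \<pi> K point] by (simp add: x_def)
  qed
  then have same_fibre: "fst \<pi> (x i) = fst \<pi> (x 0)" for i by blast
  have "x i \<notin> pts XZ closure_of {x (Suc i)}" if i: "i < n" for i
  proof
    assume closure: "x i \<in> pts XZ closure_of {x (Suc i)}"
    obtain U and R :: "'t ring" and f F where chart: "affine_chart XZ U R f F" "x i \<in> U" "countable (carrier R)"
      by (rule finite_type_chart[OF finite_type x_top])
    interpret F1_chart X XZ \<eta> \<Y> Mon \<theta> U R f F
      unfolding F1_chart_def using F1_points_axioms chart(1) by blast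
    have "x i = x (Suc i)"
      using closure_of_antisym[OF chart(2) closure] spec[of i] by (simp add: x_def)
    then have "\<theta> Y (ring_pmonoid K) (w i) (m i) = \<one>\<^bsub>K\<^esub> \<longleftrightarrow> \<theta> Y (ring_pmonoid K) (w (Suc i)) (m i) = \<one>\<^bsub>K\<^esub>"
      by (intro same_image_value_one_iff[OF K chart(2,3)] Y w m(1) i) (simp_all add: x_def)
    then show False using m(2,3)[OF i] by simp
  qed
  then have "\<exists>Z. (\<forall>i\<le>n. irreducible_closed (subtopology (pts XZ) (preim XZ (fst \<pi>) {fst \<pi> (x 0)})) (Z i)) \<and>
      (\<forall>i<n. Z i \<subset> Z (Suc i))"
    using x_top same_fibre spec by (intro irreducible_chain_of_specializations[of n x]) (auto simp: preim_def x_def)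
  moreover have "fst \<pi> (x 0) \<in> topspace (pts (Spec \<Z>))"
    using cont_\<pi> x_top by (auto simp: continuous_map_def)
  ultimately show ?thesis by blast
qed

end

section \<open>Counting points\<close>

lemma poly_of_int_shifted_powers:
  "poly (map_poly real_of_int (\<Sum>x\<in>S. [:- 1, 1:] ^ r x)) t = (\<Sum>x\<in>S. (t - 1) ^ r x)"
proof -
  have mult: "map_poly real_of_int (p * q) = map_poly of_int p * map_poly of_int q" for p q
    by (rule poly_eqI) (simp add: coeff_map_poly coeff_mult)
  have add: "map_poly real_of_int (p + q) = map_poly of_int p + map_poly of_int q" for p q
    by (rule poly_eqI) (simp add: coeff_map_poly)
  have "poly (map_poly real_of_int ([:- 1, 1:] ^ k)) t = (t - 1) ^ k" for k
    by (induction k) (simp_all only: power_Suc mult poly_mult, simp_all add: map_poly_pCons)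
  then show ?thesis
    by (induction S rule: infinite_finite_induct) (simp_all add: add)
qed

lemma poly_deg_shifted_powers:
  fixes r :: "'x \<Rightarrow> nat"
  assumes S: "finite S"
  shows "poly_deg (\<Sum>x\<in>S. [:- 1, 1:] ^ r x) = (SUP x\<in>S. ereal (real (r x)))"
proof (cases "S = {}")
  case False
  let ?P = "(\<Sum>x\<in>S. [:- 1, 1:] ^ r x) :: int poly"
  define d where "d = Max (r ` S)"
  have le: "r x \<le> d" if "x \<in> S" for x
    unfolding d_def using S that by (intro Max_ge) auto
  have "d \<in> r ` S"
    unfolding d_def using S False by (intro Max_in) auto
  then obtain x0 where x0: "x0 \<in> S" "r x0 = d" by blast
  have deg: "Polynomial.degree ([:- 1, 1 :: int:] ^ k) = k" for k
    by (simp add: degree_power_eq)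
  have "coeff ([:- 1, 1 :: int:] ^ k) d = (if k = d then 1 else 0)" if "k \<le> d" for k
    using that deg[of k] lead_coeff_power[of "[:- 1, 1 :: int:]" k] by (auto simp: coeff_eq_0)
  then have "coeff ?P d = (\<Sum>x\<in>S. if r x = d then 1 else 0)"
    unfolding coeff_sum using le by (intro sum.cong) auto
  also have "\<dots> \<ge> (\<Sum>x\<in>{x0}. if r x = d then 1 else 0)"
    using S x0 by (intro sum_mono2) auto
  finally have "coeff ?P d \<noteq> 0" using x0 by auto
  moreover have "Polynomial.degree ?P \<le> d"
    using le deg by (intro degree_sum_le S) simp
  ultimately have "?P \<noteq> 0" "Polynomial.degree ?P = d"
    using le_degree[of ?P d] by auto
  moreover have "(SUP x\<in>S. ereal (real (r x))) = ereal (real d)"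
    using le x0 by (intro SUP_eqI) auto
  ultimately show ?thesis by (simp add: poly_deg_def)
qed (simp add: poly_deg_def bot_ereal_def)

context F1_points
begin

definition strata :: "(('u pmonoid \<Rightarrow> 'v set) \<times> 'u set) set" where
  "strata = (SIGMA Y:\<Y>. {p. pmonoid_prime p (Mon Y)})"

definition stratum_rank :: "('u pmonoid \<Rightarrow> 'v set) \<times> 'u set \<Rightarrow> nat" where
  "stratum_rank = (\<lambda>(Y, p). unit_rank (Mon Y) p)"

lemma finite_Mon_primes: "Y \<in> \<Y> \<Longrightarrow> finite {p. pmonoid_prime p (Mon Y)}"
  using finite_pmonoid_primes[OF Mon] Mon_fin_gen unfolding pmonoid_fin_gen_iff by blast

lemma card_chart_points:
  obtains e where "e > 0"
    "\<And>Y (N :: 'u pmonoid). Y \<in> \<Y> \<Longrightarrow> pm_field N \<Longrightarrow> finite (carrier N) \<Longrightarrow> coprime (card (Units N)) e \<Longrightarrow>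
      finite (Y N) \<and> card (Y N) = (\<Sum>p\<in>{p. pmonoid_prime p (Mon Y)}. card (Units N) ^ unit_rank (Mon Y) p)"
proof -
  have "\<forall>Y\<in>\<Y>. \<exists>E > 0. \<forall>N :: 'u pmonoid. pm_field N \<longrightarrow> finite (carrier N) \<longrightarrow> coprime (card (Units N)) E \<longrightarrow>
      card (pm_homs (Mon Y) N) = (\<Sum>p\<in>{p. pmonoid_prime p (Mon Y)}. card (Units N) ^ unit_rank (Mon Y) p)"
  proof
    fix Y assume Y: "Y \<in> \<Y>"
    show "\<exists>E > 0. \<forall>N :: 'u pmonoid. pm_field N \<longrightarrow> finite (carrier N) \<longrightarrow> coprime (card (Units N)) E \<longrightarrow>
      card (pm_homs (Mon Y) N) = (\<Sum>p\<in>{p. pmonoid_prime p (Mon Y)}. card (Units N) ^ unit_rank (Mon Y) p)"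
      by (rule card_pm_homs[OF Mon[OF Y] Mon_fin_gen[OF Y], where ?'b = 'u]) auto
  qed
  from bchoice[OF this] obtain E where E: "\<And>Y. Y \<in> \<Y> \<Longrightarrow> E Y > 0"
    and card_homs: "\<And>Y (N :: 'u pmonoid). Y \<in> \<Y> \<Longrightarrow> pm_field N \<Longrightarrow> finite (carrier N) \<Longrightarrow> coprime (card (Units N)) (E Y) \<Longrightarrow>
      card (pm_homs (Mon Y) N) = (\<Sum>p\<in>{p. pmonoid_prime p (Mon Y)}. card (Units N) ^ unit_rank (Mon Y) p)"
    by blast
  show thesis
  proof (rule that[of "\<Prod>Y\<in>\<Y>. E Y"])
    show "(\<Prod>Y\<in>\<Y>. E Y) > 0" using E by (intro prod_pos) auto
  next
    fix Y and N :: "'u pmonoid"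
    assume Y: "Y \<in> \<Y>" and N: "pm_field N" "finite (carrier N)" and coprime: "coprime (card (Units N)) (\<Prod>Y\<in>\<Y>. E Y)"
    have "coprime (card (Units N)) (E Y)"
      using coprime dvd_prodI[OF finite_\<Y> Y, of E] by (rule coprime_divisors[OF dvd_refl, rotated])
    note bij = \<theta>_bij[OF Y pm_fieldD(1)[OF N(1)]]
    obtain G where "pmonoid_generators (Mon Y) G"
      using Mon_fin_gen[OF Y] unfolding pmonoid_fin_gen_iff by blast
    then have "finite (pm_homs (Mon Y) N)" by (rule finite_pm_homs[OF Mon[OF Y] _ N(2)])
    then show "finite (Y N) \<and> card (Y N) = (\<Sum>p\<in>{p. pmonoid_prime p (Mon Y)}. card (Units N) ^ unit_rank (Mon Y) p)"
      using bij_betw_finite[OF bij] bij_betw_same_card[OF bij]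
        card_homs[OF Y N \<open>coprime (card (Units N)) (E Y)\<close>] by simp
  qed
qed

lemma card_points_bounds:
  assumes N: "pm_field N"
    and finite_Y: "\<And>Y. Y \<in> \<Y> \<Longrightarrow> finite (Y N)"
    and card_Y: "\<And>Y. Y \<in> \<Y> \<Longrightarrow> card (Y N) = (\<Sum>p\<in>{p. pmonoid_prime p (Mon Y)}. m ^ unit_rank (Mon Y) p)"
  shows "s \<in> strata \<Longrightarrow> m ^ stratum_rank s \<le> card (mon_obj X N)"
    and "card (mon_obj X N) \<le> (\<Sum>s\<in>strata. m ^ stratum_rank s)"
proof -
  have cover_N: "mon_obj X N = (\<Union>Y\<in>\<Y>. Y N)" by (rule cover[OF N])
  show "m ^ stratum_rank s \<le> card (mon_obj X N)" if s: "s \<in> strata"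
  proof -
    obtain Y p where Y: "s = (Y, p)" "Y \<in> \<Y>" "pmonoid_prime p (Mon Y)" using s by (auto simp: strata_def)
    have "m ^ stratum_rank s \<le> card (Y N)"
      unfolding card_Y[OF Y(2)] stratum_rank_def Y(1) prod.case using Y(3) finite_Mon_primes[OF Y(2)]
      by (intro member_le_sum[of p _ "\<lambda>p. m ^ unit_rank (Mon Y) p"]) auto
    also have "\<dots> \<le> card (mon_obj X N)"
      unfolding cover_N using Y(2) finite_\<Y> finite_Y by (intro card_mono) auto
    finally show ?thesis .
  qed
  have "card (mon_obj X N) \<le> (\<Sum>Y\<in>\<Y>. card (Y N))"
    unfolding cover_N by (rule card_UN_le[OF finite_\<Y>])
  also have "\<dots> = (\<Sum>s\<in>strata. m ^ stratum_rank s)"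
    unfolding strata_def stratum_rank_def using finite_\<Y> finite_Mon_primes
    by (simp add: card_Y sum.Sigma case_prod_unfold)
  finally show "card (mon_obj X N) \<le> (\<Sum>s\<in>strata. m ^ stratum_rank s)" .
qed

lemma infinitely_many_orders_with_bounds:
  obtains T :: "nat set" where "infinite T"
    "\<And>m. m \<in> T \<Longrightarrow> \<exists>N :: 'u pmonoid. m \<ge> 1 \<and> pmonoid N \<and> pmonoid_iso N (group_pmonoid (integer_mod_group m)) \<and>
      (\<forall>s\<in>strata. m ^ stratum_rank s \<le> card (mon_obj X N)) \<and>
      card (mon_obj X N) \<le> (\<Sum>s\<in>strata. m ^ stratum_rank s)"
proof -
  obtain e where "e > 0" and card_Y: "\<And>Y (N :: 'u pmonoid). Y \<in> \<Y> \<Longrightarrow> pm_field N \<Longrightarrow> finite (carrier N) \<Longrightarrow>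
      coprime (card (Units N)) e \<Longrightarrow>
      finite (Y N) \<and> card (Y N) = (\<Sum>p\<in>{p. pmonoid_prime p (Mon Y)}. card (Units N) ^ unit_rank (Mon Y) p)"
    by (rule card_chart_points) (rule that)
  have "inj (\<lambda>k. Suc (k * e))" using \<open>e > 0\<close> by (intro injI) simp
  then have "infinite (range (\<lambda>k. Suc (k * e)))" by (rule range_inj_infinite)
  moreover have "\<exists>N :: 'u pmonoid. m \<ge> 1 \<and> pmonoid N \<and> pmonoid_iso N (group_pmonoid (integer_mod_group m)) \<and>
      (\<forall>s\<in>strata. m ^ stratum_rank s \<le> card (mon_obj X N)) \<and>
      card (mon_obj X N) \<le> (\<Sum>s\<in>strata. m ^ stratum_rank s)" if m: "m \<in> range (\<lambda>k. Suc (k * e))" for m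
  proof -
    obtain k where k: "m = Suc (k * e)" using m by blast
    then have "coprime m e"
      by (metis coprime_Suc_left_nat coprime_mult_right_iff)
    moreover obtain N :: "'u pmonoid" where N: "pm_field N" "finite (carrier N)" "card (Units N) = m"
        "pmonoid_iso N (group_pmonoid (integer_mod_group m))"
      using cyclic_pm_field_exists[of m] k by blast
    ultimately have card_N: "finite (Y N)"
        "card (Y N) = (\<Sum>p\<in>{p. pmonoid_prime p (Mon Y)}. m ^ unit_rank (Mon Y) p)" if "Y \<in> \<Y>" for Y
      using card_Y[OF that N(1,2)] by simp_all
    have "\<forall>s\<in>strata. m ^ stratum_rank s \<le> card (mon_obj X N)"
      using card_points_bounds(1)[OF N(1), of m] card_N by simp
    moreover have "card (mon_obj X N) \<le> (\<Sum>s\<in>strata. m ^ stratum_rank s)"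
      using card_points_bounds(2)[OF N(1), of m] card_N by simp
    ultimately show ?thesis using N(4) pm_fieldD(1)[OF N(1)] k by (intro exI[of _ N]) auto
  qed
  ultimately show thesis by (rule that)
qed

lemma counting_exponents:
  assumes count: "\<And>m (N :: 'u pmonoid). m \<ge> 1 \<Longrightarrow> pmonoid N \<Longrightarrow>
      pmonoid_iso N (group_pmonoid (integer_mod_group m)) \<Longrightarrow> card (mon_obj X N) = (\<Sum>x\<in>S. m ^ r x)"
  shows "s \<in> strata \<Longrightarrow> finite S" "s \<in> strata \<Longrightarrow> \<exists>x\<in>S. stratum_rank s \<le> r x"
    and "finite S \<Longrightarrow> x \<in> S \<Longrightarrow> \<exists>s\<in>strata. r x \<le> stratum_rank s"
proof -
  obtain T :: "nat set" where T: "infinite T"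
      "\<And>m. m \<in> T \<Longrightarrow> \<exists>N :: 'u pmonoid. m \<ge> 1 \<and> pmonoid N \<and> pmonoid_iso N (group_pmonoid (integer_mod_group m)) \<and>
        (\<forall>s\<in>strata. m ^ stratum_rank s \<le> card (mon_obj X N)) \<and>
        card (mon_obj X N) \<le> (\<Sum>s\<in>strata. m ^ stratum_rank s)"
    by (rule infinitely_many_orders_with_bounds) (rule that)
  have bounds: "m \<ge> 1" "s \<in> strata \<Longrightarrow> m ^ stratum_rank s \<le> (\<Sum>x\<in>S. m ^ r x)"
      "(\<Sum>x\<in>S. m ^ r x) \<le> (\<Sum>s\<in>strata. m ^ stratum_rank s)" if "m \<in> T" for m s
    using T(2)[OF that] count by (elim exE conjE; auto)+
  show "\<exists>x\<in>S. stratum_rank s \<le> r x" if s: "s \<in> strata"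
    using exponent_le_if_infinitely_often_le[OF T(1), of "stratum_rank s" "\<lambda>_. 1" r S] bounds(2) s by simp
  show "finite S" if s: "s \<in> strata"
  proof (rule ccontr)
    obtain m where "m \<in> T" using T(1) by (metis ex_in_conv finite.emptyI)
    moreover assume "infinite S"
    ultimately show False using bounds(1)[of m] bounds(2)[of m s] s by simp
  qed
  show "\<exists>s\<in>strata. r x \<le> stratum_rank s" if "finite S" "x \<in> S"
  proof -
    have "m ^ r x \<le> (\<Sum>s\<in>strata. 1 * m ^ stratum_rank s)" if "m \<in> T" for m
      using member_le_sum[of x S "\<lambda>x. m ^ r x"] \<open>finite S\<close> \<open>x \<in> S\<close> bounds(3)[OF that] by simp
    then show ?thesis by (rule exponent_le_if_infinitely_often_le[OF T(1)])
  qed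
qed

lemma poly_deg_counting:
  assumes "counting_function X XM XZ N"
  defines "S \<equiv> topspace (pts XM)" and "r \<equiv> \<lambda>x. ab_rank (stalk_units XM x)"
  shows "poly_deg (\<Sum>x\<in>S. [:- 1, 1:] ^ r x) = (SUP s\<in>strata. ereal (real (stratum_rank s)))"
proof -
  have N: "N t = (\<Sum>x\<in>S. (t - 1) ^ r x)" for t
    using assms(1) unfolding counting_function_def S_def r_def by blast
  have count: "card (mon_obj X M) = (\<Sum>x\<in>S. m ^ r x)"
    if "m \<ge> 1" "pmonoid M" "pmonoid_iso M (group_pmonoid (integer_mod_group m))" for m and M :: "'u pmonoid"
  proof -
    have "real (card (mon_obj X M)) = N (real m + 1)"
      using assms(1) that unfolding counting_function_def by blast
    then have "real (card (mon_obj X M)) = real (\<Sum>x\<in>S. m ^ r x)" by (simp add: N)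
    then show ?thesis by (simp only: of_nat_eq_iff)
  qed
  have exponents: "s \<in> strata \<Longrightarrow> finite S" "s \<in> strata \<Longrightarrow> \<exists>x\<in>S. stratum_rank s \<le> r x"
      "finite S \<Longrightarrow> x \<in> S \<Longrightarrow> \<exists>s\<in>strata. r x \<le> stratum_rank s" for s x
    by (rule counting_exponents; (rule count)?; assumption)+
  show ?thesis
  proof (cases "finite S")
    case True
    have "(SUP x\<in>S. ereal (real (r x))) = (SUP s\<in>strata. ereal (real (stratum_rank s)))"
      using exponents(2) exponents(3) True by (intro antisym SUP_mono) auto
    then show ?thesis using poly_deg_shifted_powers[OF True, of r] by simp
  next
    case False
    then have "strata = {}" using exponents(1) by blast
    then show ?thesis using False by (simp add: poly_deg_def bot_ereal_def)
  qed
qed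

lemma fibre_chain_length_le_rank:
  assumes finite_type: "finite_type_over_Z XZ" and \<pi>: "\<pi> \<in> sh_hom ring_hom XZ (Spec \<Z>)"
    and irr: "\<forall>i\<le>n. irreducible_closed (subtopology (pts XZ) (preim XZ (fst \<pi>) {y})) (Z i)"
    and strict: "\<forall>i<n. Z i \<subset> Z (Suc i)"
  shows "\<exists>s\<in>strata. n \<le> stratum_rank s"
proof -
  have sub: "Z i \<subseteq> preim XZ (fst \<pi>) {y} \<inter> topspace (pts XZ)" if "i \<le> n" for i
    using closedin_subset[OF irreducible_closedD(1)[OF irr[rule_format, OF that]]] by auto
  obtain x where x: "x \<in> Z 0"
    using irreducible_closedD(2)[OF irr[rule_format, of 0]] by auto
  then have "x \<in> topspace (pts XZ)" using sub[of 0] by blast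
  then obtain U and R :: "'t ring" and f F where chart: "affine_chart XZ U R f F" "x \<in> U" "countable (carrier R)"
    by (rule finite_type_chart[OF finite_type])
  interpret F1_chart X XZ \<eta> \<Y> Mon \<theta> U R f F
    unfolding F1_chart_def using F1_points_axioms chart(1) by blast
  have meets: "Z i \<inter> U \<noteq> {}" if "i \<le> n" for i
  proof -
    have "x \<in> Z i" using that
    proof (induction i)
      case (Suc i)
      then show ?case using strict[rule_format, of i] by auto
    qed (rule x)
    then show ?thesis using chart(2) by blast
  qed
  have "\<exists>Y\<in>\<Y>. \<exists>p. pmonoid_prime p (Mon Y) \<and> n \<le> unit_rank (Mon Y) p"
  proof (rule prime_chain_length_le_unit_rank)
    show "primeideal (vanishing_ideal (Z i)) R" if "i \<le> n" for i
      by (rule vanishing_ideal_prime[OF irr[rule_format, OF that] meets[OF that]])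
    show "vanishing_ideal (Z (Suc i)) \<subset> vanishing_ideal (Z i)" if "i < n" for i
      using that irr strict meets by (intro vanishing_ideal_strict[where S = "preim XZ (fst \<pi>) {y}"]) auto
    show "vanishing_ideal (Z i) \<inter> int_image R = vanishing_ideal (Z 0) \<inter> int_image R" if "i \<le> n" for i
      using vanishing_ideal_Int_int_image[OF \<pi> _ meets, of i y] vanishing_ideal_Int_int_image[OF \<pi> _ meets, of 0 y]
        sub[of 0] sub[OF that] that by simp
  qed (rule chart(3))
  then show ?thesis by (auto simp: strata_def stratum_rank_def)
qed

lemma reldim_eq_max_rank:
  assumes "finite_type_over_Z XZ" "\<pi> \<in> sh_hom ring_hom XZ (Spec \<Z>)"
  shows "reldim XZ (Spec \<Z>) \<pi> = (SUP s\<in>strata. ereal (real (stratum_rank s)))"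
proof (rule antisym)
  show "reldim XZ (Spec \<Z>) \<pi> \<le> (SUP s\<in>strata. ereal (real (stratum_rank s)))"
    unfolding reldim_def krull_dim_def
  proof (intro SUP_least Sup_least, elim CollectE exE conjE)
    fix y v n Z
    assume v: "v = ereal (real n)"
      and chain: "\<forall>i\<le>n. irreducible_closed (subtopology (pts XZ) (preim XZ (fst \<pi>) {y})) (Z i)" "\<forall>i<n. Z i \<subset> Z (Suc i)"
    obtain s where "s \<in> strata" "n \<le> stratum_rank s"
      using fibre_chain_length_le_rank[OF assms chain] by blast
    then show "v \<le> (SUP s\<in>strata. ereal (real (stratum_rank s)))"
      unfolding v by (intro SUP_upper2[of s]) auto
  qed
  show "(SUP s\<in>strata. ereal (real (stratum_rank s))) \<le> reldim XZ (Spec \<Z>) \<pi>"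
  proof (rule SUP_least)
    fix s assume "s \<in> strata"
    then obtain Y p where s: "Y \<in> \<Y>" "pmonoid_prime p (Mon Y)" "stratum_rank s = unit_rank (Mon Y) p"
      by (auto simp: strata_def stratum_rank_def)
    obtain y where y: "y \<in> topspace (pts (Spec \<Z>))"
        "\<exists>Z. (\<forall>i\<le>stratum_rank s. irreducible_closed (subtopology (pts XZ) (preim XZ (fst \<pi>) {y})) (Z i)) \<and>
          (\<forall>i<stratum_rank s. Z i \<subset> Z (Suc i))"
      using fibre_chain_exists[OF assms s(1,2)] unfolding s(3) by blast
    have "ereal (real (stratum_rank s)) \<le> krull_dim (subtopology (pts XZ) (preim XZ (fst \<pi>) {y}))"
      unfolding krull_dim_def using y(2) by (intro Sup_upper) blast
    also have "\<dots> \<le> reldim XZ (Spec \<Z>) \<pi>"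
      unfolding reldim_def using y(1) by (rule SUP_upper)
    finally show "ereal (real (stratum_rank s)) \<le> reldim XZ (Spec \<Z>) \<pi>" .
  qed
qed

end

theorem theorem2p32:
  fixes X :: "('u :: infinite, 'v) mr_functor"
    and XM :: "('x, 's) monoidal_space"
    and XZ :: "('y, 't) ringed_space"
    and N :: "real \<Rightarrow> real"
  assumes "F1_scheme X XM XZ"
    and "F1_noetherian X XZ"
    and "F1_torsion_free XM"
    and "counting_function X XM XZ N"
    and "finite_type_over_Z XZ"
    and "\<pi> \<in> sh_hom ring_hom XZ (Spec \<Z>)"
  shows "\<exists>P :: int poly.
           (\<forall>t. N t = poly (map_poly of_int P) t) \<and>
           poly_deg P = reldim XZ (Spec \<Z>) \<pi>"
proof -
  obtain \<eta> \<Y> Mon \<theta> where "F1_points X XZ \<eta> \<Y> Mon \<theta>"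
    by (rule F1_points_exist[OF assms(1,2)])
  then interpret F1_points X XZ \<eta> \<Y> Mon \<theta> .
  let ?P = "(\<Sum>x\<in>topspace (pts XM). [:- 1, 1:] ^ ab_rank (stalk_units XM x)) :: int poly"
  have "N t = poly (map_poly of_int ?P) t" for t
    using assms(4) unfolding poly_of_int_shifted_powers counting_function_def by blast
  moreover have "poly_deg ?P = reldim XZ (Spec \<Z>) \<pi>"
    unfolding poly_deg_counting[OF assms(4)] by (rule reldim_eq_max_rank[OF assms(5,6), symmetric])
  ultimately show ?thesis by blast
qed

end
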